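(* Let $G$ be a triangulation of the projective plane $\mathbb{P}$. Then $G$ does not have a bipartite subgraph $H$ with $|E(H)|=\frac{2}{3}|E(G)|$ if and only if $G$ is constructed as follows. Let $T=K_6$ embedded on $\mathbb{P}$, and let $f_1,\ldots,f_{10}$ be its faces. For each $i\in\{1,\ldots,10\}$, let $T_i$ be either empty or a plane quasi-Eulerian triangulation with respect to one of its faces $f_i'$. Then $G$ is obtained from $T$ and the $T_i$ by pasting $f_i$ and $f_i'$ for every $i$ with $T_i\neq\emptyset$.
   Context: A triangulation of a surface is a graph without loops or multiple edges, 2-cell embedded on the surface such that every face is bounded by a closed walk of length 3 (the paper uses "multitriangulation" when multiple edges are allowed). $K_6$ has a unique embedding on $\mathbb{P}$, which is a triangulation with 10 faces. Pasting: if $T_1,T_2$ are triangulations with faces $f\in F(T_1)$ and $f'\in F(T_2)$, where $T_2$ is a plane triangulation, the triangulation constructed from $T_1$ and $T_2$ by pasting $f$ and $f'$ is obtained by placing $T_2$ (with $f'$ as outer face) inside the face $f$ and identifying the boundary 3-cycle of $f'$ with that of $f$ (via some bijection of their vertices). A 3-cycle of a triangulation is separating if both regions it bounds contain at least one vertex. Quasi-Eulerian triangulations. Let $E$ be a simple plane Eulerian triangulation (all degrees even) with no separating 3-cycle and let $f_0$ be a face of $E$; properly 2-color the faces of $E$ red and blue with $f_0$ red. The class $\mathcal{T}_1$ (w.r.t. $f_0$) consists of all triangulations obtained from such an $E$ by pasting, into each red face $r\neq f_0$ of $E$, an arbitrary plane triangulation (or nothing) along one of its faces. For $i\ge2$,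 $\mathcal{T}_i$ (w.r.t. $f_0$) consists of all triangulations obtained from such an $E$ by pasting into each red face $r\neq f_0$ an arbitrary plane triangulation (or nothing), and into each blue face $b$ a triangulation in $\mathcal{T}_{i-1}$ with respect to the face $b'$ along which it is pasted (or nothing). A simple plane triangulation $T$ with a face $f$ is quasi-Eulerian with respect to $f$ if it belongs to $\bigcup_{i\ge1}\mathcal{T}_i$ with respect to $f$. *)

theory Defs
  imports Main
begin

text \<open>Combinatorial representation of simple triangulations of closed surfaces:
a triangulation is given by its set of faces, each face being the 3-element set
of its boundary vertices.  Vertices and edges are derived from the faces.\<close>

definition verts :: "'a set set \<Rightarrow> 'a set" where
  "verts F = \<Union>F"

definition edges :: "'a set set \<Rightarrow> 'a set set" where
  "edges F = {e. card e = 2 \<and> (\<exists>f\<in>F. e \<subseteq> f)}"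

definition adj :: "'a set set \<Rightarrow> 'a \<Rightarrow> 'a \<Rightarrow> bool" where
  "adj F u v \<longleftrightarrow> u \<noteq> v \<and> {u, v} \<in> edges F"

definition degree :: "'a set set \<Rightarrow> 'a \<Rightarrow> nat" where
  "degree F v = card {e \<in> edges F. v \<in> e}"

definition link_edges :: "'a set set \<Rightarrow> 'a \<Rightarrow> 'a set set" where
  "link_edges F v = {f - {v} | f. f \<in> F \<and> v \<in> f}"

text \<open>A (simple) triangulation of a connected closed surface: every face is a
triangle, every edge lies on exactly two faces, every vertex link is a single
(connected) cycle, and the graph is connected.\<close>
definition surface_tri :: "'a set set \<Rightarrow> bool" where
  "surface_tri F \<longleftrightarrow>
     finite F \<and> F \<noteq> {} \<and> (\<forall>f\<in>F. card f = 3) \<and>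
     (\<forall>e\<in>edges F. card {f \<in> F. e \<subseteq> f} = 2) \<and>
     (\<forall>v\<in>verts F. \<forall>x\<in>\<Union>(link_edges F v). \<forall>y\<in>\<Union>(link_edges F v).
         (\<lambda>a b. {a, b} \<in> link_edges F v)\<^sup>*\<^sup>* x y) \<and>
     (\<forall>x\<in>verts F. \<forall>y\<in>verts F. (adj F)\<^sup>*\<^sup>* x y)"

definition euler_char :: "'a set set \<Rightarrow> int" where
  "euler_char F = int (card (verts F)) - int (card (edges F)) + int (card F)"

text \<open>Triangulation of the projective plane (the unique closed surface with Euler
characteristic 1) and plane (sphere) triangulation (Euler characteristic 2).\<close>
definition proj_tri :: "'a set set \<Rightarrow> bool" where
  "proj_tri F \<longleftrightarrow> surface_tri F \<and> euler_char F = 1"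

definition plane_tri :: "'a set set \<Rightarrow> bool" where
  "plane_tri F \<longleftrightarrow> surface_tri F \<and> euler_char F = 2"

definition is_K6 :: "'a set set \<Rightarrow> bool" where
  "is_K6 F \<longleftrightarrow> card (verts F) = 6 \<and>
     (\<forall>u\<in>verts F. \<forall>v\<in>verts F. u \<noteq> v \<longrightarrow> {u, v} \<in> edges F)"

definition eulerian :: "'a set set \<Rightarrow> bool" where
  "eulerian F \<longleftrightarrow> (\<forall>v\<in>verts F. even (degree F v))"

text \<open>3-cycles and the regions they bound: two faces lie in the same region of
a 3-cycle C if they are connected through faces sharing edges not on C.\<close>
definition is_3cycle :: "'a set set \<Rightarrow> 'a set \<Rightarrow> bool" where
  "is_3cycle F C \<longleftrightarrow> C \<subseteq> verts F \<and> card C = 3 \<and>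
     (\<forall>e. e \<subseteq> C \<and> card e = 2 \<longrightarrow> e \<in> edges F)"

definition same_region :: "'a set set \<Rightarrow> 'a set \<Rightarrow> 'a set \<Rightarrow> 'a set \<Rightarrow> bool" where
  "same_region F C f g \<longleftrightarrow> f \<in> F \<and> g \<in> F \<and> card (f \<inter> g) = 2 \<and> \<not> (f \<inter> g \<subseteq> C)"

definition separating_3cycle :: "'a set set \<Rightarrow> 'a set \<Rightarrow> bool" where
  "separating_3cycle F C \<longleftrightarrow> is_3cycle F C \<and>
     (\<exists>f\<in>F. \<exists>g\<in>F. \<not> (same_region F C)\<^sup>*\<^sup>* f g \<and> \<not> f \<subseteq> C \<and> \<not> g \<subseteq> C)"

definition no_sep_3cycle :: "'a set set \<Rightarrow> bool" where
  "no_sep_3cycle F \<longleftrightarrow> (\<forall>C. \<not> separating_3cycle F C)"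

definition proper_face_2col :: "'a set set \<Rightarrow> 'a set set \<Rightarrow> bool" where
  "proper_face_2col F R \<longleftrightarrow> R \<subseteq> F \<and>
     (\<forall>f\<in>F. \<forall>g\<in>F. f \<noteq> g \<and> card (f \<inter> g) = 2 \<longrightarrow> (f \<in> R \<longleftrightarrow> g \<notin> R))"

text \<open>Simultaneous pasting: G is obtained from B by pasting, into every face s of S,
the triangulation P s along its face s (the pasted copy is already placed so
that its face s is identified with the face s of B, and its other vertices are
new and distinct from those of the other pasted pieces).\<close>
definition paste_family ::
  "'a set set \<Rightarrow> 'a set set \<Rightarrow> ('a set \<Rightarrow> 'a set set) \<Rightarrow> 'a set set \<Rightarrow> bool" where
  "paste_family B S P G \<longleftrightarrow> S \<subseteq> B \<and>
     (\<forall>s\<in>S. s \<in> P s \<and> verts (P s) \<inter> verts B = s) \<and>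
     (\<forall>s\<in>S. \<forall>t\<in>S. s \<noteq> t \<longrightarrow> verts (P s) \<inter> verts (P t) \<subseteq> verts B) \<and>
     G = (B - S) \<union> (\<Union>s\<in>S. P s - {s})"

text \<open>qe_level (Suc i) T f0 means T belongs to class T_(i+1) w.r.t. f0;
level 0 is empty.\<close>
fun qe_level :: "nat \<Rightarrow> 'a set set \<Rightarrow> 'a set \<Rightarrow> bool" where
  "qe_level 0 T f0 = False"
| "qe_level (Suc n) T f0 =
     (\<exists>E R S P. plane_tri E \<and> eulerian E \<and> no_sep_3cycle E \<and> f0 \<in> E \<and>
        proper_face_2col E R \<and> f0 \<in> R \<and>
        S \<subseteq> E - {f0} \<and> paste_family E S P T \<and>
        (\<forall>s\<in>S. s \<in> R \<longrightarrow> plane_tri (P s)) \<and>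
        (\<forall>s\<in>S. s \<notin> R \<longrightarrow> qe_level n (P s) s))"

definition quasi_eulerian :: "'a set set \<Rightarrow> 'a set \<Rightarrow> bool" where
  "quasi_eulerian T f \<longleftrightarrow> plane_tri T \<and> f \<in> T \<and> (\<exists>i. qe_level i T f)"

definition has_two_thirds_bipartite :: "'a set set \<Rightarrow> bool" where
  "has_two_thirds_bipartite G \<longleftrightarrow>
     (\<exists>H X. H \<subseteq> edges G \<and> 3 * card H = 2 * card (edges G) \<and>
            (\<forall>e\<in>H. card (e \<inter> X) = 1))"

end

theory Submission
 imports Defs "HOL-Library.Disjoint_Sets"
begin

text \<open>A bipartite subgraph with two thirds of the edges is a 2-colouring of the vertices without a
monochromatic face; its monochromatic edges form a perfect matching of the dual graph. Hence the
graphs in question are those for which every dual perfect matching has a complement outside the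
space of coboundaries (cuts of the vertex set). In the projective plane coboundaries have index two
in the cocycles, and any two cocycles that are not coboundaries share a face.

For these bad surfaces one shows by induction that they are K6 with a plane piece in each of its
ten faces. The induction works with abstract complexes in which loops, parallel edges and digons
are allowed, so that it is closed under two reductions: replacing a side of an edge cut of size
at most 3 by one face, and deleting an alternating half of the coboundary of a vertex (or of two
adjacent vertices) while merging the ends of the deleted edges. The second reduction applies at
a vertex of even degree; if all degrees are odd, a barrier from Tutte's theorem for matchings
through one edge of a non-facial triangle takes its place. In both cases there is a band of five
faces with only five vertices, and parity of matchings on non-facial triangles together with a
pentagonal Hall-type argument shows that only five faces remain outside of it.

A plane piece is admissible iff it has no 2-colouring in which the outer face is the only
monochromatic one. By Tutte's theorem again this gives a barrier whose parts are bounded by 3-cycles;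
contracting the maximal ones leaves an Eulerian triangulation, and counting the cut edges of each
part shows that pieces in blue faces satisfy the same condition.\<close>

section \<open>Matchings and Tutte barriers\<close>

text \<open>Two thirds is extremal because a triangle has at most two edges in a cut and
  \<open>2 * card E = 3 * card F\<close>. Counting over the field with two elements, the index of
  the coboundaries in the cocycles is 2 to the power 2 minus the Euler characteristic; so in a bad
  complex the complements of all dual matchings form part of one non-trivial coset. Hence a closed
  edge set that bounds no set of faces meets every such complement in an odd number of edges. This
  rigidity makes complexes without small cuts simple, so that simplicity need not survive the
  reductions, and it forbids most matchings near the band.

  The band has five faces because five of the ten faces of K6 avoid a given vertex; they carry all
  ten edges of K5, five inside the band and five on its boundary.

  The best split of the six vertices of K6 cuts 9 edges where 10 would be needed, which leaves
  exactly one monochromatic face, and this face may be any of the ten. A pasted piece can repair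
  such a colouring only by having its outer face as the lone monochromatic one; this explains the
  condition on pieces.\<close>

lemma hall_marriage:
 assumes "finite A" "!!a. a : A ==> finite (N a)"
  and "!!U. U <= A ==> card U <= card (\<Union>(N ` U))"
 shows "EX s. inj_on s A & (ALL a:A. s a : N a)"
 using assms
proof (induction "card A" arbitrary: A N rule: less_induct)
 case less
 show ?case
 proof (cases "A = {}")
  case False
  then obtain a where a: "a : A" by blast
  show ?thesis
  proof (cases "EX U. U \<subset> A & U ~= {} & card U = card (\<Union>(N ` U))")
   \<comment> \<open>A tight proper subset \<open>U\<close> is saturated first; Hall's condition
     survives on \<open>A - U\<close> after all neighbours of \<open>U\<close> are deleted. Without
     a tight subset, any choice of \<open>b\<close> costs every remaining set at most one
     neighbour.\<close>
   case True
   then obtain U where U: "U \<subset> A" "U ~= {}" "card U = card (\<Union>(N ` U))" by blast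
   have fU: "finite U" using U less.prems(1) finite_subset by blast
   have "card U < card A" using U less.prems(1) psubset_card_mono by blast
   then obtain s where s: "inj_on s U" "ALL a:U. s a : N a"
    using less.hyps[of U N] fU U less.prems by (meson order.trans psubsetD psubset_imp_subset)
   let ?N = "%x. N x - \<Union>(N ` U)"
   have "card (A - U) < card A"
    using U less.prems(1) by (intro psubset_card_mono) auto
   moreover have "card W <= card (\<Union>(?N ` W))" if W: "W <= A - U" for W
   proof -
    have fW: "finite W" using W less.prems(1) finite_subset by blast
    have "card (W Un U) <= card (\<Union>(N ` (W Un U)))"
     using W U by (intro less.prems(3)) blast
    moreover have "card (W Un U) = card W + card U"
     using W fW fU by (intro card_Un_disjoint) auto
    moreover have "\<Union>(N ` (W Un U)) = \<Union>(?N ` W) Un \<Union>(N ` U)" by auto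
    moreover have "card (\<Union>(?N ` W) Un \<Union>(N ` U)) <= card (\<Union>(?N ` W)) + card (\<Union>(N ` U))"
     by (rule card_Un_le)
    ultimately show ?thesis using U(3) by simp
   qed
   ultimately obtain t where t: "inj_on t (A - U)" "ALL a:A - U. t a : ?N a"
    using less.hyps[of "A - U" ?N] less.prems by (metis (no_types, lifting) DiffD1 finite_Diff)
   let ?r = "%x. if x : U then s x else t x"
   have "inj_on ?r (U Un (A - U))"
    unfolding inj_on_Un
   proof (intro conjI)
    show "inj_on ?r U" "inj_on ?r (A - U)"
     using s(1) t(1) by (simp_all add: inj_on_def)
    have "?r ` (U - (A - U)) <= \<Union>(N ` U)" using s(2) by auto
    moreover have "?r ` (A - U - U) Int \<Union>(N ` U) = {}" using t(2) by auto
    ultimately show "?r ` (U - (A - U)) Int ?r ` (A - U - U) = {}" by blast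
   qed
   moreover have "U Un (A - U) = A" using U by blast
   ultimately have "inj_on ?r A" by simp
   moreover have "ALL a:A. ?r a : N a" using s(2) t(2) by auto
   ultimately show ?thesis by blast
  next
   case False
   have "N a ~= {}" using less.prems(3)[of "{a}"] a by auto
   then obtain b where b: "b : N a" by blast
   let ?N = "%x. N x - {b}"
   have "card (A - {a}) < card A" using a less.prems(1) by (meson card_Diff1_less)
   moreover have "card W <= card (\<Union>(?N ` W))" if W: "W <= A - {a}" for W
   proof (cases "W = {}")
    case False2: False
    have "W \<subset> A" using W a by blast
    hence "card W ~= card (\<Union>(N ` W))" using False False2 by blast
    moreover have "card W <= card (\<Union>(N ` W))" using W by (intro less.prems(3)) blast
    moreover have eq: "\<Union>(?N ` W) = \<Union>(N ` W) - {b}" by auto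
    moreover have "card (\<Union>(N ` W)) - 1 <= card (\<Union>(N ` W) - {b})"
     by (metis card_Diff1_le card_Diff_singleton_if diff_le_self order_refl)
    ultimately show ?thesis unfolding eq by linarith
   qed simp
   ultimately obtain t where t: "inj_on t (A - {a})" "ALL x:A - {a}. t x : ?N x"
    using less.hyps[of "A - {a}" ?N] less.prems by (metis (no_types, lifting) DiffD1 finite_Diff)
   let ?r = "t(a := b)"
   have "inj_on ?r A"
    using t by (auto simp: inj_on_def)
   moreover have "ALL a:A. ?r a : N a" using t(2) b by auto
   ultimately show ?thesis by blast
  qed
 qed auto
qed

text \<open>Only the existence of a perfect matching of a vertex set matters in the barrier
  arguments, so it is an inductive predicate on sets; the edges used are recovered later by
  \<open>matchable_edges\<close>.\<close>

inductive matchable :: "('f => 'f => bool) => 'f set => bool" for near where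
 empty: "matchable near {}"
| pair: "matchable near U ==> x ~: U ==> y ~: U ==> x ~= y ==> near x y ==> matchable near (insert x (insert y U))"

lemma matchable_Un: "matchable near U ==> matchable near W ==> U Int W = {} ==> matchable near (U Un W)"
proof (induction rule: matchable.induct)
 case (pair U x y)
 hence "matchable near (insert x (insert y (U Un W)))"
  by (intro matchable.pair) auto
 thus ?case by simp
qed simp

lemma matchable_UN:
 assumes "finite I" "!!i. i : I ==> matchable near (X i)" "disjoint_family_on X I"
 shows "matchable near (UN i:I. X i)"
 using assms
proof (induction I rule: finite_induct)
 case empty thus ?case by (simp add: matchable.empty)
next
 case (insert i I)
 have "matchable near (X i Un (UN i:I. X i))"
  using insert by (intro matchable_Un) (auto simp: disjoint_family_on_def)
 thus ?case by simp
qed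

definition factor_critical :: "('f => 'f => bool) => 'f set => bool" where
 "factor_critical near K \<longleftrightarrow> (ALL x:K. matchable near (K - {x}))"

text \<open>Hall's condition gives a bijection from \<open>A\<close> to \<open>KK\<close> along
  edges of \<open>near\<close>; each part loses the vertex matched in this way, and
  factor-criticality matches the rest. The contrapositive produces the Hall violators of
  \<open>hall_step\<close>.\<close>

lemma matchable_expand:
 assumes "finite A" "disjoint KK" "A Int \<Union>KK = {}" "finite KK" "card A = card KK"
  and fc: "!!K. K : KK ==> factor_critical near K"
  and hall: "!!U. U <= A ==> card U <= card {K:KK. EX u:U. EX x:K. near u x}"
 shows "matchable near (A Un \<Union>KK)"
proof -
 let ?N = "%a. {K:KK. EX x:K. near a x}"
 have "\<Union>(?N ` U) = {K:KK. EX u:U. EX x:K. near u x}" for U by auto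
 hence "EX s. inj_on s A & (ALL a:A. s a : ?N a)"
  using hall by (intro hall_marriage) (use assms in auto)
 then obtain s where s: "inj_on s A" "!!a. a : A ==> s a : KK"
  "!!a. a : A ==> EX x:s a. near a x" by auto
 have img: "s ` A = KK"
  using s assms by (intro card_subset_eq) (auto simp: card_image)
 have 1: "matchable near (insert a (s a))" if a: "a : A" for a
 proof -
  obtain x where x: "x : s a" "near a x" using s a by blast
  have "a ~: s a" using a s(2) assms(3) by blast
  moreover have "matchable near (s a - {x})"
   using fc[OF s(2)[OF a]] x by (auto simp: factor_critical_def)
  ultimately have "matchable near (insert a (insert x (s a - {x})))"
   using x by (intro matchable.pair) auto
  thus ?thesis using x by (simp add: insert_absorb)
 qed
 have "disjoint_family_on (%a. insert a (s a)) A"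
 proof (unfold disjoint_family_on_def, intro ballI impI)
  fix a b assume ab: "a : A" "b : A" "a ~= b"
  hence "s a ~= s b" using s(1) by (auto dest: inj_onD)
  hence "s a Int s b = {}" using assms(2) s(2) ab by (auto simp: disjoint_def)
  moreover have "a ~: s b" "b ~: s a" using ab s(2) assms(3) by blast+
  ultimately show "insert a (s a) Int insert b (s b) = {}" using ab by auto
 qed
 from matchable_UN[OF assms(1) _ this] 1
 have "matchable near (UN a:A. insert a (s a))" by blast
 moreover have "(UN a:A. insert a (s a)) = A Un \<Union>KK" using img by blast
 ultimately show ?thesis by simp
qed

text \<open>The sets in the family need not be connected; this makes the family easy to modify.\<close>
definition separation :: "('f => 'f => bool) => 'f set => 'f set => 'f set set => bool" where
 "separation near U A KK \<longleftrightarrow> A <= U & partition_on (U - A) KK &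
   (ALL K:KK. ALL L:KK. K ~= L --> (ALL x:K. ALL y:L. ~ near x y))"

definition odds :: "'f set set => nat" where "odds KK = card {K:KK. odd (card K)}"

section \<open>Separations of maximal deficiency\<close>

lemma partition_on_finite: "partition_on A P ==> finite A ==> finite P"
 by (rule finite_elements)

lemma card_partition_parity:
 assumes "partition_on A P" "finite A"
 shows "even (card A) \<longleftrightarrow> even (odds P)"
proof -
 have fP: "finite P" using partition_on_finite assms .
 have "card A = sum card P"
  using assms by (intro product_partition) (auto simp: partition_on_def intro: finite_subset)
 also have "even (sum card P) \<longleftrightarrow> even (card {K:P. odd (card K)})"
  using fP by (simp add: even_sum_iff)
 finally show ?thesis by (simp add: odds_def)
qed


text \<open>One part is replaced by a separation of that part. An odd part stops counting when it is
  broken up, which is the correction term in the second equation. In \<open>tutte\<close> a part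
  with a defect is refined in this way to beat a maximal separation.\<close>

lemma separation_refine:
 assumes "separation near U A KK" "K : KK" "separation near K A2 KK2" "finite U"
 shows "separation near U (A Un A2) (KK - {K} Un KK2)"
  and "odds (KK - {K} Un KK2) + (if odd (card K) then 1 else 0) = odds KK + odds KK2"
  and "card (A Un A2) = card A + card A2"
proof -
 have p: "partition_on (U - A) KK" "partition_on (K - A2) KK2" "A <= U" "A2 <= K"
  using assms by (auto simp: separation_def)
 have K: "K <= U - A" using p(1) assms(2) by (auto simp: partition_on_def)
 have sub: "L <= K" if "L : KK2" for L using p that by (auto simp: partition_on_def)
 have disj: "L Int K = {}" if "L : KK - {K}" for L
  using p(1) assms(2) that by (auto simp: partition_on_def disjoint_def)
 have ne: "L ~= {}" if "L : KK2" for L using p that by (auto simp: partition_on_def)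
 have "partition_on (U - (A Un A2)) (KK - {K} Un KK2)"
 proof (rule partition_onI)
  have 1: "\<Union>KK = U - A" "\<Union>KK2 = K - A2" using p by (auto simp: partition_on_def)
  have "\<Union>(KK - {K}) = \<Union>KK - K" using disj by fastforce
  hence "\<Union>(KK - {K}) = U - A - K" using 1 by simp
  thus "\<Union>(KK - {K} Un KK2) = U - (A Un A2)" using 1(2) K p(4) by auto
  show "{} ~: KK - {K} Un KK2"
   using partition_onD3[OF p(1)] ne[of "{}"] by blast
  show "disjnt q q'" if q: "q : KK - {K} Un KK2" "q' : KK - {K} Un KK2" "q ~= q'" for q q'
  proof -
   have d: "L Int M = {}" if "L : KK" "M : KK" "L ~= M" for L M
    using p that by (auto simp: partition_on_def disjoint_def)
   have d2: "L Int M = {}" if "L : KK2" "M : KK2" "L ~= M" for L M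
    using p that by (auto simp: partition_on_def disjoint_def)
   have d3: "L Int M = {}" if "L : KK - {K}" "M : KK2" for L M
    using disj[OF that(1)] sub[OF that(2)] by blast
   consider "q : KK - {K}" "q' : KK - {K}" | "q : KK2" "q' : KK2"
    | "q : KK - {K}" "q' : KK2" | "q : KK2" "q' : KK - {K}" using q by blast
   thus ?thesis unfolding disjnt_def
   proof cases
    case 4 thus "q Int q' = {}" using d3[of q' q] by blast
   next
    case 1 thus "q Int q' = {}" using d[of q q'] q(3) by simp
   next
    case 2 thus "q Int q' = {}" using d2[of q q'] q(3) by simp
   next
    case 3 thus "q Int q' = {}" using d3[of q q'] by simp
   qed
  qed
 qed
 moreover have "~ near x y" if q: "L : KK - {K} Un KK2" "M : KK - {K} Un KK2" "L ~= M" "x : L" "y : M" for L M x y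
 proof -
  have a: "~ near x y" if "L : KK" "M : KK" "L ~= M" "x : L" "y : M" for L M x y
   using assms(1) that by (auto simp: separation_def)
  have b: "~ near x y" if "L : KK2" "M : KK2" "L ~= M" "x : L" "y : M" for L M x y
   using assms(3) that by (auto simp: separation_def)
  consider "L : KK" "M : KK" | "L : KK2" "M : KK2"
   | "L : KK - {K}" "M : KK2" | "L : KK2" "M : KK - {K}" using q(1,2) by blast
  thus ?thesis
  proof cases
   case 3 thus ?thesis using a[of L K x y] sub q assms(2) by blast
  next
   case 4 thus ?thesis using a[of K M x y] sub q assms(2) by blast
  next
   case 1 thus ?thesis using a[of L M x y] q(3-5) by blast
  next
   case 2 thus ?thesis using b[of L M x y] q(3-5) by blast
  qed
 qed
 ultimately show "separation near U (A Un A2) (KK - {K} Un KK2)"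
  unfolding separation_def using p K by auto
 have fin: "finite KK" "finite KK2" "finite A" "finite A2"
  using p assms(4) K by (meson finite_Diff finite_subset partition_on_finite)+
 have "(KK - {K}) Int KK2 = {}"
 proof (rule ccontr)
  assume "(KK - {K}) Int KK2 ~= {}"
  then obtain L where "L : KK - {K}" "L : KK2" by blast
  thus False using disj[of L] sub[of L] ne[of L] by blast
 qed
 hence "odds (KK - {K} Un KK2) = odds (KK - {K}) + odds KK2"
  using fin unfolding odds_def by (subst card_Un_disjoint[symmetric]) (auto intro: arg_cong[where f=card])
 moreover have "odds (KK - {K}) + (if odd (card K) then 1 else 0) = odds KK"
 proof (cases "odd (card K)")
  case True
  hence "{L:KK. odd (card L)} = insert K {L:KK - {K}. odd (card L)}" using assms(2) by auto
  thus ?thesis using fin True by (simp add: odds_def)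
 next
  case False
  hence "{L:KK. odd (card L)} = {L:KK - {K}. odd (card L)}" by auto
  thus ?thesis using False by (simp add: odds_def)
 qed
 ultimately show "odds (KK - {K} Un KK2) + (if odd (card K) then 1 else 0) = odds KK + odds KK2" by simp
 have "A Int A2 = {}" using p K by auto
 thus "card (A Un A2) = card A + card A2" using fin by (simp add: card_Un_disjoint)
qed

lemma odds_le: "finite KK ==> odds KK <= card KK"
 unfolding odds_def by (intro card_mono) auto

lemma odds_all: "(!!K. K : KK ==> odd (card K)) ==> odds KK = card KK"
 unfolding odds_def by (intro arg_cong[where f=card]) auto

lemma partition_on_card_le:
 assumes "partition_on A P" "finite A" shows "card P <= card A"
proof -
 have "card P = (SUM p:P. 1)" by simp
 also have "... <= sum card P"
 proof (rule sum_mono)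
  fix p assume "p : P"
  hence "p ~= {}" "finite p" using assms by (auto simp: partition_on_def intro: finite_subset)
  thus "1 <= card p" by (simp add: Suc_leI card_gt_0_iff)
 qed
 also have "... = card A"
  using assms by (intro product_partition[symmetric]) (auto simp: partition_on_def intro: finite_subset)
 finally show ?thesis .
qed

text \<open>The deficiency \<open>odds KK - card A\<close> is maximised, and among the optima
  \<open>card A\<close>; the conclusion says this without subtraction. The tie-break is what makes
  every part odd.\<close>

lemma maximal_separation:
 assumes "finite U"
 obtains A KK where "separation near U A KK"
  "!!A2 KK2. separation near U A2 KK2 ==>
    odds KK2 + card A < odds KK + card A2 | odds KK2 + card A = odds KK + card A2 & card A2 <= card A"
proof -
 define n where "n = card U"
 \<comment> \<open>The lexicographic order packed into one natural number: \<open>card A\<close> is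
   at most \<open>n\<close>, so the factor \<open>n + 1\<close> lets the deficiency dominate. The
   summand \<open>n\<close> keeps the truncated subtraction exact.\<close>
 define w where "w = (%(A :: 'a set, KK :: 'a set set). (n + 1) * (n + odds KK - card A) + card A)"
 define P where "P = (%(A, KK). separation near U A KK)"
 have bnd: "card A <= n" "odds KK <= n" if "P (A, KK)" for A KK
 proof -
  have p: "partition_on (U - A) KK" "A <= U" using that by (auto simp: P_def separation_def)
  show "card A <= n" using p assms by (simp add: n_def card_mono)
  have "odds KK <= card KK" using p assms by (intro odds_le) (meson finite_Diff partition_on_finite)
  also have "... <= card (U - A)" using p assms by (intro partition_on_card_le) auto
  also have "... <= n" using assms by (simp add: n_def card_mono)
  finally show "odds KK <= n" .
 qed
 have "P (U, {})" by (simp add: P_def separation_def partition_on_def)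
 moreover have "ALL y. P y --> w y <= (n + 1) * (2 * n) + n"
 proof (intro allI impI)
  fix y assume "P y"
  obtain A KK where y: "y = (A, KK)" by (cases y)
  have "n + odds KK - card A <= 2 * n" "card A <= n" using bnd[of A KK] \<open>P y\<close> y by auto
  thus "w y <= (n + 1) * (2 * n) + n"
   unfolding w_def y by (auto intro: add_mono mult_le_mono2 simp del: mult_Suc mult_Suc_right)
 qed
 ultimately obtain x where x: "P x" "!!y. P y ==> w y <= w x"
  using ex_has_greatest_nat[of P "(U, {})" w "Suc ((n + 1) * (2 * n) + n)"] by (auto simp: le_imp_less_Suc)
 obtain A KK where xe: "x = (A, KK)" by (cases x)
 show ?thesis
 proof (rule that)
  show "separation near U A KK" using x xe by (simp add: P_def)
  fix A2 KK2 assume "separation near U A2 KK2"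
  hence P2: "P (A2, KK2)" by (simp add: P_def)
  define p q where "p = n + odds KK - card A" and "q = n + odds KK2 - card A2"
  have le: "(n + 1) * q + card A2 <= (n + 1) * p + card A"
   using x(2)[OF P2] by (simp add: w_def xe p_def q_def)
  have b: "card A <= n" "card A2 <= n" using bnd x(1) P2 xe by auto
  have "q <= p"
  proof (rule ccontr)
   assume "~ q <= p"
   hence "(n + 1) * (p + 1) <= (n + 1) * q" by (intro mult_le_mono2) simp
   thus False using le b by (simp add: algebra_simps)
  qed
  moreover have "card A2 <= card A" if "q = p" using le that by simp
  ultimately show "odds KK2 + card A < odds KK + card A2 | odds KK2 + card A = odds KK + card A2 & card A2 <= card A"
   using b unfolding p_def q_def by linarith
 qed
qed

text \<open>A maximal separation has only odd factor-critical parts, as in the Gallai-Edmonds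
  decomposition. If there are not more parts than elements of \<open>A\<close>, there are equally
  many, and Hall's condition holds because a violator could be moved out of \<open>A\<close> with
  profit. Factor-criticality is the surplus over the classical statement that
  \<open>hall_step\<close> uses.\<close>

theorem tutte:
 assumes "finite U" and sym: "!!x y. near x y ==> near y x"
 shows "matchable near U | (EX A KK. separation near U A KK &
  (ALL K:KK. odd (card K) & factor_critical near K) & card A < card KK)"
 using assms(1)
proof (induction "card U" arbitrary: U rule: less_induct)
 case less
 obtain A KK where sep: "separation near U A KK" and max: "!!A2 KK2. separation near U A2 KK2 ==>
    odds KK2 + card A < odds KK + card A2 | odds KK2 + card A = odds KK + card A2 & card A2 <= card A"
  using maximal_separation[OF less.prems] by blast
 have p: "partition_on (U - A) KK" "A <= U" using sep by (auto simp: separation_def)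
 have fin: "finite A" "finite KK" "finite (U - A)"
  using p less.prems by (meson finite_Diff finite_subset partition_on_finite)+
 have K_sub: "K <= U - A" "K ~= {}" "finite K" if "K : KK" for K
  using p that fin(3) by (auto simp: partition_on_def intro: finite_subset)
 have refine: False if K: "K : KK" and s: "separation near K A2 KK2" and A2: "A2 ~= {}"
  and c: "card A2 + (if odd (card K) then 1 else 0) <= odds KK2" for K A2 KK2
 proof -
  note r = separation_refine[OF sep K s less.prems]
  have "0 < card A2" using A2 s finite_subset[OF _ K_sub(3)[OF K]] by (simp add: separation_def card_gt_0_iff)
  thus False using max[OF r(1)] r(2,3) c by linarith
 qed
 \<comment> \<open>An even part could give one vertex to \<open>A\<close>: the deficiency stays the
   same and \<open>A\<close> grows.\<close>
 have odd_K: "odd (card K)" if K: "K : KK" for K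
 proof (rule ccontr)
  assume ev: "~ odd (card K)"
  obtain x where x: "x : K" using K_sub[OF K] by blast
  have o: "odd (card (K - {x}))" using ev x K_sub[OF K] by (simp add: card_Diff_singleton card_gt_0_iff)
  hence "K - {x} ~= {}" by force
  hence "separation near K {x} {K - {x}}"
   using x by (auto simp: separation_def partition_on_def disjoint_def)
  thus False by (rule refine[OF K]) (use o ev odds_all[of "{K - {x}}"] in auto)
 qed
 have fc: "factor_critical near K" if K: "K : KK" for K
  unfolding factor_critical_def
 proof (rule ballI, rule ccontr)
  fix x assume x: "x : K" and nm: "~ matchable near (K - {x})"
  have "card (K - {x}) < card U"
   using K_sub[OF K] x less.prems by (intro psubset_card_mono) auto
  from less.hyps[OF this] nm K_sub[OF K] obtain A2 KK2 where
   s: "separation near (K - {x}) A2 KK2" and o: "ALL K:KK2. odd (card K)" and c: "card A2 < card KK2" by auto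
  have p2: "partition_on (K - {x} - A2) KK2" "A2 <= K - {x}" using s by (auto simp: separation_def)
  have oK: "odds KK2 = card KK2" using o by (simp add: odds_all)
  \<comment> \<open>Parity raises the excess of the inner barrier from one to two: one unit pays for
    the odd part \<open>K\<close> that is broken up, the other for the vertex \<open>x\<close> that
    joins the barrier.\<close>
  have "even (card (K - {x}))" using odd_K[OF K] x K_sub[OF K] by (simp add: card_Diff_singleton)
  moreover have "card (K - {x}) = card (K - {x} - A2) + card A2"
   using p2 K_sub[OF K] by (metis card_Diff_subset card_mono finite_Diff finite_subset le_add_diff_inverse2)
  moreover have "even (card (K - {x} - A2)) \<longleftrightarrow> even (card KK2)"
   using card_partition_parity[OF p2(1)] K_sub[OF K] oK by simp
  ultimately have "card A2 + 2 <= card KK2" using c by presburger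
  moreover have "separation near K (insert x A2) KK2"
  proof -
   have "K - {x} - A2 = K - insert x A2" by auto
   thus ?thesis using s x by (auto simp: separation_def)
  qed
  moreover have "card (insert x A2) = card A2 + 1"
   using p2 K_sub[OF K] by (subst card_insert_disjoint) (auto intro: finite_subset)
  ultimately show False using refine[OF K, of "insert x A2" KK2] odd_K[OF K] oK by auto
 qed
 have oKK: "odds KK = card KK" using odd_K by (simp add: odds_all)
 show ?case
 proof (cases "card A < card KK")
  case True thus ?thesis using sep odd_K fc by blast
 next
  case False
  have "separation near U {} (if U = {} then {} else {U})" by (auto simp: separation_def partition_on_def disjoint_def)
  from max[OF this] have "card A <= card KK" using oKK by auto
  with False have eq: "card A = card KK" by simp
  have "matchable near (A Un \<Union>KK)"
  proof (rule matchable_expand)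
   show "disjoint KK" "A Int \<Union>KK = {}" using p by (auto simp: partition_on_def)
   fix W assume W: "W <= A"
   define N where "N = {K:KK. EX u:W. EX x:K. near u x}"
   have NK: "N <= KK" by (auto simp: N_def)
   have no_N: "~ near u x" if "M : KK - N" "u : W" "x : M" for M u x
    using that by (auto simp: N_def)
   show "card W <= card {K:KK. EX u:W. EX x:K. near u x}" unfolding N_def[symmetric]
   proof (rule ccontr)
    assume *: "~ card W <= card N"
    \<comment> \<open>The violator leaves \<open>A\<close> and is glued to all parts it touches. At
      most \<open>card N\<close> odd parts are lost while \<open>A\<close> shrinks by the larger
      number \<open>card W\<close>, so the deficiency would grow.\<close>
    define L where "L = W Un \<Union>N"
    have "L ~= {}" using * W fin by (auto simp: L_def)
    define KK2 where "KK2 = insert L (KK - N)"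
    have "partition_on (U - (A - W)) KK2"
    proof (rule partition_onI)
     have "\<Union>KK = U - A" using p by (simp add: partition_on_def)
     moreover have "\<Union>KK2 = W Un \<Union>KK" using NK unfolding KK2_def L_def by blast
     ultimately show "\<Union>KK2 = U - (A - W)" using W p(2) by auto
     show "{} ~: KK2" using K_sub \<open>L ~= {}\<close> by (auto simp: KK2_def)
     have d: "q Int q' = {}" if "q : KK" "q' : KK" "q ~= q'" for q q'
      using p that by (auto simp: partition_on_def disjoint_def)
     have "q Int L = {}" if "q : KK - N" for q
     proof -
      have "q Int W = {}" using that K_sub W by blast
      moreover have "q Int \<Union>N = {}" using d[of q] that NK by blast
      ultimately show ?thesis by (auto simp: L_def)
     qed
     hence e: "q Int L = {}" "L Int q = {}" if "q : KK - N" for q using that by blast+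
     show "disjnt q q'" if q: "q : KK2" "q' : KK2" "q ~= q'" for q q'
     proof -
      consider "q = L" "q' : KK - N" | "q' = L" "q : KK - N" | "q : KK - N" "q' : KK - N"
       using q unfolding KK2_def by blast
      thus ?thesis unfolding disjnt_def
      proof cases
       case 1 thus "q Int q' = {}" using e(2)[of q'] by simp
      next
       case 2 thus "q Int q' = {}" using e(1)[of q] by simp
      next
       case 3 thus "q Int q' = {}" using d[of q q'] q(3) by simp
      qed
     qed
    qed
    moreover have "~ near x y" if q: "M : KK2" "M' : KK2" "M ~= M'" "x : M" "y : M'" for M M' x y
    proof -
     have a: "~ near x y" if "M : KK" "M' : KK" "M ~= M'" "x : M" "y : M'" for M M' x y
      using sep that by (auto simp: separation_def)
     have b: "~ near x y" "~ near y x" if "M : KK - N" "x : L" "y : M" for M x y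
     proof -
      show "~ near x y"
      proof (cases "x : W")
       case True thus ?thesis using that no_N by blast
      next
       case False
       then obtain M' where "M' : N" "x : M'" using \<open>x : L\<close> by (auto simp: L_def)
       thus ?thesis using a[of M' M x y] that NK by blast
      qed
      thus "~ near y x" using sym by blast
     qed
     consider "M = L" "M' : KK - N" | "M' = L" "M : KK - N" | "M : KK - N" "M' : KK - N"
      using q(1-3) unfolding KK2_def by blast
     thus ?thesis
     proof cases
      case 1 thus ?thesis using b(1)[of M' x y] q(4,5) by simp
     next
      case 2 thus ?thesis using b(2)[of M y x] q(4,5) by simp
     next
      case 3 thus ?thesis using a[of M M' x y] q(3-5) by simp
     qed
    qed
    ultimately have s2: "separation near U (A - W) KK2"
     using p(2) by (auto simp: separation_def)
    have "card (KK - N) = card KK - card N" using fin NK by (intro card_Diff_subset) (auto intro: finite_subset)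
    moreover have "card (KK - N) <= odds KK2"
     unfolding odds_def using fin odd_K by (intro card_mono) (auto simp: KK2_def)
    moreover have "card N <= card KK" using fin NK by (intro card_mono) auto
    moreover have "card (A - W) = card A - card W" "card W <= card A"
     using W fin by (auto intro: card_Diff_subset card_mono finite_subset)
    ultimately show False using max[OF s2] oKK eq * by linarith
   qed
  qed (use fin eq fc in auto)
  moreover have "A Un \<Union>KK = U" using p by (auto simp: partition_on_def)
  ultimately show ?thesis by simp
 qed
qed

lemma even_card_sym_diff:
 assumes "finite A" "finite B"
 shows "even (card (sym_diff A B)) \<longleftrightarrow> (even (card A) \<longleftrightarrow> even (card B))"
proof -
 have "card (sym_diff A B) = card (A - B) + card (B - A)"
  using assms by (intro card_Un_disjoint) auto
 moreover have "card A = card (A - B) + card (A Int B)"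
  using assms by (subst card_Un_disjoint[symmetric]) (auto intro: arg_cong[where f=card])
 moreover have "card B = card (B - A) + card (A Int B)"
  using assms by (subst card_Un_disjoint[symmetric]) (auto intro: arg_cong[where f=card])
 ultimately show ?thesis by auto
qed

lemma sym_diff_Int: "sym_diff A B Int C = sym_diff (A Int C) (B Int C)" by blast

lemma even_sum_card:
 assumes "finite A" "finite B"
 shows "(SUM a:A. card {b:B. R a b}) = (SUM b:B. card {a:A. R a b})"
 using sum_multicount_gen[of A B R "%b. card {a:A. R a b}"] assms by simp

section \<open>Face-edge incidences and cuts\<close>

text \<open>Faces are counted inside \<open>X\<close> alone, so no ambient face set appears. Once
  every edge has two faces, \<open>cut\<close> is the edge boundary of \<open>X\<close> in the dual
  graph and \<open>inner\<close> consists of the dual edges within \<open>X\<close>.\<close>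

definition cut :: "'e set => ('f => 'e set) => 'f set => 'e set" where
 "cut E bd X = {e:E. card {f:X. e : bd f} = 1}"

definition inner :: "'e set => ('f => 'e set) => 'f set => 'e set" where
 "inner E bd X = {e:E. card {f:X. e : bd f} = 2}"

locale incidence =
 fixes F :: "'f set" and E :: "'e set" and bd :: "'f => 'e set"
 assumes finF: "finite F" and finE: "finite E"
  and bdE: "!!f. f : F ==> bd f <= E"
  and two: "!!e. e : E ==> card {f:F. e : bd f} = 2"
begin

abbreviation "cut' == cut E bd"
abbreviation "inner' == inner E bd"

lemma fin_sub: "X <= F ==> finite X" using finF finite_subset by blast
lemma fin_bd: "f : F ==> finite (bd f)" using bdE finE finite_subset by blast
lemma fin_cut: "finite (cut' X)" using finE by (simp add: cut_def)
lemma fin_inner: "finite (inner' X)" using finE by (simp add: inner_def)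
lemma cut_E: "cut' X <= E" by (auto simp: cut_def)
lemma inner_E: "inner' X <= E" by (auto simp: inner_def)

lemma faces_split:
 assumes "X <= F" "e : E"
 shows "card {f:X. e : bd f} + card {f:F - X. e : bd f} = 2"
proof -
 have "{f:F. e : bd f} = {f:X. e : bd f} Un {f:F - X. e : bd f}" using assms by auto
 moreover have "card ... = card {f:X. e : bd f} + card {f:F - X. e : bd f}"
  using fin_sub[OF assms(1)] finF by (intro card_Un_disjoint) auto
 ultimately show ?thesis using two[OF assms(2)] by simp
qed

lemma cut_iff:
 assumes "X <= F"
 shows "e : cut' X \<longleftrightarrow> e : E & (EX f:X. e : bd f) & (EX g:F - X. e : bd g)"
proof (cases "e : E")
 case True
 have fin: "finite {f:X. e : bd f}" "finite {f:F - X. e : bd f}" using fin_sub[OF assms] finF by auto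
 have "(EX f:X. e : bd f) \<longleftrightarrow> card {f:X. e : bd f} ~= 0"
  using fin by auto
 moreover have "(EX f:F - X. e : bd f) \<longleftrightarrow> card {f:F - X. e : bd f} ~= 0"
  using fin by auto
 ultimately show ?thesis using faces_split[OF assms True] True by (auto simp: cut_def)
qed (simp add: cut_def)

lemma inner_iff:
 assumes "X <= F"
 shows "e : inner' X \<longleftrightarrow> e : E & (ALL f:F. e : bd f --> f : X)"
proof (cases "e : E")
 case True
 have fin: "finite {f:F - X. e : bd f}" using finF by auto
 have "(ALL f:F. e : bd f --> f : X) \<longleftrightarrow> card {f:F - X. e : bd f} = 0"
  using fin by auto
 thus ?thesis using faces_split[OF assms True] True by (auto simp: inner_def)
qed (simp add: inner_def)

lemma cut_compl: "X <= F ==> cut' (F - X) = cut' X"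
 by (rule set_eqI) (auto simp: cut_iff)

lemma cut_empty: "cut' {} = {}" by (simp add: cut_def)
lemma cut_F: "cut' F = {}" using two by (auto simp: cut_def)

lemma edge_cases:
 assumes "X <= F" "e : E"
 shows "e : inner' X | e : cut' X | e : inner' (F - X)"
 using assms by (auto simp: cut_iff inner_iff)

lemma inner_cut_disj: "inner' X Int cut' X = {}" by (auto simp: inner_def cut_def)

lemma cut_inner_compl:
 assumes "X <= F" shows "cut' X Int inner' (F - X) = {}"
 using cut_iff[OF assms] inner_iff[of "F - X"] assms by blast

lemma two_faces:
 assumes "e : E"
 obtains f g where "f : F" "g : F" "f ~= g" "e : bd f" "e : bd g" "{h:F. e : bd h} = {f, g}"
proof -
 obtain f g where fg: "{f:F. e : bd f} = {f, g}" "f ~= g" using two[OF assms] by (auto simp: card_2_iff)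
 have 1: "f : {f:F. e : bd f}" "g : {f:F. e : bd f}" unfolding fg(1) by auto
 have "f : F" "e : bd f" "g : F" "e : bd g" using 1 by auto
 thus ?thesis by (intro that[of f g] fg)
qed

lemma other_face:
 assumes "f : F" "e : bd f"
 obtains g where "g : F" "g ~= f" "e : bd g" "{h:F. e : bd h} = {f, g}"
proof -
 have "e : E" using assms bdE by blast
 then obtain a b where ab: "a : F" "b : F" "a ~= b" "e : bd a" "e : bd b" "{h:F. e : bd h} = {a, b}"
  using two_faces by blast
 have "f : {h:F. e : bd h}" using assms by simp
 hence "f = a | f = b" using ab by simp
 thus ?thesis
 proof
  assume "f = a" thus ?thesis using that[of b] ab by simp
 next
  assume "f = b" thus ?thesis using that[of a] ab by (simp add: insert_commute)
 qed
qed

lemma cut_two: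
 assumes "X <= F" "{h:F. e : bd h} = {f, g}" "f ~= g"
 shows "e : cut' X \<longleftrightarrow> (f : X \<longleftrightarrow> g ~: X)"
proof -
 have f: "h : F & e : bd h \<longleftrightarrow> h = f | h = g" for h using assms(2) by (metis (mono_tags, lifting) insert_iff mem_Collect_eq singletonD)
 hence "f : F" "e : bd f" by auto
 hence "e : E" using bdE by blast
 moreover have "(EX h:X. e : bd h) \<longleftrightarrow> f : X | g : X" using assms(1) f by (metis subsetD)
 moreover have "(EX h:F - X. e : bd h) \<longleftrightarrow> f ~: X | g ~: X" using f by (metis DiffD1 DiffD2 DiffI)
 ultimately show ?thesis unfolding cut_iff[OF assms(1)] by (metis assms(3))
qed

lemma inner_two:
 assumes "X <= F" "{h:F. e : bd h} = {f, g}" "f ~= g"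
 shows "e : inner' X \<longleftrightarrow> f : X & g : X"
proof -
 have f: "h : F & e : bd h \<longleftrightarrow> h = f | h = g" for h using assms(2) by (metis (mono_tags, lifting) insert_iff mem_Collect_eq singletonD)
 hence "f : F" "e : bd f" by auto
 hence "e : E" using bdE by blast
 thus ?thesis unfolding inner_iff[OF assms(1)] using f by metis
qed

lemma handshake:
 assumes "X <= F" "z <= E"
 shows "(SUM f:X. card (z Int bd f)) = 2 * card (z Int inner' X) + card (z Int cut' X)"
proof -
 have fz: "finite z" using assms finE finite_subset by blast
 have "(SUM f:X. card (z Int bd f)) = (SUM f:X. card {e:z. e : bd f})"
  by (intro sum.cong refl arg_cong[where f=card]) auto
 also have "... = (SUM e:z. card {f:X. e : bd f})"
  using fz fin_sub[OF assms(1)] by (intro even_sum_card)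
 also have "... = (SUM e:z. (if e : inner' X then 2 else 0) + (if e : cut' X then 1 else 0))"
 proof (intro sum.cong refl)
  fix e assume "e : z"
  hence e: "e : E" using assms by blast
  have "card {f:X. e : bd f} <= 2" using faces_split[OF assms(1) e] by simp
  thus "card {f:X. e : bd f} = (if e : inner' X then 2 else 0) + (if e : cut' X then 1 else 0)"
   using e unfolding inner_def cut_def by auto
 qed
 also have "... = 2 * card (z Int inner' X) + card (z Int cut' X)"
  using fz by (simp add: sum.distrib sum.If_cases Int_def)
 finally show ?thesis .
qed

lemma handshake_bd:
 assumes "X <= F"
 shows "(SUM f:X. card (bd f)) = 2 * card (inner' X) + card (cut' X)"
proof -
 have "(SUM f:X. card (bd f)) = (SUM f:X. card (E Int bd f))"
  using bdE assms by (intro sum.cong refl arg_cong[where f=card]) auto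
 also have "... = 2 * card (E Int inner' X) + card (E Int cut' X)"
  using handshake[OF assms order_refl] .
 finally show ?thesis by (simp add: Int_absorb1 inner_E cut_E)
qed

lemma cut_single:
 assumes "f : F" shows "cut' {f} = bd f"
proof -
 have "{g. g = f & e : bd g} = (if e : bd f then {f} else {})" for e by auto
 thus ?thesis using bdE[OF assms] by (auto simp: cut_def split: if_splits)
qed

lemma inner_single: "inner' {f} = {}"
proof -
 have "{g. g = f & e : bd g} = (if e : bd f then {f} else {})" for e by auto
 thus ?thesis by (auto simp: inner_def split: if_splits)
qed

lemma cut_submodular:
 assumes "X <= F" "Y <= F"
 shows "card (cut' (X Int Y)) + card (cut' (X Un Y)) <= card (cut' X) + card (cut' Y)"
proof -
 have *: "(e : cut' (X Int Y) | e : cut' (X Un Y) --> e : cut' X | e : cut' Y) &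
   (e : cut' (X Int Y) & e : cut' (X Un Y) --> e : cut' X & e : cut' Y)" for e
 proof (cases "e : E")
  case True
  obtain f g where fg: "{h:F. e : bd h} = {f, g}" "f ~= g"
   using two_faces[OF True] by blast
  note c = cut_two[OF _ fg]
  have sub: "X Int Y <= F" "X Un Y <= F" using assms by auto
  show ?thesis unfolding c[OF sub(1)] c[OF sub(2)] c[OF assms(1)] c[OF assms(2)] by blast
 qed (use cut_E in blast)
 have "cut' (X Int Y) Un cut' (X Un Y) <= cut' X Un cut' Y"
  and "cut' (X Int Y) Int cut' (X Un Y) <= cut' X Int cut' Y" using * by blast+
 hence "card (cut' (X Int Y) Un cut' (X Un Y)) + card (cut' (X Int Y) Int cut' (X Un Y))
   <= card (cut' X Un cut' Y) + card (cut' X Int cut' Y)"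
  using fin_cut by (intro add_mono card_mono) auto
 thus ?thesis using card_Un_Int[OF fin_cut fin_cut] by metis
qed

lemma cut_posimodular:
 assumes "X <= F" "Y <= F"
 shows "card (cut' (X - Y)) + card (cut' (Y - X)) <= card (cut' X) + card (cut' Y)"
proof -
 have "X Int (F - Y) = X - Y" "X Un (F - Y) = F - (Y - X)" using assms by auto
 thus ?thesis using cut_submodular[of X "F - Y"] assms cut_compl[of Y] cut_compl[of "Y - X"]
  by (metis Diff_subset order.trans)
qed

lemma cut_Un_disj:
 assumes "X <= F" "Y <= F" "X Int Y = {}"
 shows "cut' (X Un Y) = sym_diff (cut' X) (cut' Y)"
proof (rule set_eqI)
 fix e
 have sub: "X Un Y <= F" using assms by auto
 show "e : cut' (X Un Y) \<longleftrightarrow> e : sym_diff (cut' X) (cut' Y)"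
 proof (cases "e : E")
  case True
  have "{f:X Un Y. e : bd f} = {f:X. e : bd f} Un {f:Y. e : bd f}" by auto
  moreover have "card ... = card {f:X. e : bd f} + card {f:Y. e : bd f}"
   using assms fin_sub by (intro card_Un_disjoint) auto
  moreover have "card {f:X Un Y. e : bd f} <= 2" using faces_split[OF sub True] by simp
  ultimately show ?thesis using True by (auto simp: cut_def)
 qed (simp add: cut_def)
qed

text \<open>Dual adjacency after deletion of the edges in \<open>N\<close>. The parameter serves to
  ask for matchings that avoid given edges or, with a complement such as \<open>E - Z\<close>, that
  use only given ones.\<close>

definition near :: "'e set => 'f => 'f => bool" where
 "near N f g \<longleftrightarrow> f : F & g : F & f ~= g & (EX e:E - N. e : bd f & e : bd g)"

lemma near_sym: "near N f g ==> near N g f" by (auto simp: near_def)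

lemma nearI: "f : F ==> g : F ==> f ~= g ==> e : bd f ==> e : bd g ==> e ~: N ==> near N f g"
 using bdE by (auto simp: near_def)

lemma matchable_edges:
 assumes "matchable (near N) U" "U <= F"
 shows "EX m. m <= E - N & (ALL f:U. card (m Int bd f) = 1) & (ALL f:F - U. m Int bd f = {}) & m <= inner' U"
 using assms
proof (induction rule: matchable.induct)
 case empty thus ?case by auto
next
 case (pair U x y)
 then obtain m where m: "m <= E - N" "ALL f:U. card (m Int bd f) = 1" "ALL f:F - U. m Int bd f = {}" "m <= inner' U" by auto
 obtain e where e: "e : E - N" "e : bd x" "e : bd y" using pair by (auto simp: near_def)
 have xy: "x : F" "y : F" "U <= F" using pair by auto
 have only: "h = x | h = y" if h: "h : F" "e : bd h" for h
 proof -
  obtain g where g: "{h:F. e : bd h} = {x, g}"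
   using other_face[OF xy(1) e(2)] by blast
  have "h : {h:F. e : bd h}" "y : {h:F. e : bd h}" using h e xy by auto
  thus ?thesis using pair(4) unfolding g by auto
 qed
 have "insert e m Int bd x = {e}" "insert e m Int bd y = {e}" using m(3) xy pair e by auto
 moreover have same: "insert e m Int bd f = m Int bd f" if "f : F" "f ~= x" "f ~= y" for f
  using only[of f] that by auto
 moreover have "card (insert e m Int bd f) = 1" if "f : U" for f
  using same[of f] that xy m(2) pair(2,3) by (metis subsetD)
 moreover have "insert e m Int bd f = {}" if "f : F - insert x (insert y U)" for f
  using same[of f] that m(3) by blast
 moreover have "insert e m <= inner' (insert x (insert y U))"
 proof -
  have s: "insert x (insert y U) <= F" using xy by auto
  have "e : inner' (insert x (insert y U))" unfolding inner_iff[OF s] using e only by blast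
  moreover have "inner' U <= inner' (insert x (insert y U))"
   unfolding subset_iff inner_iff[OF s] inner_iff[OF xy(3)] by blast
  ultimately show ?thesis using m(4) by blast
 qed
 moreover have "insert e m <= E - N" using m e by blast
 ultimately show ?case
  by (intro exI[of _ "insert e m"]) auto
qed

end

section \<open>Abstract complexes and the two reductions\<close>

text \<open>\<open>bd f\<close> is the set of edges of the face \<open>f\<close> and \<open>en e\<close> the set of ends of the edge \<open>e\<close>, where
a loop has \<open>en e = {}\<close>: only the sum of the ends modulo 2 matters.\<close>

definition cob :: "'e set => ('e => 'v set) => 'v set => 'e set" where
 "cob E en Q = {e:E. odd (card (en e Int Q))}"

definition is_cob :: "'e set => ('e => 'v set) => 'e set => bool" where
 "is_cob E en z \<longleftrightarrow> (EX Q. z = cob E en Q)"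

definition cocycle :: "'f set => 'e set => ('f => 'e set) => 'e set => bool" where
 "cocycle F E bd z \<longleftrightarrow> z <= E & (ALL f:F. even (card (z Int bd f)))"

text \<open>Faces of length 0 or 2 arise by contraction; there a matching is only required to be even.\<close>

definition pm_at :: "('f => 'e set) => 'e set => 'f => bool" where
 "pm_at bd m f \<longleftrightarrow> (if card (bd f) = 3 then card (m Int bd f) = 1 else even (card (m Int bd f)))"

definition pm :: "'f set => 'e set => ('f => 'e set) => 'e set => bool" where
 "pm F E bd m \<longleftrightarrow> m <= E & (ALL f:F. pm_at bd m f)"

definition bad :: "'f set => 'e set => ('f => 'e set) => ('e => 'v set) => bool" where
 "bad F E bd en \<longleftrightarrow> (ALL m. pm F E bd m --> ~ is_cob E en (E - m))"

definition pairs :: "'v set => 'v set set" where "pairs L = {p. p <= L & card p = 2}"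

text \<open>The parts in \<open>PP\<close> are the ten faces of K6 together with what was pasted into them.\<close>

definition k6_structure :: "'f set => 'e set => ('f => 'e set) => ('e => 'v set) => 'v set => 'f set set => bool" where
 "k6_structure F E bd en L PP \<longleftrightarrow> card L = 6 & partition_on F PP &
   bij_betw en (UN X:PP. cut E bd X) (pairs L) &
   (ALL X:PP. EX t<=L. card t = 3 & en ` cut E bd X = pairs t)"

lemma pm_at_parity: "pm_at bd m f ==> odd (card (m Int bd f)) \<longleftrightarrow> card (bd f) = 3"
 unfolding pm_at_def by (cases "card (bd f) = 3") simp_all

locale cx = incidence F E bd for F :: "'f set" and E :: "'e set" and bd +
 fixes en :: "'e => 'v set"
 assumes card_bd: "f : F ==> card (bd f) : {0, 2, 3}"
  and en2: "e : E ==> en e = {} | card (en e) = 2"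
  and closed_bd: "f : F ==> even (card {e:bd f. v : en e})"
begin

abbreviation "cob' == cob E en"
abbreviation "is_cob' == is_cob E en"
abbreviation "cocycle' == cocycle F E bd"

lemma fin_en: "e : E ==> finite (en e)"
 using en2 by (metis card.infinite finite.emptyI zero_neq_numeral)

lemma even_le_3: "even n ==> n <= 3 ==> n = 0 | n = (2::nat)" by presburger

lemma cob_E: "cob' Q <= E" by (auto simp: cob_def)

lemma cob_sd: "sym_diff (cob' Q) (cob' R) = cob' (sym_diff Q R)"
proof (rule set_eqI)
 fix e
 show "e : sym_diff (cob' Q) (cob' R) \<longleftrightarrow> e : cob' (sym_diff Q R)"
 proof (cases "e : E")
  case True
  have eq: "en e Int sym_diff Q R = sym_diff (en e Int Q) (en e Int R)" by blast
  have "even (card (en e Int sym_diff Q R)) \<longleftrightarrow> (even (card (en e Int Q)) \<longleftrightarrow> even (card (en e Int R)))"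
   unfolding eq by (rule even_card_sym_diff) (use fin_en[OF True] in auto)
  thus ?thesis using True by (auto simp: cob_def)
 qed (simp add: cob_def)
qed

lemma is_cob_sd: "is_cob' z ==> is_cob' y ==> is_cob' (sym_diff z y)"
 unfolding is_cob_def using cob_sd by blast

lemma is_cob_empty: "is_cob' {}"
 unfolding is_cob_def by (rule exI[of _ "{}"]) (auto simp: cob_def)

lemma cocycle_fin: "cocycle' z ==> finite z"
 using finE finite_subset by (auto simp: cocycle_def)

lemma cocycle_sd:
 assumes "cocycle' z" "cocycle' y" shows "cocycle' (sym_diff z y)"
 unfolding cocycle_def
proof (intro conjI ballI)
 show "sym_diff z y <= E" using assms by (auto simp: cocycle_def)
 fix f assume f: "f : F"
 have eq: "sym_diff z y Int bd f = sym_diff (z Int bd f) (y Int bd f)" by blast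
 show "even (card (sym_diff z y Int bd f))"
  unfolding eq using assms f fin_bd[OF f] by (subst even_card_sym_diff) (auto simp: cocycle_def)
qed

definition closed :: "'e set => bool" where
 "closed t \<longleftrightarrow> t <= E & (ALL v. even (card {e:t. v : en e}))"

text \<open>Double counting of the incidences between \<open>t\<close> and \<open>Q\<close>: cycles
  and coboundaries are orthogonal modulo 2.\<close>

lemma closed_cob:
 assumes "closed t" shows "even (card (t Int cob' Q))"
proof -
 have ft: "finite t" "t <= E" using assms finE finite_subset by (auto simp: closed_def)
 define W where "W = Q Int (UN e:t. en e)"
 have fW: "finite W" using ft fin_en by (auto simp: W_def)
 have "(SUM e:t. card (en e Int Q)) = (SUM e:t. card {v:W. v : en e})"
  by (intro sum.cong refl arg_cong[where f=card]) (auto simp: W_def)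
 also have "... = (SUM v:W. card {e:t. v : en e})"
  using even_sum_card[OF ft(1) fW, of "%e v. v : en e"] by simp
 also have "even ..." using assms by (intro dvd_sum) (auto simp: closed_def)
 finally have "even (card {e:t. odd (card (en e Int Q))})" using ft by (simp add: even_sum_iff)
 moreover have "t Int cob' Q = {e:t. odd (card (en e Int Q))}" using ft by (auto simp: cob_def)
 ultimately show ?thesis by simp
qed

lemma closed_bd': "f : F ==> closed (bd f)"
 using closed_bd bdE by (auto simp: closed_def)

lemma cob_cocycle: "cocycle' (cob' Q)"
 unfolding cocycle_def using closed_cob[OF closed_bd'] cob_E by (auto simp: Int_commute)

lemma is_cob_cocycle: "is_cob' z ==> cocycle' z"
 using cob_cocycle by (auto simp: is_cob_def)

text \<open>A cut is the sum modulo 2 of the face boundaries on one side; the edges inside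
  \<open>X\<close> cancel.\<close>

lemma closed_cut:
 assumes "X <= F" shows "closed (cut' X)"
 unfolding closed_def
proof (intro conjI allI)
 show "cut' X <= E" by (rule cut_E)
 fix v
 have "(SUM f:X. card ({e:E. v : en e} Int bd f)) =
  2 * card ({e:E. v : en e} Int inner' X) + card ({e:E. v : en e} Int cut' X)"
  using assms by (intro handshake) auto
 moreover have "even (SUM f:X. card ({e:E. v : en e} Int bd f))"
 proof (rule dvd_sum)
  fix f assume "f : X"
  hence f: "f : F" using assms by auto
  have "{e:E. v : en e} Int bd f = {e:bd f. v : en e}" using bdE[OF f] by auto
  thus "even (card ({e:E. v : en e} Int bd f))" using closed_bd[OF f, of v] by simp
 qed
 ultimately have "even (card ({e:E. v : en e} Int cut' X))" by presburger
 moreover have "{e:E. v : en e} Int cut' X = {e:cut' X. v : en e}" using cut_E by auto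
 ultimately show "even (card {e:cut' X. v : en e})" by simp
qed

lemma cocycle_cut: "cocycle' z ==> X <= F ==> even (card (z Int cut' X))"
proof -
 assume z: "cocycle' z" and X: "X <= F"
 hence zE: "z <= E" by (simp add: cocycle_def)
 have "even (SUM f:X. card (z Int bd f))" using z X by (intro dvd_sum) (auto simp: cocycle_def)
 thus ?thesis using handshake[OF X zE] by simp
qed

lemma pm_cocycle:
 assumes "pm F E bd m" shows "cocycle' (E - m)"
 unfolding cocycle_def
proof (intro conjI ballI)
 fix f assume f: "f : F"
 have "(E - m) Int bd f = bd f - (m Int bd f)" using bdE[OF f] by auto
 hence c: "card ((E - m) Int bd f) = card (bd f) - card (m Int bd f)"
  using fin_bd[OF f] by (simp add: card_Diff_subset)
 have le: "card (m Int bd f) <= card (bd f)" using fin_bd[OF f] by (intro card_mono) auto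
 have p: "pm_at bd m f" using assms f by (simp add: pm_def)
 show "even (card ((E - m) Int bd f))"
 proof (cases "card (bd f) = 3")
  case True thus ?thesis using p c by (simp add: pm_at_def)
 next
  case False
  hence "even (card (bd f))" using card_bd[OF f] by auto
  thus ?thesis using p c le False by (simp add: pm_at_def)
 qed
qed auto

end

text \<open>What is needed of the topology of the projective plane; all three properties survive both
reductions.\<close>

locale pcx = cx F E bd en for F :: "'f set" and E :: "'e set" and bd and en :: "'e => 'v set" +
 assumes index2: "cocycle F E bd z ==> cocycle F E bd y ==> ~ is_cob E en z ==> ~ is_cob E en y ==> is_cob E en (sym_diff z y)"
  and meet: "cocycle F E bd z ==> cocycle F E bd y ==> ~ is_cob E en z ==> ~ is_cob E en y ==>
   EX f:F. z Int bd f ~= {} & y Int bd f ~= {}"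
  and bridgeless: "X <= F ==> card (cut E bd X) ~= 1"

text \<open>\<open>balanced\<close> says that \<open>X\<close> is a disc, \<open>ext\<close> that matchings of the contracted complex lift.\<close>

locale contraction = pcx F E bd en for F :: "'f set" and E :: "'e set" and bd and en :: "'e => 'v set" +
 fixes X :: "'f set" and x0 :: 'f
 assumes X: "X <= F" and x0: "x0 : X" and cX: "card (cut E bd X) : {0, 2, 3}"
  and balanced: "cocycle F E bd z ==> z <= inner E bd X ==> is_cob E en z"
  and ext: "s <= cut E bd X ==> (if card (cut E bd X) = 3 then card s = 1 else even (card s)) ==>
   EX m<=inner E bd X. ALL f:X. pm_at bd (m Un s) f"
  and badF: "bad F E bd en"
begin

text \<open>The face \<open>x0\<close> survives as the name of the face that replaces
  \<open>X\<close>, so the type of faces does not change and the induction can continue on it;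
  \<open>up\<close> translates face sets back.\<close>

definition "F1 = insert x0 (F - X)"
definition "E1 = E - inner' X"
definition "bd1 = bd(x0 := cut' X)"
definition "up Y = (if x0 : Y then Y Un X else Y)"

lemma x0F: "x0 : F" using x0 X by blast

lemma bd1_simps: "bd1 x0 = cut' X" "f ~= x0 ==> bd1 f = bd f" by (auto simp: bd1_def)

lemma bd_out: "f : F - X ==> bd f Int inner' X = {}" using inner_iff[OF X] by blast
lemma bd_in: "f : X ==> bd f Int E1 <= cut' X"
 using X edge_cases[OF X] inner_iff[of "F - X"] by (auto simp: E1_def)

lemma E1_count:
 assumes "e : E1" shows "card {f:X. e : bd f} = (if e : cut' X then 1 else 0)"
proof -
 have e: "e : E" "e ~: inner' X" using assms by (auto simp: E1_def)
 have "card {f:X. e : bd f} <= 2" using faces_split[OF X e(1)] by simp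
 thus ?thesis using e by (auto simp: inner_def cut_def)
qed

lemma count1:
 assumes "e : E1" "Y <= F1"
 shows "card {f:Y. e : bd1 f} = card {f:up Y. e : bd f}"
proof (cases "x0 : Y")
 case True
 have fY: "finite Y" using assms(2) finF finite_subset by (auto simp: F1_def)
 have "{f:Y. e : bd1 f} = {f:Y - {x0}. e : bd f} Un (if e : cut' X then {x0} else {})"
  using True by (auto simp: bd1_def)
 moreover have "card ... = card {f:Y - {x0}. e : bd f} + (if e : cut' X then 1 else 0)"
  using fY by (subst card_Un_disjoint) auto
 moreover have "{f:up Y. e : bd f} = {f:Y - {x0}. e : bd f} Un {f:X. e : bd f}"
  using True x0 by (auto simp: up_def)
 moreover have "card ... = card {f:Y - {x0}. e : bd f} + card {f:X. e : bd f}"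
  using fY fin_sub[OF X] assms(2) by (intro card_Un_disjoint) (auto simp: F1_def)
 ultimately show ?thesis using E1_count[OF assms(1)] by simp
next
 case False
 hence "{f:Y. e : bd1 f} = {f:up Y. e : bd f}" by (auto simp: bd1_def up_def)
 thus ?thesis by simp
qed

lemma up_F: "Y <= F1 ==> up Y <= F" using X x0F by (auto simp: up_def F1_def)

lemma cut1:
 assumes "Y <= F1" shows "cut E1 bd1 Y = cut' (up Y)"
proof (rule set_eqI)
 fix e
 show "e : cut E1 bd1 Y \<longleftrightarrow> e : cut' (up Y)"
 proof (cases "e : inner' X")
  case True
  have "e ~: cut' (up Y)"
  proof
   assume "e : cut' (up Y)"
   then obtain f g where "f : up Y" "e : bd f" "g : F - up Y" "e : bd g"
    using cut_iff[OF up_F[OF assms]] by blast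
   moreover have "f : X" "g : X" using True inner_iff[OF X] calculation up_F[OF assms] by blast+
   ultimately show False using assms by (auto simp: up_def F1_def split: if_splits)
  qed
  thus ?thesis using True by (auto simp: cut_def E1_def)
 next
  case False
  thus ?thesis using count1[OF _ assms, of e] by (auto simp: cut_def E1_def)
 qed
qed

lemma inc1: "incidence F1 E1 bd1"
proof
 show "finite F1" "finite E1" using finF finE by (auto simp: F1_def E1_def)
 show "bd1 f <= E1" if "f : F1" for f
  using that bd_out[of f] bdE[of f] cut_E[of X] inner_cut_disj[of X] by (auto simp: F1_def E1_def bd1_def)
 show "card {f:F1. e : bd1 f} = 2" if "e : E1" for e
 proof -
  have "up F1 = F" using X x0 by (auto simp: up_def F1_def)
  thus ?thesis using count1[OF that order_refl] two[of e] that by (simp add: E1_def)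
 qed
qed

lemma cob1: "cob E1 en Q = cob' Q Int E1" by (auto simp: cob_def E1_def)

lemma restrict_cob: "is_cob' z ==> is_cob E1 en (z Int E1)"
 unfolding is_cob_def using cob1 by metis

lemma cx1: "cx F1 E1 bd1 en"
proof -
 interpret i: incidence F1 E1 bd1 by (rule inc1)
 show ?thesis
 proof
  show "card (bd1 f) : {0, 2, 3}" if "f : F1" for f
   using that cX card_bd[of f] by (auto simp: F1_def bd1_def)
  show "en e = {} | card (en e) = 2" if "e : E1" for e using that en2[of e] by (auto simp: E1_def)
  show "even (card {e:bd1 f. v : en e})" if "f : F1" for f v
   using that closed_cut[OF X] closed_bd[of f v] by (auto simp: F1_def bd1_def closed_def)
 qed
qed

text \<open>A cocycle meets \<open>cut' X\<close> in 0 or 2 edges. Two edges are the difference of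
  two admissible traces, and the difference of the two matchings supplied by \<open>ext\<close>
  fills the inside of \<open>X\<close>. The last conjunct, that nothing is added if the cut is
  missed, is what transports \<open>meet\<close>.\<close>

lemma lift:
 assumes "cocycle F1 E1 bd1 z"
 shows "EX y. cocycle' y & y Int E1 = z & (z Int cut' X = {} --> y = z)"
proof -
 have zE: "z <= E1" and all: "!!f. f : F1 ==> even (card (z Int bd1 f))"
  using assms by (auto simp: cocycle_def)
 have ev: "even (card (z Int cut' X))" using all[of x0] by (simp add: F1_def bd1_def)
 have out: "even (card (z Int bd f))" if "f : F - X" for f
  using all[of f] that x0 by (auto simp: F1_def bd1_def split: if_splits)
 have zX: "z Int bd f = z Int cut' X Int bd f" if "f : X" for f using bd_in[OF that] zE by blast
 show ?thesis
 proof (cases "z Int cut' X = {}")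
  case True
  have "cocycle' z" unfolding cocycle_def
  proof (intro conjI ballI)
   show "z <= E" using zE by (auto simp: E1_def)
   show "even (card (z Int bd f))" if "f : F" for f
    using that out[of f] zX[of f] True by (cases "f : X") auto
  qed
  thus ?thesis using zE by auto
 next
  case False
  let ?adm = "%s. s <= cut' X & (if card (cut' X) = 3 then card s = 1 else even (card s))"
  have le: "card (z Int cut' X) <= card (cut' X)" using fin_cut by (intro card_mono) auto
  have pos: "card (z Int cut' X) ~= 0" using False fin_cut[of X] by simp
  have z2: "card (z Int cut' X) = 2"
   using even_le_3[OF ev] cX le pos by auto
  have "EX s1 s2. ?adm s1 & ?adm s2 & z Int cut' X = sym_diff s1 s2"
  proof (cases "card (cut' X) = 3")
   case True
   obtain a b where "z Int cut' X = {a, b}" "a ~= b" using z2 by (auto simp: card_2_iff)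
   thus ?thesis using True by (intro exI[of _ "{a}"] exI[of _ "{b}"]) auto
  next
   case False
   hence "card (cut' X) = 2" using cX z2 le by auto
   hence "z Int cut' X = cut' X" using z2 fin_cut[of X] by (intro card_subset_eq) auto
   thus ?thesis using False \<open>card (cut' X) = 2\<close> by (intro exI[of _ "cut' X"] exI[of _ "{}"]) auto
  qed
  then obtain s1 s2 where s: "?adm s1" "?adm s2" "z Int cut' X = sym_diff s1 s2" by blast
  obtain m1 where m1: "m1 <= inner' X" "ALL f:X. pm_at bd (m1 Un s1) f" using ext[of s1] s(1) by blast
  obtain m2 where m2: "m2 <= inner' X" "ALL f:X. pm_at bd (m2 Un s2) f" using ext[of s2] s(2) by blast
  define y where "y = z Un sym_diff m1 m2"
  have "cocycle' y" unfolding cocycle_def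
  proof (intro conjI ballI)
   show "y <= E" using zE m1(1) m2(1) inner_E[of X] unfolding y_def E1_def by blast
   fix f assume f: "f : F"
   show "even (card (y Int bd f))"
   proof (cases "f : X")
    case True
    have zb: "z Int bd f = sym_diff s1 s2 Int bd f" using zX[OF True] s(3) by simp
    have "y Int bd f = (z Int bd f) Un (sym_diff m1 m2 Int bd f)" unfolding y_def by blast
    hence "y Int bd f = (sym_diff s1 s2 Un sym_diff m1 m2) Int bd f" unfolding zb by blast
    also have "... = sym_diff ((m1 Un s1) Int bd f) ((m2 Un s2) Int bd f)"
    proof -
     have "(m1 Un m2) Int (s1 Un s2) = {}" using s(1,2) m1(1) m2(1) inner_cut_disj[of X] by blast
     thus ?thesis by blast
    qed
    finally have e: "y Int bd f = sym_diff ((m1 Un s1) Int bd f) ((m2 Un s2) Int bd f)" .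
    have "even (card ((m1 Un s1) Int bd f)) \<longleftrightarrow> even (card ((m2 Un s2) Int bd f))"
     using pm_at_parity[of bd "m1 Un s1" f] pm_at_parity[of bd "m2 Un s2" f] m1(2) m2(2) True by blast
    thus ?thesis unfolding e using fin_bd[OF f] by (subst even_card_sym_diff) auto
   next
    case False
    hence "y Int bd f = z Int bd f" using bd_out[of f] f m1(1) m2(1) by (auto simp: y_def)
    thus ?thesis using out[of f] f False by simp
   qed
  qed
  moreover have "y Int E1 = z" using zE m1(1) m2(1) by (auto simp: y_def E1_def)
  ultimately show ?thesis using False by blast
 qed
qed

lemma pcx1: "pcx F1 E1 bd1 en"
proof -
 interpret i: cx F1 E1 bd1 en by (rule cx1)
 show ?thesis
 proof
  fix z y assume z: "cocycle F1 E1 bd1 z" and y: "cocycle F1 E1 bd1 y"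
   and nz: "~ is_cob E1 en z" and ny: "~ is_cob E1 en y"
  obtain z' where z': "cocycle' z'" "z' Int E1 = z" "z Int cut' X = {} --> z' = z" using lift[OF z] by blast
  obtain y' where y': "cocycle' y'" "y' Int E1 = y" "y Int cut' X = {} --> y' = y" using lift[OF y] by blast
  have nn: "~ is_cob' z'" "~ is_cob' y'" using restrict_cob[of z'] restrict_cob[of y'] z' y' nz ny by auto
  have "is_cob' (sym_diff z' y')" using index2[OF z'(1) y'(1) nn] .
  hence "is_cob E1 en (sym_diff z' y' Int E1)" by (rule restrict_cob)
  moreover have "sym_diff z' y' Int E1 = sym_diff z y" using z' y' by blast
  ultimately show "is_cob E1 en (sym_diff z y)" by simp
  obtain f where f: "f : F" "z' Int bd f ~= {}" "y' Int bd f ~= {}" using meet[OF z'(1) y'(1) nn] by blast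
  have zE: "z <= E1" "y <= E1" using z y by (auto simp: cocycle_def)
  show "EX f:F1. z Int bd1 f ~= {} & y Int bd1 f ~= {}"
  proof (cases "f : X")
   \<comment> \<open>A cocycle of the contracted complex that misses the cut is lifted unchanged and
     has no edge in a face of \<open>X\<close>. So a common face inside \<open>X\<close> makes both
     cocycles cross the cut, and \<open>x0\<close> is the common face.\<close>
   case True
   have "z Int cut' X ~= {}" using z'(3) f(2) bd_in[OF True] zE by blast
   moreover have "y Int cut' X ~= {}" using y'(3) f(3) bd_in[OF True] zE by blast
   ultimately show ?thesis by (intro bexI[of _ x0]) (auto simp: bd1_def F1_def)
  next
   case False
   hence b: "bd f <= E1" using bd_out[of f] bdE f by (auto simp: E1_def)
   have "f ~= x0" using False x0 by auto
   thus ?thesis using f False b z'(2) y'(2) by (intro bexI[of _ f]) (auto simp: bd1_def F1_def)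
  qed
 next
  fix Y assume "Y <= F1"
  thus "card (cut E1 bd1 Y) ~= 1" using cut1 bridgeless up_F by metis
 qed
qed

text \<open>A matching with coboundary complement would extend over \<open>X\<close> by
  \<open>ext\<close>. The new complement differs from a coboundary only inside \<open>X\<close>, and
  \<open>balanced\<close> turns that difference into a coboundary.\<close>

lemma bad1: "bad F1 E1 bd1 en"
 unfolding bad_def
proof (intro allI impI notI)
 fix m1 assume pm1: "pm F1 E1 bd1 m1" and b: "is_cob E1 en (E1 - m1)"
 have m1E: "m1 <= E1" using pm1 by (simp add: pm_def)
 define s where "s = m1 Int cut' X"
 have "pm_at bd1 m1 x0" using pm1 by (simp add: pm_def F1_def)
 hence "if card (cut' X) = 3 then card s = 1 else even (card s)" unfolding pm_at_def bd1_simps(1) s_def .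
 then obtain mX where mX: "mX <= inner' X" "ALL f:X. pm_at bd (mX Un s) f" using ext[of s] by (auto simp: s_def)
 define m where "m = m1 Un mX"
 have "pm F E bd m" unfolding pm_def
 proof (intro conjI ballI)
  show "m <= E" using m1E mX(1) inner_E[of X] unfolding m_def E1_def by blast
  fix f assume f: "f : F"
  show "pm_at bd m f"
  proof (cases "f : X")
   case True
   have "m Int bd f = (mX Un s) Int bd f" using bd_in[OF True] m1E by (auto simp: m_def s_def)
   thus ?thesis using mX(2) True by (simp add: pm_at_def)
  next
   case False
   hence "f ~= x0" using x0 by auto
   have "pm_at bd1 m1 f" using pm1 False f by (auto simp: pm_def F1_def)
   hence "pm_at bd m1 f" unfolding pm_at_def bd1_simps(2)[OF \<open>f ~= x0\<close>] .
   moreover have "m Int bd f = m1 Int bd f" using bd_out[of f] f False mX(1) by (auto simp: m_def)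
   ultimately show ?thesis by (simp add: pm_at_def)
  qed
 qed
 hence nb: "~ is_cob' (E - m)" and c: "cocycle' (E - m)" using badF pm_cocycle by (auto simp: bad_def)
 obtain Q where Q: "E1 - m1 = cob E1 en Q" using b by (auto simp: is_cob_def)
 have "cocycle' (sym_diff (E - m) (cob' Q))" using cocycle_sd c cob_cocycle by blast
 moreover have "sym_diff (E - m) (cob' Q) <= inner' X"
 proof -
  have "(E - m) Int E1 = cob' Q Int E1" using Q cob1[of Q] mX(1) by (auto simp: m_def E1_def)
  thus ?thesis using cob_E[of Q] by (auto simp: E1_def)
 qed
 ultimately have "is_cob' (sym_diff (E - m) (cob' Q))" by (rule balanced)
 hence "is_cob' (sym_diff (sym_diff (E - m) (cob' Q)) (cob' Q))"
  by (rule is_cob_sd) (auto simp: is_cob_def)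
 moreover have "sym_diff (sym_diff (E - m) (cob' Q)) (cob' Q) = E - m" by blast
 ultimately show False using nb by simp
qed

lemma k6_up:
 assumes "k6_structure F1 E1 bd1 en L PP"
 shows "k6_structure F E bd en L (up ` PP)"
proof -
 have P: "partition_on F1 PP" "card L = 6" "bij_betw en (UN Y:PP. cut E1 bd1 Y) (pairs L)"
  "ALL Y:PP. EX t<=L. card t = 3 & en ` cut E1 bd1 Y = pairs t" using assms by (auto simp: k6_structure_def)
 have sub: "Y <= F1" if "Y : PP" for Y using P(1) that by (auto simp: partition_on_def)
 have c: "cut E1 bd1 Y = cut' (up Y)" if "Y : PP" for Y using cut1 sub that by blast
 have "partition_on F (up ` PP)"
 proof (rule partition_onI)
  have U: "\<Union>PP = F1" using P(1) by (simp add: partition_on_def)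
  then obtain Y0 where Y0: "Y0 : PP" "x0 : Y0" by (auto simp: F1_def)
  have "\<Union>(up ` PP) = \<Union>PP Un X" using Y0 by (auto simp: up_def)
  thus "\<Union>(up ` PP) = F" using U X x0 by (auto simp: F1_def)
  show "{} ~: up ` PP" using P(1) by (auto simp: partition_on_def up_def split: if_splits)
  fix p q assume "p : up ` PP" "q : up ` PP" "p ~= q"
  then obtain A B where AB: "A : PP" "B : PP" "p = up A" "q = up B" "A ~= B" by auto
  hence d: "A Int B = {}" using P(1) by (auto simp: partition_on_def disjoint_def)
  have "x0 ~: A ==> A Int X = {}" "x0 ~: B ==> B Int X = {}" using sub AB by (auto simp: F1_def)
  thus "disjnt p q" using AB d unfolding disjnt_def up_def by auto
 qed
 moreover have "(UN Y:PP. cut E1 bd1 Y) = (UN Y:up ` PP. cut' Y)" using c by auto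
 ultimately show ?thesis using P c unfolding k6_structure_def by auto
qed

lemma card_F1: "card F1 + card X = card F + 1"
proof -
 have "card F1 = card (F - X) + 1" using finF x0 by (simp add: F1_def)
 moreover have "card (F - X) = card F - card X" "card X <= card F"
  using X finF fin_sub by (auto simp: card_Diff_subset card_mono)
 ultimately show ?thesis by simp
qed

lemma card_E1: "card E1 <= card E" using finE by (intro card_mono) (auto simp: E1_def)

end

text \<open>\<open>r\<close> merges the two ends of every edge of \<open>Z0\<close>, whose faces become digons.\<close>

locale reduction = pcx F E bd en for F :: "'f set" and E :: "'e set" and bd and en :: "'e => 'v set" +
 fixes Z Z0 :: "'e set" and r :: "'v => 'v"
 assumes cubic: "f : F ==> card (bd f) = 3"
  and Zcob: "is_cob E en Z" and Z0: "Z0 <= Z"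
  and alt: "f : F ==> card (Z Int bd f) = 2 ==> card (Z0 Int bd f) = 1"
  and r1: "e : Z0 ==> a : en e ==> b : en e ==> r a = r b"
  and r2: "r a = a | (EX e:Z0. en e = {a, r a})"
  and br: "Y <= F ==> card (cut E bd Y - Z0) ~= 1"
  and badF: "bad F E bd en"
begin

definition "E1 = E - Z0"
definition "bd1 f = bd f - Z0"
text \<open>Ends are pushed forward modulo 2: two ends with the same image cancel, which yields
  exactly the encoding of a loop by the empty set.\<close>

definition "en1 e = {w. odd (card {a:en e. r a = w})}"

lemma Z_E: "Z <= E" using is_cob_cocycle[OF Zcob] by (simp add: cocycle_def)

lemma Z_bd: assumes "f : F" shows "card (Z Int bd f) = 0 | card (Z Int bd f) = 2"
proof -
 have "even (card (Z Int bd f))" using is_cob_cocycle[OF Zcob] assms by (simp add: cocycle_def)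
 moreover have "card (Z Int bd f) <= 3"
  using card_mono[OF fin_bd[OF assms], of "Z Int bd f"] cubic[OF assms] by simp
 ultimately show ?thesis by presburger
qed

lemma en1_cases:
 assumes "e : E"
 shows "en e = {} & en1 e = {} | (EX a b. a ~= b & en e = {a, b} & (if r a = r b then en1 e = {} else en1 e = {r a, r b}))"
proof (cases "en e = {}")
 case True thus ?thesis by (simp add: en1_def)
next
 case False
 then obtain a b where ab: "en e = {a, b}" "a ~= b" using en2[OF assms] by (auto simp: card_2_iff)
 have "{x:{a, b}. r x = w} = (if r a = w then {a} else {}) Un (if r b = w then {b} else {})" for w by auto
 hence "en1 e = (if r a = r b then {} else {r a, r b})" using ab by (auto simp: en1_def split: if_splits)
 thus ?thesis using ab by auto
qed

lemma en1_Int: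
 assumes "e : E" shows "odd (card (en1 e Int Q)) \<longleftrightarrow> odd (card (en e Int r -` Q))"
 using en1_cases[OF assms]
proof
 assume "EX a b. a ~= b & en e = {a, b} & (if r a = r b then en1 e = {} else en1 e = {r a, r b})"
 then obtain a b where ab: "a ~= b" "en e = {a, b}" "if r a = r b then en1 e = {} else en1 e = {r a, r b}" by blast
 have "{a, b} Int r -` Q = (if r a : Q then {a} else {}) Un (if r b : Q then {b} else {})" by auto
 moreover have "{r a, r b} Int Q = (if r a : Q then {r a} else {}) Un (if r b : Q then {r b} else {})" by auto
 ultimately show ?thesis using ab by (auto split: if_splits)
qed simp

lemma cob_Z0: "cob' (r -` Q) Int Z0 = {}"
proof -
 have False if e: "e : cob' (r -` Q)" "e : Z0" for e
 proof -
  have eE: "e : E" using e cob_E by blast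
  have "en e Int r -` Q = {} | en e Int r -` Q = en e" using r1[OF e(2)] by auto
  hence "even (card (en e Int r -` Q))" using en2[OF eE] by auto
  thus False using e(1) by (simp add: cob_def)
 qed
 thus ?thesis by blast
qed

lemma cob1: "cob E1 en1 Q = cob' (r -` Q)"
 using en1_Int cob_Z0[of Q] cob_E by (auto simp: cob_def E1_def)

text \<open>If the coboundary of \<open>Q\<close> avoids \<open>Z0\<close>, then \<open>Q\<close>
  contains both or neither of \<open>a\<close> and \<open>r a\<close>; it is a union of fibres of
  \<open>r\<close> and therefore comes from the merged complex.\<close>

lemma is_cob1: "is_cob E1 en1 z \<longleftrightarrow> is_cob' z & z Int Z0 = {}"
proof
 assume "is_cob E1 en1 z"
 thus "is_cob' z & z Int Z0 = {}" using cob1 cob_Z0 by (auto simp: is_cob_def)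
next
 assume z: "is_cob' z & z Int Z0 = {}"
 then obtain Q where Q: "z = cob' Q" by (auto simp: is_cob_def)
 have "a : Q \<longleftrightarrow> r a : Q" for a
 proof (cases "r a = a")
  case False
  then obtain e where e: "e : Z0" "en e = {a, r a}" using r2 by blast
  hence "e : E" using Z0 Z_E by blast
  hence "even (card (en e Int Q))" using z Q e by (auto simp: cob_def)
  moreover have "en e Int Q = (if a : Q then {a} else {}) Un (if r a : Q then {r a} else {})" using e by auto
  ultimately show ?thesis using False by (auto split: if_splits)
 qed simp
 hence "r -` Q = Q" by auto
 thus "is_cob E1 en1 z" using Q cob1[of Q] by (auto simp: is_cob_def)
qed

lemma cocycle1: "cocycle F E1 bd1 z \<longleftrightarrow> cocycle' z & z Int Z0 = {}"
proof -
 have eq: "z Int bd1 f = z Int bd f" if "z Int Z0 = {}" for f using that by (auto simp: bd1_def)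
 have "z <= E1 \<longleftrightarrow> z <= E & z Int Z0 = {}" by (auto simp: E1_def)
 thus ?thesis unfolding cocycle_def using eq by metis
qed

lemma cut1: "cut E1 bd1 Y = cut' Y - Z0"
proof -
 have "{f:Y. e : bd1 f} = {f:Y. e : bd f}" if "e ~: Z0" for e using that by (auto simp: bd1_def)
 thus ?thesis by (auto simp: cut_def E1_def)
qed

lemma card_bd1:
 assumes "f : F"
 shows "card (bd1 f) = (if card (Z Int bd f) = 2 then 2 else 3)"
proof -
 have c: "card (bd1 f) = card (bd f) - card (Z0 Int bd f)"
  using fin_bd[OF assms] unfolding bd1_def by (metis Int_commute card_Diff_subset_Int finite_Int)
 show ?thesis
 proof (cases "card (Z Int bd f) = 2")
  case False
  hence "Z Int bd f = {}" using Z_bd[OF assms] fin_bd[OF assms] by simp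
  hence "Z0 Int bd f = {}" using Z0 by blast
  thus ?thesis using False c cubic[OF assms] by simp
 qed (use c cubic[OF assms] alt[OF assms] in simp)
qed

lemma pcx1: "pcx F E1 bd1 en1"
proof
 show "finite F" "finite E1" using finF finE by (auto simp: E1_def)
 show "bd1 f <= E1" if "f : F" for f using bdE[OF that] by (auto simp: bd1_def E1_def)
 show "card {f:F. e : bd1 f} = 2" if "e : E1" for e
 proof -
  have "{f:F. e : bd1 f} = {f:F. e : bd f}" using that by (auto simp: bd1_def E1_def)
  thus ?thesis using two that by (simp add: E1_def)
 qed
 show "card (bd1 f) : {0, 2, 3}" if "f : F" for f using card_bd1[OF that] by simp
 show "en1 e = {} | card (en1 e) = 2" if "e : E1" for e
  using that en1_cases[of e] by (auto simp: E1_def split: if_splits)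
 show "even (card {e:bd1 f. v : en1 e})" if "f : F" for f v
 proof -
  have "v : en1 e \<longleftrightarrow> e : cob E1 en1 {v}" if "e : E1" for e
  proof -
   have "en1 e Int {v} = (if v : en1 e then {v} else {})" by auto
   thus ?thesis using that by (simp add: cob_def)
  qed
  moreover have "bd1 f <= E1" using bdE[OF that] by (auto simp: bd1_def E1_def)
  ultimately have "{e:bd1 f. v : en1 e} = cob E1 en1 {v} Int bd1 f" by auto
  also have "... = cob' (r -` {v}) Int bd f" using cob_Z0[of "{v}"] by (auto simp: cob1 bd1_def)
  finally show ?thesis using cob_cocycle that by (simp add: cocycle_def)
 qed
 fix z y assume z: "cocycle F E1 bd1 z" and y: "cocycle F E1 bd1 y"
  and nz: "~ is_cob E1 en1 z" and ny: "~ is_cob E1 en1 y"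
 have zy: "cocycle' z" "cocycle' y" "z Int Z0 = {}" "y Int Z0 = {}" "~ is_cob' z" "~ is_cob' y"
  using z y nz ny by (auto simp: cocycle1 is_cob1)
 have "sym_diff z y Int Z0 = {}" using zy by blast
 thus "is_cob E1 en1 (sym_diff z y)" using index2[of z y] zy by (simp add: is_cob1)
 obtain f where "f : F" "z Int bd f ~= {}" "y Int bd f ~= {}" using meet[OF zy(1,2,5,6)] by blast
 thus "EX f:F. z Int bd1 f ~= {} & y Int bd1 f ~= {}"
  using zy by (intro bexI[of _ f]) (auto simp: bd1_def)
next
 show "card (cut E1 bd1 Y) ~= 1" if "Y <= F" for Y using br[OF that] by (simp add: cut1)
qed

text \<open>Adding \<open>Z - Z0\<close> modulo 2 turns a matching of the reduced complex into one
  of the original. A digon keeps one edge of \<open>Z\<close> and one other edge; the matching has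
  none or both of them, and the sum has exactly one. The complement changes by the coboundary
  \<open>Z\<close>.\<close>

lemma bad1: "bad F E1 bd1 en1"
 unfolding bad_def
proof (intro allI impI notI)
 fix m1 assume pm1: "pm F E1 bd1 m1" and b: "is_cob E1 en1 (E1 - m1)"
 have m1E: "m1 <= E1" using pm1 by (simp add: pm_def)
 define m where "m = sym_diff m1 (Z - Z0)"
 have "pm F E bd m" unfolding pm_def
 proof (intro conjI ballI)
  show "m <= E" using m1E Z_E by (auto simp: m_def E1_def)
  fix f assume f: "f : F"
  have p: "pm_at bd1 m1 f" using pm1 f by (simp add: pm_def)
  have mb: "m1 Int bd1 f = m1 Int bd f" using m1E by (auto simp: bd1_def E1_def)
  have "card (m Int bd f) = 1"
  proof (cases "card (Z Int bd f) = 2")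
   case False
   hence "Z Int bd f = {}" using Z_bd[OF f] fin_bd[OF f] by simp
   hence "m Int bd f = m1 Int bd f" by (auto simp: m_def)
   thus ?thesis using p card_bd1[OF f] False mb by (simp add: pm_at_def)
  next
   case True
   have b2: "card (bd1 f) = 2" using card_bd1[OF f] True by simp
   have fb: "finite (bd1 f)" using fin_bd[OF f] by (simp add: bd1_def)
   have ev: "even (card (m1 Int bd1 f))" using p b2 by (simp add: pm_at_def)
   have "(Z - Z0) Int bd f = Z Int bd f - Z0 Int bd f" by blast
   hence z1: "card ((Z - Z0) Int bd f) = 1"
    using True alt[OF f True] fin_bd[OF f] Z0 card_Diff_subset[of "Z0 Int bd f" "Z Int bd f"] by auto
   have zs: "(Z - Z0) Int bd f <= bd1 f" by (auto simp: bd1_def)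
   have "card (m1 Int bd1 f) <= 2" using card_mono[OF fb, of "m1 Int bd1 f"] b2 by simp
   hence "card (m1 Int bd1 f) = 0 | card (m1 Int bd1 f) = 2" using even_le_3[OF ev] by auto
   thus ?thesis
   proof
    assume "card (m1 Int bd1 f) = 0"
    hence "m1 Int bd f = {}" using fin_bd[OF f] mb by simp
    hence "m Int bd f = (Z - Z0) Int bd f" by (auto simp: m_def)
    thus ?thesis using z1 by simp
   next
    assume "card (m1 Int bd1 f) = 2"
    hence "m1 Int bd1 f = bd1 f" using fb b2 by (intro card_subset_eq) auto
    hence "m Int bd f = bd1 f - (Z - Z0) Int bd f" using mb zs m1E by (auto simp: m_def bd1_def E1_def)
    thus ?thesis using z1 b2 zs fb finite_subset[OF zs fb] by (simp add: card_Diff_subset)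
   qed
  qed
  thus "pm_at bd m f" using cubic[OF f] by (simp add: pm_at_def)
 qed
 hence "~ is_cob' (E - m)" using badF by (simp add: bad_def)
 moreover have "E - m = sym_diff (E1 - m1) Z" using m1E Z0 Z_E by (auto simp: m_def E1_def)
 moreover have "is_cob' (E1 - m1)" using b is_cob1 by blast
 ultimately show False using is_cob_sd[OF _ Zcob] by simp
qed

end

lemma parity_3: "3 * a = 2 * b + c ==> even c \<longleftrightarrow> even (a :: nat)" by presburger

lemma odd_ge_3: "odd n ==> n ~= 1 ==> 3 <= (n :: nat)" by presburger
lemma even_less: "even (b + a) ==> a < b ==> a + 2 <= (b :: nat)" by presburger

section \<open>Barrier counts and matchings in cubic complexes\<close>

context incidence
begin

text \<open>An edge between two members of the family is counted twice on the left and not at all in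
  the cut of the union; \<open>b\<close> collects these edges.\<close>

lemma sum_cuts:
 assumes sub': "ALL K:KK. K <= F" and dis: "disjoint KK"
  and no: "ALL K:KK. ALL L:KK. K ~= L --> cut' K Int cut' L <= N"
 shows "EX b<=N. b <= inner' (\<Union>KK) & (ALL e:b. EX K:KK. EX L:KK. K ~= L & e : cut' K & e : cut' L)
  & (SUM K:KK. card (cut' K)) = card (cut' (\<Union>KK)) + 2 * card b"
proof -
 have sub: "K <= F" if "K : KK" for K using sub' that by blast
 have KF: "KK <= Pow F" using sub by blast
 have fK: "finite KK" using finite_subset[OF KF] finF by simp
 have UF: "\<Union>KK <= F" using sub by blast
 define b where "b = {e:E. EX K:KK. EX L:KK. K ~= L & e : cut' K & e : cut' L}"
 have "card {K:KK. e : cut' K} = (if e : cut' (\<Union>KK) then 1 else 0) + (if e : b then 2 else 0)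
   & (e : b --> e : inner' (\<Union>KK))" if e: "e : E" for e
 proof -
  obtain f g where fg: "f : F" "g : F" "f ~= g" "e : bd f" "e : bd g" "{h:F. e : bd h} = {f, g}"
   using two_faces[OF e] by blast
  have c: "e : cut' X \<longleftrightarrow> (f : X \<longleftrightarrow> g ~: X)" if "X <= F" for X using cut_two[OF that fg(6,3)] .
  have i: "e : inner' X \<longleftrightarrow> f : X & g : X" if "X <= F" for X using inner_two[OF that fg(6,3)] .
  have uniq: "K = L" if "K : KK" "L : KK" "h : K" "h : L" for K L h
   using dis that unfolding disjoint_def by blast
  define S where "S = {K:KK. e : cut' K}"
  have S: "K : S \<longleftrightarrow> K : KK & (f : K \<longleftrightarrow> g ~: K)" for K using c[OF sub[of K]] unfolding S_def by blast
  have bS: "e : b \<longleftrightarrow> (EX K:S. EX L:S. K ~= L)" using e unfolding b_def S_def by blast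
  consider (none) "f ~: \<Union>KK" "g ~: \<Union>KK" | (f) K where "K : KK" "f : K" "g ~: \<Union>KK"
   | (g) K where "K : KK" "g : K" "f ~: \<Union>KK" | (same) K where "K : KK" "f : K" "g : K"
   | (diff) K L where "K : KK" "L : KK" "f : K" "g : L" "K ~= L" by blast
  hence "card S = (if e : cut' (\<Union>KK) then 1 else 0) + (if e : b then 2 else 0)
   & (e : b --> e : inner' (\<Union>KK))"
  proof cases
   case none
   hence "S = {}" using S by blast
   hence "e ~: b" "card S = 0" using bS by auto
   moreover have "e ~: cut' (\<Union>KK)" using c[OF UF] none by blast
   ultimately show ?thesis by simp
  next
   case f
   have "M : S \<longleftrightarrow> M = K" for M using S[of M] uniq[of M K f] f by auto
   hence "S = {K}" by blast
   hence "e ~: b" "card S = 1" using bS by auto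
   moreover have "e : cut' (\<Union>KK)" using c[OF UF] f by blast
   ultimately show ?thesis by simp
  next
   case g
   have "M : S \<longleftrightarrow> M = K" for M using S[of M] uniq[of M K g] g by auto
   hence "S = {K}" by blast
   hence "e ~: b" "card S = 1" using bS by auto
   moreover have "e : cut' (\<Union>KK)" using c[OF UF] g by blast
   ultimately show ?thesis by simp
  next
   case same
   have "M ~: S" for M using S[of M] uniq[of M K f] uniq[of M K g] same by auto
   hence "S = {}" by blast
   hence "e ~: b" "card S = 0" using bS by auto
   moreover have "e ~: cut' (\<Union>KK)" using c[OF UF] same by blast
   ultimately show ?thesis by simp
  next
   case diff
   have gf: "g ~: K" "f ~: L" using diff uniq[of K L g] uniq[of K L f] by auto
   have "M : S \<longleftrightarrow> M = K | M = L" for M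
    using S[of M] uniq[of M K f] uniq[of M L g] diff gf by auto
   hence "S = {K, L}" by blast
   hence "e : b" "card S = 2" using bS diff(5) by auto
   moreover have "e ~: cut' (\<Union>KK)" "e : inner' (\<Union>KK)" using c[OF UF] i[OF UF] diff by blast+
   ultimately show ?thesis by simp
  qed
  thus ?thesis unfolding S_def .
 qed
 hence *: "card {K:KK. e : cut' K} = (if e : cut' (\<Union>KK) then 1 else 0) + (if e : b then 2 else 0)"
  and bi: "e : b ==> e : inner' (\<Union>KK)" if "e : E" for e using that by auto
 have bE: "b <= E" by (auto simp: b_def)
 have "(SUM K:KK. card (cut' K)) = (SUM K:KK. card {e:E. e : cut' K})"
  using cut_E by (intro sum.cong refl arg_cong[where f=card]) auto
 also have "... = (SUM e:E. card {K:KK. e : cut' K})"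
  by (rule even_sum_card[OF fK finE])
 also have "... = (SUM e:E. (if e : cut' (\<Union>KK) then 1 else 0) + (if e : b then 2 else 0))"
  using * by (intro sum.cong refl)
 also have "... = card (E Int cut' (\<Union>KK)) + 2 * card (E Int b)"
  using finE by (simp add: sum.distrib sum.If_cases Int_def)
 also have "E Int cut' (\<Union>KK) = cut' (\<Union>KK)" using cut_E by blast
 also have "E Int b = b" using bE by blast
 finally have eq: "(SUM K:KK. card (cut' K)) = card (cut' (\<Union>KK)) + 2 * card b" .
 have "b <= N" using no unfolding b_def by blast
 moreover have "b <= inner' (\<Union>KK)" using bi bE by blast
 ultimately show ?thesis using eq by (intro exI[of _ b]) (auto simp: b_def)
qed

end

locale cubic_cx = cx F E bd en for F :: "'f set" and E :: "'e set" and bd and en :: "'e => 'v set" +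
 assumes cubic: "f : F ==> card (bd f) = 3"
begin

lemma cubic_count: "X <= F ==> 3 * card X = 2 * card (inner' X) + card (cut' X)"
 using handshake_bd[of X] cubic by (simp add: subset_iff)

lemma cut_parity: "X <= F ==> even (card (cut' X)) \<longleftrightarrow> even (card X)"
proof -
 assume "X <= F"
 from parity_3[OF cubic_count[OF this]] show ?thesis .
qed

lemma even_F: "even (card F)"
 using cut_parity[of F] cut_F by simp

text \<open>The basic double counting behind all barrier arguments: \<open>b\<close> collects the edges of \<open>N\<close>
that join two members of the family.\<close>
lemma barrier_count:
 assumes A: "A <= F" and p: "partition_on (X - A) KK" and AX: "A <= X" "X <= F"
  and no: "ALL K:KK. ALL L:KK. K ~= L --> (ALL x:K. ALL y:L. ~ near N x y)"
 shows "EX b<=N. b <= inner' (X - A) & (ALL e:b. EX K:KK. EX L:KK. K ~= L & e : cut' K & e : cut' L) &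
  (SUM K:KK. card (cut' K)) + 2 * card (inner' A) + 2 * card (cut' A Int cut' X) = 3 * card A + card (cut' X) + 2 * card b"
proof -
 have U: "\<Union>KK = X - A" using p by (simp add: partition_on_def)
 have sub: "K <= F" if "K : KK" for K using U that AX by blast
 have dis: "disjoint KK" using p by (simp add: partition_on_def)
 have no': "e : N" if KL: "K : KK" "L : KK" "K ~= L" "e : cut' K" "e : cut' L" for K L e
 proof (rule ccontr)
  assume "e ~: N"
  have "e : E" using KL(4) cut_E by blast
  obtain x where x: "x : K" "e : bd x" using KL(4) cut_iff[OF sub[OF KL(1)]] by blast
  obtain y where y: "y : L" "e : bd y" using KL(5) cut_iff[OF sub[OF KL(2)]] by blast
  have "K Int L = {}" using dis KL by (auto simp: disjoint_def)
  hence "x ~= y" using x y by blast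
  hence "near N x y" using x y sub KL \<open>e ~: N\<close> by (intro nearI[of x y e]) auto
  thus False using no KL(1-3) x(1) y(1) by blast
 qed
 have s1: "ALL K:KK. K <= F" and s2: "ALL K:KK. ALL L:KK. K ~= L --> cut' K Int cut' L <= N"
  using sub no' by blast+
 obtain b where b: "b <= N" "b <= inner' (X - A)" "ALL e:b. EX K:KK. EX L:KK. K ~= L & e : cut' K & e : cut' L"
   "(SUM K:KK. card (cut' K)) = card (cut' (X - A)) + 2 * card b"
  using sum_cuts[OF s1 dis s2] unfolding U by (elim exE conjE) (rule that; assumption)
 have "cut' (A Un (X - A)) = sym_diff (cut' A) (cut' (X - A))"
  using A AX by (intro cut_Un_disj) auto
 moreover have "A Un (X - A) = X" using AX by blast
 ultimately have "cut' X = sym_diff (cut' A) (cut' (X - A))" by simp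
 hence "cut' (X - A) = sym_diff (cut' X) (cut' A)" by blast
 moreover have "card (sym_diff (cut' X) (cut' A)) + 2 * card (cut' A Int cut' X) = card (cut' X) + card (cut' A)"
 proof -
  have "card (sym_diff (cut' X) (cut' A)) = card (cut' X - cut' A) + card (cut' A - cut' X)"
   using fin_cut by (intro card_Un_disjoint) auto
  moreover have "card (cut' X) = card (cut' X - cut' A) + card (cut' A Int cut' X)"
   using fin_cut by (subst card_Un_disjoint[symmetric]) (auto intro: arg_cong[where f=card])
  moreover have "card (cut' A) = card (cut' A - cut' X) + card (cut' A Int cut' X)"
   using fin_cut by (subst card_Un_disjoint[symmetric]) (auto intro: arg_cong[where f=card])
  ultimately show ?thesis by simp
 qed
 ultimately have "card (cut' (X - A)) + 2 * card (cut' A Int cut' X) = card (cut' X) + card (cut' A)" by simp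
 hence "(SUM K:KK. card (cut' K)) + 2 * card (inner' A) + 2 * card (cut' A Int cut' X) = 3 * card A + card (cut' X) + 2 * card b"
  using b(4) cubic_count[OF A] by simp
 thus ?thesis using b(1-3) by blast
qed

text \<open>Petersen's theorem with prescribed edges \<open>s\<close> leaving \<open>X\<close> and
  forbidden edges \<open>N\<close>. By parity a barrier has at least two parts more than
  \<open>card A0\<close>, each with a cut of at least 3. This excess of 6 would have to be paid by
  \<open>card (cut' X) + card s + 2 * card N\<close>.\<close>

lemma pm_exists:
 assumes bridgeless: "ALL Y<=F. card (cut' Y) ~= 1"
  and X: "X <= F" and s: "s <= cut' X" and one: "!!f. f : X ==> card (s Int bd f) <= 1"
  and ev: "even (card X + card s)" and N: "finite N" "card (cut' X) + card s + 2 * card N < 6"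
 shows "EX m<=inner' X - N. ALL f:X. card ((m Un s) Int bd f) = 1"
proof -
 \<comment> \<open>The faces already served by \<open>s\<close>. They leave the matching problem and
   are then added to the barrier.\<close>
 define R where "R = {f:X. s Int bd f ~= {}}"
 have R: "R <= X" "R <= F" using X by (auto simp: R_def)
 have fin: "finite X" "finite R" "finite s" using fin_sub[OF X] R fin_sub finite_subset[OF s fin_cut] by auto
 have "card s = card R"
 proof -
  have "card s = (SUM e:s. card {f:X. e : bd f})" using s by (simp add: cut_def subset_iff)
  also have "... = (SUM f:X. card {e:s. e : bd f})" using fin even_sum_card[of s X "%e f. e : bd f"] by simp
  also have "... = (SUM f:X. if f : R then 1 else 0)"
  proof (intro sum.cong refl)
   fix f assume f: "f : X"
   have "{e:s. e : bd f} = s Int bd f" by auto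
   moreover have "card (s Int bd f) = 0 \<longleftrightarrow> s Int bd f = {}" using fin by simp
   ultimately show "card {e:s. e : bd f} = (if f : R then 1 else 0)"
    using one[OF f] f by (auto simp: R_def)
  qed
  also have "... = card R" using fin R by (simp add: sum.If_cases Int_absorb1)
  finally show ?thesis .
 qed
 let ?U = "X - R"
 have cU: "card ?U + card R = card X" using fin R by (metis card_Diff_subset card_mono le_add_diff_inverse2)
 hence evU: "even (card ?U)" using ev \<open>card s = card R\<close> by presburger
 have "matchable (near N) ?U"
 proof (rule ccontr)
  assume "~ matchable (near N) ?U"
  then obtain A0 KK where sep: "separation (near N) ?U A0 KK" and odd: "ALL K:KK. odd (card K)" and lt: "card A0 < card KK"
   using tutte[of ?U "near N"] fin near_sym by blast
  have p: "A0 <= ?U" "partition_on (?U - A0) KK"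
   and no: "ALL K:KK. ALL L:KK. K ~= L --> (ALL x:K. ALL y:L. ~ near N x y)"
   using sep unfolding separation_def by blast+
  define A where "A = A0 Un R"
  have finA: "finite A0" using p fin finite_subset by blast
  have A: "A <= F" "A <= X" using p R X by (auto simp: A_def)
  have "?U - A0 = X - A" by (auto simp: A_def)
  hence pX: "partition_on (X - A) KK" using p by simp
  have cA: "card A = card A0 + card R" using p finA fin unfolding A_def by (intro card_Un_disjoint) auto
  obtain b where b: "b <= N" and eq: "(SUM K:KK. card (cut' K)) + 2 * card (inner' A) + 2 * card (cut' A Int cut' X)
    = 3 * card A + card (cut' X) + 2 * card b"
   using barrier_count[OF A(1) pX A(2) X no] by (elim exE conjE) (rule that; assumption)
  have "card b <= card N" using b N(1) by (intro card_mono)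
  have "s <= cut' A Int cut' X"
  proof
   fix e assume e: "e : s"
   hence eX: "e : cut' X" using s by blast
   then obtain f g where "f : X" "e : bd f" "g : F - X" "e : bd g" "e : E" using cut_iff[OF X] by blast
   hence "f : A" "g : F - A" using e A by (auto simp: A_def R_def)
   thus "e : cut' A Int cut' X" using cut_iff[OF A(1)] eX \<open>e : bd f\<close> \<open>e : bd g\<close> \<open>e : E\<close> by blast
  qed
  hence "card s <= card (cut' A Int cut' X)" using fin_cut by (intro card_mono) auto
  moreover have "3 * card KK <= (SUM K:KK. card (cut' K))"
  proof -
   have "(SUM K:KK. 3) <= (SUM K:KK. card (cut' K))"
   proof (rule sum_mono)
    fix K assume K: "K : KK"
    hence "K <= F" using pX X by (auto simp: partition_on_def)
    hence "odd (card (cut' K))" "card (cut' K) ~= 1" using cut_parity[of K] odd K bridgeless by auto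
    thus "3 <= card (cut' K)" by (rule odd_ge_3)
   qed
   thus ?thesis by simp
  qed
  moreover have "card A0 + 2 <= card KK"
  proof -
   have "odds KK = card KK" using odd by (simp add: odds_all)
   hence "even (card (?U - A0)) \<longleftrightarrow> even (card KK)" using card_partition_parity[OF p(2)] fin by simp
   moreover have "card (?U - A0) + card A0 = card ?U"
    using p(1) fin finA by (metis card_Diff_subset card_mono finite_Diff le_add_diff_inverse2)
   ultimately have "even (card KK + card A0)" using evU by presburger
   thus ?thesis using lt by (rule even_less)
  qed
  ultimately show False using eq cA \<open>card b <= card N\<close> N(2) \<open>card s = card R\<close> by linarith
 qed
 from matchable_edges[OF this] obtain m where m: "m <= E - N" "ALL f:?U. card (m Int bd f) = 1"
   "ALL f:F - ?U. m Int bd f = {}" "m <= inner' ?U" using X by blast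
 have "m <= inner' X - N"
 proof -
  have "?U <= F" using X by blast
  have "inner' ?U <= inner' X" unfolding subset_iff inner_iff[OF X] inner_iff[OF \<open>?U <= F\<close>] by blast
  thus ?thesis using m by blast
 qed
 moreover have "card ((m Un s) Int bd f) = 1" if f: "f : X" for f
 proof (cases "f : R")
  case True
  hence "m Int bd f = {}" "s Int bd f ~= {}" using m(3) X f by (auto simp: R_def)
  hence "(m Un s) Int bd f = s Int bd f" by blast
  moreover have "card (s Int bd f) ~= 0" using \<open>s Int bd f ~= {}\<close> fin by simp
  ultimately show ?thesis using one[OF f] by simp
 next
  case False
  hence "(m Un s) Int bd f = m Int bd f" using f by (auto simp: R_def)
  thus ?thesis using m(2) f False by simp
 qed
 ultimately show ?thesis by blast
qed

lemma pm_cubic: "pm F E bd m \<longleftrightarrow> m <= E & (ALL f:F. card (m Int bd f) = 1)"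
 unfolding pm_def pm_at_def using cubic by auto

end

section \<open>Duality between closed edge sets and face sets\<close>

context cx
begin

text \<open>Modulo 2, \<open>p\<close> behaves like a dual path from \<open>f\<close> to
  \<open>g\<close>; for \<open>f = g\<close> the condition says that \<open>p\<close> is a
  cocycle.\<close>

definition join :: "'f => 'f => 'e set => bool" where
 "join f g p \<longleftrightarrow> p <= E & (ALL h:F. odd (card (p Int bd h)) \<longleftrightarrow> (h = f) ~= (h = g))"

lemma join_step:
 assumes "join f g p" "{k:F. e : bd k} = {g, h}" "g ~= h" "f : F"
 shows "join f h (sym_diff p {e})"
 unfolding join_def
proof (intro conjI ballI)
 have "g : {k:F. e : bd k}" "h : {k:F. e : bd k}" using assms by auto
 hence gh: "g : F" "h : F" "e : bd g" "e : bd h" by auto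
 hence "e : E" using bdE by blast
 thus "sym_diff p {e} <= E" using assms by (auto simp: join_def)
 fix k assume k: "k : F"
 have fp: "finite p" using assms finE finite_subset by (auto simp: join_def)
 have eq: "sym_diff p {e} Int bd k = sym_diff (p Int bd k) ({e} Int bd k)" by blast
 have "e : bd k \<longleftrightarrow> k = g | k = h" using assms(2) k by blast
 hence "card ({e} Int bd k) = (if k = g | k = h then 1 else 0)" by auto
 hence "odd (card (sym_diff p {e} Int bd k)) \<longleftrightarrow> (odd (card (p Int bd k))) ~= (k = g | k = h)"
  unfolding eq using fp by (subst even_card_sym_diff) auto
 thus "odd (card (sym_diff p {e} Int bd k)) \<longleftrightarrow> (k = f) ~= (k = h)"
  using assms(1,3) k by (auto simp: join_def)
qed

lemma join_ex:
 assumes conn: "ALL X<=F. cut' X = {} --> X = {} | X = F" and "f : F" "g : F"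
 shows "EX p. join f g p"
proof -
 define S where "S = {g:F. EX p. join f g p}"
 have S: "S <= F" by (auto simp: S_def)
 have "join f f {}" by (auto simp: join_def)
 hence "f : S" using assms by (auto simp: S_def)
 have "cut' S = {}"
 proof (rule ccontr)
  assume "cut' S ~= {}"
  then obtain e where e: "e : cut' S" by blast
  then obtain a where a: "a : S" "e : bd a" using cut_iff[OF S] by blast
  hence aF: "a : F" using S by blast
  then obtain b where b: "b : F" "b ~= a" "{h:F. e : bd h} = {a, b}" using other_face[OF aF a(2)] by metis
  obtain p where "join f a p" using a by (auto simp: S_def)
  hence "join f b (sym_diff p {e})" using join_step[OF _ b(3)] b(2) assms by blast
  hence "b : S" using b by (auto simp: S_def)
  thus False using cut_two[OF S b(3)] b(2) a e by blast
 qed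
 hence "S = F" using conn S \<open>f : S\<close> by blast
 thus ?thesis using assms by (auto simp: S_def)
qed

text \<open>Edge sets orthogonal to all cocycles are cuts. \<open>X\<close> collects the faces
  reached from \<open>f0\<close> by dual paths crossing \<open>t\<close> an odd number of times; two
  paths to the same face differ by a cocycle, so this parity is well defined.\<close>

lemma duality:
 assumes conn: "ALL X<=F. cut' X = {} --> X = {} | X = F"
  and t: "t <= E" and ev: "ALL z. cocycle' z --> even (card (t Int z))"
 shows "EX X<=F. t = cut' X"
proof (cases "F = {}")
 case True
 hence "E = {}" using two by auto
 thus ?thesis using t by (auto simp: cut_def)
next
 case False
 then obtain f0 where f0: "f0 : F" by blast
 have fj: "finite p" if "join f0 g p" for g p using that finE finite_subset by (auto simp: join_def)
 define X where "X = {g:F. EX p. join f0 g p & odd (card (t Int p))}"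
 have ft: "finite t" using t finE finite_subset by blast
 have same: "even (card (t Int p)) \<longleftrightarrow> even (card (t Int q))" if pq: "join f0 g p" "join f0 g q" for g p q
 proof -
  have fin: "finite p" "finite q" using pq fj by auto
  have "cocycle' (sym_diff p q)" unfolding cocycle_def
  proof (intro conjI ballI)
   show "sym_diff p q <= E" using pq by (auto simp: join_def)
   fix f assume "f : F"
   have eq: "sym_diff p q Int bd f = sym_diff (p Int bd f) (q Int bd f)" by blast
   show "even (card (sym_diff p q Int bd f))"
    unfolding eq using fin pq \<open>f : F\<close> by (subst even_card_sym_diff) (auto simp: join_def)
  qed
  hence e: "even (card (t Int sym_diff p q))" using ev by blast
  have eq: "t Int sym_diff p q = sym_diff (t Int p) (t Int q)" by blast
  show ?thesis using e unfolding eq using fin by (subst (asm) even_card_sym_diff) auto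
 qed
 have X: "X <= F" by (auto simp: X_def)
 have inX: "g : X \<longleftrightarrow> odd (card (t Int p))" if "g : F" "join f0 g p" for g p
 proof
  assume "g : X"
  then obtain q where "join f0 g q" "odd (card (t Int q))" by (auto simp: X_def)
  thus "odd (card (t Int p))" using same[OF that(2), of q] by simp
 next
  assume "odd (card (t Int p))"
  thus "g : X" using that unfolding X_def by blast
 qed
 have "e : t \<longleftrightarrow> e : cut' X" if e: "e : E" for e
 proof -
  obtain a b where ab: "a : F" "b : F" "a ~= b" "{h:F. e : bd h} = {a, b}" using two_faces[OF e] by metis
  obtain p where p: "join f0 a p" using join_ex[OF conn f0 ab(1)] by blast
  have q: "join f0 b (sym_diff p {e})" using join_step[OF p ab(4,3) f0] .
  have eq: "t Int sym_diff p {e} = sym_diff (t Int p) (t Int {e})" by blast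
  have "even (card (t Int sym_diff p {e})) \<longleftrightarrow> (even (card (t Int p)) \<longleftrightarrow> even (card (t Int {e})))"
   unfolding eq using ft by (subst even_card_sym_diff) auto
  moreover have "even (card (t Int {e})) \<longleftrightarrow> e ~: t" by (cases "e : t") auto
  ultimately show ?thesis using cut_two[OF X ab(4,3)] inX[OF ab(1) p] inX[OF ab(2) q] by blast
 qed
 hence "t = cut' X" using t cut_E by blast
 thus ?thesis using X by blast
qed

end

lemma triangle_labels:
 assumes "card S = 3" "!!p. p : S ==> card p = 2" "!!v. even (card {p:S. v : p})"
 shows "EX a b c. a ~= b & b ~= c & a ~= c & S = {{a, b}, {b, c}, {a, c}}"
proof -
 obtain p q s where S: "S = {p, q, s}" "p ~= q" "q ~= s" "p ~= s" using assms(1) by (auto simp: card_3_iff)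
 have cnt: "even ((if v : p then 1 else 0) + (if v : q then 1 else 0) + (if v : s then 1 else 0 :: nat))" for v
 proof -
  have "{x:S. v : x} = (if v : p then {p} else {}) Un (if v : q then {q} else {}) Un (if v : s then {s} else {})"
   using S by auto
  thus ?thesis using assms(3)[of v] S(2-4) by (auto split: if_splits)
 qed
 obtain a b where ab: "p = {a, b}" "a ~= b" using assms(2)[of p] S by (auto simp: card_2_iff)
 obtain c d where cd: "q = {c, d}" "c ~= d" using assms(2)[of q] S by (auto simp: card_2_iff)
 obtain x y where xy: "s = {x, y}" "x ~= y" using assms(2)[of s] S by (auto simp: card_2_iff)
 have 1: "(a : q) ~= (a : s)" "(b : q) ~= (b : s)" using cnt[of a] cnt[of b] ab by (auto split: if_splits)
 have 2: "~ (a : q & b : q)" "~ (a : s & b : s)" using S(2-4) ab cd xy by auto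
 have "EX w. w ~= a & w ~= b & ((q = {a, w} & s = {b, w}) | (q = {b, w} & s = {a, w}))"
 proof (cases "a : q")
  case True
  hence "b : s" using 1 2 by blast
  obtain w where w: "q = {a, w}" "w ~= a" using True cd by auto
  have "w ~= b" using w 2 by auto
  hence "w : s" using cnt[of w] w ab by (auto split: if_splits)
  hence "s = {b, w}" using \<open>b : s\<close> \<open>w ~= b\<close> xy by auto
  thus ?thesis using w \<open>w ~= b\<close> by blast
 next
  case False
  hence "a : s" "b : q" using 1 2 by blast+
  obtain w where w: "q = {b, w}" "w ~= b" using \<open>b : q\<close> cd by auto
  have "w ~= a" using w False by auto
  hence "w : s" using cnt[of w] w ab by (auto split: if_splits)
  hence "s = {a, w}" using \<open>a : s\<close> \<open>w ~= a\<close> xy by auto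
  thus ?thesis using w \<open>w ~= a\<close> by blast
 qed
 then obtain w where w: "w ~= a" "w ~= b" "q = {a, w} & s = {b, w} | q = {b, w} & s = {a, w}" by blast
 have "S = {{a, b}, {b, w}, {a, w}}" using w(3) unfolding S(1) ab(1) by (auto simp: insert_commute)
 thus ?thesis using ab(2) w(1,2) by (intro exI[of _ a] exI[of _ b] exI[of _ w]) auto
qed

lemma pairs_3: "a ~= b ==> b ~= c ==> a ~= c ==> pairs {a, b, c} = {{a, b}, {b, c}, {a, c}}"
proof (rule set_eqI)
 fix p assume d: "a ~= b" "b ~= c" "a ~= c"
 show "p : pairs {a, b, c} \<longleftrightarrow> p : {{a, b}, {b, c}, {a, c}}"
 proof
  assume "p : pairs {a, b, c}"
  then obtain x y where "p = {x, y}" "x ~= y" "x : {a,b,c}" "y : {a,b,c}" by (auto simp: pairs_def card_2_iff)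
  thus "p : {{a, b}, {b, c}, {a, c}}" by (auto simp: insert_commute)
 qed (use d in \<open>auto simp: pairs_def\<close>)
qed

section \<open>Complexes without small cuts\<close>

text \<open>What remains when digons have been absorbed and the sides of small cuts contracted: a
  cut of size at most 3 has at most one face on one of its sides. Simplicity is derived from this in
  \<open>no_loop\<close> and \<open>simple\<close>.\<close>

locale tight = pcx F E bd en for F :: "'f set" and E :: "'e set" and bd and en :: "'e => 'v set" +
 assumes all3: "f : F ==> card (bd f) = 3"
  and conn4: "X <= F ==> card (cut E bd X) <= 3 ==> card X <= 1 | card (F - X) <= 1"
  and badF: "bad F E bd en"

sublocale tight \<subseteq> cubic_cx F E bd en
 using all3 by unfold_locales

context tight
begin

lemma bridgeless_all: "ALL Y<=F. card (cut' Y) ~= 1" using bridgeless by blast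

lemma card_compl: "X <= F ==> card X + card (F - X) = card F"
 using finF fin_sub by (metis card_Diff_subset card_mono le_add_diff_inverse)

lemma cut_small:
 assumes X: "X <= F" and c: "card (cut' X) <= 3"
 shows "X = {} | X = F | (EX f:F. cut' X = bd f & (X = {f} | F - X = {f}))"
proof -
 have *: "Y = {} | (EX f:F. Y = {f})" if "card Y <= 1" "Y <= F" for Y
 proof (cases "card Y = 0")
  case True thus ?thesis using fin_sub[OF that(2)] by simp
 next
  case False
  hence "card Y = 1" using that by simp
  thus ?thesis using that(2) by (auto simp: card_1_singleton_iff)
 qed
 from conn4[OF X c] show ?thesis
 proof
  assume "card X <= 1"
  from *[OF this X] show ?thesis using cut_single by blast
 next
  assume "card (F - X) <= 1"
  from *[OF this] have "F - X = {} | (EX f:F. F - X = {f})" by blast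
  thus ?thesis
  proof
   assume "F - X = {}" thus ?thesis using X by blast
  next
   assume "EX f:F. F - X = {f}"
   then obtain f where f: "f : F" "F - X = {f}" by blast
   hence "cut' X = bd f" using cut_compl[OF X] cut_single[OF f(1)] by simp
   thus ?thesis using f by blast
  qed
 qed
qed

lemma conn: "ALL X<=F. cut' X = {} --> X = {} | X = F"
proof (intro allI impI)
 fix X assume X: "X <= F" "cut' X = {}"
 have "bd f ~= {}" if "f : F" for f using cubic[OF that] by auto
 thus "X = {} | X = F" using cut_small[OF X(1)] X(2) by auto
qed

lemma cut_ge3: "X <= F ==> X ~= {} ==> X ~= F ==> card (cut' X) >= 3"
proof (rule ccontr)
 assume X: "X <= F" "X ~= {}" "X ~= F" and c: "~ card (cut' X) >= 3"
 then obtain f where "f : F" "cut' X = bd f" using cut_small[OF X(1)] by auto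
 thus False using cubic[of f] c by simp
qed

lemma cut_eq3: "X <= F ==> card (cut' X) = 3 ==> (EX f:F. cut' X = bd f & (X = {f} | F - X = {f}))"
proof -
 assume X: "X <= F" "card (cut' X) = 3"
 hence "X ~= {}" "X ~= F" using cut_empty cut_F by auto
 thus ?thesis using cut_small[OF X(1)] X(2) by simp
qed

text \<open>With one face \<open>g\<close> of \<open>e\<close> left out, \<open>e\<close> lies in
  the cut and can be prescribed; in \<open>pm_exists\<close> this costs 3 + 1 < 6.\<close>

lemma pm_with:
 assumes "e : E" shows "EX m. pm F E bd m & e : m"
proof -
 obtain f g where fg: "f : F" "g : F" "f ~= g" "e : bd f" "e : bd g" "{h:F. e : bd h} = {f, g}"
  using two_faces[OF assms] by blast
 have X: "F - {g} <= F" by blast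
 have cX: "cut' (F - {g}) = bd g" using cut_compl[of "{g}"] cut_single[OF fg(2)] fg by simp
 have "card (F - {g}) + 1 = card F" using card.remove[OF finF fg(2)] by simp
 hence ev: "even (card (F - {g}) + card {e})" using even_F by simp
 have "card ({e} Int bd h) <= 1" for h by (cases "e : bd h") auto
 then obtain m where m: "m <= inner' (F - {g}) - {}" "ALL f:F - {g}. card ((m Un {e}) Int bd f) = 1"
  using pm_exists[OF bridgeless_all X _ _ ev, of "{}"] cX fg cubic[OF fg(2)] by auto
 have "(m Un {e}) Int bd g = {e}" using m(1) inner_cut_disj[of "F - {g}"] cX fg by blast
 hence "card ((m Un {e}) Int bd f) = 1" if "f : F" for f using m(2) that by (cases "f = g") auto
 moreover have "m Un {e} <= E" using m(1) inner_E[of "F - {g}"] assms by blast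
 ultimately have "pm F E bd (m Un {e})" unfolding pm_cubic by blast
 thus ?thesis by blast
qed

text \<open>Two forbidden edges cost at most 2 * 2 < 6 in \<open>pm_exists\<close>.\<close>

lemma pm_avoid: "EX m. pm F E bd m & e1 ~: m & e2 ~: m"
proof -
 have "card {e1, e2} <= 2" by (simp add: card_insert_if)
 hence "EX m<=inner' F - {e1, e2}. ALL f:F. card ((m Un {}) Int bd f) = 1"
  by (intro pm_exists[OF bridgeless_all]) (use cut_F even_F in auto)
 then obtain m where "m <= inner' F - {e1, e2}" "ALL f:F. card (m Int bd f) = 1" by auto
 thus ?thesis unfolding pm_cubic using inner_E[of F] by blast
qed

lemma pm_sd: assumes "pm F E bd m" "cocycle' z" "~ is_cob' z" shows "is_cob' (sym_diff (E - m) z)"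
 using index2[OF pm_cocycle[OF assms(1)] assms(2)] badF assms by (auto simp: bad_def)

text \<open>All complements of matchings lie in the single non-trivial coset of the coboundaries. A
  closed set is orthogonal to coboundaries, so its parity is constant on this coset, and
  \<open>z\<close> shows that it is odd.\<close>

lemma closed_parity:
 assumes t: "closed t" and z: "cocycle' z" "odd (card (t Int z))" and m: "pm F E bd m"
 shows "odd (card (t Int (E - m)))"
proof -
 have ft: "finite t" "finite z" using t finE finite_subset cocycle_fin[OF z(1)] by (auto simp: closed_def)
 have "~ is_cob' z" using closed_cob[OF t] z by (auto simp: is_cob_def)
 from pm_sd[OF m z(1) this] have "even (card (t Int sym_diff (E - m) z))"
  using closed_cob[OF t] by (auto simp: is_cob_def)
 moreover have eq: "t Int sym_diff (E - m) z = sym_diff (t Int (E - m)) (t Int z)" by blast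
 ultimately have "even (card (sym_diff (t Int (E - m)) (t Int z)))" by simp
 thus ?thesis using z ft by (subst (asm) even_card_sym_diff) auto
qed

text \<open>By duality some cocycle meets \<open>t\<close> oddly as soon as \<open>t\<close> is not
  a cut. The main parity test for matchings on non-facial triangles.\<close>

lemma noncut_parity:
 assumes t: "closed t" and "!!X. X <= F ==> t ~= cut' X" and m: "pm F E bd m"
 shows "odd (card (t Int (E - m)))"
proof -
 have "~ (ALL z. cocycle' z --> even (card (t Int z)))"
  using duality[OF conn, of t] t assms(2) by (auto simp: closed_def)
 thus ?thesis using closed_parity[OF t _ _ m] by blast
qed

text \<open>Some matching contains \<open>e\<close> and some matching avoids it. Their complements
  differ by a coboundary containing \<open>e\<close>, but a loop lies in no coboundary.\<close>

lemma no_loop: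
 assumes "e : E" shows "card (en e) = 2"
proof (rule ccontr)
 assume "card (en e) ~= 2"
 hence e: "en e = {}" using en2[OF assms] by blast
 obtain m1 where m1: "pm F E bd m1" "e : m1" using pm_with[OF assms] by blast
 obtain m2 where m2: "pm F E bd m2" "e ~: m2" using pm_avoid[of e e] by blast
 have "is_cob' (sym_diff (E - m1) (E - m2))"
  using pm_sd[OF m1(1) pm_cocycle[OF m2(1)]] badF m2 by (auto simp: bad_def)
 moreover have "e : sym_diff (E - m1) (E - m2)" using m1 m2 assms by auto
 ultimately obtain Q where "e : cob' Q" unfolding is_cob_def by auto
 thus False using e by (simp add: cob_def)
qed

text \<open>Two parallel edges are a closed set too small to be a cut, yet a matching that avoids
  both has an even number of them, two, in its complement.\<close>

lemma simple: "inj_on en E"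
proof (rule inj_onI, rule ccontr)
 fix e1 e2 assume e: "e1 : E" "e2 : E" "en e1 = en e2" "e1 ~= e2"
 have "{e:{e1, e2}. v : en e} = (if v : en e1 then {e1, e2} else {})" for v using e by auto
 hence c: "closed {e1, e2}" using e by (auto simp: closed_def)
 have "{e1, e2} ~= cut' X" if X: "X <= F" for X
 proof
  assume eq: "{e1, e2} = cut' X"
  hence "card (cut' X) = 2" using e by (metis card_2_iff)
  thus False using cut_small[OF X] cut_empty cut_F cubic by force
 qed
 moreover obtain m where m: "pm F E bd m" "e1 ~: m" "e2 ~: m" using pm_avoid by blast
 ultimately have "odd (card ({e1, e2} Int (E - m)))" using noncut_parity[OF c] by blast
 moreover have "{e1, e2} Int (E - m) = {e1, e2}" using m e by auto
 ultimately show False using e by simp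
qed

lemma labels3:
 assumes "closed t" "card t = 3"
 obtains a b c where "a ~= b" "b ~= c" "a ~= c" "en ` t = {{a, b}, {b, c}, {a, c}}"
proof -
 have tE: "t <= E" using assms by (simp add: closed_def)
 hence inj: "inj_on en t" using simple inj_on_subset by blast
 have 1: "card (en ` t) = 3" using inj assms by (simp add: card_image)
 have 2: "card p = 2" if "p : en ` t" for p using that no_loop tE by auto
 have 3: "even (card {p:en ` t. v : p})" for v
 proof -
  have "{p:en ` t. v : p} = en ` {e:t. v : en e}" by auto
  moreover have "card ... = card {e:t. v : en e}" by (intro card_image inj_on_subset[OF inj]) auto
  ultimately show ?thesis using assms by (simp add: closed_def)
 qed
 from triangle_labels[OF 1 2 3] show ?thesis using that by blast
qed

lemma face_labels:
 assumes "f : F"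
 obtains a b c where "a ~= b" "b ~= c" "a ~= c" "en ` bd f = {{a, b}, {b, c}, {a, c}}"
 using labels3[OF closed_bd'[OF assms] cubic[OF assms]] .

definition lab :: "'f => 'v set" where "lab f = (UN e:bd f. en e)"

lemma lab_pairs: assumes "f : F" shows "card (lab f) = 3" "en ` bd f = pairs (lab f)"
proof -
 obtain a b c where abc: "a ~= b" "b ~= c" "a ~= c" "en ` bd f = {{a, b}, {b, c}, {a, c}}"
  using face_labels[OF assms] .
 have "lab f = \<Union>(en ` bd f)" by (simp add: lab_def)
 also have "... = {a, b, c}" unfolding abc(4) by auto
 finally have l: "lab f = {a, b, c}" .
 thus "card (lab f) = 3" using abc by simp
 show "en ` bd f = pairs (lab f)" using abc l pairs_3 by metis
qed

lemma lab_edge: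
 assumes "f : F" "a : lab f" "b : lab f" "a ~= b"
 obtains e where "e : bd f" "en e = {a, b}"
proof -
 have "{a, b} : pairs (lab f)" using assms by (simp add: pairs_def)
 hence "{a, b} : en ` bd f" using lab_pairs[OF assms(1)] by simp
 thus ?thesis using that by auto
qed

lemma closed_ge3:
 assumes t: "closed t" "t ~= {}" shows "3 <= card t"
proof (rule ccontr)
 assume c: "~ 3 <= card t"
 have tE: "t <= E" using t by (simp add: closed_def)
 hence ft: "finite t" using finE finite_subset by blast
 obtain e where e: "e : t" using t by blast
 then obtain a b where ab: "en e = {a, b}" "a ~= b" using no_loop tE by (meson card_2_iff subsetD)
 have other: "EX e':t. e' ~= e & v : en e'" if "v : en e" for v
 proof (rule ccontr)
  assume "~ ?thesis"
  hence "{e:t. v : en e} = {e}" using e that by auto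
  hence "card {e:t. v : en e} = 1" by simp
  moreover have "even (card {e:t. v : en e})" using t by (simp add: closed_def)
  ultimately show False by simp
 qed
 obtain x where x: "x : t" "x ~= e" "a : en x" using other[of a] ab by auto
 obtain y where y: "y : t" "y ~= e" "b : en y" using other[of b] ab by auto
 have "x = y"
 proof (rule ccontr)
  assume "x ~= y"
  hence "card {e, x, y} = 3" using x y by auto
  moreover have "card {e, x, y} <= card t" using ft e x y by (intro card_mono) auto
  ultimately show False using c by simp
 qed
 hence "en e <= en x" using ab x y by auto
 hence "en e = en x" using no_loop[of e] no_loop[of x] fin_en[of x] subsetD[OF tE e] subsetD[OF tE x(1)] by (intro card_subset_eq) auto
 thus False using inj_onD[OF simple, of e x] e x tE by blast
qed

lemma en_mem: "e : E ==> a : en e ==> b : en e ==> a ~= b ==> en e = {a, b}"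
 using no_loop[of e] by (auto simp: card_2_iff)

lemma cob_iff: "e : cob' Q \<longleftrightarrow> e : E & (EX a b. en e = {a, b} & a : Q & b ~: Q)"
proof (cases "e : E")
 case True
 then obtain a b where ab: "en e = {a, b}" "a ~= b" using no_loop by (meson card_2_iff)
 have "{a, b} Int Q = (if a : Q then {a} else {}) Un (if b : Q then {b} else {})" by auto
 thus ?thesis using ab True by (auto simp: cob_def doubleton_eq_iff split: if_splits)
qed (simp add: cob_def)

lemma cob_compl: "cob' (- Q) = cob' Q"
 by (auto simp: cob_iff) (metis insert_commute)+

lemma star_cob: "cob' {v} = {e:E. v : en e}"
proof -
 have "card (en e Int {v}) = (if v : en e then 1 else 0)" for e by auto
 thus ?thesis by (auto simp: cob_def)
qed

lemma cocycle_bd02: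
 assumes "cocycle' z" "f : F" shows "card (z Int bd f) = 0 | card (z Int bd f) = 2"
proof -
 have "even (card (z Int bd f))" using assms by (simp add: cocycle_def)
 moreover have "card (z Int bd f) <= 3"
  using card_mono[OF fin_bd[OF assms(2)], of "z Int bd f"] cubic[OF assms(2)] by simp
 ultimately show ?thesis by (rule even_le_3)
qed

text \<open>Since the dual graph is connected, removing the vertices of \<open>K0\<close> does not disconnect
the links around it; hence the coboundary of \<open>K0\<close> is a single dual cycle.\<close>
lemma cob_minimal:
 assumes K0: "!!Q. cob' Q <= cob' K0 ==> K0 <= Q | K0 Int Q = {}"
  and one: "card {e:E. en e <= K0} <= 1"
  and D: "cocycle' D" "D <= cob' K0"
 shows "D = {} | D = cob' K0"
proof (rule ccontr)
 assume nt: "~ ?thesis"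
 let ?Z = "cob' K0"
 have cD: "cocycle' (sym_diff ?Z D)" using cocycle_sd cob_cocycle D by blast
 have Dd: "sym_diff ?Z D = ?Z - D" using D by blast
 show False
 proof (cases "is_cob' D")
  case False
  have "~ is_cob' (?Z - D)"
  proof
   assume "is_cob' (?Z - D)"
   hence "is_cob' (sym_diff ?Z (?Z - D))" by (intro is_cob_sd) (auto simp: is_cob_def)
   moreover have "sym_diff ?Z (?Z - D) = D" using D by blast
   ultimately show False using False by simp
  qed
  \<comment> \<open>Both \<open>D\<close> and the rest of \<open>?Z\<close> are non-trivial, so
    \<open>meet\<close> gives a face crossed by both, twice each, although it has only three
    edges.\<close>
  then obtain f where f: "f : F" "D Int bd f ~= {}" "(?Z - D) Int bd f ~= {}"
   using meet[OF D(1) _ False] cD Dd by metis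
  have fb: "finite (bd f)" using fin_bd[OF f(1)] .
  have "card (D Int bd f) = 2" "card ((?Z - D) Int bd f) = 2"
   using cocycle_bd02[OF D(1) f(1)] cocycle_bd02[OF cD f(1)] f Dd fb by auto
  moreover have "card (D Int bd f) + card ((?Z - D) Int bd f) = card (D Int bd f Un (?Z - D) Int bd f)"
   using fb by (intro card_Un_disjoint[symmetric]) auto
  moreover have "card (D Int bd f Un (?Z - D) Int bd f) <= card (bd f)" using fb by (intro card_mono) auto
  ultimately show False using cubic[OF f(1)] by simp
 next
  case True
  then obtain Q0 where Q0: "D = cob' Q0" by (auto simp: is_cob_def)
  have "EX Q. D = cob' Q & K0 <= Q"
  proof (cases "K0 <= Q0")
   case False
   hence "K0 Int Q0 = {}" using K0[of Q0] D Q0 by blast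
   thus ?thesis using Q0 cob_compl[of Q0] by (intro exI[of _ "- Q0"]) auto
  qed (use Q0 in blast)
  then obtain Q where Q: "D = cob' Q" "K0 <= Q" by blast
  have sep: False if f: "f : F" and a: "a : lab f" "a : Q" "a ~: K0" and b: "b : lab f" "b ~: Q" for f a b
  proof -
   have "a ~= b" using a b by blast
   obtain e where e: "e : bd f" "en e = {a, b}" using lab_edge[OF f a(1) b(1) \<open>a ~= b\<close>] .
   hence "e : D" using Q a b bdE[OF f] by (auto simp: cob_iff)
   hence "e : ?Z" using D by blast
   thus False using e a b Q by (auto simp: cob_iff doubleton_eq_iff)
  qed
  define X where "X = {f:F. lab f Int (Q - K0) ~= {}}"
  have X: "X <= F" by (auto simp: X_def)
  have "cut' X <= {e:E. en e <= K0}"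
  proof
   fix e assume e: "e : cut' X"
   then obtain f g where fg: "f : X" "e : bd f" "g : F - X" "e : bd g" "e : E" using cut_iff[OF X] by blast
   have "en e <= K0"
   proof
    fix w assume w: "w : en e"
    have wl: "w : lab f" "w : lab g" using w fg by (auto simp: lab_def)
    show "w : K0"
    proof (rule ccontr)
     assume "w ~: K0"
     hence "w ~: Q" using fg(3) wl by (auto simp: X_def)
     obtain a where "a : lab f" "a : Q" "a ~: K0" using fg(1) by (auto simp: X_def)
     thus False using sep[of f a w] fg(1) X wl(1) \<open>w ~: Q\<close> by blast
    qed
   qed
   thus "e : {e:E. en e <= K0}" using fg by simp
  qed
  hence "card (cut' X) <= card {e:E. en e <= K0}" using finE by (intro card_mono) auto
  hence "card (cut' X) <= 1" using one by simp
  hence "card (cut' X) = 0" using bridgeless[OF X] by (cases "card (cut' X)") auto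
  hence "X = {} | X = F" using conn X fin_cut[of X] by auto
  thus False
  proof
   assume XF: "X = F"
   have "D = {}"
   proof (rule ccontr)
    assume "D ~= {}"
    then obtain e where "e : D" by blast
    then obtain a b where e: "e : E" "en e = {a, b}" "b ~: Q" using Q by (auto simp: cob_iff)
    obtain f where f: "f : F" "e : bd f" using two_faces[OF e(1)] by blast
    hence "b : lab f" using e by (auto simp: lab_def)
    moreover obtain c where "c : lab f" "c : Q" "c ~: K0" using XF f by (auto simp: X_def)
    ultimately show False using sep[of f c b] f e by blast
   qed
   thus False using nt by simp
  next
   assume XE: "X = {}"
   have "?Z <= D"
   proof
    fix e assume "e : ?Z"
    then obtain a b where e: "e : E" "en e = {a, b}" "a : K0" "b ~: K0" by (auto simp: cob_iff)
    obtain f where f: "f : F" "e : bd f" using two_faces[OF e(1)] by blast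
    hence "b : lab f" using e by (auto simp: lab_def)
    hence "b ~: Q" using XE f e(4) by (auto simp: X_def)
    thus "e : D" using e Q by (auto simp: cob_iff)
   qed
   thus False using nt D by blast
  qed
 qed
qed

text \<open>The faces crossed by \<open>Z\<close> form a 2-regular dual graph that is connected by
  minimality, an even cycle; \<open>Z0\<close> is one of its two perfect matchings. Tutte's theorem
  replaces a walk around the cycle.\<close>

lemma alternating:
 assumes Z: "cocycle' Z" and min: "!!D. cocycle' D ==> D <= Z ==> D = {} | D = Z" and ev: "even (card Z)"
 shows "EX Z0<=Z. ALL f:F. card (Z Int bd f) = 2 --> card (Z0 Int bd f) = 1"
proof -
 have ZE: "Z <= E" using Z by (simp add: cocycle_def)
 have fZ: "finite Z" using cocycle_fin[OF Z] .
 define N where "N = {f:F. card (Z Int bd f) = 2}"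
 have N: "N <= F" by (auto simp: N_def)
 have fN: "finite N" using fin_sub[OF N] .
 let ?near = "near (E - Z)"
 have inN: "f : N" if "f : F" "e : Z" "e : bd f" for e f
  using cocycle_bd02[OF Z that(1)] that fin_bd[OF that(1)] by (auto simp: N_def)
 have hs: "2 * card K = 2 * card (Z Int inner' K) + card (Z Int cut' K)" if K: "K <= N" for K
 proof -
  have "(SUM f:K. card (Z Int bd f)) = (SUM f:K. 2)" using K by (intro sum.cong) (auto simp: N_def)
  thus ?thesis using handshake[of K Z] K N ZE by simp
 qed
 have in_K: "e : inner' K | e : cut' K" if "K <= F" "e : E" "f : K" "e : bd f" for e f K
  using edge_cases[OF that(1,2)] inner_iff[of "F - K"] that by blast
 have "matchable ?near N"
 proof (rule ccontr)
  assume "~ matchable ?near N"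
  then obtain A KK where sep: "separation ?near N A KK" and odd: "ALL K:KK. odd (card K)" and lt: "card A < card KK"
   using tutte[of N ?near] fN near_sym by blast
  have p: "A <= N" "partition_on (N - A) KK"
   and no: "ALL K:KK. ALL L:KK. K ~= L --> (ALL x:K. ALL y:L. ~ ?near x y)"
   using sep unfolding separation_def by blast+
  have KN: "K <= N - A" "K ~= {}" if "K : KK" for K using p(2) that by (auto simp: partition_on_def)
  have dis: "K Int L = {}" if "K : KK" "L : KK" "K ~= L" for K L
   using p(2) that by (auto simp: partition_on_def disjoint_def)
  have fKK: "finite KK" using p(2) fN by (meson finite_Diff partition_on_finite)
  have toA: "e : cut' A" if K: "K : KK" and e: "e : Z" "e : cut' K" for e K
  proof -
   have KF: "K <= F" and AF: "A <= F" using KN[OF K] N p by auto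
   obtain x y where xy: "x : K" "e : bd x" "y : F - K" "e : bd y" "e : E" using e cut_iff[OF KF] by blast
   have "y : N" using inN[of y e] xy e by blast
   have "y : A"
   proof (rule ccontr)
    assume "y ~: A"
    then obtain L where L: "L : KK" "y : L" using \<open>y : N\<close> p(2) by (auto simp: partition_on_def)
    have "?near x y" using xy KF e by (intro nearI[of x y e]) auto
    thus False using no K L xy by blast
   qed
   moreover have "x : F - A" using KN[OF K] xy KF by blast
   ultimately show ?thesis using cut_iff[OF AF] xy by blast
  qed
  have ge2: "2 <= card (Z Int cut' K)" if K: "K : KK" for K
  proof -
   have KN': "K <= N" using KN[OF K] by blast
   have ev2: "even (card (Z Int cut' K))" using hs[OF KN'] by (metis dvd_add_right_iff dvd_triv_left)
   \<comment> \<open>A part without outgoing edges of \<open>Z\<close> would carry a sub-cocycle,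
     hence all of \<open>Z\<close>, and would have the even size \<open>card Z\<close>.\<close>
   have "card (Z Int cut' K) ~= 0"
   proof
    assume "card (Z Int cut' K) = 0"
    hence zc: "Z Int cut' K = {}" using fZ by simp
    have KF: "K <= F" using KN' N by blast
    have "cocycle' (Z Int inner' K)" unfolding cocycle_def
    proof (intro conjI ballI)
     fix f assume f: "f : F"
     show "even (card (Z Int inner' K Int bd f))"
     proof (cases "f : K")
      case True
      hence "Z Int inner' K Int bd f = Z Int bd f" using zc in_K[OF KF] ZE by blast
      thus ?thesis using Z f by (simp add: cocycle_def)
     next
      case False
      hence "inner' K Int bd f = {}" using inner_iff[OF KF] f by blast
      hence "Z Int inner' K Int bd f = {}" by blast
      thus ?thesis by simp
     qed
    qed (use ZE in blast)
    moreover obtain f where f: "f : K" using KN[OF K] by blast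
    hence "Z Int bd f ~= {}" using KN' by (auto simp: N_def)
    hence "Z Int inner' K ~= {}" using f zc in_K[OF KF] ZE by blast
    ultimately have all: "Z Int inner' K = Z" using min[of "Z Int inner' K"] by blast
    have "N <= K"
    proof
     fix g assume g: "g : N"
     hence "Z Int bd g ~= {}" by (auto simp: N_def)
     then obtain e where "e : Z" "e : bd g" by blast
     thus "g : K" using all inner_iff[OF KF] g N by blast
    qed
    hence "card K = card Z" using hs[OF KN'] all zc by simp
    thus False using ev odd K by metis
   qed
   with ev2 show ?thesis by (cases "card (Z Int cut' K) = 1") auto
  qed
  have disj: "(Z Int cut' K) Int (Z Int cut' L) = {}" if KL: "K : KK" "L : KK" "K ~= L" for K L
  proof (rule ccontr)
   assume "(Z Int cut' K) Int (Z Int cut' L) ~= {}"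
   then obtain e where e: "e : Z" "e : cut' K" "e : cut' L" by blast
   have KF: "K <= F" "L <= F" using KN KL N by blast+
   obtain x where x: "x : K" "e : bd x" using e(2) cut_iff[OF KF(1)] by blast
   obtain y where y: "y : L" "e : bd y" using e(3) cut_iff[OF KF(2)] by blast
   have "x ~= y" using x y dis[OF KL] by blast
   hence "?near x y" using x y KF e by (intro nearI[of x y e]) auto
   thus False using no KL x y by blast
  qed
  have "2 * card KK <= (SUM K:KK. card (Z Int cut' K))"
   using sum_mono[of KK "%_. 2" "%K. card (Z Int cut' K)"] ge2 by simp
  also have "... = card (UN K:KK. Z Int cut' K)"
   using fKK fZ disj by (intro card_UN_disjoint[symmetric]) auto
  also have "... <= card (Z Int cut' A)" using toA fZ by (intro card_mono) auto
  also have "... <= 2 * card A" using hs[OF p(1)] by simp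
  finally show False using lt by simp
 qed
 from matchable_edges[OF this N] obtain m where m: "m <= E - (E - Z)" "ALL f:N. card (m Int bd f) = 1" by blast
 show ?thesis using m by (intro exI[of _ m]) (auto simp: N_def)
qed

text \<open>\<open>r\<close> moves the outer end of each edge of \<open>Z0\<close> to its end in
  \<open>K0\<close>, and \<open>uniq\<close> makes this well defined. The obstacle is
  bridgelessness: deleting \<open>Z0\<close> might leave a single edge of some cut.\<close>

lemma reduce:
 assumes Z: "Z = cob' K0" and Z0: "Z0 <= Z" and alt: "ALL f:F. card (Z Int bd f) = 2 --> card (Z0 Int bd f) = 1"
  and uniq: "!!e e' a. e : Z0 ==> e' : Z0 ==> a : en e ==> a : en e' ==> a ~: K0 ==> e = e'"
 obtains r where "reduction F E bd en Z Z0 r" "!!a. r a ~= a ==> a ~: K0 & r a : K0"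
  "!!a. a ~: K0 ==> EX e:Z0. a : en e ==> r a : K0"
proof -
 have ends: "EX a c. en e = {a, c} & a ~: K0 & c : K0" if "e : Z0" for e
 proof -
  have "e : cob' K0" using that Z0 Z by blast
  thus ?thesis unfolding cob_iff by (metis insert_commute)
 qed
 define r where "r a = (if a ~: K0 & (EX e:Z0. a : en e) then (THE c. EX e:Z0. en e = {a, c}) else a)" for a
 have r_leaf: "r a = c" if e: "e : Z0" "en e = {a, c}" "a ~: K0" for a c e
 proof -
  have "(THE c. EX e:Z0. en e = {a, c}) = c"
  proof (rule the_equality)
   show "EX e:Z0. en e = {a, c}" using e by blast
   fix d assume "EX e:Z0. en e = {a, d}"
   then obtain e' where "e' : Z0" "en e' = {a, d}" by blast
   hence "e' = e" using uniq[of e' e a] e by auto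
   thus "d = c" using \<open>en e' = {a, d}\<close> e by (auto simp: doubleton_eq_iff)
  qed
  thus ?thesis using e by (auto simp: r_def)
 qed
 have r_K0: "r a = a" if "a : K0" for a using that by (simp add: r_def)
 have "reduction F E bd en Z Z0 r"
 proof
  show "card (bd f) = 3" if "f : F" for f using cubic[OF that] .
  show "is_cob' Z" using Z by (auto simp: is_cob_def)
  show "Z0 <= Z" by (rule Z0)
  show "card (Z0 Int bd f) = 1" if "f : F" "card (Z Int bd f) = 2" for f using alt that by blast
  show "r a = r b" if e: "e : Z0" "a : en e" "b : en e" for e a b
  proof -
   obtain x c where xc: "en e = {x, c}" "x ~: K0" "c : K0" using ends[OF e(1)] by blast
   hence "r x = c" "r c = c" using r_leaf[OF e(1) xc(1,2)] r_K0 by auto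
   thus ?thesis using e xc by auto
  qed
  show "r a = a | (EX e:Z0. en e = {a, r a})" for a
  proof (cases "a ~: K0 & (EX e:Z0. a : en e)")
   case True
   then obtain e where e: "e : Z0" "a : en e" by blast
   obtain x c where xc: "en e = {x, c}" "x ~: K0" "c : K0" using ends[OF e(1)] by blast
   hence "x = a" using e True by auto
   thus ?thesis using r_leaf[OF e(1) xc(1,2)] xc e by blast
  qed (auto simp: r_def)
  show "bad F E bd en" by (rule badF)
  show "card (cut' Y - Z0) ~= 1" if Y: "Y <= F" for Y
  proof
   assume "card (cut' Y - Z0) = 1"
   then obtain e where e: "cut' Y - Z0 = {e}" by (auto simp: card_1_singleton_iff)
   define T where "T = cut' Y Int Z0"
   have cY: "cut' Y = insert e T" "e ~: T" using e by (auto simp: T_def)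
   have eE: "e : E" using cY cut_E by blast
   have cl: "closed (cut' Y)" using closed_cut[OF Y] .
   \<comment> \<open>\<open>lf d\<close> is the end of \<open>d\<close> outside \<open>K0\<close>.
     If only \<open>e\<close> survives in the cut, evenness at \<open>lf d\<close> forces
     \<open>e\<close> to end there, so at most two edges were deleted. The cut is then the boundary
     of a face with two edges of \<open>Z0\<close>, against alternation.\<close>
   define lf where "lf d = (THE a. a : en d & a ~: K0)" for d
   have lf: "lf d : en d" "lf d ~: K0" if d: "d : T" for d
   proof -
    have "d : Z0" using d by (simp add: T_def)
    then obtain x c where xc: "en d = {x, c}" "x ~: K0" "c : K0" using ends[of d] by blast
    have "lf d = x" unfolding lf_def using xc by (intro the_equality) auto
    thus "lf d : en d" "lf d ~: K0" using xc by auto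
   qed
   have "lf d : en e" if d: "d : T" for d
   proof (rule ccontr)
    assume "lf d ~: en e"
    have dZ: "d : Z0" using d by (simp add: T_def)
    have "x = d" if "x : cut' Y" "lf d : en x" for x
    proof -
     have "x : insert e T" using that cY(1) by simp
     hence "x : Z0" using that \<open>lf d ~: en e\<close> by (auto simp: T_def)
     thus ?thesis using uniq[OF _ dZ that(2) lf[OF d]] by blast
    qed
    moreover have "d : cut' Y" using d by (simp add: T_def)
    ultimately have "{x:cut' Y. lf d : en x} = {d}" using lf(1)[OF d] by blast
    hence "card {x:cut' Y. lf d : en x} = 1" by simp
    moreover have "even (card {x:cut' Y. lf d : en x})" using cl by (simp add: closed_def)
    ultimately show False by simp
   qed
   moreover have "inj_on lf T"
   proof (rule inj_onI)
    fix d d' assume d: "d : T" "d' : T" "lf d = lf d'"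
    hence "d : Z0" "d' : Z0" by (auto simp: T_def)
    thus "d = d'" using uniq[of d d' "lf d"] lf(1)[OF d(1)] lf(1)[OF d(2)] lf(2)[OF d(1)] d(3) by simp
   qed
   ultimately have "card T <= card (en e)" using fin_en[OF eE] by (intro card_inj_on_le) auto
   hence T2: "card T <= 2" using no_loop[OF eE] by simp
   have fT: "finite T" using cY fin_cut[of Y] by (metis finite_insert)
   have "3 <= card (cut' Y)" using closed_ge3[OF cl] cY by blast
   hence cT: "card T = 2" "card (cut' Y) = 3" using T2 cY fT by auto
   then obtain f where f: "f : F" "cut' Y = bd f" using cut_eq3[OF Y] by blast
   have fb: "finite (bd f)" using fin_bd[OF f(1)] .
   have T_sub: "T <= Z0 Int bd f" "T <= Z Int bd f" using f(2) Z0 unfolding T_def by blast+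
   have "cocycle' Z" using Z cob_cocycle by simp
   hence "card (Z Int bd f) = 2"
    using cocycle_bd02[OF _ f(1), of Z] card_mono[OF _ T_sub(2)] cT fb by auto
   hence "card (Z0 Int bd f) = 1" using alt f by blast
   thus False using card_mono[OF _ T_sub(1)] cT fb by auto
  qed
 qed
 moreover have "a ~: K0 & r a : K0" if "r a ~= a" for a
 proof -
  have c: "a ~: K0" "EX e:Z0. a : en e" using that by (auto simp: r_def split: if_splits)
  then obtain e where e: "e : Z0" "a : en e" by blast
  obtain x c where xc: "en e = {x, c}" "x ~: K0" "c : K0" using ends[OF e(1)] by blast
  hence "x = a" using e \<open>a ~: K0\<close> by auto
  thus ?thesis using r_leaf[OF e(1) xc(1,2)] xc by auto
 qed
 moreover have "r a : K0" if q: "a ~: K0" "EX e:Z0. a : en e" for a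
 proof -
  obtain e where e: "e : Z0" "a : en e" using q(2) by blast
  obtain x c where xc: "en e = {x, c}" "x ~: K0" "c : K0" using ends[OF e(1)] by blast
  hence "x = a" using e q by auto
  thus ?thesis using r_leaf[OF e(1) xc(1,2)] xc by auto
 qed
 ultimately show ?thesis using that by blast
qed

end

section \<open>The pentagonal complement of a band\<close>

text \<open>The outside \<open>R\<close> of a band: its five cut edges end in five different faces,
  collected in \<open>P\<close>. A matching of \<open>R\<close> minus three faces of
  \<open>P\<close> would leave those three to be matched into the band.\<close>

locale pentagon = tight F E bd en for F :: "'f set" and E :: "'e set" and bd and en :: "'e => 'v set" +
 fixes R P :: "'f set"
 assumes R: "R <= F" and out2: "card (F - R) >= 2" and cR: "card (cut E bd R) = 5"
  and P: "P <= R" "card P = 5"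
  and P1: "f : R ==> card (cut E bd R Int bd f) = (if f : P then 1 else 0)"
begin

lemma fR: "finite R" using fin_sub[OF R] .

lemma pend: "Y <= R ==> card (cut' Y Int cut' R) = card (Y Int P)"
proof -
 assume Y: "Y <= R"
 hence YF: "Y <= F" using R by blast
 have "(SUM f:Y. card (cut' R Int bd f)) = 2 * card (cut' R Int inner' Y) + card (cut' R Int cut' Y)"
  using handshake[OF YF cut_E] .
 moreover have "cut' R Int inner' Y = {}"
  using inner_iff[OF YF] cut_iff[OF R] Y by blast
 moreover have "(SUM f:Y. card (cut' R Int bd f)) = (SUM f:Y. if f : P then 1 else 0)"
  using P1 Y by (intro sum.cong) auto
 moreover have "(SUM f:Y. if f : P then 1 else 0 :: nat) = card (Y Int P)"
  using fin_sub[OF YF] by (simp add: sum.If_cases Int_def)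
 ultimately show ?thesis by (simp add: Int_commute)
qed

lemma d3: assumes "Y <= R" "Y ~= {}" shows "card (cut' Y) >= 3"
proof -
 have "Y ~= F" using assms R out2 by auto
 thus ?thesis using cut_ge3[of Y] assms R by blast
qed

lemma d3_single: assumes "Y <= R" "card (cut' Y) = 3" shows "card Y = 1"
proof -
 have "Y <= F" using assms R by blast
 from cut_eq3[OF this assms(2)] obtain f where "Y = {f} | F - Y = {f}" by blast
 moreover have "card (F - R) <= card (F - Y)" using assms finF by (intro card_mono) auto
 ultimately show ?thesis using out2 by auto
qed

lemma d_compl: assumes "Y <= R" shows "card (cut' (R - Y)) + 2 * card (Y Int P) = card (cut' Y) + 5"
proof -
 have YF: "Y <= F" "R - Y <= F" using assms R by auto
 have "cut' (Y Un (R - Y)) = sym_diff (cut' Y) (cut' (R - Y))" using YF by (intro cut_Un_disj) auto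
 moreover have "Y Un (R - Y) = R" using assms by blast
 ultimately have "cut' (R - Y) = sym_diff (cut' R) (cut' Y)" by auto
 moreover have "card (sym_diff (cut' R) (cut' Y)) = card (cut' R - cut' Y) + card (cut' Y - cut' R)"
  using fin_cut by (intro card_Un_disjoint) auto
 moreover have "card (cut' R) = card (cut' R - cut' Y) + card (cut' Y Int cut' R)"
  using fin_cut by (subst card_Un_disjoint[symmetric]) (auto intro: arg_cong[where f=card])
 moreover have "card (cut' Y) = card (cut' Y - cut' R) + card (cut' Y Int cut' R)"
  using fin_cut by (subst card_Un_disjoint[symmetric]) (auto intro: arg_cong[where f=card])
 ultimately show ?thesis using pend[OF assms] cR by simp
qed

lemma card_P_split: assumes "Y <= R" shows "card (Y Int P) + card ((R - Y) Int P) = 5"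
proof -
 have "P = (Y Int P) Un ((R - Y) Int P)" using P by blast
 moreover have "card ((Y Int P) Un ((R - Y) Int P)) = card (Y Int P) + card ((R - Y) Int P)"
  using fR assms by (intro card_Un_disjoint) (auto intro: finite_subset)
 ultimately show ?thesis using P(2) by simp
qed

text \<open>\<open>d_compl\<close> transfers the question to \<open>R - Y\<close>. In the critical
  case the complement contains two faces of \<open>P\<close>, so it is not a single face and its cut
  is not 3.\<close>

lemma d_pend3: assumes "Y <= R" "card (Y Int P) >= 3" shows "card (cut' Y) >= 5"
proof (cases "R - Y = {}")
 case True
 hence "Y = R" using assms by blast
 thus ?thesis using cR by simp
next
 case False
 have "card (cut' (R - Y)) >= 3" using d3[of "R - Y"] False by blast
 moreover have "card (Y Int P) = 3 ==> card (cut' (R - Y)) ~= 3"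
 proof
  assume "card (Y Int P) = 3" "card (cut' (R - Y)) = 3"
  hence "card (R - Y) = 1" "card ((R - Y) Int P) = 2"
   using d3_single[of "R - Y"] card_P_split[OF assms(1)] by auto
  moreover have "card ((R - Y) Int P) <= card (R - Y)" using fR by (intro card_mono) auto
  ultimately show False by simp
 qed
 ultimately show ?thesis using d_compl[OF assms(1)] assms(2) by linarith
qed

lemma d_pend4:
 assumes "Y <= R" "card (Y Int P) = 4"
 shows "card (cut' Y) >= 6" and "card (cut' Y) = 6 ==> card (R - Y) = 1"
proof -
 have "(R - Y) Int P ~= {}" using card_P_split[OF assms(1)] assms(2) by force
 hence ne: "R - Y ~= {}" by blast
 hence "card (cut' (R - Y)) >= 3" using d3[of "R - Y"] by blast
 thus "card (cut' Y) >= 6" using d_compl[OF assms(1)] assms(2) by linarith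
 assume "card (cut' Y) = 6"
 hence "card (cut' (R - Y)) = 3" using d_compl[OF assms(1)] assms(2) by linarith
 thus "card (R - Y) = 1" using d3_single[of "R - Y"] by blast
qed

text \<open>Hall's condition fails for the exposed set \<open>{q1, x, q4}\<close>; the violator gives a 4-cut that
has used up the whole slack of the barrier \<open>A\<close>.\<close>
lemma hall_step:
 assumes A: "A <= R" and part: "partition_on (R - A) KK"
  and no: "ALL K:KK. ALL L:KK. K ~= L --> (ALL x:K. ALL y:L. ~ near {} x y)"
  and fc: "ALL K:KK. factor_critical (near {}) K" and cKK: "card KK + 1 = card A"
  and eq8: "(SUM K:KK. card (cut' K) - 3) + 2 * card (inner' A) + 2 * card (A Int P) = 8"
  and q: "q1 : A" "q2 : A" "q4 : A" "q1 : P" "q2 : P" "q4 : P" "q1 ~= q2" "q1 ~= q4" "q2 ~= q4"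
  and x: "x : P" "x ~: A" and nm: "~ matchable (near {}) (R - {q1, x, q4})"
 shows "EX W<=R. card (cut' W) = 4 & W Int P = {q2, x} &
   ((EX K:KK. K <= W & card (cut' K) > 3) | (EX e:inner' A. EX f:W. e : bd f))"
proof -
 have KR: "K <= R - A" "K ~= {}" if "K : KK" for K using part that by (auto simp: partition_on_def)
 have dis: "disjoint KK" using part by (simp add: partition_on_def)
 have U: "\<Union>KK = R - A" using part by (simp add: partition_on_def)
 have finA: "finite A" using A fR finite_subset by blast
 have fKK: "finite KK" using part fR by (meson finite_Diff partition_on_finite)
 have AF: "A <= F" using A R by blast
 have "x : R - A" using x P by blast
 then obtain K3 where K3: "K3 : KK" "x : K3" using U by blast
 define A' where "A' = A - {q1, q4}"
 define KK' where "KK' = KK - {K3}"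
 \<comment> \<open>\<open>q1\<close> and \<open>q4\<close> are exposed and \<open>x\<close> is taken
   out of its factor-critical part \<open>K3\<close>. The remaining \<open>A'\<close> and
   \<open>KK'\<close> are equinumerous, so only Hall's condition can fail.\<close>
 have cA': "card A' = card KK'"
 proof -
  have "card (A - {q1, q4}) = card A - card {q1, q4}" using q finA by (intro card_Diff_subset) auto
  hence "card A' = card A - 2" using q by (simp add: A'_def)
  moreover have "card KK' = card KK - 1" using K3 fKK by (simp add: KK'_def)
  ultimately show ?thesis using cKK by simp
 qed
 have "EX V<=A'. ~ card V <= card {K:KK'. EX u:V. EX y:K. near {} u y}"
 proof (rule ccontr)
  assume h: "~ ?thesis"
  have "matchable (near {}) (A' Un \<Union>KK')"
  proof (rule matchable_expand)
   show "finite A'" "finite KK'" using finA fKK by (auto simp: A'_def KK'_def)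
   show "disjoint KK'" using dis by (auto simp: KK'_def disjoint_def)
   show "A' Int \<Union>KK' = {}" using U by (auto simp: A'_def KK'_def)
   show "card A' = card KK'" by (rule cA')
   show "factor_critical (near {}) K" if "K : KK'" for K using fc that by (simp add: KK'_def)
   show "card V <= card {K:KK'. EX u:V. EX y:K. near {} u y}" if "V <= A'" for V using h that by blast
  qed
  moreover have "matchable (near {}) (K3 - {x})" using fc K3 by (auto simp: factor_critical_def)
  moreover have "(A' Un \<Union>KK') Int (K3 - {x}) = {}"
  proof -
   have "K3 Int A = {}" using KR[OF K3(1)] by blast
   moreover have "K3 Int L = {}" if "L : KK'" for L
    using dis that K3 by (auto simp: KK'_def disjoint_def)
   ultimately show ?thesis by (auto simp: A'_def)
  qed
  ultimately have m: "matchable (near {}) ((A' Un \<Union>KK') Un (K3 - {x}))" by (rule matchable_Un)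
  have "\<Union>KK = \<Union>KK' Un K3" using K3 by (auto simp: KK'_def)
  moreover have "x ~: \<Union>KK'"
  proof
   assume "x : \<Union>KK'"
   then obtain L where "L : KK" "L ~= K3" "x : L" by (auto simp: KK'_def)
   thus False using dis K3 by (auto simp: disjoint_def)
  qed
  moreover have "(A - {q1, q4} Un V) Un (K3 - {x}) = R - {q1, x, q4}"
   if "V Un K3 = R - A" "x ~: V" for V
   using that A x(2) q(1,3) K3(2) by blast
  ultimately have "(A' Un \<Union>KK') Un (K3 - {x}) = R - {q1, x, q4}"
   using U unfolding A'_def by metis
  thus False using m nm by simp
 qed
 then obtain V where V: "V <= A'" and viol: "card {K:KK'. EX u:V. EX y:K. near {} u y} < card V" by force
 define NN where "NN = insert K3 {K:KK'. EX u:V. EX y:K. near {} u y}"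
 define W where "W = V Un \<Union>NN"
 have NNK: "NN <= KK" using K3 by (auto simp: NN_def KK'_def)
 have VA: "V <= A" using V by (auto simp: A'_def)
 have fNN: "finite NN" "finite V" using NNK fKK finite_subset VA finA by blast+
 have "card NN <= card {K:KK'. EX u:V. EX y:K. near {} u y} + 1"
  using fNN(1) unfolding NN_def by (simp add: card_insert_if)
 hence cNN: "card NN <= card V" using viol by simp
 have UN: "\<Union>NN <= R - A" using NNK U by blast
 have WR: "W <= R" "W <= F" using UN VA A R by (auto simp: W_def)
 have VW: "V <= W" "V <= F" using VA AF by (auto simp: W_def)
 have "W - V = \<Union>NN" using UN VA by (auto simp: W_def)
 moreover have "disjoint NN" using NNK dis by (meson pairwise_subset)
 moreover have "{} ~: NN" using NNK KR by blast
 ultimately have pN: "partition_on (W - V) NN" by (simp add: partition_on_def)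
 have noN: "ALL K:NN. ALL L:NN. K ~= L --> (ALL x:K. ALL y:L. ~ near {} x y)" using no NNK by blast
 obtain b :: "'e set" where b: "b <= {}" and cnt: "(SUM K:NN. card (cut' K)) + 2 * card (inner' V) + 2 * card (cut' V Int cut' W)
   = 3 * card V + card (cut' W) + 2 * card b"
  using barrier_count[OF VW(2) pN VW(1) WR(2) noN] by (elim exE conjE) (rule that; assumption)
 \<comment> \<open>Edges inside \<open>A\<close> at a face of \<open>V\<close>. An edge from
   \<open>V\<close> to the outside of \<open>W\<close> leaves \<open>R\<close> or ends in
   \<open>A\<close>, because every part adjacent to \<open>V\<close> was put into
   \<open>W\<close>.\<close>
 define touch where "touch = {e:inner' A. EX f:V. e : bd f}"
 have cut_sub: "cut' V Int cut' W <= (cut' V Int cut' R) Un (touch - inner' V)"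
 proof
  fix e assume e: "e : cut' V Int cut' W"
  then obtain f where f: "f : V" "e : bd f" "e : E" using cut_iff[OF VW(2)] by blast
  have fF: "f : F" using f VW by blast
  obtain g where g: "g : F" "g ~= f" "e : bd g" "{h:F. e : bd h} = {f, g}" using other_face[OF fF f(2)] by blast
  have "g ~: V" "g ~: W" using e cut_two[OF VW(2) g(4)] cut_two[OF WR(2) g(4)] g(2) f VW by auto
  show "e : (cut' V Int cut' R) Un (touch - inner' V)"
  proof (cases "g : R")
   case False
   hence "e : cut' R" using cut_two[OF R g(4)] g(2) f VW WR by auto
   thus ?thesis using e by blast
  next
   case gR: True
   have "g : A"
   proof (rule ccontr)
    assume "g ~: A"
    then obtain L where L: "L : KK" "g : L" using gR U by blast
    have "near {} f g" using f g fF by (intro nearI[of f g e]) auto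
    hence "L : NN" using L f(1) by (auto simp: NN_def KK'_def)
    thus False using L(2) \<open>g ~: W\<close> by (auto simp: W_def)
   qed
   hence "e : inner' A" using inner_two[OF AF g(4)] g(2) f VA by auto
   moreover have "e ~: inner' V" using e inner_cut_disj[of V] by blast
   ultimately show ?thesis using f by (auto simp: touch_def)
  qed
 qed
 have inV: "inner' V <= touch"
 proof
  fix e assume e: "e : inner' V"
  hence "e : E" using inner_E by blast
  then obtain f g where fg: "f : F" "e : bd f" using two_faces by blast
  hence "f : V" using e inner_iff[OF VW(2)] by blast
  moreover have "e : inner' A" using e inner_iff[OF VW(2)] inner_iff[OF AF] VA by blast
  ultimately show "e : touch" using fg by (auto simp: touch_def)
 qed
 have ft: "finite touch" using fin_inner[of A] by (simp add: touch_def)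
 have "card (cut' V Int cut' W) <= card ((cut' V Int cut' R) Un (touch - inner' V))"
  using cut_sub fin_cut ft by (intro card_mono) auto
 also have "... <= card (cut' V Int cut' R) + card (touch - inner' V)" by (rule card_Un_le)
 also have "card (touch - inner' V) = card touch - card (inner' V)" using inV ft finite_subset by (intro card_Diff_subset) auto
 finally have c1: "card (cut' V Int cut' W) + card (inner' V) <= card (V Int P) + card touch"
  using pend[of V] VA A card_mono[OF ft inV] by simp
 have ge3: "card (cut' K) >= 3" if "K : KK" for K using d3[of K] KR[OF that] by blast
 have sN: "(SUM K:NN. card (cut' K)) = (SUM K:NN. card (cut' K) - 3) + 3 * card NN"
 proof -
  have "(SUM K:NN. card (cut' K)) = (SUM K:NN. (card (cut' K) - 3) + 3)"
   using ge3 NNK by (intro sum.cong) auto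
  thus ?thesis by (simp add: sum.distrib)
 qed
 have dW: "card (cut' W) <= (SUM K:NN. card (cut' K) - 3) + 2 * card (V Int P) + 2 * card touch"
  using cnt sN cNN c1 by linarith
 have sKK: "(SUM K:NN. card (cut' K) - 3) <= (SUM K:KK. card (cut' K) - 3)"
  using fKK NNK by (intro sum_mono2) auto
 have cT: "card touch <= card (inner' A)" using fin_inner by (intro card_mono) (auto simp: touch_def)
 have pV: "card (V Int P) + 2 + (if q2 : V then 0 else 1) <= card (A Int P)"
 proof -
  have "insert q1 (insert q4 (if q2 : V then V Int P else insert q2 (V Int P))) <= A Int P"
   using q VA by auto
  from card_mono[OF _ this] have "card (insert q1 (insert q4 (if q2 : V then V Int P else insert q2 (V Int P)))) <= card (A Int P)"
   using finA by auto
  moreover have "q1 ~: V" "q4 ~: V" using V by (auto simp: A'_def)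
  ultimately show ?thesis using q fNN(2) by (auto split: if_splits)
 qed
 have xW: "x : W" using K3 by (auto simp: W_def NN_def)
 have W3: "card (cut' W) >= 3" using d3[OF WR(1)] xW by blast
 \<comment> \<open>The budget 8 of \<open>eq8\<close> is spent here: without \<open>q2\<close> at
   least three faces of \<open>A Int P\<close> lie outside \<open>V\<close>, which leaves
   \<open>card (cut' W) <= 8 - 6\<close>. With \<open>q2\<close> in \<open>V\<close> the bound is 8
   - 4.\<close>
 have q2V: "q2 : V"
 proof (rule ccontr)
  assume "q2 ~: V"
  hence "card (V Int P) + 3 <= card (A Int P)" using pV by simp
  thus False using dW sKK cT eq8 W3 by linarith
 qed
 hence le4: "card (cut' W) <= 4" using dW sKK cT eq8 pV by simp
 have q2x: "{q2, x} <= W" "q2 ~= x" using q2V VW xW x q by auto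
 have "card (cut' W) ~= 3"
 proof
  assume "card (cut' W) = 3"
  hence "card W = 1" using d3_single[OF WR(1)] by blast
  thus False using q2x by (auto simp: card_1_singleton_iff)
 qed
 hence d4: "card (cut' W) = 4" using le4 W3 by simp
 hence "card (W Int P) <= 2" using d_pend3[OF WR(1)] by linarith
 moreover have sub: "{q2, x} <= W Int P" using q2x q x by auto
 moreover have "finite (W Int P)" using WR fR finite_subset by blast
 ultimately have WP: "W Int P = {q2, x}" using q2x(2) card_seteq[of "W Int P" "{q2, x}"] by simp
 have "V Int P <= {q2}" using WP VW VA x(2) by auto
 hence "card (V Int P) <= 1" by (metis card.empty card_insert_disjoint card_mono empty_iff finite.emptyI finite_insert One_nat_def)
 hence "(SUM K:NN. card (cut' K) - 3) + 2 * card touch >= 2" using dW d4 by linarith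
 hence "(EX K:NN. card (cut' K) - 3 ~= 0) | card touch ~= 0"
  by (metis (no_types, lifting) mult_0_right add_0_right sum.neutral zero_neq_numeral le_zero_eq)
 hence "(EX K:KK. K <= W & card (cut' K) > 3) | (EX e:inner' A. EX f:W. e : bd f)"
 proof
  assume "EX K:NN. card (cut' K) - 3 ~= 0"
  then obtain K where "K : NN" "card (cut' K) > 3" by auto
  thus ?thesis using NNK by (intro disjI1 bexI[of _ K]) (auto simp: W_def)
 next
  assume "card touch ~= 0"
  then obtain e where "e : touch" by (metis card.empty ex_in_conv)
  thus ?thesis using VW by (auto simp: touch_def)
 qed
 thus ?thesis using WR(1) d4 WP by blast
qed

text \<open>The barrier of one unmatchable triple is confronted with two others sharing
  \<open>r4\<close>. Each yields a 4-cut that uses slack of the barrier, but besides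
  \<open>r1\<close>, \<open>r2\<close>, \<open>r4\<close> only slack 2 remains. It is one edge
  between \<open>W\<close> and \<open>W'\<close>, so their union has a cut of exactly 6 and misses
  only the face \<open>r4\<close>.\<close>

lemma step:
 assumes P5: "P = {r1, r2, r3, r4, r5}" "distinct [r1, r2, r3, r4, r5]"
  and n1: "~ matchable (near {}) (R - {r1, r2, r4})"
  and n3: "~ matchable (near {}) (R - {r1, r3, r4})"
  and n4: "~ matchable (near {}) (R - {r2, r5, r4})"
 obtains W W' where "W <= R" "W' <= R" "card (cut' W) = 4" "card (cut' W') = 4"
  "W Int P = {r2, r3}" "W' Int P = {r1, r5}" "R = W Un W' Un {r4}"
proof -
 have PR: "r1 : R" "r2 : R" "r3 : R" "r4 : R" "r5 : R" using P P5 by auto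
 let ?T = "{r1, r2, r4}"
 let ?U = "R - ?T"
 have cT: "card ?T = 3" using P5(2) by auto
 have finU: "finite ?U" using fR by simp
 have cU: "card ?U + 3 = card R" using cT fR PR card_Diff_subset[of ?T R] card_mono[of R ?T] by auto
 have oddR: "odd (card R)" using cut_parity[OF R] cR by simp
 obtain A0 KK where sep: "separation (near {}) ?U A0 KK" and odd: "ALL K:KK. odd (card K) & factor_critical (near {}) K"
  and lt: "card A0 < card KK"
  using tutte[of ?U "near {}"] finU near_sym n1 by blast
 have p: "A0 <= ?U" "partition_on (?U - A0) KK"
  and no: "ALL K:KK. ALL L:KK. K ~= L --> (ALL x:K. ALL y:L. ~ near {} x y)"
  using sep unfolding separation_def by blast+
 have finA0: "finite A0" using p finU finite_subset by blast
 define A where "A = A0 Un ?T"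
 have A: "A <= R" "A <= F" using p PR R by (auto simp: A_def)
 have cA: "card A = card A0 + 3" using p finA0 cT unfolding A_def by (subst card_Un_disjoint) auto
 have eqU: "?U - A0 = R - A" by (auto simp: A_def)
 hence part: "partition_on (R - A) KK" using p by simp
 have parity: "even (card KK + card A0)"
 proof -
  have "odds KK = card KK" using odd by (simp add: odds_all)
  hence "even (card (?U - A0)) \<longleftrightarrow> even (card KK)" using card_partition_parity[OF p(2)] finU by simp
  moreover have "card (?U - A0) + card A0 = card ?U"
   using p(1) finU finA0 by (metis card_Diff_subset card_mono le_add_diff_inverse2)
  moreover have "even (card ?U)" using cU oddR by (metis even_add odd_numeral)
  ultimately show ?thesis by (metis even_add)
 qed
 have KK2: "card A0 + 2 <= card KK" using even_less[OF parity lt] .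
 obtain b :: "'e set" where b: "b <= {}" and cnt: "(SUM K:KK. card (cut' K)) + 2 * card (inner' A) + 2 * card (cut' A Int cut' R)
   = 3 * card A + card (cut' R) + 2 * card b"
  using barrier_count[OF A(2) part A(1) R no] by (elim exE conjE) (rule that; assumption)
 have finA: "finite A" using A fR finite_subset by blast
 have fKK: "finite KK" using part fR by (meson finite_Diff partition_on_finite)
 have KR: "K <= R - A" "K ~= {}" if "K : KK" for K using part that by (auto simp: partition_on_def)
 have ge3: "card (cut' K) >= 3" if "K : KK" for K using d3[of K] KR[OF that] by blast
 have sN: "(SUM K:KK. card (cut' K)) = (SUM K:KK. card (cut' K) - 3) + 3 * card KK"
 proof -
  have "(SUM K:KK. card (cut' K)) = (SUM K:KK. (card (cut' K) - 3) + 3)"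
   using ge3 by (intro sum.cong) auto
  thus ?thesis by (simp add: sum.distrib)
 qed
 have TP: "?T <= A Int P" using P5 by (auto simp: A_def)
 hence p3: "card (A Int P) >= 3" using card_mono[OF _ TP] finA cT by simp
 have cntP: "(SUM K:KK. card (cut' K) - 3) + 3 * card KK + 2 * card (inner' A) + 2 * card (A Int P) = 3 * card A + 5"
  using cnt b sN pend[OF A(1)] cR by simp
 have cKK: "card KK + 1 = card A" using cntP p3 KK2 cA by linarith
 \<comment> \<open>8 = 3 + 5, with 3 from \<open>card A = card KK + 1\<close> and 5 from
   \<open>cut' R\<close>.\<close>
 have eq8: "(SUM K:KK. card (cut' K) - 3) + 2 * card (inner' A) + 2 * card (A Int P) = 8"
  using cntP cKK by linarith
 have fc: "ALL K:KK. factor_critical (near {}) K" using odd by blast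
 have inA: "r1 : A" "r2 : A" "r4 : A" by (auto simp: A_def)
 have inP: "r1 : P" "r2 : P" "r3 : P" "r4 : P" "r5 : P" using P5 by auto
 note hs = hall_step[OF A(1) part no fc cKK eq8]
 have h3: "EX W<=R. card (cut' W) = 4 & W Int P = {r2, r3} &
   ((EX K:KK. K <= W & card (cut' K) > 3) | (EX e:inner' A. EX f:W. e : bd f))" if "r3 ~: A"
  using hs[of r1 r2 r4 r3] inA inP P5(2) that n3 by auto
 have h5: "EX W<=R. card (cut' W) = 4 & W Int P = {r1, r5} &
   ((EX K:KK. K <= W & card (cut' K) > 3) | (EX e:inner' A. EX f:W. e : bd f))" if "r5 ~: A"
  using hs[of r2 r1 r4 r5] inA inP P5(2) that n4 by auto
 have big: "(SUM K:KK. card (cut' K) - 3) >= 1" if "K : KK" "card (cut' K) > 3" for K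
  using member_le_sum[of K KK "%K. card (cut' K) - 3"] that fKK by auto
 have inn: "card (inner' A) >= 1" if "e : inner' A" for e
  using that fin_inner[of A] by (metis One_nat_def Suc_leI card_gt_0_iff empty_iff)
 \<comment> \<open>A fourth face of \<open>P\<close> in \<open>A\<close> would exhaust the budget 8;
   but \<open>r3\<close> or \<open>r5\<close> is still outside \<open>A\<close>, and its Hall
   violator needs positive slack.\<close>
 have tight: "card (A Int P) = 3"
 proof (rule ccontr)
  assume "card (A Int P) ~= 3"
  hence p4: "card (A Int P) = 4" "(SUM K:KK. card (cut' K) - 3) = 0" "card (inner' A) = 0" using p3 eq8 by auto
  have "~ (r3 : A & r5 : A)"
  proof
   assume "r3 : A & r5 : A"
   hence "A Int P = P" using inA P5 by auto
   thus False using P(2) p4 by simp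
  qed
  thus False using h3 h5 big inn p4 by (metis not_one_le_zero)
 qed
 have nA: "r3 ~: A" "r5 ~: A"
 proof -
  have "y ~: A" if y: "y = r3 | y = r5" for y
  proof
   assume "y : A"
   hence "insert y ?T <= A Int P" using y TP inP by auto
   hence "card (insert y ?T) <= card (A Int P)" using finA by (intro card_mono) auto
   moreover have "card (insert y ?T) = 4" using y P5(2) by auto
   ultimately show False using tight by simp
  qed
  thus "r3 ~: A" "r5 ~: A" by auto
 qed
 obtain W where W: "W <= R" "card (cut' W) = 4" "W Int P = {r2, r3}"
   "(EX K:KK. K <= W & card (cut' K) > 3) | (EX e:inner' A. EX f:W. e : bd f)" using h3[OF nA(1)] by (elim bexE exE conjE) (rule that; assumption)
 obtain W' where W': "W' <= R" "card (cut' W') = 4" "W' Int P = {r1, r5}"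
   "(EX K:KK. K <= W' & card (cut' K) > 3) | (EX e:inner' A. EX f:W'. e : bd f)" using h5[OF nA(2)] by (elim bexE exE conjE) (rule that; assumption)
 have WF: "W <= F" "W' <= F" "W Un W' <= R" using W(1) W'(1) R by blast+
 have "(W Un W') Int P = {r2, r3, r1, r5}" using W(3) W'(3) by (simp add: Int_Un_distrib2 insert_commute)
 hence p4: "card ((W Un W') Int P) = 4" using P5(2) by auto
 have sm: "card (cut' (W Int W')) + card (cut' (W Un W')) <= 8" using cut_submodular[OF WF(1,2)] W(2) W'(2) by simp
 \<comment> \<open>Two 4-cuts add up to 8, less than 3 for a non-empty intersection plus 6 for a
   union with four faces of \<open>P\<close>.\<close>
 have dis: "W Int W' = {}"
 proof (rule ccontr)
  assume "W Int W' ~= {}"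
  hence "card (cut' (W Int W')) >= 3" using d3[of "W Int W'"] W(1) by blast
  thus False using sm d_pend4(1)[OF WF(3) p4] by linarith
 qed
 have eq2: "(SUM K:KK. card (cut' K) - 3) + 2 * card (inner' A) = 2" using eq8 tight by simp
 \<comment> \<open>Parts are odd, so slack in a part comes in steps of 2. A part inside
   \<open>W\<close> would use it up and leave nothing for the disjoint set
   \<open>W'\<close>.\<close>
 have "~ (EX K:KK. K <= W & card (cut' K) > 3)"
 proof
  assume "EX K:KK. K <= W & card (cut' K) > 3"
  then obtain K where K: "K : KK" "K <= W" "card (cut' K) > 3" by blast
  hence "card (inner' A) = 0" using big[OF K(1,3)] eq2 by linarith
  then obtain K2 where K2: "K2 : KK" "K2 <= W'" "card (cut' K2) > 3" using W'(4) inn by fastforce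
  have "K ~= K2" using K K2 dis KR by blast
  have od: "odd (card (cut' L))" if "L : KK" for L using cut_parity[of L] odd that KR[OF that] R by auto
  have "card (cut' K) >= 5" "card (cut' K2) >= 5" using od[OF K(1)] od[OF K2(1)] K(3) K2(3) by (auto elim!: oddE)
  moreover have "(SUM L:{K, K2}. card (cut' L) - 3) <= (SUM K:KK. card (cut' K) - 3)"
   using fKK K K2 by (intro sum_mono2) auto
  ultimately show False using eq2 \<open>K ~= K2\<close> by simp
 qed
 then obtain e f where e: "e : inner' A" "f : W" "e : bd f" using W(4) by blast
 hence i1: "card (inner' A) = 1" "(SUM K:KK. card (cut' K) - 3) = 0" using inn[OF e(1)] eq2 by auto
 hence "~ (EX K:KK. K <= W' & card (cut' K) > 3)" using big by fastforce
 then obtain e' f' where e': "e' : inner' A" "f' : W'" "e' : bd f'" using W'(4) by blast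
 have "e' = e" using i1(1) e(1) e'(1) by (auto simp: card_1_singleton_iff)
 have ff: "f : F - W'" "f' : F - W" using e e' dis WF by auto
 have "e : E" using e inner_E by blast
 hence "e : cut' W Int cut' W'" using cut_iff[OF WF(1)] cut_iff[OF WF(2)] e e' ff \<open>e' = e\<close> by blast
 hence "card (cut' W Int cut' W') >= 1" using fin_cut by (metis One_nat_def Suc_leI card_gt_0_iff empty_iff finite_Int)
 moreover have "card (cut' (W Un W')) + 2 * card (cut' W Int cut' W') = 8"
 proof -
  have "cut' (W Un W') = sym_diff (cut' W) (cut' W')" using cut_Un_disj[OF WF(1,2) dis] .
  moreover have "card (sym_diff (cut' W) (cut' W')) = card (cut' W - cut' W') + card (cut' W' - cut' W)"
   using fin_cut by (intro card_Un_disjoint) auto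
  moreover have "card (cut' W) = card (cut' W - cut' W') + card (cut' W Int cut' W')"
   using fin_cut by (subst card_Un_disjoint[symmetric]) (auto intro: arg_cong[where f=card])
  moreover have "card (cut' W') = card (cut' W' - cut' W) + card (cut' W Int cut' W')"
   using fin_cut by (subst card_Un_disjoint[symmetric]) (auto intro: arg_cong[where f=card])
  ultimately show ?thesis using W(2) W'(2) by simp
 qed
 ultimately have "card (cut' (W Un W')) = 6" using d_pend4(1)[OF WF(3) p4] by linarith
 hence "card (R - (W Un W')) = 1" using d_pend4(2)[OF WF(3) p4] by blast
 moreover have "r4 : R - (W Un W')" using PR(4) inP(4) P5(2) W(3) W'(3) by auto
 ultimately have "R - (W Un W') = {r4}" by (metis card_1_singletonE singletonD)
 hence "R = W Un W' Un {r4}" using WF by blast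
 thus ?thesis using that[OF W(1) W'(1) W(2) W'(2) W(3) W'(3)] by blast
qed

text \<open>Uncrossing: the union contains three faces of \<open>P\<close> and so has a cut of at
  least 5, which leaves at most 3 for the intersection.\<close>

lemma meet_single:
 assumes Y: "Y <= R" "Y' <= R" "card (cut' Y) = 4" "card (cut' Y') = 4" and x: "x : Y" "x : Y'" and p: "card ((Y Un Y') Int P) = 3"
 shows "Y Int Y' = {x}"
proof -
 have YF: "Y <= F" "Y' <= F" "Y Un Y' <= R" using Y R by auto
 have "card (cut' (Y Un Y')) >= 5" using d_pend3[OF YF(3)] p by simp
 hence "card (cut' (Y Int Y')) <= 3" using cut_submodular[OF YF(1,2)] Y by linarith
 moreover have "card (cut' (Y Int Y')) >= 3" using d3[of "Y Int Y'"] x Y by blast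
 ultimately have "card (Y Int Y') = 1" using d3_single[of "Y Int Y'"] Y by (metis le_antisym le_infI1)
 then obtain y where "Y Int Y' = {y}" by (auto simp: card_1_singleton_iff)
 thus ?thesis using x by (metis IntI singletonD)
qed

text \<open>The five exposed triples are the rotations of one pattern under the 5-cycle of indices;
intersecting the 4-cuts of all rotations pins down every face of \<open>R\<close>.\<close>

theorem pentagon_five:
 assumes P5: "P = {r1, r2, r3, r4, r5}" "distinct [r1, r2, r3, r4, r5]"
  and n1: "~ matchable (near {}) (R - {r1, r2, r4})"
  and n2: "~ matchable (near {}) (R - {r2, r3, r5})"
  and n3: "~ matchable (near {}) (R - {r3, r4, r1})"
  and n4: "~ matchable (near {}) (R - {r4, r5, r2})"
  and n5: "~ matchable (near {}) (R - {r5, r1, r3})"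
 shows "R = P"
proof -
 have i1: "R - {r3, r4, r1} = R - {r1, r3, r4}" "R - {r4, r5, r2} = R - {r2, r5, r4}" by auto
 have i2: "R - {r4, r5, r2} = R - {r2, r4, r5}" "R - {r5, r1, r3} = R - {r3, r1, r5}" by auto
 have i5: "R - {r5, r1, r3} = R - {r5, r1, r3}" "R - {r2, r3, r5} = R - {r5, r2, r3}" "R - {r3, r4, r1} = R - {r1, r4, r3}" by auto
 have d: "distinct [r2, r3, r4, r5, r1]" "distinct [r5, r1, r2, r3, r4]" "P = {r2, r3, r4, r5, r1}" "P = {r5, r1, r2, r3, r4}"
  using P5 by auto
 obtain W1 V1 where s1: "W1 <= R" "V1 <= R" "card (cut' W1) = 4" "card (cut' V1) = 4"
  "W1 Int P = {r2, r3}" "V1 Int P = {r1, r5}" "R = W1 Un V1 Un {r4}"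
  using step[OF P5 n1 n3[unfolded i1] n4[unfolded i1]] by blast
 obtain W2 V2 where s2: "W2 <= R" "V2 <= R" "card (cut' W2) = 4" "card (cut' V2) = 4"
  "W2 Int P = {r3, r4}" "V2 Int P = {r2, r1}" "R = W2 Un V2 Un {r5}"
  using step[OF d(3,1) n2 n4[unfolded i2] n5[unfolded i2]] by blast
 obtain W5 V5 where s5: "W5 <= R" "V5 <= R" "card (cut' W5) = 4" "card (cut' V5) = 4"
  "W5 Int P = {r1, r2}" "V5 Int P = {r5, r4}" "R = W5 Un V5 Un {r3}"
  using step[OF d(4,2) n5 n2[unfolded i5] n3[unfolded i5]] by blast
 have c3: "Y Int Y' = {b}"
  if h: "Y Int P = {a, b}" "Y' Int P = {b, c}" "distinct [a, b, c]" "Y <= R" "Y' <= R" "card (cut' Y) = 4" "card (cut' Y') = 4"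
  for Y Y' a b c
 proof (rule meet_single[OF h(4-7)])
  have "(Y Un Y') Int P = {a, b, c}" using h(1,2) by (auto simp: Int_Un_distrib2)
  thus "card ((Y Un Y') Int P) = 3" using h(3) by simp
 qed (use h(1,2) in blast)+
 have sw: "W1 Int P = {r3, r2}" "V1 Int P = {r1, r5}" "V1 Int P = {r5, r1}" using s1 by (auto simp: insert_commute)
 have m1: "W1 Int W2 = {r3}" using c3[OF s1(5) s2(5) _ s1(1) s2(1) s1(3) s2(3)] P5(2) by simp
 have m2: "W1 Int V2 = {r2}" using c3[OF sw(1) s2(6) _ s1(1) s2(2) s1(3) s2(4)] P5(2) by auto
 have m3: "V1 Int W5 = {r1}" using c3[OF sw(3) s5(5) _ s1(2) s5(1) s1(4) s5(3)] P5(2) by auto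
 have m4: "V1 Int V5 = {r5}" using c3[OF sw(2) s5(6) _ s1(2) s5(2) s1(4) s5(4)] P5(2) by auto
 have n: "r5 ~: W1" "r3 ~: V1"
 proof -
  have "r5 : P" "r3 : P" using P5(1) by auto
  moreover have "r5 ~: W1 Int P" "r3 ~: V1 Int P" using s1(5,6) P5(2) by auto
  ultimately show "r5 ~: W1" "r3 ~: V1" by blast+
 qed
 \<comment> \<open>\<open>W1\<close> is covered by \<open>W2\<close>, \<open>V2\<close> and
   \<open>r5\<close>, and meets each of \<open>W2\<close> and \<open>V2\<close> in one face.
   \<open>V1\<close> is treated in the same way with \<open>W5\<close> and
   \<open>V5\<close>.\<close>
 have "W1 <= {r2, r3}" using s1(1) s2(7) m1 m2 n(1) by blast
 moreover have "V1 <= {r1, r5}" using s1(2) s5(7) m3 m4 n(2) by blast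
 ultimately have "R <= P" using s1(7) P5(1) by blast
 thus ?thesis using P by blast
qed

end

section \<open>Pairs, triples and five-cycles\<close>

lemma card_pairs: "finite L ==> card (pairs L) = card L choose 2"
 using n_subsets[of L 2] by (simp add: pairs_def)

lemma le1_if: "(n :: nat) <= 1 ==> (Q \<longleftrightarrow> n ~= 0) ==> n = (if Q then 1 else 0)"
 by auto

lemma odd_seven: "even (a :: nat) ==> 12 = a + 5 ==> False" by presburger

lemma card2_mem: "card p = 2 ==> a : p ==> EX c. c ~= a & p = {a, c}"
 by (metis card_2_iff doubleton_eq_iff empty_iff insert_iff)

lemma pairs_3_even: assumes "card t = 3" shows "even (card {p:pairs t. v : p})"
proof -
 obtain a b c where abc: "t = {a, b, c}" "a ~= b" "b ~= c" "a ~= c" using assms by (auto simp: card_3_iff)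
 have "{p:pairs t. v : p} = (if v = a then {{a,b},{a,c}} else if v = b then {{a,b},{b,c}} else if v = c then {{b,c},{a,c}} else {})"
  unfolding abc(1) pairs_3[OF abc(2,3,4)] using abc(2-4) by auto
 thus ?thesis using abc(2-4) by (auto simp: doubleton_eq_iff)
qed

text \<open>The alternative is a triangle with two vertices left over, and these would have degree
  at most 1.\<close>

lemma five_cycle:
 assumes c: "card Y = 5" and irr: "ALL x. ~ nb x x" and sym': "ALL x y. nb x y --> nb y x"
  and two: "ALL x:Y. card {y:Y. nb x y} = 2"
 obtains c0 c1 c2 c3 c4 where "Y = {c0, c1, c2, c3, c4}" "distinct [c0, c1, c2, c3, c4]"
  "nb c0 c1" "nb c1 c2" "nb c2 c3" "nb c3 c4" "nb c4 c0"
proof -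
 have fin: "finite Y" using c by (metis card.infinite zero_neq_numeral)
 have sym: "nb x y ==> nb y x" for x y using sym' by blast
 have N: "EX a b. a ~= b & a : Y & b : Y & a ~= x & b ~= x & (ALL y:Y. nb x y \<longleftrightarrow> y = a | y = b)" if x: "x : Y" for x
 proof -
  obtain a b where ab: "{y:Y. nb x y} = {a, b}" "a ~= b" using bspec[OF two x] by (auto simp: card_2_iff)
  hence i: "y : Y & nb x y \<longleftrightarrow> y = a | y = b" for y by (simp add: set_eq_iff)
  have "a ~= x" "b ~= x" using i[of x] irr by auto
  thus ?thesis using i ab(2) by (intro exI[of _ a] exI[of _ b]) metis
 qed
 have N1: "EX b. b : Y & b ~= a & b ~= x & (ALL y:Y. nb x y \<longleftrightarrow> y = a | y = b)" if x: "x : Y" "a : Y" "nb x a" for x a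
 proof -
  obtain p q where pq: "p ~= q" "p : Y" "q : Y" "p ~= x" "q ~= x" "ALL y:Y. nb x y \<longleftrightarrow> y = p | y = q"
   using N[OF x(1)] by (elim exE conjE) (rule that; assumption)
  have "a = p | a = q" using pq(6) x(2,3) by blast
  thus ?thesis
  proof
   assume "a = p" thus ?thesis using pq by (intro exI[of _ q]) auto
  next
   assume "a = q" thus ?thesis using pq by (intro exI[of _ p]) auto
  qed
 qed
 have "Y ~= {}" using c by auto
 then obtain c0 where c0: "c0 : Y" by blast
 obtain c1 c4 where c14: "c1 ~= c4" "c1 : Y" "c4 : Y" "c1 ~= c0" "c4 ~= c0"
  "ALL y:Y. nb c0 y \<longleftrightarrow> y = c1 | y = c4" using N[OF c0] by blast
 have n: "nb c1 c0" "nb c4 c0" using c14 sym by blast+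
 obtain c2 where c2: "c2 : Y" "c2 ~= c0" "c2 ~= c1" "ALL y:Y. nb c1 y \<longleftrightarrow> y = c0 | y = c2"
  using N1[OF c14(2) c0 n(1)] by blast
 obtain c3 where c3: "c3 : Y" "c3 ~= c0" "c3 ~= c4" "ALL y:Y. nb c4 y \<longleftrightarrow> y = c0 | y = c3"
  using N1[OF c14(3) c0 n(2)] by blast
 have "card (Y - {c0, c1, c4}) = 2"
  using c c14 c0 fin by (subst card_Diff_subset) auto
 then obtain p q where pq: "Y - {c0, c1, c4} = {p, q}" "p ~= q" by (auto simp: card_2_iff)
 have pY: "p : Y - {c0, c1, c4}" "q : Y - {c0, c1, c4}" using pq by blast+
 have Y: "Y = {c0, c1, c4, p, q}" using pq(1) c0 c14 by blast
 have c24: "c2 ~= c4"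
 proof
  assume e: "c2 = c4"
  hence "c3 = c1" using c2 c3 c14 sym by metis
  obtain a b where ab: "a ~= b" "a : Y" "b : Y" "a ~= p" "b ~= p" "nb p a" "nb p b" using N[of p] pY by blast
  hence "nb a p" "nb b p" using sym by blast+
  moreover have "a ~= q | b ~= q" using ab by blast
  ultimately obtain z where z: "nb z p" "z : {c0, c1, c4}" using ab Y by blast
  thus False using c14(6) c2(4) c3(4) e \<open>c3 = c1\<close> pY by auto
 qed
 have "EX p q. p ~= q & p : Y - {c0, c1, c4} & q : Y - {c0, c1, c4} & Y = {c0, c1, c4, p, q} & c2 = p"
 proof (cases "c2 = p")
  case True thus ?thesis using pq Y pY by blast
 next
  case False
  hence "c2 = q" using c2 c24 Y by blast
  moreover have "Y = {c0, c1, c4, q, p}" using Y by blast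
  ultimately show ?thesis using pq(2) pY by blast
 qed
 then obtain q where q: "c2 ~= q" "c2 : Y - {c0, c1, c4}" "q : Y - {c0, c1, c4}" "Y = {c0, c1, c4, c2, q}" by blast
 have "nb c2 c1" using c2 sym by blast
 then obtain d where d: "d : Y" "d ~= c1" "d ~= c2" "ALL y:Y. nb c2 y \<longleftrightarrow> y = c1 | y = d"
  using N1[of c2 c1] c2 c14 by blast
 have "d ~= c0" using d c14(6) sym q by (metis DiffD2 insertCI)
 have "d ~= c4"
 proof
  assume e: "d = c4"
  obtain z where z: "z : Y" "z ~= q" "nb q z" using N[of q] q(3) by blast
  hence "nb z q" using sym by blast
  moreover have "z = c0 | z = c1 | z = c4 | z = c2" using z q(4) by blast
  moreover have "c3 = c2" using e d c3 sym c2 c14 by metis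
  ultimately show False using c14(6) c2(4) c3(4) d(4) e q by auto
 qed
 hence dq: "d = q" using d \<open>d ~= c0\<close> q(4) by blast
 have "nb q c2" using d dq sym by blast
 then obtain z where z: "z : Y" "z ~= c2" "z ~= q" "nb q z" using N1[of q c2] q by blast
 have "z ~= c0" "z ~= c1" using z(4) sym c14(6) c2(4) q by blast+
 hence "z = c4" using z q(4) by blast
 hence "nb q c4" using z by blast
 moreover have "nb c2 q" using d dq by blast
 moreover have "Y = {c0, c1, c2, q, c4}" using q(4) by blast
 moreover have "distinct [c0, c1, c2, q, c4]" using c14 c2 q by auto
 moreover have "nb c0 c1" "nb c1 c2" using c14 c2 by blast+
 ultimately show ?thesis using that n(2) by blast
qed

context tight
begin

lemma lab_inj:
 assumes "f : F" "g : F" "lab f = lab g" "card F > 2" shows "f = g"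
proof (rule ccontr)
 assume ne: "f ~= g"
 have "en ` bd f = en ` bd g" using lab_pairs(2)[OF assms(1)] lab_pairs(2)[OF assms(2)] assms(3) by simp
 hence b: "bd f = bd g" using inj_on_image_eq_iff[OF simple bdE[OF assms(1)] bdE[OF assms(2)]] by simp
 have "cut' ({f} Un {g}) = sym_diff (bd f) (bd g)"
  using cut_Un_disj[of "{f}" "{g}"] ne assms(1,2) cut_single[OF assms(1)] cut_single[OF assms(2)] by simp
 moreover have "{f} Un {g} = {f, g}" by blast
 ultimately have "cut' {f, g} = {}" using b by auto
 hence "{f, g} = F" using conn[rule_format, of "{f, g}"] assms(1,2) by blast
 thus False using assms(4) ne by auto
qed

lemma edge_lab: "f : F ==> e : bd f ==> en e <= lab f" by (auto simp: lab_def)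

lemma lab_union:
 assumes "f : F" "e : bd f" "e' : bd f" "e ~= e'" shows "lab f = en e Un en e'"
proof -
 have E: "e : E" "e' : E" using assms bdE by blast+
 hence ne: "en e ~= en e'" using inj_onD[OF simple] assms by blast
 have fl: "finite (lab f)" using lab_pairs(1)[OF assms(1)] by (metis card.infinite zero_neq_numeral)
 have sub: "en e Un en e' <= lab f" using edge_lab assms by blast
 have "card (en e) = 2" "card (en e') = 2" using no_loop E by auto
 have "card (en e Un en e') >= 3"
 proof (rule ccontr)
  assume "~ 3 <= card (en e Un en e')"
  hence l: "card (en e Un en e') <= 2" by simp
  have fu: "finite (en e Un en e')" using sub fl finite_subset by blast
  have "en e = en e Un en e'" using l fu no_loop[OF E(1)] by (intro card_seteq) auto
  moreover have "en e' = en e Un en e'" using l fu no_loop[OF E(2)] by (intro card_seteq) auto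
  ultimately show False using ne by simp
 qed
 hence "en e Un en e' = lab f" using sub fl lab_pairs(1)[OF assms(1)] by (intro card_seteq) auto
 thus ?thesis by simp
qed

lemma share_one:
 assumes "f : F" "g : F" "f ~= g" "card F > 2" "e : bd f" "e : bd g" "e' : bd f" "e' : bd g"
 shows "e = e'"
proof (rule ccontr)
 assume "e ~= e'"
 hence "lab f = lab g" using lab_union[OF assms(1,5,7)] lab_union[OF assms(2,6,8)] by simp
 thus False using lab_inj[OF assms(1,2) _ assms(4)] assms(3) by blast
qed

lemma card_E: "2 * card E = 3 * card F"
proof -
 have "inner' F = E" using inner_iff[of F] by blast
 thus ?thesis using cubic_count[of F] cut_F by simp
qed

lemma en_pairs: "en e : pairs L \<longleftrightarrow> en e <= L" if "e : E"
 using no_loop[OF that] by (simp add: pairs_def)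

lemma k6_singletons:
 assumes F10: "card F = 10" and L: "card L = 6" "!!f. f : F ==> lab f <= L"
 shows "k6_structure F E bd en L ((%f. {f}) ` F)"
proof -
 have fL: "finite L" using L(1) by (metis card.infinite zero_neq_numeral)
 have c15: "card (pairs L) = 15" using card_pairs[OF fL] L(1) by (simp add: numeral_eq_Suc)
 have E15: "card E = 15" using card_E F10 by simp
 have sub: "en ` E <= pairs L"
 proof
  fix p assume "p : en ` E"
  then obtain e where e: "e : E" "p = en e" by blast
  obtain f where f: "f : F" "e : bd f" using two_faces[OF e(1)] by blast
  thus "p : pairs L" using e en_pairs[OF e(1)] edge_lab L(2) by blast
 qed
 have "card (en ` E) = 15" using card_image[OF simple] E15 by simp
 hence "en ` E = pairs L" using sub c15 fL by (intro card_seteq) (auto simp: pairs_def)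
 hence bij: "bij_betw en E (pairs L)" using simple by (simp add: bij_betw_def)
 have cs: "cut' {f} = bd f" if "f : F" for f using cut_single[OF that] .
 have U: "(UN X:(%f. {f}) ` F. cut' X) = E"
 proof
  show "(UN X:(%f. {f}) ` F. cut' X) <= E" using cut_E by blast
  show "E <= (UN X:(%f. {f}) ` F. cut' X)"
  proof
   fix e assume "e : E"
   then obtain f where "f : F" "e : bd f" using two_faces by blast
   thus "e : (UN X:(%f. {f}) ` F. cut' X)" using cs by auto
  qed
 qed
 have part: "partition_on F ((%f. {f}) ` F)" by (rule partition_onI) (auto simp: disjnt_def)
 have "EX t<=L. card t = 3 & en ` cut' X = pairs t" if X: "X : (%f. {f}) ` F" for X
 proof -
  obtain f where f: "f : F" "X = {f}" using X by blast
  thus ?thesis using lab_pairs[OF f(1)] L(2)[OF f(1)] cs[OF f(1)] by (intro exI[of _ "lab f"]) simp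
 qed
 thus ?thesis unfolding k6_structure_def U using L(1) part bij by blast
qed

end

section \<open>Bands of five faces\<close>

text \<open>Modelled on the five faces of K6 that avoid one vertex. Five faces with five boundary
  edges have ten edges, exactly the number of pairs of labels, so every pair of labels is an edge of
  the band.\<close>

locale band = tight F E bd en for F :: "'f set" and E :: "'e set" and bd and en :: "'e => 'v set" +
 fixes Y :: "'f set" and L5 :: "'v set"
 assumes Y: "Y <= F" "card Y = 5" and cY: "card (cut E bd Y) = 5" and L5: "card L5 = 5"
  and labY: "f : Y ==> (UN e:bd f. en e) <= L5"
begin

lemma labY': "f : Y ==> lab f <= L5" using labY by (simp add: lab_def)
lemma YF: "f : Y ==> f : F" using Y by blast
lemma fin5: "finite L5" using L5 by (metis card.infinite zero_neq_numeral)
lemma finY: "finite Y" using fin_sub[OF Y(1)] .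

definition EE where "EE = inner' Y Un cut' Y"

lemma EE_iff: "e : EE \<longleftrightarrow> (EX f:Y. e : bd f)"
proof
 assume "e : EE"
 hence e: "e : inner' Y | e : cut' Y" by (simp add: EE_def)
 hence "e : E" using inner_E cut_E by blast
 then obtain f where "f : F" "e : bd f" using two_faces by blast
 thus "EX f:Y. e : bd f" using e inner_iff[OF Y(1)] cut_iff[OF Y(1)] by blast
next
 assume "EX f:Y. e : bd f"
 then obtain f where f: "f : Y" "e : bd f" by blast
 hence "e : E" using YF bdE by blast
 hence "e : inner' Y | e : cut' Y | e : inner' (F - Y)" using edge_cases[OF Y(1)] by blast
 moreover have "e ~: inner' (F - Y)" using inner_iff[of "F - Y"] f YF by blast
 ultimately show "e : EE" by (auto simp: EE_def)
qed

lemma EE_E: "EE <= E" using inner_E cut_E by (auto simp: EE_def)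

lemma card_EE: "card (inner' Y) = 5" "card EE = 10"
proof -
 show i: "card (inner' Y) = 5" using cubic_count[OF Y(1)] Y(2) cY by simp
 show "card EE = 10" unfolding EE_def
  using i cY fin_inner fin_cut inner_cut_disj by (subst card_Un_disjoint) auto
qed

lemma en_EE: "en ` EE = pairs L5"
proof -
 have "en ` EE <= pairs L5"
 proof
  fix p assume "p : en ` EE"
  then obtain e f where e: "p = en e" "f : Y" "e : bd f" using EE_iff by blast
  thus "p : pairs L5" using en_pairs[of e] bdE YF edge_lab[of f e] labY'[of f] by blast
 qed
 moreover have "card (en ` EE) = 10" using card_image[OF inj_on_subset[OF simple EE_E]] card_EE by simp
 moreover have "card (pairs L5) = 10" using card_pairs[OF fin5] L5 by (simp add: numeral_eq_Suc)
 ultimately show ?thesis using fin5 by (intro card_seteq) (auto simp: pairs_def)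
qed

lemma EE_lab: "e : EE \<longleftrightarrow> en e <= L5" if "e : E"
proof
 assume "e : EE" thus "en e <= L5" using en_EE by (auto simp: pairs_def)
next
 assume "en e <= L5"
 hence "en e : en ` EE" using en_EE en_pairs[OF that] by blast
 then obtain e' where "e' : EE" "en e = en e'" by blast
 thus "e : EE" using inj_onD[OF simple, of e e'] that EE_E by auto
qed

lemma out_cut: "r : F - Y ==> e : bd r ==> e : EE ==> e : cut' Y"
 using EE_iff[of e] cut_iff[OF Y(1), of e] bdE[of r] by blast

lemma F_big: "card F > 2" "F - Y ~= {}"
proof -
 have "5 <= card F" using card_mono[OF finF Y(1)] Y(2) by simp
 thus "card F > 2" by simp
 have "Y ~= F" using cY cut_F by auto
 thus "F - Y ~= {}" using Y(1) by blast
qed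

text \<open>The boundary degrees are even and add up to 10. Degree 4 at one label would make every
  other label a boundary neighbour of degree at least 2, a total of 12. So no degree exceeds 2, and
  the sum makes all of them equal to 2.\<close>

lemma deg_pend: assumes b: "b : L5" shows "card {e:cut' Y. b : en e} = 2"
proof -
 define d where "d a = card {e:cut' Y. a : en e}" for a
 have ev: "even (d a)" for a using closed_cut[OF Y(1)] by (simp add: closed_def d_def)
 have "(SUM a:L5. d a) = (SUM e:cut' Y. card {a:L5. a : en e})"
  unfolding d_def using even_sum_card[OF fin5 fin_cut[of Y], of "%a e. a : en e"] by simp
 also have "... = (SUM e:cut' Y. 2)"
 proof (rule sum.cong[OF refl])
  fix e assume e: "e : cut' Y"
  hence "e : EE" "e : E" using cut_E by (auto simp: EE_def)
  hence "en e <= L5" using EE_lab by blast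
  hence "{a:L5. a : en e} = en e" by blast
  thus "card {a:L5. a : en e} = 2" using no_loop \<open>e : E\<close> by simp
 qed
 finally have s: "(SUM a:L5. d a) = 10" using cY by simp
 have le2: "d a <= 2" if a: "a : L5" for a
 proof (rule ccontr)
  assume "~ d a <= 2"
  hence d4: "d a >= 4" using ev[of a] by presburger
  have inj: "inj_on en {e:cut' Y. a : en e}" using simple by (rule inj_on_subset) (use cut_E in blast)
  have c4: "card ((%c. {a, c}) ` (L5 - {a})) = 4"
  proof -
   have "inj_on (%c. {a, c}) (L5 - {a})" by (auto simp: inj_on_def doubleton_eq_iff)
   thus ?thesis using card_image[of "%c. {a, c}" "L5 - {a}"] a L5 fin5 by simp
  qed
  have sub: "en ` {e:cut' Y. a : en e} <= (%c. {a, c}) ` (L5 - {a})"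
  proof
   fix p assume "p : en ` {e:cut' Y. a : en e}"
   then obtain e where e: "p = en e" "e : cut' Y" "a : en e" by blast
   hence eE: "e : E" "en e <= L5" using cut_E[of Y] EE_lab[of e] by (auto simp: EE_def)
   obtain c where "c ~= a" "en e = {a, c}" using card2_mem[OF no_loop[OF eE(1)] e(3)] by blast
   thus "p : (%c. {a, c}) ` (L5 - {a})" using e eE by auto
  qed
  have eq: "en ` {e:cut' Y. a : en e} = (%c. {a, c}) ` (L5 - {a})"
   using sub c4 d4 card_image[OF inj] fin5 unfolding d_def by (intro card_seteq) auto
  have "d c >= 2" if c: "c : L5 - {a}" for c
  proof -
   have "{a, c} : en ` {e:cut' Y. a : en e}" using eq c by blast
   then obtain e where "e : cut' Y" "en e = {a, c}" by auto
   hence "{e:cut' Y. c : en e} ~= {}" by blast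
   hence "d c ~= 0" using fin_cut[of Y] by (simp add: d_def)
   thus ?thesis using ev[of c] by presburger
  qed
  hence "(SUM c:L5 - {a}. d c) >= (SUM c:L5 - {a}. 2)" by (intro sum_mono) auto
  hence "(SUM c:L5 - {a}. d c) >= 8" using a L5 fin5 by simp
  thus False using s d4 sum.remove[OF fin5 a, of d] by simp
 qed
 have "d b = 2"
 proof (rule ccontr)
  assume "d b ~= 2"
  hence "d b = 0" using le2[OF b] ev[of b] by presburger
  hence "(SUM a:L5. d a) = (SUM a:L5 - {b}. d a)" using sum.remove[OF fin5 b, of d] by simp
  also have "... <= (SUM a:L5 - {b}. 2)" using le2 by (intro sum_mono) auto
  also have "... = 8" using b L5 fin5 by simp
  finally show False using s by simp
 qed
 thus ?thesis by (simp add: d_def)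
qed

lemma deg_inner: assumes b: "b : L5" shows "card {e:inner' Y. b : en e} = 2"
proof -
 have "{e:EE. b : en e} = {e:inner' Y. b : en e} Un {e:cut' Y. b : en e}" by (auto simp: EE_def)
 moreover have "card ... = card {e:inner' Y. b : en e} + card {e:cut' Y. b : en e}"
  using fin_inner[of Y] fin_cut[of Y] inner_cut_disj[of Y] by (intro card_Un_disjoint) auto
 moreover have "card {e:EE. b : en e} = 4"
 proof -
  have "en ` {e:EE. b : en e} = {p:pairs L5. b : p}" using en_EE by auto
  moreover have "inj_on en {e:EE. b : en e}" using simple by (rule inj_on_subset) (use EE_E in blast)
  moreover have "{p:pairs L5. b : p} = (%c. {b, c}) ` (L5 - {b})"
  proof
   show "{p:pairs L5. b : p} <= (%c. {b, c}) ` (L5 - {b})"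
   proof
    fix p assume "p : {p:pairs L5. b : p}"
    hence p: "p <= L5" "card p = 2" "b : p" by (auto simp: pairs_def)
    then obtain c where "c ~= b" "p = {b, c}" using card2_mem[OF p(2,3)] by blast
    thus "p : (%c. {b, c}) ` (L5 - {b})" using p by auto
   qed
  qed (use b in \<open>auto simp: pairs_def\<close>)
  moreover have "inj_on (%c. {b, c}) (L5 - {b})" by (auto simp: inj_on_def doubleton_eq_iff)
  ultimately show ?thesis using card_image[of en "{e:EE. b : en e}"] card_image[of "%c. {b, c}" "L5 - {b}"] b L5 fin5 by simp
 qed
 ultimately show ?thesis using deg_pend[OF b] by simp
qed

text \<open>Two boundary edges of \<open>f\<close> share a label \<open>b\<close> and use up its
  boundary degree. The two inner edges at \<open>b\<close> must then occur together in both faces at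
  \<open>i1\<close>, but distinct faces share at most one edge.\<close>

lemma pend_le1: assumes f: "f : Y" shows "card (cut' Y Int bd f) <= 1"
proof (rule ccontr)
 assume "~ ?thesis"
 have fF: "f : F" using f YF by blast
 then obtain p1 p2 where p: "p1 : cut' Y Int bd f" "p2 : cut' Y Int bd f" "p1 ~= p2"
  using \<open>~ card (cut' Y Int bd f) <= 1\<close> fin_bd[OF fF] card_le_Suc0_iff_eq[of "cut' Y Int bd f"] by auto
 have pE: "p1 : E" "p2 : E" using p cut_E by blast+
 have "lab f = en p1 Un en p2" using lab_union[of f p1 p2] fF p by blast
 hence "card (en p1 Int en p2) = 1"
  using card_Un_Int[of "en p1" "en p2"] no_loop pE fin_en lab_pairs(1)[OF fF] by simp
 then obtain b where b: "en p1 Int en p2 = {b}" by (auto simp: card_1_singleton_iff)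
 have "p1 : EE" using p by (simp add: EE_def)
 hence bL: "b : L5" using EE_lab[OF pE(1)] b by blast
 have bp: "b : en p1" "b : en p2" using b by blast+
 have pp: "{p1, p2} = {e:cut' Y. b : en e}"
 proof (rule card_seteq)
  show "finite {e:cut' Y. b : en e}" using fin_cut[of Y] by simp
  show "{p1, p2} <= {e:cut' Y. b : en e}" using p bp by blast
  show "card {e:cut' Y. b : en e} <= card {p1, p2}" using deg_pend[OF bL] p(3) by simp
 qed
 obtain i1 i2 where i: "{e:inner' Y. b : en e} = {i1, i2}" "i1 ~= i2" using deg_inner[OF bL] by (auto simp: card_2_iff)
 have "i1 : {e:inner' Y. b : en e}" using i by simp
 hence i': "i1 : inner' Y" "b : en i1" by auto
 have bE: "e = p1 | e = p2 | e = i1 | e = i2" if "e : EE" "b : en e" for e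
 proof -
  have "e : {e:cut' Y. b : en e} | e : {e:inner' Y. b : en e}" using that by (auto simp: EE_def)
  thus ?thesis using pp[symmetric] i(1) by simp
 qed
 obtain g h where gh: "g : F" "h : F" "g ~= h" "i1 : bd g" "i1 : bd h" using two_faces[OF subsetD[OF inner_E i'(1)]] by metis
 hence ghY: "g : Y" "h : Y" using i' inner_iff[OF Y(1)] by blast+
 have both: "i2 : bd k" if k: "k : Y" "i1 : bd k" for k
 proof -
  have kF: "k : F" using k YF by blast
  have "EX e:bd k. e ~= i1 & b : en e"
  proof (rule ccontr)
   assume "~ ?thesis"
   hence "{e:bd k. b : en e} = {i1}" using k i' by blast
   hence "card {e:bd k. b : en e} = 1" by simp
   thus False using closed_bd[OF kF, of b] by simp
  qed
  then obtain e where e: "e : bd k" "e ~= i1" "b : en e" by blast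
  have "e : EE" using EE_iff e k by blast
  moreover have "e ~= p1 & e ~= p2"
  proof (rule ccontr)
   assume a: "~ ?thesis"
   hence ep: "e : cut' Y" "e : bd f" using p by auto
   obtain g' where g': "g' ~= f" "{h:F. e : bd h} = {f, g'}" using other_face[OF fF ep(2)] by blast
   have "g' ~: Y" using cut_two[OF Y(1) g'(2)] g'(1) ep(1) f by auto
   moreover have "k : {h:F. e : bd h}" using kF e by blast
   ultimately have "k = f" using g' k by auto
   hence "i1 : bd f" using k by blast
   have "i1 ~= p1" "i1 ~= p2" using i' p inner_cut_disj[of Y] by blast+
   hence "{p1, p2, i1} <= {e:bd f. b : en e}" using p bp i' \<open>i1 : bd f\<close> by blast
   moreover have "card {p1, p2, i1} = 3" using p(3) \<open>i1 ~= p1\<close> \<open>i1 ~= p2\<close> by auto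
   moreover have "card {e:bd f. b : en e} <= 3" using cubic[OF fF] fin_bd[OF fF] card_mono[of "bd f" "{e:bd f. b : en e}"] by auto
   ultimately have "card {e:bd f. b : en e} = 3" using card_mono[of "{e:bd f. b : en e}" "{p1, p2, i1}"] fin_bd[OF fF] by auto
   thus False using closed_bd[OF fF, of b] by simp
  qed
  ultimately show ?thesis using bE e by blast
 qed
 show False using share_one[OF gh(1,2,3) F_big(1) gh(4,5)] both[OF ghY(1) gh(4)] both[OF ghY(2) gh(5)] i(2) by blast
qed

lemma pend1: assumes f: "f : Y" shows "card (cut' Y Int bd f) = 1"
proof (rule ccontr)
 assume n: "card (cut' Y Int bd f) ~= 1"
 have "cut' Y Int inner' Y = {}" using inner_cut_disj by blast
 hence s: "(SUM f:Y. card (cut' Y Int bd f)) = 5" using handshake[OF Y(1) cut_E[of Y]] cY by simp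
 have "(SUM g:Y. card (cut' Y Int bd g)) < (SUM g:Y. 1)"
  using finY f n pend_le1 by (intro sum_strict_mono_ex1) (auto intro!: bexI[of _ f] simp: le_less)
 thus False using s Y(2) by simp
qed

definition nb where "nb x y \<longleftrightarrow> x ~= y & (EX e. e : bd x & e : bd y)"

lemma nb2: assumes x: "x : Y" shows "card {y:Y. nb x y} = 2"
proof -
 have xF: "x : F" using x YF by blast
 define I where "I = bd x - cut' Y"
 have cI: "card I = 2"
 proof -
  have "card (bd x - cut' Y) = card (bd x) - card (bd x Int cut' Y)" using fin_bd[OF xF] by (intro card_Diff_subset_Int) auto
  thus ?thesis using pend1[OF x] cubic[OF xF] by (simp add: I_def Int_commute)
 qed
 have oth: "EX y:Y. y ~= x & e : bd y" if e: "e : I" for e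
 proof -
  have eb: "e : bd x" "e ~: cut' Y" using e by (auto simp: I_def)
  obtain y where y: "y : F" "y ~= x" "e : bd y" "{h:F. e : bd h} = {x, y}" using other_face[OF xF eb(1)] by blast
  have "y : Y" using cut_two[OF Y(1) y(4)] y(2) eb(2) x by auto
  thus ?thesis using y by blast
 qed
 then obtain o1 where o1: "!!e. e : I ==> o1 e : Y & o1 e ~= x & e : bd (o1 e)" by metis
 have "inj_on o1 I"
 proof (rule inj_onI)
  fix e e' assume e: "e : I" "e' : I" "o1 e = o1 e'"
  have "o1 e : F" "x ~= o1 e" "e : bd (o1 e)" "e' : bd (o1 e)" using o1[OF e(1)] o1[OF e(2)] e(3) YF by auto
  thus "e = e'" using share_one[OF xF, of "o1 e" e e'] F_big e by (auto simp: I_def)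
 qed
 moreover have "o1 ` I = {y:Y. nb x y}"
 proof
  show "o1 ` I <= {y:Y. nb x y}"
  proof
   fix y assume "y : o1 ` I"
   then obtain e where e: "e : I" "y = o1 e" by blast
   thus "y : {y:Y. nb x y}" using o1[OF e(1)] unfolding nb_def I_def by blast
  qed
  show "{y:Y. nb x y} <= o1 ` I"
  proof
   fix y assume "y : {y:Y. nb x y}"
   then obtain e where e: "y : Y" "y ~= x" "e : bd x" "e : bd y" by (auto simp: nb_def)
   have yF: "y : F" using e YF by blast
   obtain z where z: "{h:F. e : bd h} = {x, z}" "z ~= x" using other_face[OF xF e(3)] by blast
   have "y : {h:F. e : bd h}" using yF e by blast
   hence yz: "y = z" using z e by auto
   hence "e ~: cut' Y" using cut_two[OF Y(1) z(1)] z(2) x e by auto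
   hence eI: "e : I" using e by (simp add: I_def)
   have "o1 e : {h:F. e : bd h}" using o1[OF eI] YF by blast
   hence "o1 e = y" using o1[OF eI] z yz by auto
   thus "y : o1 ` I" using eI by blast
  qed
 qed
 ultimately show ?thesis using card_image[of o1 I] cI by simp
qed

definition "R = F - Y"

lemma R_F: "R <= F" by (auto simp: R_def)
lemma cut_R: "cut' R = cut' Y" unfolding R_def using cut_compl[OF Y(1)] .

text \<open>Two boundary edges determine all labels of \<open>r\<close>, so its third edge also
  joins labels of the band and lies in the cut. Adding \<open>r\<close> to the band would leave a
  cut of size 2.\<close>

lemma R_le1: assumes r: "r : R" shows "card (cut' R Int bd r) <= 1"
proof (rule ccontr)
 assume "~ ?thesis"
 have rF: "r : F" "r : F - Y" using r by (auto simp: R_def)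
 obtain p1 p2 where p: "p1 : cut' Y Int bd r" "p2 : cut' Y Int bd r" "p1 ~= p2"
  using \<open>~ card (cut' R Int bd r) <= 1\<close> fin_bd[OF rF(1)] card_le_Suc0_iff_eq[of "cut' R Int bd r"] cut_R by auto
 have "lab r = en p1 Un en p2" using lab_union[of r p1 p2] rF p by blast
 moreover have "en p1 <= L5" "en p2 <= L5" using p EE_lab cut_E by (auto simp: EE_def)
 ultimately have "lab r <= L5" by blast
 have sub: "bd r <= cut' Y"
 proof
  fix e assume e: "e : bd r"
  hence "en e <= L5" using \<open>lab r <= L5\<close> edge_lab rF by blast
  hence "e : EE" using EE_lab e bdE rF by blast
  thus "e : cut' Y" using out_cut rF e by blast
 qed
 have "cut' (Y Un {r}) = sym_diff (cut' Y) (bd r)" using cut_Un_disj[of Y "{r}"] rF Y cut_single by auto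
 also have "... = cut' Y - bd r" using sub by blast
 finally have c: "cut' (Y Un {r}) = cut' Y - bd r" .
 have c2: "card (cut' (Y Un {r})) = 2" unfolding c using sub cY cubic rF fin_bd by (simp add: card_Diff_subset)
 have "Y Un {r} ~= F" using c2 cut_F by auto
 hence "card (cut' (Y Un {r})) >= 3" using rF Y by (intro cut_ge3) auto
 thus False using c2 by simp
qed

definition "P = {r:R. cut' R Int bd r ~= {}}"

lemma P1: "f : R ==> card (cut' R Int bd f) = (if f : P then 1 else 0)"
proof -
 assume f: "f : R"
 have "finite (cut' R Int bd f)" using fin_cut by blast
 hence "cut' R Int bd f ~= {} \<longleftrightarrow> card (cut' R Int bd f) ~= 0" by simp
 moreover have "f : P \<longleftrightarrow> cut' R Int bd f ~= {}" using f by (simp add: P_def)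
 ultimately show ?thesis using le1_if[OF R_le1[OF f]] by blast
qed

lemma card_P: "card P = 5"
proof -
 have "cut' R Int inner' R = {}" using inner_cut_disj by blast
 hence "(SUM f:R. card (cut' R Int bd f)) = 5" using handshake[OF R_F cut_E[of R]] cut_R cY by simp
 moreover have "(SUM f:R. card (cut' R Int bd f)) = (SUM f:R. if f : P then 1 else 0)"
  using P1 by (intro sum.cong) auto
 moreover have "... = card (R Int P)" using fin_sub[OF R_F] by (simp add: sum.If_cases Int_def)
 moreover have "R Int P = P" by (auto simp: P_def)
 ultimately show ?thesis by simp
qed

lemma FR: "F - R = Y" using Y by (auto simp: R_def)

lemma pentagon: "pentagon F E bd en R P"
proof
 show "R <= F" by (rule R_F)
 show "2 <= card (F - R)" using FR Y by simp
 show "card (cut' R) = 5" using cut_R cY by simp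
 show "P <= R" by (auto simp: P_def)
 show "card P = 5" by (rule card_P)
qed (rule P1)

definition pe where "pe x = (THE e. e : cut' Y Int bd x)"
definition rho where "rho x = (THE r. r : R & pe x : bd r)"

lemma pe: assumes x: "x : Y" shows "cut' Y Int bd x = {pe x}"
proof -
 obtain e where e: "cut' Y Int bd x = {e}" using pend1[OF x] by (auto simp: card_1_singleton_iff)
 hence "pe x = e" by (simp add: pe_def)
 thus ?thesis using e by simp
qed

lemma pe': "x : Y ==> pe x : cut' Y" "x : Y ==> pe x : bd x" using pe by blast+

lemma rho: assumes x: "x : Y" shows "{h:F. pe x : bd h} = {x, rho x}" "rho x : R" "pe x : bd (rho x)"
proof -
 obtain y where y: "{h:F. pe x : bd h} = {x, y}" "y ~= x" "y : F" "pe x : bd y"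
  using other_face[OF YF[OF x] pe'(2)[OF x]] by blast
 have yR: "y : R" using cut_two[OF Y(1) y(1)] y(2,3) pe'(1)[OF x] x by (auto simp: R_def)
 have "rho x = y" unfolding rho_def
 proof (rule the_equality)
  fix r assume r: "r : R & pe x : bd r"
  hence "r : {h:F. pe x : bd h}" using R_F by blast
  thus "r = y" using y(1) r x by (auto simp: R_def)
 qed (use yR y in blast)
 thus "{h:F. pe x : bd h} = {x, rho x}" "rho x : R" "pe x : bd (rho x)" using y yR by auto
qed

lemma rho_P: "rho ` Y = P"
proof
 show "rho ` Y <= P"
 proof
  fix r assume "r : rho ` Y"
  then obtain x where "x : Y" "r = rho x" by blast
  thus "r : P" using rho[of x] pe'(1)[of x] cut_R by (auto simp: P_def)
 qed
 show "P <= rho ` Y"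
 proof
  fix r assume r: "r : P"
  then obtain e where e: "e : cut' Y" "e : bd r" "r : R" using cut_R by (auto simp: P_def)
  then obtain x where x: "x : Y" "e : bd x" using cut_iff[OF Y(1)] by blast
  hence "e = pe x" using pe[OF x(1)] e by blast
  hence "r : {h:F. pe x : bd h}" using e R_F by blast
  hence "r = rho x" using rho(1)[OF x(1)] e(3) x by (auto simp: R_def)
  thus "r : rho ` Y" using x by blast
 qed
qed

lemma rho_inj: "inj_on rho Y"
 using rho_P card_P Y(2) finY by (intro eq_card_imp_inj_on) auto

lemma pe_inj: assumes "x : Y" "y : Y" "pe x = pe y" shows "x = y"
proof -
 have "{x, rho x} = {y, rho y}" using rho(1)[OF assms(1)] rho(1)[OF assms(2)] assms(3) by simp
 moreover have "rho y ~: Y" using rho(2)[OF assms(2)] by (simp add: R_def)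
 ultimately show ?thesis using assms by auto
qed

text \<open>A matching exposing these three faces extends over the band; summing its intersections with all
triples of \<open>L5\<close> that bound no face gives an odd number, although each of them is even.\<close>

lemma forbid:
 assumes Yx: "Y = {x1, x2, x3, u, w}" "distinct [x1, x2, x3, u, w]" and nb: "nb u w"
 shows "~ matchable (near {}) (R - {rho x1, rho x2, rho x3})"
proof
 assume m: "matchable (near {}) (R - {rho x1, rho x2, rho x3})"
 define U where "U = R - {rho x1, rho x2, rho x3}"
 have UF: "U <= F" "U <= R" using R_F by (auto simp: U_def)
 obtain m where m: "m <= E" "ALL f:U. card (m Int bd f) = 1" "ALL f:F - U. m Int bd f = {}"
  using matchable_edges[OF m[folded U_def] UF(1)] by auto
 obtain ee where ee: "ee : bd u" "ee : bd w" using nb by (auto simp: nb_def)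
 have xY: "x1 : Y" "x2 : Y" "x3 : Y" "u : Y" "w : Y" using Yx by auto
 have uw: "u : F" "w : F" "u ~= w" using xY YF Yx(2) by auto
 have fee: "{h:F. ee : bd h} = {u, w}"
 proof -
  obtain z where z: "{h:F. ee : bd h} = {u, z}" using other_face[OF uw(1) ee(1)] by blast
  moreover have "w : {h:F. ee : bd h}" using uw ee by blast
  ultimately show ?thesis using uw by auto
 qed
 \<comment> \<open>The exposed faces are matched across the boundary to \<open>x1\<close>,
   \<open>x2\<close>, \<open>x3\<close>, and the adjacent band faces \<open>u\<close> and
   \<open>w\<close> to each other.\<close>
 define S where "S = {pe x1, pe x2, pe x3, ee}"
 define M where "M = m Un S"
 have eeC: "ee ~: cut' Y" using cut_two[OF Y(1) fee uw(3)] xY by simp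
 have SE: "S <= EE" using xY ee pe' EE_iff unfolding S_def by blast
 have in_pe: "pe x : bd f \<longleftrightarrow> f = x | f = rho x" if "x : Y" "f : F" for x f
  using rho(1)[OF that(1)] that(2) by blast
 have in_ee: "ee : bd f \<longleftrightarrow> f = u | f = w" if "f : F" for f using fee that by blast
 have rhoY: "rho x ~: Y" if "x : Y" for x using rho(2)[OF that] by (simp add: R_def)
 have SY: "card (S Int bd y) = 1" if y: "y : Y" for y
 proof -
  have yF: "y : F" using y YF by blast
  have "S Int bd y = (if y = u | y = w then {ee} else {pe y})"
  proof -
   have "y = x1 | y = x2 | y = x3 | y = u | y = w" using y Yx by blast
   thus ?thesis
    unfolding S_def using in_pe[OF xY(1) yF] in_pe[OF xY(2) yF] in_pe[OF xY(3) yF] in_ee[OF yF]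
     rhoY[OF xY(1)] rhoY[OF xY(2)] rhoY[OF xY(3)] Yx(2) y by auto
  qed
  thus ?thesis by auto
 qed
 have SR: "S Int bd f = (if f = rho x1 then {pe x1} else if f = rho x2 then {pe x2} else if f = rho x3 then {pe x3} else {})" if f: "f : R" for f
 proof -
  have fF: "f : F" "f ~: Y" using f by (auto simp: R_def)
  have "rho x1 ~= rho x2" "rho x1 ~= rho x3" "rho x2 ~= rho x3" using inj_onD[OF rho_inj] xY Yx(2) by auto
  moreover have "f ~= x1" "f ~= x2" "f ~= x3" "f ~= u" "f ~= w" using fF xY by blast+
  ultimately show ?thesis unfolding S_def
   using in_pe[OF xY(1) fF(1)] in_pe[OF xY(2) fF(1)] in_pe[OF xY(3) fF(1)] in_ee[OF fF(1)] by auto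
 qed
 have pmM: "pm F E bd M" unfolding pm_cubic
 proof (intro conjI ballI)
  show "M <= E" using m(1) SE EE_E by (auto simp: M_def)
  fix f assume f: "f : F"
  have eq: "M Int bd f = (m Int bd f) Un (S Int bd f)" by (auto simp: M_def)
  show "card (M Int bd f) = 1"
  proof (cases "f : U")
   case True
   hence "f : R" "f ~= rho x1" "f ~= rho x2" "f ~= rho x3" by (auto simp: U_def)
   hence "S Int bd f = {}" using SR by simp
   thus ?thesis using eq m(2) True by simp
  next
   case False
   hence e2: "M Int bd f = S Int bd f" using eq m(3) f by auto
   show ?thesis
   proof (cases "f : Y")
    case True thus ?thesis using e2 SY by simp
   next
    case False
    hence "f : R" using f by (simp add: R_def)
    hence "f = rho x1 | f = rho x2 | f = rho x3" using \<open>f ~: U\<close> by (auto simp: U_def)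
    thus ?thesis unfolding e2 SR[OF \<open>f : R\<close>] by auto
   qed
  qed
 qed
 have ME: "M Int EE = S"
 proof -
  have "y : F - U" if "y : Y" for y using that YF by (auto simp: U_def R_def)
  hence "m Int EE = {}" using m(3) EE_iff by blast
  thus ?thesis using SE by (auto simp: M_def)
 qed
 have cS: "card S = 4"
 proof -
  have "pe x1 ~= pe x2" "pe x1 ~= pe x3" "pe x2 ~= pe x3" using pe_inj xY Yx(2) by auto
  moreover have "ee ~= pe x1" "ee ~= pe x2" "ee ~= pe x3" using eeC pe'(1) xY by auto
  ultimately show ?thesis by (simp add: S_def)
 qed
 define TT where "TT = {t. t <= L5 & card t = 3}"
 define ET where "ET t = {e:E. en e <= t}" for t
 have fTT: "finite TT" using fin5 by (simp add: TT_def)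
 have ETE: "ET t <= EE" if "t : TT" for t using that EE_lab by (auto simp: ET_def TT_def)
 have ETp: "en ` ET t = pairs t" if t: "t : TT" for t
 proof
  show "en ` ET t <= pairs t" using en_pairs by (auto simp: ET_def)
  show "pairs t <= en ` ET t"
  proof
   fix p assume p: "p : pairs t"
   hence "p : pairs L5" using t by (auto simp: TT_def pairs_def)
   then obtain e where "e : EE" "p = en e" using en_EE by auto
   thus "p : en ` ET t" using p EE_E by (auto simp: ET_def pairs_def)
  qed
 qed
 have inE: "inj_on en (ET t)" for t using simple by (rule inj_on_subset) (auto simp: ET_def)
 \<comment> \<open>Four edges of \<open>M\<close> have both ends in \<open>L5\<close>, and each lies
   in 3 of the triples: 4 * 3 = 12. The five facial triples of the band account for 5 of
   these.\<close>
 have tot: "(SUM t:TT. card (M Int ET t)) = 12"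
 proof -
  have "(SUM t:TT. card (M Int ET t)) = (SUM t:TT. card {e:S. en e <= t})"
  proof (intro sum.cong refl arg_cong[where f=card])
   fix t assume t: "t : TT"
   have "M Int ET t = S Int ET t" using ME ETE[OF t] by blast
   also have "... = {e:S. en e <= t}" using SE EE_E by (auto simp: ET_def)
   finally show "M Int ET t = {e:S. en e <= t}" .
  qed
  also have "... = (SUM e:S. card {t:TT. en e <= t})"
   using even_sum_card[OF fTT, of S "%t e. en e <= t"] by (simp add: S_def)
  also have "... = (SUM e:S. 3)"
  proof (rule sum.cong[OF refl])
   fix e assume e: "e : S"
   hence eE: "e : E" "en e <= L5" using SE EE_E EE_lab by blast+
   have c2: "card (en e) = 2" "finite (en e)" using no_loop[OF eE(1)] fin_en[OF eE(1)] by auto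
   have "{t:TT. en e <= t} = (%c. insert c (en e)) ` (L5 - en e)"
   proof
    show "{t:TT. en e <= t} <= (%c. insert c (en e)) ` (L5 - en e)"
    proof
     fix t assume "t : {t:TT. en e <= t}"
     hence t: "t <= L5" "card t = 3" "en e <= t" by (auto simp: TT_def)
     have "card (t - en e) = 1" using t c2 by (simp add: card_Diff_subset)
     then obtain c where "t - en e = {c}" by (auto simp: card_1_singleton_iff)
     hence "t = insert c (en e)" "c : L5 - en e" using t by blast+
     thus "t : (%c. insert c (en e)) ` (L5 - en e)" by blast
    qed
   qed (use eE c2 in \<open>auto simp: TT_def\<close>)
   moreover have "inj_on (%c. insert c (en e)) (L5 - en e)" by (auto simp: inj_on_def)
   moreover have "card (L5 - en e) = 3" using eE c2 L5 by (simp add: card_Diff_subset)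
   ultimately show "card {t:TT. en e <= t} = 3" by (simp add: card_image)
  qed
  finally show ?thesis using cS by simp
 qed
 have labTT: "lab ` Y <= TT" using labY' lab_pairs(1) YF by (auto simp: TT_def)
 have ET_lab: "ET (lab y) = bd y" if y: "y : Y" for y
 proof -
  have yF: "y : F" using y YF by blast
  have "en ` ET (lab y) = en ` bd y" using ETp[of "lab y"] labTT y lab_pairs(2)[OF yF] by auto
  moreover have sE: "ET (lab y) <= E" by (auto simp: ET_def)
  ultimately show ?thesis using inj_on_image_eq_iff[OF simple sE bdE[OF yF]] by simp
 qed
 have injl: "inj_on lab Y" using lab_inj[OF YF YF _ F_big(1)] by (intro inj_onI)
 have s5: "(SUM t:lab ` Y. card (M Int ET t)) = 5"
 proof -
  have "(SUM t:lab ` Y. card (M Int ET t)) = (SUM y:Y. card (M Int ET (lab y)))" using sum.reindex[OF injl] by simp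
  also have "... = (SUM y:Y. 1)" using ET_lab pmM YF by (intro sum.cong) (auto simp: pm_cubic)
  finally show ?thesis using Y by simp
 qed
 \<comment> \<open>Such a triple is no cut: a face outside the band bounded by it would have three
   edges in \<open>cut' R\<close>. So its three edges meet the complement of \<open>M\<close> oddly
   and \<open>M\<close> evenly.\<close>
 have ev: "even (card (M Int ET t))" if t: "t : TT - lab ` Y" for t
 proof -
  have tT: "t : TT" using t by blast
  have ft: "finite t" "card t = 3" using tT by (auto simp: TT_def intro: card_ge_0_finite)
  have c3: "card (ET t) = 3" using ETp[OF tT] card_image[OF inE[of t]] card_pairs[OF ft(1)] ft by (simp add: numeral_eq_Suc)
  have fE: "finite (ET t)" using finE by (simp add: ET_def)
  have cl: "closed (ET t)" unfolding closed_def
  proof (intro conjI allI)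
   show "ET t <= E" by (auto simp: ET_def)
   fix v
   have "en ` {e:ET t. v : en e} = {p:pairs t. v : p}" using ETp[OF tT] by auto
   moreover have "inj_on en {e:ET t. v : en e}" using inE[of t] by (rule inj_on_subset) auto
   ultimately have "card {e:ET t. v : en e} = card {p:pairs t. v : p}"
    using card_image[of en "{e:ET t. v : en e}"] by simp
   thus "even (card {e:ET t. v : en e})" using pairs_3_even[OF ft(2)] by simp
  qed
  have "ET t ~= cut' X" if X: "X <= F" for X
  proof
   assume eq: "ET t = cut' X"
   then obtain f where f: "f : F" "cut' X = bd f" using cut_eq3[OF X] c3 by auto
   have "lab f = \<Union>(en ` ET t)" using eq f by (simp add: lab_def)
   also have "... <= t" unfolding ETp[OF tT] by (auto simp: pairs_def)
   finally have "lab f = t" using ft lab_pairs(1)[OF f(1)] by (intro card_subset_eq) auto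
   hence "f ~: Y" using t by blast
   hence fR: "f : R" using f by (simp add: R_def)
   have "bd f <= cut' R" using out_cut[of f] f eq ETE[OF tT] \<open>f ~: Y\<close> cut_R by auto
   hence "cut' R Int bd f = bd f" by blast
   thus False using R_le1[OF fR] cubic[OF f(1)] by simp
  qed
  hence "odd (card (ET t Int (E - M)))" using noncut_parity[OF cl _ pmM] by blast
  moreover have "ET t Int (E - M) = ET t - M" by (auto simp: ET_def)
  moreover have "card (ET t - M) = 3 - card (ET t Int M)" using fE c3 by (simp add: card_Diff_subset_Int)
  moreover have "card (ET t Int M) <= 3" using card_mono[OF fE, of "ET t Int M"] c3 by simp
  ultimately show ?thesis by (simp add: Int_commute)
 qed
 have "(SUM t:TT. card (M Int ET t)) = (SUM t:TT - lab ` Y. card (M Int ET t)) + (SUM t:lab ` Y. card (M Int ET t))"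
  using sum.subset_diff[OF labTT fTT] .
 moreover have "even (SUM t:TT - lab ` Y. card (M Int ET t))" using ev by (intro dvd_sum) auto
 ultimately show False using tot s5 odd_seven by metis
qed

lemma card_R: "R = P"
proof -
 have nbs: "ALL x. ~ nb x x" "ALL x y. nb x y --> nb y x" by (auto simp: nb_def)
 have nb2': "ALL x:Y. card {y:Y. nb x y} = 2" using nb2 by blast
 obtain c0 c1 c2 c3 c4 where c: "Y = {c0, c1, c2, c3, c4}" "distinct [c0, c1, c2, c3, c4]"
  "nb c0 c1" "nb c1 c2" "nb c2 c3" "nb c3 c4" "nb c4 c0"
  by (rule five_cycle[OF Y(2) nbs nb2'])
 interpret pentagon F E bd en R P by (rule pentagon)
 \<comment> \<open>Pentagram order. The triples of \<open>pentagon_five\<close> must leave over two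
   band faces that are neighbours on the 5-cycle, so consecutive indices there are two steps apart
   here.\<close>
 have P5: "P = {rho c2, rho c4, rho c1, rho c3, rho c0}" using rho_P c(1) by auto
 have "distinct (map rho [c2, c4, c1, c3, c0])"
  using c(2) rho_inj c(1) unfolding distinct_map by (auto intro: inj_on_subset)
 hence d: "distinct [rho c2, rho c4, rho c1, rho c3, rho c0]" by simp
 show ?thesis
 proof (rule pentagon_five[OF P5 d])
  show "~ matchable (near {}) (R - {rho c2, rho c4, rho c3})" by (rule forbid[OF _ _ c(3)]) (use c(1,2) in auto)
  show "~ matchable (near {}) (R - {rho c4, rho c1, rho c0})" by (rule forbid[OF _ _ c(5)]) (use c(1,2) in auto)
  show "~ matchable (near {}) (R - {rho c1, rho c3, rho c2})" by (rule forbid[OF _ _ c(7)]) (use c(1,2) in auto)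
  show "~ matchable (near {}) (R - {rho c3, rho c0, rho c4})" by (rule forbid[OF _ _ c(4)]) (use c(1,2) in auto)
  show "~ matchable (near {}) (R - {rho c0, rho c2, rho c1})" by (rule forbid[OF _ _ c(6)]) (use c(1,2) in auto)
 qed
qed

text \<open>Each of the five outer faces has one edge on the band and an apex outside
  \<open>L5\<close>; faces sharing another edge share the apex. Two different apexes would split
  \<open>R\<close> into two sets whose cuts are at most their sizes but at least 3, against
  \<open>card R = 5\<close>. The common apex is the sixth vertex.\<close>

theorem band_k6: "EX L PP. k6_structure F E bd en L PP"
proof -
 have cR: "card R = 5" using card_R card_P by simp
 have F10: "card F = 10" using card_compl[OF Y(1)] Y(2) cR by (simp add: R_def)
 have R1: "card (cut' R Int bd r) = 1" if "r : R" for r using P1[OF that] that card_R by simp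
 have wex: "EX w q. w ~: L5 & w : lab r & lab r - {w} <= L5 & (ALL e:bd r. e ~: cut' Y --> w : en e)" if r: "r : R" for r
 proof -
  have rF: "r : F" "r : F - Y" using r by (auto simp: R_def)
  obtain p where p: "cut' R Int bd r = {p}" using R1[OF r] by (auto simp: card_1_singleton_iff)
  have pp: "p : cut' Y" "p : bd r" using p cut_R by auto
  have pE: "p : E" using pp cut_E by blast
  have pL: "en p <= L5" "en p <= lab r" using EE_lab[OF pE] pp edge_lab[OF rF(1)] by (auto simp: EE_def)
  have "card (lab r - en p) = 1" using pL lab_pairs(1)[OF rF(1)] no_loop[OF pE] fin_en[OF pE] by (simp add: card_Diff_subset)
  then obtain w where w: "lab r - en p = {w}" by (auto simp: card_1_singleton_iff)
  have wl: "w : lab r" "lab r <= insert w (en p)" using w by blast+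
  have wL: "w ~: L5"
  proof
   assume "w : L5"
   hence "lab r <= L5" using wl pL by blast
   hence "bd r <= cut' Y" using EE_lab edge_lab[OF rF(1)] bdE[OF rF(1)] out_cut[OF rF(2)] by blast
   hence "cut' R Int bd r = bd r" using cut_R by blast
   thus False using R1[OF r] cubic[OF rF(1)] by simp
  qed
  have "w : en e" if e: "e : bd r" "e ~: cut' Y" for e
  proof (rule ccontr)
   assume "w ~: en e"
   hence "en e <= L5" using edge_lab[OF rF(1) e(1)] wl pL by blast
   thus False using EE_lab[of e] bdE[OF rF(1)] e out_cut[OF rF(2) e(1)] by blast
  qed
  thus ?thesis using wL wl pL by blast
 qed
 then obtain wl where wl: "!!r. r : R ==> wl r ~: L5 & wl r : lab r & lab r - {wl r} <= L5 & (ALL e:bd r. e ~: cut' Y --> wl r : en e)"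
  by metis
 obtain r0 where r0: "r0 : R" using F_big(2) by (auto simp: R_def)
 define X where "X = {r:R. wl r = wl r0}"
 have XR: "X <= R" by (auto simp: X_def)
 have cl: "card (cut' Z) <= card Z" if Z: "Z <= R" "!!e. e : cut' Z ==> e : cut' R" for Z
 proof -
  have ZF: "Z <= F" using Z R_F by blast
  have "cut' Z <= (UN f:Z. cut' R Int bd f)" using cut_iff[OF ZF] Z(2) by blast
  hence "card (cut' Z) <= card (UN f:Z. cut' R Int bd f)" using fin_sub[OF ZF] fin_cut by (intro card_mono) auto
  also have "... <= (SUM f:Z. card (cut' R Int bd f))" using fin_sub[OF ZF] by (rule card_UN_le)
  also have "... = (SUM f:Z. 1)" using R1 Z by (intro sum.cong) auto
  finally show ?thesis by simp
 qed
 have nocross: "e : cut' R" if e: "r : X" "s : R - X" "e : bd r" "e : bd s" for r s e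
 proof (rule ccontr)
  assume "e ~: cut' R"
  hence n: "e ~: cut' Y" using cut_R by simp
  have rs: "r : R" "s : R" "s : F" using e XR R_F by blast+
  have "wl r : en e" "wl s : en e" using wl rs e n by blast+
  hence "wl r : lab s" using edge_lab[OF rs(3) e(4)] by blast
  hence "wl r = wl s" using wl[OF rs(1)] wl[OF rs(2)] by blast
  thus False using e by (auto simp: X_def)
 qed
 have XF: "X <= F" "R - X <= F" using XR R_F by blast+
 have "X = R"
 proof (rule ccontr)
  assume "X ~= R"
  have "e : cut' R" if eX: "e : cut' X" for e
  proof -
   obtain r s where rs: "r : X" "e : bd r" "s : F - X" "e : bd s" "e : E" using eX cut_iff[OF XF(1), of e] by blast
   show ?thesis
   proof (cases "s : R")
    case True thus ?thesis using nocross rs by blast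
   next
    case False thus ?thesis using cut_iff[OF R_F] rs XR by blast
   qed
  qed
  hence 1: "card (cut' X) <= card X" using cl[OF XR] by blast
  have "e : cut' R" if eX: "e : cut' (R - X)" for e
  proof -
   obtain r s where rs: "r : R - X" "e : bd r" "s : F - (R - X)" "e : bd s" "e : E" using eX cut_iff[OF XF(2), of e] by blast
   show ?thesis
   proof (cases "s : R")
    case True thus ?thesis using nocross[of s r e] rs by blast
   next
    case False thus ?thesis using cut_iff[OF R_F] rs by blast
   qed
  qed
  hence 2: "card (cut' (R - X)) <= card (R - X)" using cl[of "R - X"] by blast
  have "card X + card (R - X) = 5" using cR XR fin_sub[OF R_F] by (metis card_Diff_subset card_mono finite_subset le_add_diff_inverse)
  moreover have "R ~= F" using cR F10 by auto
  hence "card (cut' X) >= 3" "card (cut' (R - X)) >= 3"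
   using XF XR R_F r0 \<open>X ~= R\<close> by (auto intro!: cut_ge3 simp: X_def)
  ultimately show False using 1 2 by linarith
 qed
 define L where "L = insert (wl r0) L5"
 have "card L = 6" using wl[OF r0] L5 fin5 by (simp add: L_def)
 moreover have "lab f <= L" if f: "f : F" for f
 proof (cases "f : Y")
  case True thus ?thesis using labY' by (auto simp: L_def)
 next
  case False
  hence fR: "f : R" using f by (simp add: R_def)
  hence "wl f = wl r0" using \<open>X = R\<close> by (auto simp: X_def)
  thus ?thesis using wl[OF fR] by (auto simp: L_def)
 qed
 ultimately show ?thesis using k6_singletons[OF F10] by blast
qed

end

section \<open>The minimal complex\<close>

lemma barrier_arith:
 "s + 3 * k + 2 * i = 3 * a + 2 * b ==> b <= 2 ==> 1 <= i ==> a <= k ==> even s ==> even (k + a) ==>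
  k = a & (s = 0 & i = b | s = 2 & i = 1 & b = (2 :: nat))"
proof -
 assume h: "s + 3 * k + 2 * i = 3 * a + 2 * b" "b <= 2" "1 <= i" "a <= k" "even s" "even (k + a)"
 have ka: "k = a"
 proof (rule ccontr)
  assume "k ~= a"
  hence "a + 2 <= k" using even_less[OF h(6)] h(4) by simp
  thus False using h(1-3) by linarith
 qed
 hence e: "s + 2 * i = 2 * b" using h(1) by simp
 have "s = 0 | 2 <= s" using h(5) by (cases s; cases "s - 1") auto
 thus ?thesis using ka e h(2,3) by auto
qed

lemma choose2_le: "n <= 5 ==> n choose 2 <= 10" "n <= 4 ==> n choose 2 <= 6"
proof -
 show "n choose 2 <= 10" if "n <= 5"
 proof -
  have "n = 0 | n = 1 | n = 2 | n = 3 | n = 4 | n = 5" using that by linarith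
  thus ?thesis by (auto simp: numeral_eq_Suc)
 qed
 show "n choose 2 <= 6" if "n <= 4"
 proof -
  have "n = 0 | n = 1 | n = 2 | n = 3 | n = 4" using that by linarith
  thus ?thesis by (auto simp: numeral_eq_Suc)
 qed
qed

lemma card_pairs_at: assumes "finite L" shows "card {p:pairs L. v : p} = (if v : L then card L - 1 else 0)"
proof (cases "v : L")
 case True
 have "{p:pairs L. v : p} = (%c. {v, c}) ` (L - {v})"
 proof
  show "{p:pairs L. v : p} <= (%c. {v, c}) ` (L - {v})"
  proof
   fix p assume "p : {p:pairs L. v : p}"
   hence p: "p <= L" "card p = 2" "v : p" by (auto simp: pairs_def)
   then obtain c where "c ~= v" "p = {v, c}" using card2_mem[OF p(2,3)] by blast
   thus "p : (%c. {v, c}) ` (L - {v})" using p by auto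
  qed
 qed (use True in \<open>auto simp: pairs_def\<close>)
 moreover have "inj_on (%c. {v, c}) (L - {v})" by (auto simp: inj_on_def doubleton_eq_iff)
 ultimately show ?thesis using card_image[of "%c. {v, c}" "L - {v}"] True assms by simp
next
 case False
 hence "{p:pairs L. v : p} = {}" by (auto simp: pairs_def)
 hence "card {p:pairs L. v : p} = 0" by (simp only: card.empty)
 thus ?thesis using False by simp
qed

lemma even_card_other: assumes "even (card S)" "e : S" shows "EX x:S. x ~= e"
proof (rule ccontr)
 assume "~ ?thesis"
 hence "S = {e}" using assms(2) by blast
 thus False using assms(1) by simp
qed

lemma even_nz_ge2: "even (n :: nat) ==> n ~= 0 ==> 2 <= n"
 by (cases n; cases "n - 1") auto

lemma image_filter_mem: "f ` {x:A. v : f x} = {p:f ` A. v : p}" by auto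
lemma pairs_mono: "t <= Q ==> pairs t <= pairs Q" by (auto simp: pairs_def)

lemma even_sd_odd: "finite A ==> finite B ==> odd (card A) ==> odd (card B) ==> even (card (sym_diff A B))"
 by (subst even_card_sym_diff) auto

text \<open>The induction hypothesis in the form in which it is consumed: for reductions that delete
  something and keep the dual graph connected. The reduced complex is written out in full in place
  of the constants of \<open>reduction\<close>.\<close>

locale mincx = tight F E bd en for F :: "'f set" and E :: "'e set" and bd and en :: "'e => 'v set" +
 assumes IH: "reduction F E bd en Z Z0 r ==> Z0 ~= {} ==> (ALL Y<=F. cut E bd Y - Z0 = {} --> Y = {} | Y = F) ==>
  EX L PP. k6_structure F (E - Z0) (%f. bd f - Z0) (%e. {w. odd (card {a:en e. r a = w})}) L PP"
begin

abbreviation "merged_k6 Z0 r L PP == k6_structure F (E - Z0) (%f. bd f - Z0) (%e. {w. odd (card {a:en e. r a = w})}) L PP"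

abbreviation star where "star v == {e:E. v : en e}"

lemma fin_star: "finite (star v)" using finE by simp

lemma E_ne: "E ~= {}"
proof
 assume e: "E = {}"
 have "F = {}"
 proof (rule ccontr)
  assume "F ~= {}"
  then obtain f where f: "f : F" by blast
  thus False using bdE[OF f] cubic[OF f] e by simp
 qed
 hence "pm F E bd {}" by (simp add: pm_def)
 moreover have "is_cob' (E - {})" using is_cob_empty e by simp
 ultimately show False using badF by (auto simp: bad_def)
qed

lemma triple_closed:
 assumes t: "card t = 3" "pairs t <= en ` E"
 shows "closed {e:E. en e <= t}" "card {e:E. en e <= t} = 3"
proof -
 let ?T = "{e:E. en e <= t}"
 have ft: "finite t" using t(1) by (metis card.infinite zero_neq_numeral)
 have im: "en ` ?T = pairs t"
 proof
  show "en ` ?T <= pairs t" using en_pairs by auto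
  show "pairs t <= en ` ?T"
  proof
   fix p assume p: "p : pairs t"
   then obtain e where "e : E" "p = en e" using t(2) by blast
   thus "p : en ` ?T" using p by (auto simp: pairs_def)
  qed
 qed
 have inE: "inj_on en ?T" using simple by (rule inj_on_subset) auto
 show "card ?T = 3" using im card_image[OF inE] card_pairs[OF ft] t(1) by (simp add: numeral_eq_Suc)
 show "closed ?T" unfolding closed_def
 proof (intro conjI allI)
  fix v
  have "en ` {e:?T. v : en e} = {p:pairs t. v : p}" unfolding image_filter_mem im ..
  moreover have "inj_on en {e:?T. v : en e}" using inE by (rule inj_on_subset) auto
  ultimately have "card {e:?T. v : en e} = card {p:pairs t. v : p}"
   using card_image[of en "{e:?T. v : en e}"] by simp
  thus "even (card {e:?T. v : en e})" using pairs_3_even[OF t(1)] by simp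
 qed auto
qed

lemma lab_eqI: "f : F ==> bd f = {e:E. en e <= t} ==> card t = 3 ==> lab f = t"
proof -
 assume f: "f : F" "bd f = {e:E. en e <= t}" "card t = 3"
 have "lab f <= t" using f(2) by (auto simp: lab_def)
 moreover have "finite t" using f(3) by (metis card.infinite zero_neq_numeral)
 ultimately show "lab f = t" using lab_pairs(1)[OF f(1)] f(3) by (intro card_subset_eq) auto
qed

text \<open>The four triangles of a K4 are then faces, and every edge of the K4 already has both its
  faces among them. They close up to a tetrahedron, which by connectedness is the whole
  complex.\<close>

lemma no_facial_K4:
 assumes fac: "!!t. closed t ==> card t = 3 ==> EX f:F. t = bd f"
  and Q: "card Q = 4" "pairs Q <= en ` E"
 shows "card E <= 6"
proof -
 have fQ: "finite Q" using Q(1) by (metis card.infinite zero_neq_numeral)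
 have tri: "EX f:F. bd f = {e:E. en e <= t} & lab f = t" if t: "t <= Q" "card t = 3" for t
 proof -
  have "pairs t <= en ` E" using pairs_mono[OF t(1)] Q(2) by blast
  then obtain f where f: "f : F" "{e:E. en e <= t} = bd f" using triple_closed[OF t(2)] fac[of "{e:E. en e <= t}"] by blast
  thus ?thesis using lab_eqI[OF f(1) f(2)[symmetric] t(2)] by blast
 qed
 define Y where "Y = {f:F. lab f <= Q}"
 have YF: "Y <= F" by (auto simp: Y_def)
 have "cut' Y = {}"
 proof (rule ccontr)
  assume "cut' Y ~= {}"
  then obtain e where e: "e : cut' Y" by blast
  then obtain f g where fg: "f : Y" "e : bd f" "g : F - Y" "e : bd g" "e : E" using cut_iff[OF YF, of e] by blast
  have eQ: "en e <= Q" using fg(1,2) edge_lab[of f e] by (auto simp: Y_def)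
  have c2: "card (en e) = 2" "finite (en e)" using no_loop[OF fg(5)] fin_en[OF fg(5)] by auto
  have "card (Q - en e) = 2" using eQ c2 Q(1) by (simp add: card_Diff_subset)
  then obtain c d where cd: "Q - en e = {c, d}" "c ~= d" by (auto simp: card_2_iff)
  hence cdQ: "c : Q" "d : Q" "c ~: en e" "d ~: en e" by blast+
  obtain f1 where f1: "f1 : F" "bd f1 = {x:E. en x <= insert c (en e)}" "lab f1 = insert c (en e)"
   using tri[of "insert c (en e)"] cdQ c2 eQ by auto
  obtain f2 where f2: "f2 : F" "bd f2 = {x:E. en x <= insert d (en e)}" "lab f2 = insert d (en e)"
   using tri[of "insert d (en e)"] cdQ c2 eQ by auto
  have ne: "f1 ~= f2"
  proof
   assume "f1 = f2"
   hence "c : insert d (en e)" using f1(3) f2(3) by auto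
   thus False using cd(2) cdQ by blast
  qed
  have Y12: "f1 : Y" "f2 : Y" using f1(1,3) f2(1,3) cdQ eQ by (auto simp: Y_def)
  have "{f1, f2, g} <= {h:F. e : bd h}" using f1(1,2) f2(1,2) fg(3,4,5) by auto
  hence "card {f1, f2, g} <= 2" using two[OF fg(5)] finF card_mono[of "{h:F. e : bd h}" "{f1, f2, g}"] by simp
  moreover have "f1 ~= g" "f2 ~= g" using Y12 fg(3) by blast+
  hence "card {f1, f2, g} = 3" using ne by simp
  ultimately show False by simp
 qed
 hence "Y = {} | Y = F" using conn YF by blast
 moreover have "Y ~= {}"
 proof -
  obtain t where t: "t <= Q" "card t = 3" using obtain_subset_with_card_n[of 3 Q] Q(1) by auto
  thus ?thesis using tri[OF t] by (auto simp: Y_def)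
 qed
 ultimately have FY: "F = Y" by blast
 have "card F <= 4"
 proof (cases "card F > 2")
  case True
  have "inj_on lab F" using lab_inj[OF _ _ _ True] by (intro inj_onI)
  moreover have "lab ` F <= {t. t <= Q & card t = 3}" using FY lab_pairs(1) by (auto simp: Y_def)
  moreover have "card {t. t <= Q & card t = 3} = 4" using n_subsets[OF fQ, of 3] Q(1) by (simp add: numeral_eq_Suc)
  ultimately show ?thesis using card_inj_on_le[of lab F "{t. t <= Q & card t = 3}"] fQ by simp
 qed simp
 thus ?thesis using card_E by simp
qed

text \<open>Minimality, alternation, merging and the induction hypothesis are combined. The dual
  graph stays connected because a non-empty cut inside \<open>Z0\<close> would be closed and contain
  two edges with the same end outside \<open>K0\<close>.\<close>

lemma reduction_exists:
 assumes K0: "!!Q. cob' Q <= cob' K0 ==> K0 <= Q | K0 Int Q = {}"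
  and one: "card {e:E. en e <= K0} <= 1"
  and Z: "even (card (cob' K0))" "cob' K0 ~= {}"
  and uniq: "!!Z0 e e' a. Z0 <= cob' K0 ==> ALL f:F. card (cob' K0 Int bd f) = 2 --> card (Z0 Int bd f) = 1 ==>
   e : Z0 ==> e' : Z0 ==> a : en e ==> a : en e' ==> a ~: K0 ==> e = e'"
 obtains Z0 r L PP where "reduction F E bd en (cob' K0) Z0 r" "!!a. r a ~= a ==> a ~: K0 & r a : K0"
  "merged_k6 Z0 r L PP"
proof -
 have "EX Z0<=cob' K0. ALL f:F. card (cob' K0 Int bd f) = 2 --> card (Z0 Int bd f) = 1"
  by (rule alternating[OF cob_cocycle _ Z(1)]) (rule cob_minimal[OF K0 one])
 then obtain Z0 where Z0: "Z0 <= cob' K0" "ALL f:F. card (cob' K0 Int bd f) = 2 --> card (Z0 Int bd f) = 1" by blast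
 have "EX r. reduction F E bd en (cob' K0) Z0 r & (ALL a. r a ~= a --> a ~: K0 & r a : K0)"
 proof (rule reduce[OF refl Z0])
  show "e = e'" if "e : Z0" "e' : Z0" "a : en e" "a : en e'" "a ~: K0" for e e' a
   using uniq[OF Z0 that] .
  fix r assume "reduction F E bd en (cob' K0) Z0 r" "!!a. r a ~= a ==> a ~: K0 & r a : K0"
  thus ?thesis by blast
 qed
 then obtain r where r: "reduction F E bd en (cob' K0) Z0 r" "!!a. r a ~= a ==> a ~: K0 & r a : K0" by blast
 have conn0: "ALL Y<=F. cut' Y - Z0 = {} --> Y = {} | Y = F"
 proof (intro allI impI)
  fix Y assume Y: "Y <= F" "cut' Y - Z0 = {}"
  have "cut' Y = {}"
  proof (rule ccontr)
   assume "cut' Y ~= {}"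
   then obtain d where d: "d : cut' Y" by blast
   have sub: "cut' Y <= Z0" using Y(2) by blast
   hence "d : cob' K0" using d Z0(1) by blast
   then obtain x where x: "x : en d" "x ~: K0" unfolding cob_iff by blast
   have "even (card {y:cut' Y. x : en y})" using closed_cut[OF Y(1)] by (simp add: closed_def)
   moreover have "d : {y:cut' Y. x : en y}" using d x by simp
   ultimately have "EX y:{y:cut' Y. x : en y}. y ~= d" by (rule even_card_other)
   then obtain y where y: "y : cut' Y" "x : en y" "y ~= d" by auto
   have "y = d" by (rule uniq[OF Z0 _ _ y(2) x]) (use y(1) d sub in auto)
   thus False using y(3) by blast
  qed
  thus "Y = {} | Y = F" using conn Y(1) by blast
 qed
 have "Z0 ~= {}"
 proof
  assume "Z0 = {}"
  obtain e where e: "e : cob' K0" using Z(2) by blast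
  hence "e : E" using cob_E by blast
  then obtain f where f: "f : F" "e : bd f" using two_faces by blast
  hence "card (cob' K0 Int bd f) ~= 0" using e fin_bd[OF f(1)] by auto
  hence "card (cob' K0 Int bd f) = 2" using cocycle_bd02[OF cob_cocycle f(1), of K0] by simp
  thus False using Z0(2) f(1) \<open>Z0 = {}\<close> by simp
 qed
 then obtain L PP where "merged_k6 Z0 r L PP"
  using IH[OF r(1) _ conn0] by blast
 thus ?thesis using that r by blast
qed

lemma star_reduction:
 assumes v: "even (card (star v))" "star v ~= {}"
 obtains Z0 r L PP where "reduction F E bd en (cob' {v}) Z0 r" "!!a. r a ~= a ==> a ~= v & r a = v"
  "merged_k6 Z0 r L PP"
proof -
 have "{e:E. en e <= {v}} = {}"
 proof (rule ccontr)
  assume "~ ?thesis"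
  then obtain e where e: "e : E" "en e <= {v}" by blast
  thus False using no_loop[OF e(1)] card_mono[OF _ e(2)] by simp
 qed
 hence one: "card {e:E. en e <= {v}} <= 1" by (metis card.empty zero_le)
 have uniq: "e = e'" if h: "Z0 <= cob' {v}" "e : Z0" "e' : Z0" "a : en e" "a : en e'" "a ~: {v}" for Z0 e e' a
 proof -
  have s: "e : star v" "e' : star v" using h(1-3) star_cob by auto
  have "a ~= v" using h(6) by simp
  hence "en e = {a, v}" "en e' = {a, v}" using en_mem[of e a v] en_mem[of e' a v] s h by auto
  thus ?thesis using inj_onD[OF simple, of e e'] s by auto
 qed
 show ?thesis
 proof (rule reduction_exists[of "{v}"])
  show "card {e:E. en e <= {v}} <= 1" by (rule one)
  show "even (card (cob' {v}))" "cob' {v} ~= {}" using v star_cob by auto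
  fix Z0 e e' a assume "Z0 <= cob' {v}" "e : Z0" "e' : Z0" "a : en e" "a : en e'" "a ~: {v}"
  thus "e = e'" by (rule uniq)
 next
  fix Z0 r L PP assume "reduction F E bd en (cob' {v}) Z0 r" "!!a. r a ~= a ==> a ~: {v} & r a : {v}"
   "merged_k6 Z0 r L PP"
  thus thesis using that by blast
 qed blast
qed

text \<open>Two odd degrees make the coboundary of \<open>{u, v}\<close> even. Edges of
  \<open>Z0\<close> from \<open>a\<close> to \<open>u\<close> and to \<open>v\<close> would form a
  triangle with \<open>e0\<close>; being facial, it contains only one edge of
  \<open>Z0\<close>.\<close>

lemma pair_reduction:
 assumes fac: "!!t. closed t ==> card t = 3 ==> EX f:F. t = bd f"
  and e0: "e0 : E" "en e0 = {u, v}" and od: "odd (card (star u))" "odd (card (star v))"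
 obtains Z0 r L PP where "reduction F E bd en (cob' {u, v}) Z0 r" "!!a. r a ~= a ==> a ~: {u, v} & r a : {u, v}"
  "merged_k6 Z0 r L PP"
proof -
 have uv: "u ~= v" using no_loop[OF e0(1)] e0(2) by auto
 have sub: "{e:E. en e <= {u, v}} <= {e0}"
 proof
  fix e assume e: "e : {e:E. en e <= {u, v}}"
  hence "en e = {u, v}" using no_loop[of e] uv by (intro card_subset_eq) auto
  thus "e : {e0}" using inj_onD[OF simple, of e e0] e e0 by auto
 qed
 have one: "card {e:E. en e <= {u, v}} <= 1" using card_mono[OF _ sub] by simp
 have cb: "cob' {u, v} = sym_diff (star u) (star v)"
 proof -
  have "sym_diff {u} {v} = {u, v}" using uv by auto
  thus ?thesis using cob_sd[of "{u}" "{v}"] star_cob by simp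
 qed
 have ev: "even (card (cob' {u, v}))" unfolding cb by (rule even_sd_odd) (use od fin_star in auto)
 have ne: "cob' {u, v} ~= {}"
 proof
  assume "cob' {u, v} = {}"
  hence "star u = star v" using cb by blast
  hence "star u <= {e:E. en e <= {u, v}}" using en_mem[of _ u v] uv by auto
  hence "star u <= {e0}" using sub by blast
  obtain f where f: "f : F" "e0 : bd f" using two_faces[OF e0(1)] by blast
  have "{e:bd f. u : en e} = {e0}" using \<open>star u <= {e0}\<close> bdE[OF f(1)] f e0 by blast
  hence "card {e:bd f. u : en e} = 1" by simp
  thus False using closed_bd[OF f(1), of u] by simp
 qed
 have e0n: "e0 ~: cob' {u, v}" unfolding cb using e0 by auto
 have K0: "{u, v} <= Q | {u, v} Int Q = {}" if h: "cob' Q <= cob' {u, v}" for Q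
 proof (rule ccontr)
  assume n: "~ ?thesis"
  hence "u : Q & v ~: Q | v : Q & u ~: Q" by blast
  hence "e0 : cob' Q" using e0 unfolding cob_iff by (metis insert_commute)
  thus False using h e0n by blast
 qed
 have uniq: "e = e'"
  if h: "Z0 <= cob' {u, v}" "ALL f:F. card (cob' {u, v} Int bd f) = 2 --> card (Z0 Int bd f) = 1"
   "e : Z0" "e' : Z0" "a : en e" "a : en e'" "a ~: {u, v}" for Z0 e e' a
 proof (rule ccontr)
  assume nee: "e ~= e'"
  have eZ: "e : cob' {u, v}" "e' : cob' {u, v}" "e : E" "e' : E" using h(1,3,4) cob_E by blast+
  have av: "a ~= u" "a ~= v" using h(7) by auto
  have or: "en x = {a, u} | en x = {a, v}" if x: "x : cob' {u, v}" "a : en x" for x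
  proof -
   have xE: "x : E" using x cob_E by blast
   have "u : en x | v : en x" using x(1) unfolding cb by blast
   thus ?thesis using en_mem[OF xE x(2)] av by blast
  qed
  have d: "en e ~= en e'" using inj_onD[OF simple, of e e'] eZ nee by blast
  have ens: "en e = {a, u} & en e' = {a, v} | en e = {a, v} & en e' = {a, u}"
   using or[OF eZ(1) h(5)] or[OF eZ(2) h(6)] d by auto
  have ne0: "e ~= e0" "e' ~= e0" using e0n eZ by blast+
  have split3: "{x:{e, e', e0}. w : en x} = (if w : en e then {e} else {}) Un (if w : en e' then {e'} else {}) Un (if w : en e0 then {e0} else {})" for w
   by auto
  have sum3: "card {x:{e, e', e0}. w : en x} = (if w : en e then 1 else 0) + (if w : en e' then 1 else 0) + (if w : en e0 then 1 else 0)" for w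
   unfolding split3 using nee ne0 by simp
  have "card {x:{e, e', e0}. w : en x} = (if w : {a, u, v} then 2 else 0)" for w
   using ens
  proof (elim disjE conjE)
   assume "en e = {a, u}" "en e' = {a, v}"
   thus ?thesis unfolding sum3 e0(2) using av uv by simp
  next
   assume "en e = {a, v}" "en e' = {a, u}"
   thus ?thesis unfolding sum3 e0(2) using av uv by simp
  qed
  hence "closed {e, e', e0}" using eZ e0 by (auto simp: closed_def)
  moreover have "card {e, e', e0} = 3" using nee ne0 by simp
  ultimately obtain f where f: "f : F" "{e, e', e0} = bd f" using fac by blast
  have "cob' {u, v} Int bd f = {e, e'}" using f(2)[symmetric] eZ e0n by blast
  hence "card (cob' {u, v} Int bd f) = 2" using nee by simp
  hence "card (Z0 Int bd f) = 1" using h(2) f(1) by blast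
  moreover have "{e, e'} <= Z0 Int bd f" using f(2) h(3,4) by blast
  hence "card {e, e'} <= card (Z0 Int bd f)" using fin_bd[OF f(1)] by (intro card_mono) auto
  ultimately show False using nee by simp
 qed
 show ?thesis
 proof (rule reduction_exists[of "{u, v}"])
  show "card {e:E. en e <= {u, v}} <= 1" by (rule one)
  show "even (card (cob' {u, v}))" "cob' {u, v} ~= {}" by (rule ev, rule ne)
  show "{u, v} <= Q | {u, v} Int Q = {}" if "cob' Q <= cob' {u, v}" for Q by (rule K0[OF that])
  fix Z0 e e' a assume "Z0 <= cob' {u, v}" "ALL f:F. card (cob' {u, v} Int bd f) = 2 --> card (Z0 Int bd f) = 1"
   "e : Z0" "e' : Z0" "a : en e" "a : en e'" "a ~: {u, v}"
  thus "e = e'" by (rule uniq)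
 next
  fix Z0 r L PP assume "reduction F E bd en (cob' {u, v}) Z0 r" "!!a. r a ~= a ==> a ~: {u, v} & r a : {u, v}"
   "merged_k6 Z0 r L PP"
  thus thesis by (rule that)
 qed
qed

text \<open>At most two vertices of the K6 found after the reduction lie in \<open>K0\<close>. Four
  others span a K4 whose edges were not affected by merging, so \<open>no_facial_K4\<close> allows
  at most 6 edges, but K6 alone needs 15.\<close>

lemma facial_contra:
 assumes fac: "!!t. closed t ==> card t = 3 ==> EX f:F. t = bd f"
  and K0: "card K0 <= 2" "finite K0"
  and red: "reduction F E bd en (cob' K0) Z0 r" and r: "!!a. r a ~= a ==> a ~: K0 & r a : K0"
  and k6: "merged_k6 Z0 r L PP"
 shows False
proof -
 interpret rd: reduction F E bd en "cob' K0" Z0 r by (rule red)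
 let ?en = "%e. {w. odd (card {a:en e. r a = w})}"
 have en1: "rd.en1 = ?en" by (rule ext) (simp add: rd.en1_def)
 define CC where "CC = (UN X:PP. cut (E - Z0) (%f. bd f - Z0) X)"
 have L: "card L = 6" "bij_betw ?en CC (pairs L)" using k6 by (auto simp: k6_structure_def CC_def)
 have CE: "CC <= E" by (auto simp: CC_def cut_def)
 have fL: "finite L" using L(1) by (metis card.infinite zero_neq_numeral)
 have "card CC = 15" using bij_betw_same_card[OF L(2)] card_pairs[OF fL] L(1) by (simp add: numeral_eq_Suc)
 hence E15: "card E >= 15" using card_mono[OF finE CE] by simp
 have "card (L - K0) >= 4" using L(1) K0 card_Diff_subset_Int[of L K0] card_mono[OF K0(2), of "L Int K0"] fL by auto
 then obtain Q where Q: "Q <= L - K0" "card Q = 4" by (meson obtain_subset_with_card_n)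
 have "pairs Q <= en ` E"
 proof
  fix p assume p: "p : pairs Q"
  hence "p : pairs L" using Q by (auto simp: pairs_def)
  hence "p : ?en ` CC" using bij_betw_imp_surj_on[OF L(2)] by simp
  then obtain e where e: "e : CC" "p = ?en e" by blast
  have eE: "e : E" using e CE by blast
  have pn: "p ~= {}" "p Int K0 = {}" using p Q by (auto simp: pairs_def)
  have "rd.en1 e = p" using e(2) en1 by simp
  then obtain a b where ab: "en e = {a, b}" "p = {r a, r b}" using rd.en1_cases[OF eE] pn(1) by (auto split: if_splits)
  hence "r a = a" "r b = b" using r pn(2) by blast+
  thus "p : en ` E" using ab eE by auto
 qed
 thus False using no_facial_K4[OF fac Q(2)] E15 by simp
qed

text \<open>An edge has an end of even degree or two ends of odd degree, so one of the two
  reductions applies and \<open>facial_contra\<close> refutes it.\<close>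

lemma nonfacial_ex: "EX t. closed t & card t = 3 & (ALL f:F. t ~= bd f)"
proof (rule ccontr)
 assume "~ ?thesis"
 hence fac: "closed t ==> card t = 3 ==> EX f:F. t = bd f" for t by blast
 obtain e0 where e0: "e0 : E" using E_ne by blast
 obtain u v where uv: "en e0 = {u, v}" using no_loop[OF e0] by (auto simp: card_2_iff)
 have ne: "star u ~= {}" "star v ~= {}" using e0 uv by auto
 have st: False if ev: "even (card (star w))" "star w ~= {}" for w
 proof -
  obtain Z0 r L PP where "reduction F E bd en (cob' {w}) Z0 r" "!!a. r a ~= a ==> a ~= w & r a = w"
   "merged_k6 Z0 r L PP"
   using star_reduction[OF ev] by blast
  thus False using facial_contra[OF fac, of "{w}" Z0 r L PP] by auto
 qed
 show False
 proof (cases "even (card (star u)) | even (card (star v))")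
  case True thus False using st ne by blast
 next
  case False
  then obtain Z0 r L PP where "reduction F E bd en (cob' {u, v}) Z0 r" "!!a. r a ~= a ==> a ~: {u, v} & r a : {u, v}"
   "merged_k6 Z0 r L PP"
   using pair_reduction[OF fac e0 uv] by blast
  moreover have "card {u, v} <= 2" by (simp add: card_insert_if)
  ultimately show False using facial_contra[OF fac, of "{u, v}" Z0 r L PP] by blast
 qed
qed

text \<open>The remaining argument does not depend on the induction: a band is recognised by
its few labels.\<close>
lemma band_ex:
 assumes Y: "Y <= F" "card Y = 5" "card (F - Y) ~= 1" and L5: "finite L5" "card L5 <= 5"
  and lab: "!!f. f : Y ==> lab f <= L5"
 shows "EX L PP. k6_structure F E bd en L PP"
proof -
 have cc: "15 = 2 * card (inner' Y) + card (cut' Y)" using cubic_count[OF Y(1)] Y(2) by simp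
 have sub: "en ` (inner' Y Un cut' Y) <= pairs L5"
 proof
  fix p assume "p : en ` (inner' Y Un cut' Y)"
  then obtain e where e: "p = en e" "e : inner' Y | e : cut' Y" by blast
  hence eE: "e : E" using inner_E cut_E by blast
  then obtain g where "g : F" "e : bd g" using two_faces by blast
  then obtain f where f: "f : Y" "e : bd f" using e(2) inner_iff[OF Y(1), of e] cut_iff[OF Y(1), of e] by blast
  thus "p : pairs L5" using e(1) en_pairs[OF eE] edge_lab[of f e] lab[OF f(1)] Y(1) by blast
 qed
 have inj: "inj_on en (inner' Y Un cut' Y)" using simple by (rule inj_on_subset) (use inner_E cut_E in blast)
 have fp: "finite (pairs L5)" using L5(1) by (simp add: pairs_def)
 have "card (inner' Y) + card (cut' Y) = card (inner' Y Un cut' Y)"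
  using fin_inner fin_cut inner_cut_disj by (intro card_Un_disjoint[symmetric]) auto
 also have "... <= card (pairs L5)" using card_inj_on_le[OF inj sub fp] .
 finally have le: "card (inner' Y) + card (cut' Y) <= card L5 choose 2" using card_pairs[OF L5(1)] by simp
 have le10: "card (inner' Y) + card (cut' Y) <= 10" using le choose2_le(1)[OF L5(2)] by simp
 have "card (cut' Y) ~= 1" using bridgeless Y(1) by blast
 moreover have "card (cut' Y) ~= 3"
 proof
  assume "card (cut' Y) = 3"
  then obtain f where "Y = {f} | F - Y = {f}" using cut_eq3[OF Y(1)] by blast
  thus False using Y by auto
 qed
 \<comment> \<open>Writing i and c for the numbers of inner and cut edges, 2i + c = 15 and i + c <=
   10 give c <= 5 with c odd.\<close>
 ultimately have c5: "card (cut' Y) = 5" using cc le10 by presburger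
 have "card L5 = 5"
 proof (rule ccontr)
  assume "card L5 ~= 5"
  hence "card L5 <= 4" using L5(2) by simp
  hence "card (inner' Y) + card (cut' Y) <= 6" using le choose2_le(2)[of "card L5"] by simp
  thus False using cc c5 by simp
 qed
 then interpret band F E bd en Y L5
  using Y c5 lab by unfold_locales (auto simp: lab_def)
 show ?thesis by (rule band_k6)
qed

text \<open>A part of the K6 structure whose triangle avoids \<open>v\<close> is bounded by no
  deleted edge; its 3-cut is one of the original complex, so it is a single face. If
  \<open>v\<close> is in \<open>L\<close>, five of the ten parts contain it and the other five faces
  form a band on \<open>L - {v}\<close>; otherwise all ten parts are faces.\<close>

lemma even_vertex_case:
 assumes v: "even (card (star v))" "star v ~= {}"
 shows "EX L PP. k6_structure F E bd en L PP"
proof -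
 obtain Z0 r L PP where red: "reduction F E bd en (cob' {v}) Z0 r" and r: "!!a. r a ~= a ==> a ~= v & r a = v"
  and k6: "merged_k6 Z0 r L PP"
  using star_reduction[OF v] by blast
 interpret rd: reduction F E bd en "cob' {v}" Z0 r by (rule red)
 let ?en = "%e. {w. odd (card {a:en e. r a = w})}"
 have en1: "rd.en1 = ?en" by (rule ext) (simp add: rd.en1_def)
 have bd1: "rd.bd1 = (%f. bd f - Z0)" by (rule ext) (simp add: rd.bd1_def)
 define c1 where "c1 X = cut' X - Z0" for X
 have cc: "cut (E - Z0) (%f. bd f - Z0) X = c1 X" for X using rd.cut1[of X] unfolding bd1 rd.E1_def c1_def .
 define en1 where "en1 = ?en"
 have en1_cases: "(en e = {} & en1 e = {}) | (EX a b. a ~= b & en e = {a, b} & (if r a = r b then en1 e = {} else en1 e = {r a, r b}))"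
  if "e : E" for e using rd.en1_cases[OF that] unfolding en1 en1_def .
 define CC where "CC = (UN X:PP. c1 X)"
 have L: "card L = 6" "partition_on F PP" "bij_betw en1 CC (pairs L)"
  "ALL X:PP. EX t<=L. card t = 3 & en1 ` c1 X = pairs t"
  using k6 unfolding k6_structure_def cc CC_def en1_def by blast+
 obtain T where T: "!!X. X : PP ==> T X <= L & card (T X) = 3 & en1 ` c1 X = pairs (T X)" using L(4) by metis
 have fL: "finite L" using L(1) by (metis card.infinite zero_neq_numeral)
 have CE: "CC <= E" "!!X. c1 X <= E" using cut_E by (auto simp: CC_def c1_def)
 have XF: "X <= F" "X ~= {}" if "X : PP" for X using L(2) that by (auto simp: partition_on_def)
 have fPP: "finite PP" using L(2) finF by (rule partition_on_finite)
 have cCC: "card CC = 15" using bij_betw_same_card[OF L(3)] card_pairs[OF fL] L(1) by (simp add: numeral_eq_Suc)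
 have injC: "inj_on en1 CC" using L(3) by (simp add: bij_betw_def)
 have inj: "inj_on en1 (c1 X)" if "X : PP" for X using injC by (rule inj_on_subset) (use that in \<open>auto simp: CC_def\<close>)
 have fT: "finite (T X)" if "X : PP" for X using T[OF that] fL finite_subset by blast
 have c3: "card (c1 X) = 3" if "X : PP" for X
  using card_image[OF inj[OF that]] T[OF that] card_pairs[OF fT[OF that]] by (simp add: numeral_eq_Suc)
 have rv: "r v = v" using r[of v] by blast
 have en1_v: "en1 e = en e" if e: "e : E" "v ~: en1 e" "en1 e ~= {}" for e
 proof -
  obtain a b where ab: "a ~= b" "en e = {a, b}" "if r a = r b then en1 e = {} else en1 e = {r a, r b}"
   using en1_cases[OF e(1)] e(3) by blast
  hence "en1 e = {r a, r b}" using e(3) by (auto split: if_splits)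
  moreover have "r a = a" "r b = b" using r[of a] r[of b] e(2) calculation by auto
  ultimately show ?thesis using ab by simp
 qed
 have en1_mem: "r a : en1 e" if e: "X : PP" "e : c1 X" "a : en e" for a e X
 proof -
  have eE: "e : E" using e CE by blast
  have "en1 e : pairs (T X)" using T[OF e(1)] e(2) by blast
  hence "en1 e ~= {}" by (auto simp: pairs_def)
  then obtain x b where ab: "x ~= b" "en e = {x, b}" "if r x = r b then en1 e = {} else en1 e = {r x, r b}"
   using en1_cases[OF eE] by blast
  hence "en1 e = {r x, r b}" using \<open>en1 e ~= {}\<close> by (auto split: if_splits)
  thus ?thesis using ab e(3) by auto
 qed
 have en1_T: "en1 e <= T X" if "X : PP" "e : c1 X" for X e using T[OF that(1)] that(2) by (auto simp: pairs_def)
 \<comment> \<open>If the edge from \<open>v\<close> to \<open>a\<close> is deleted, evenness of the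
   cut at \<open>a\<close> gives another cut edge at \<open>a\<close>, which survives. Since
   \<open>r a = v\<close>, it ends at \<open>v\<close> in the merged complex, and so
   \<open>v\<close> would be in \<open>T X\<close>.\<close>
 have avoid: "cut' X Int Z0 = {}" if X: "X : PP" "v ~: T X" for X
 proof (rule ccontr)
  assume "cut' X Int Z0 ~= {}"
  then obtain e where e: "e : cut' X" "e : Z0" by blast
  hence "e : star v" using rd.Z0 star_cob by blast
  hence eE: "e : E" "v : en e" by auto
  then obtain a where a: "a ~= v" "en e = {v, a}" using card2_mem[OF no_loop] by metis
  have ra: "r a = v" using rd.r1[OF e(2), of a v] a rv by simp
  have "even (card {x:cut' X. a : en x})" using closed_cut[OF XF(1)[OF X(1)]] by (simp add: closed_def)
  moreover have "e : {x:cut' X. a : en x}" using e a by auto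
  ultimately have "EX x:{x:cut' X. a : en x}. x ~= e" by (rule even_card_other)
  then obtain x where x: "x : cut' X" "x ~= e" "a : en x" by auto
  have xE: "x : E" using x cut_E by blast
  have "x ~: Z0"
  proof
   assume "x : Z0"
   hence "v : en x" using rd.Z0 star_cob by blast
   hence "en x = {v, a}" using en_mem[OF xE, of v a] x a by blast
   thus False using inj_onD[OF simple, of x e] a x xE eE by auto
  qed
  hence xc: "x : c1 X" using x by (simp add: c1_def)
  hence "v : en1 x" using en1_mem[OF X(1) xc x(3)] ra by simp
  thus False using en1_T[OF X(1) xc] X(2) by blast
 qed
 have two1: "card {X:PP. e : c1 X} = 2" if e: "e : CC" for e
 proof -
  have eE: "e : E" using e CE by blast
  obtain X0 where X0: "X0 : PP" "e : c1 X0" using e by (auto simp: CC_def)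
  hence nZ: "e ~: Z0" "e : cut' X0" by (auto simp: c1_def)
  obtain f g where fg: "f : F" "g : F" "f ~= g" "{h:F. e : bd h} = {f, g}" using two_faces[OF eE] by metis
  have U: "\<Union>PP = F" using L(2) by (simp add: partition_on_def)
  have dj: "A = B" if "A : PP" "B : PP" "z : A" "z : B" for A B z
   using L(2) that by (auto simp: partition_on_def disjoint_def)
  obtain A where A: "A : PP" "f : A" using U fg by blast
  obtain B where B: "B : PP" "g : B" using U fg by blast
  have mem: "e : c1 X \<longleftrightarrow> (f : X \<longleftrightarrow> g ~: X)" if "X : PP" for X
   using cut_two[OF XF(1)[OF that] fg(4,3)] nZ by (simp add: c1_def)
  have "A ~= B"
  proof
   assume "A = B"
   have "f : X0 | g : X0" using mem[OF X0(1)] X0(2) by blast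
   hence "X0 = A" using dj A B X0 \<open>A = B\<close> by blast
   thus False using mem[OF X0(1)] X0(2) A B \<open>A = B\<close> by blast
  qed
  have "{X:PP. e : c1 X} = {A, B}"
  proof
   show "{X:PP. e : c1 X} <= {A, B}" using mem dj[OF _ A(1) _ A(2)] dj[OF _ B(1) _ B(2)] by blast
   have "g ~: A" "f ~: B" using dj[OF A(1) B(1) _ B(2)] dj[OF A(1) B(1) A(2)] \<open>A ~= B\<close> by blast+
   thus "{A, B} <= {X:PP. e : c1 X}" using mem A B by blast
  qed
  thus ?thesis using \<open>A ~= B\<close> by simp
 qed
 have fCC: "finite CC" using CE finE finite_subset by blast
 have dc: "(SUM X:PP. card {e:CC. e : c1 X & P e}) = 2 * card {e:CC. P e}" for P
 proof -
  have "(SUM X:PP. card {e:CC. e : c1 X & P e}) = (SUM X:PP. card {e:{e:CC. P e}. e : c1 X})"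
   by (intro sum.cong refl arg_cong[where f=card]) auto
  also have "... = (SUM e:{e:CC. P e}. card {X:PP. e : c1 X})"
   using even_sum_card[OF fPP, of "{e:CC. P e}" "%X e. e : c1 X"] fCC by simp
  also have "... = (SUM e:{e:CC. P e}. 2)" using two1 by (intro sum.cong) auto
  finally show ?thesis by simp
 qed
 have sub: "{e:CC. e : c1 X & P e} = {e:c1 X. P e}" if "X : PP" for X P using that by (auto simp: CC_def)
 have "(SUM X:PP. 3) = (2::nat) * 15"
 proof -
  have "(SUM X:PP. card {e:CC. e : c1 X & True}) = (SUM X:PP. 3)"
  proof (rule sum.cong[OF refl])
   fix X assume X: "X : PP"
   show "card {e:CC. e : c1 X & True} = 3" unfolding sub[OF X] using c3[OF X] by simp
  qed
  thus ?thesis using dc[of "%_. True"] cCC by simp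
 qed
 hence P10: "card PP = 10" by simp
 define Pv where "Pv = {X:PP. v : T X}"
 have "2 * card Pv = 2 * card {e:CC. v : en1 e}"
 proof -
  have "(SUM X:PP. card {e:CC. e : c1 X & v : en1 e}) = (SUM X:PP. if v : T X then 2 else 0)"
  proof (rule sum.cong[OF refl])
   fix X assume X: "X : PP"
   have im: "en1 ` {e:c1 X. v : en1 e} = {p:pairs (T X). v : p}" unfolding image_filter_mem using T[OF X] by simp
   have "inj_on en1 {e:c1 X. v : en1 e}" using inj[OF X] by (rule inj_on_subset) auto
   hence "card {e:c1 X. v : en1 e} = card {p:pairs (T X). v : p}" using card_image[of en1 "{e:c1 X. v : en1 e}"] im by simp
   moreover have "card {p:pairs (T X). v : p} = (if v : T X then 2 else 0)"
    using card_pairs_at[OF fT[OF X]] T[OF X] by simp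
   ultimately show "card {e:CC. e : c1 X & v : en1 e} = (if v : T X then 2 else 0)" using sub[OF X] by simp
  qed
  also have "... = 2 * card Pv" using fPP by (simp add: Pv_def sum.If_cases Int_def)
  finally show ?thesis using dc[of "%e. v : en1 e"] by simp
 qed
 hence cPv: "card Pv = card {e:CC. v : en1 e}" by simp
 have n5: "card Pv = (if v : L then 5 else 0)"
 proof -
  have im: "en1 ` {e:CC. v : en1 e} = {p:pairs L. v : p}"
   unfolding image_filter_mem using bij_betw_imp_surj_on[OF L(3)] by simp
  have "inj_on en1 {e:CC. v : en1 e}" using injC by (rule inj_on_subset) auto
  hence "card {e:CC. v : en1 e} = card {p:pairs L. v : p}" using card_image[of en1 "{e:CC. v : en1 e}"] im by simp
  moreover have "card {p:pairs L. v : p} = (if v : L then 5 else 0)"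
   using card_pairs_at[OF fL] L(1) by simp
  ultimately show ?thesis using cPv by simp
 qed
 have single: "EX f:F. X = {f} & lab f = T X" if X: "X : PP" "v ~: T X" for X
 proof -
  have c1X: "c1 X = cut' X" using avoid[OF X] by (auto simp: c1_def)
  then obtain f where f: "f : F" "cut' X = bd f" "X = {f} | F - X = {f}" using cut_eq3[OF XF(1)[OF X(1)]] c3[OF X(1)] by auto
  have "F - X ~= {f}"
  proof
   assume F1: "F - X = {f}"
   have "PP <= {X, {f}}"
   proof
    fix A assume A: "A : PP"
    show "A : {X, {f}}"
    proof (cases "A = X")
     case False
     hence "A Int X = {}" using L(2) A X(1) by (auto simp: partition_on_def disjoint_def)
     hence "A <= {f}" using XF(1)[OF A] F1 by blast
     thus ?thesis using XF(2)[OF A] by blast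
    qed simp
   qed
   hence "card PP <= card {X, {f}}" by (intro card_mono) auto
   also have "... <= 2" by (simp add: card_insert_if)
   finally show False using P10 by simp
  qed
  hence "X = {f}" using f(3) by blast
  have ene: "en e = en1 e" if "e : bd f" for e
  proof -
   have ec: "e : c1 X" "e : E" using that f c1X bdE by auto
   hence "en1 e : pairs (T X)" using T[OF X(1)] by blast
   hence "v ~: en1 e" "en1 e ~= {}" using X(2) by (auto simp: pairs_def)
   thus ?thesis using en1_v[OF ec(2)] by simp
  qed
  have "lab f <= T X" using ene en1_T[OF X(1)] c1X f(2) by (auto simp: lab_def)
  hence "lab f = T X" using lab_pairs(1)[OF f(1)] T[OF X(1)] fT[OF X(1)] by (intro card_subset_eq) auto
  thus ?thesis using f(1) \<open>X = {f}\<close> by blast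
 qed
 have cPF: "card PP <= card F"
  using partition_on_card_le[OF L(2) finF] .
 define Y where "Y = \<Union>(PP - Pv)"
 have YF: "Y <= F" using XF by (auto simp: Y_def)
 have labY: "lab f <= L - {v}" if "f : Y" for f
 proof -
  obtain X where X: "X : PP" "v ~: T X" "f : X" using \<open>f : Y\<close> by (auto simp: Y_def Pv_def)
  thus ?thesis using single[OF X(1,2)] T[OF X(1)] by auto
 qed
 have cY: "card Y = card (PP - Pv)"
 proof -
  have p: "partition_on Y (PP - Pv)"
   using L(2) unfolding Y_def partition_on_def by (meson Diff_iff Diff_subset pairwise_subset)
  have "card Y = sum card (PP - Pv)"
   using p XF(1) fin_sub by (intro product_partition) auto
  also have "... = (SUM X:PP - Pv. 1)"
  proof (rule sum.cong[OF refl])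
   fix X assume "X : PP - Pv"
   hence "X : PP" "v ~: T X" by (auto simp: Pv_def)
   thus "card X = 1" using single by fastforce
  qed
  finally show ?thesis by simp
 qed
 have cD: "card (PP - Pv) = card PP - card Pv" using fPP by (intro card_Diff_subset) (auto simp: Pv_def)
 show ?thesis
 proof (cases "v : L")
  case True
  hence c5: "card Y = 5" using cY cD P10 n5 by simp
  have "card (F - Y) >= 5" using card_compl[OF YF] c5 cPF P10 by simp
  thus ?thesis using band_ex[OF YF c5 _ _ _ labY] fL L(1) True by simp
 next
  case False
  hence "Pv = {}" using n5 fPP by (simp add: Pv_def)
  hence "Y = F" using L(2) by (simp add: Y_def partition_on_def)
  hence "card F = 10" using cY cD P10 \<open>Pv = {}\<close> by simp
  moreover have "lab f <= L" if "f : F" for f using labY[of f] that \<open>Y = F\<close> by blast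
  ultimately show ?thesis using k6_singletons L(1) by blast
 qed
qed

text \<open>Otherwise the edges at \<open>w\<close> inside \<open>X\<close> form a cocycle that is a
  proper non-empty part of the star of \<open>w\<close>, against the minimality of stars.\<close>

lemma link_cut:
 assumes X: "X <= F" and f: "f : X" "w : lab f" and g: "g : F - X" "w : lab g"
 shows "EX e:cut' X. w : en e"
proof (rule ccontr)
 assume n: "~ ?thesis"
 define D where "D = {e:inner' X. w : en e}"
 have D: "D <= star w" using inner_E by (auto simp: D_def)
 have cD: "cocycle' D" unfolding cocycle_def
 proof (intro conjI ballI)
  show "D <= E" using D by blast
  fix h assume h: "h : F"
  show "even (card (D Int bd h))"
  proof (cases "h : X")
   case True
   have "D Int bd h = {e:bd h. w : en e}"
   proof
    show "{e:bd h. w : en e} <= D Int bd h"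
    proof
     fix e assume e: "e : {e:bd h. w : en e}"
     hence eE: "e : E" using bdE[OF h] by blast
     have "e ~: inner' (F - X)" using inner_iff[of "F - X" e] e True h by blast
     hence "e : inner' X" using edge_cases[OF X eE] n e by blast
     thus "e : D Int bd h" using e by (simp add: D_def)
    qed
   qed (auto simp: D_def)
   thus ?thesis using closed_bd[OF h] by simp
  next
   case False
   hence "D Int bd h = {}" using inner_iff[OF X] h by (auto simp: D_def)
   thus ?thesis by simp
  qed
 qed
 have no1: "{e:E. en e <= {w}} = {}"
 proof (rule ccontr)
  assume "~ ?thesis"
  then obtain e where e: "e : E" "en e <= {w}" by blast
  thus False using no_loop[OF e(1)] card_mono[OF _ e(2)] by simp
 qed
 have "D = {} | D = cob' {w}"
 proof (rule cob_minimal)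
  show "card {e:E. en e <= {w}} <= 1" unfolding no1 by simp
  show "cocycle' D" by (rule cD)
  show "D <= cob' {w}" using D star_cob by simp
 qed auto
 moreover have "D ~= {}"
 proof -
  obtain e where e: "e : bd f" "w : en e" using f(2) by (auto simp: lab_def)
  have fF: "f : F" using f X by blast
  hence eE: "e : E" using bdE e by blast
  have "e ~: inner' (F - X)" using inner_iff[of "F - X" e] e f fF by blast
  hence "e : inner' X" using edge_cases[OF X eE] n e by blast
  thus ?thesis using e by (auto simp: D_def)
 qed
 moreover have "D ~= cob' {w}"
 proof -
  obtain e where e: "e : bd g" "w : en e" using g(2) by (auto simp: lab_def)
  hence "e : cob' {w}" using star_cob bdE[of g] g by blast
  moreover have "e ~: inner' X" using inner_iff[OF X] g e by blast
  ultimately show ?thesis by (auto simp: D_def)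
 qed
 ultimately show False by blast
qed

text \<open>No matching contains \<open>e1\<close> and avoids \<open>e2\<close> and
  \<open>e3\<close>, since it would leave two edges of a non-facial triangle. The resulting barrier
  has slack at most 4, contributed by \<open>e2\<close> and \<open>e3\<close>. Odd degrees exclude
  all distributions of the slack but one, in which a single part \<open>K0\<close> has a 5-cut; its
  complement is the band.\<close>

lemma odd_case:
 assumes t: "closed t" "card t = 3" "ALL f:F. t ~= bd f"
  and od: "!!v. star v ~= {} ==> odd (card (star v))"
 shows "EX L PP. k6_structure F E bd en L PP"
proof -
 have tE: "t <= E" using t(1) by (simp add: closed_def)
 obtain a b c where abc: "a ~= b" "b ~= c" "a ~= c" "en ` t = {{a, b}, {b, c}, {a, c}}" using labels3[OF t(1,2)] .
 have "{a, b} : en ` t" "{b, c} : en ` t" "{a, c} : en ` t" unfolding abc(4) by blast+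
 then obtain e1 e2 e3 where e: "e1 : t" "en e1 = {a, b}" "e2 : t" "en e2 = {b, c}" "e3 : t" "en e3 = {a, c}" by (metis imageE)
 have d: "e1 ~= e2" "e1 ~= e3" "e2 ~= e3" using e abc(1-3) by (auto simp: doubleton_eq_iff)
 have "{e1, e2, e3} = t"
 proof (rule card_subset_eq)
  show "finite t" using tE finE finite_subset by blast
 qed (use e d t(2) in auto)
 hence te: "t = {e1, e2, e3}" by simp
 have eE: "e1 : E" "e2 : E" "e3 : E" using e tE by auto
 have nocut: "t ~= cut' X" if X: "X <= F" for X
 proof
  assume "t = cut' X"
  then obtain f where "f : F" "cut' X = bd f" using cut_eq3[OF X] t(2) by auto
  thus False using t(3) \<open>t = cut' X\<close> by auto
 qed
 obtain f g where fg: "f : F" "g : F" "f ~= g" "e1 : bd f" "e1 : bd g" "{h:F. e1 : bd h} = {f, g}" using two_faces[OF eE(1)] by metis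
 define U where "U = F - {f, g}"
 have UF: "U <= F" by (auto simp: U_def)
 have finU: "finite U" using fin_sub[OF UF] .
 let ?N = "{e2, e3}"
 have nm: "~ matchable (near ?N) U"
 proof
  assume "matchable (near ?N) U"
  then obtain m where m: "m <= E - ?N" "ALL f:U. card (m Int bd f) = 1" "ALL f:F - U. m Int bd f = {}"
   using matchable_edges[OF _ UF, of ?N] by auto
  have "card ((m Un {e1}) Int bd h) = 1" if h: "h : F" for h
  proof (cases "h : U")
   case True
   hence "h ~= f" "h ~= g" by (auto simp: U_def)
   hence "e1 ~: bd h" using fg(6) h by blast
   hence "(m Un {e1}) Int bd h = m Int bd h" by blast
   thus ?thesis using m(2) True by simp
  next
   case False
   hence "h = f | h = g" using h by (auto simp: U_def)
   hence "(m Un {e1}) Int bd h = {e1}" using m(3) h False fg(4,5) by blast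
   thus ?thesis by simp
  qed
  hence "pm F E bd (m Un {e1})" unfolding pm_cubic using m(1) eE(1) by blast
  hence "odd (card (t Int (E - (m Un {e1}))))" using noncut_parity[OF t(1) nocut] by blast
  moreover have "t Int (E - (m Un {e1})) = {e2, e3}" using te d m(1) eE by auto
  ultimately show False using d(3) by simp
 qed
 obtain A0 KK where sep: "separation (near ?N) U A0 KK" and odd: "ALL K:KK. odd (card K) & factor_critical (near ?N) K"
  and lt: "card A0 < card KK"
  using tutte[of U "near ?N"] finU near_sym nm by blast
 have p: "A0 <= U" "partition_on (U - A0) KK"
  and no: "ALL K:KK. ALL L:KK. K ~= L --> (ALL x:K. ALL y:L. ~ near ?N x y)"
  using sep unfolding separation_def by blast+
 have finA0: "finite A0" using p finU finite_subset by blast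
 define A where "A = A0 Un {f, g}"
 have A: "A <= F" using p UF fg by (auto simp: A_def)
 have fgA: "f : A" "g : A" by (auto simp: A_def)
 have cA: "card A = card A0 + 2"
 proof -
  have "A0 Int {f, g} = {}" using p by (auto simp: U_def)
  hence "card A = card A0 + card {f, g}" using finA0 unfolding A_def by (intro card_Un_disjoint) auto
  thus ?thesis using fg(3) by simp
 qed
 have "U - A0 = F - A" by (auto simp: U_def A_def)
 hence part: "partition_on (F - A) KK" using p by simp
 have cU: "card U + 2 = card F"
 proof -
  have "card U = card F - card {f, g}" unfolding U_def using fg by (intro card_Diff_subset) auto
  moreover have "card {f, g} <= card F" using fg finF by (intro card_mono) auto
  ultimately show ?thesis using fg(3) by simp
 qed
 have parity: "even (card KK + card A)"
 proof -
  have "odds KK = card KK" using odd by (simp add: odds_all)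
  hence "even (card (U - A0)) \<longleftrightarrow> even (card KK)" using card_partition_parity[OF p(2)] finU by simp
  moreover have "card (U - A0) + card A0 = card U"
   using p(1) finU finA0 by (metis card_Diff_subset card_mono le_add_diff_inverse2)
  moreover have "even (card U)" using cU even_F by (metis even_add even_numeral)
  ultimately show ?thesis using cA by (metis even_add even_numeral)
 qed
 have KKA: "card A <= card KK" using even_less[of "card KK" "card A0"] parity lt cA by auto
 have KR: "K <= F - A" "K ~= {}" if "K : KK" for K using part that by (auto simp: partition_on_def)
 have UKK: "\<Union>KK = F - A" using part by (simp add: partition_on_def)
 have fKK: "finite KK" using part finF by (meson finite_Diff partition_on_finite)
 obtain bb :: "'e set" where bb: "bb <= ?N" "bb <= inner' (F - A)" "ALL e:bb. EX K:KK. EX L:KK. K ~= L & e : cut' K & e : cut' L"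
  and cnt: "(SUM K:KK. card (cut' K)) + 2 * card (inner' A) + 2 * card (cut' A Int cut' F) = 3 * card A + card (cut' F) + 2 * card bb"
  using barrier_count[OF A part A order_refl no] by (elim exE conjE) (rule that; assumption)
 have ge3: "card (cut' K) >= 3" if "K : KK" for K
  using cut_ge3[of K] KR[OF that] fgA A by blast
 have sN: "(SUM K:KK. card (cut' K)) = (SUM K:KK. card (cut' K) - 3) + 3 * card KK"
 proof -
  have "(SUM K:KK. card (cut' K)) = (SUM K:KK. (card (cut' K) - 3) + 3)"
   using ge3 by (intro sum.cong) auto
  thus ?thesis by (simp add: sum.distrib)
 qed
 have ev3: "even (card (cut' K) - 3)" if "K : KK" for K
  using cut_parity[of K] odd that KR[OF that] ge3[OF that] by auto
 have e1A: "e1 : inner' A" using inner_two[OF A fg(6,3)] fgA by blast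
 have i1: "1 <= card (inner' A)" using e1A fin_inner[of A] card_gt_0_iff by (metis One_nat_def Suc_leI empty_iff)
 have b2: "card bb <= 2" using card_mono[OF _ bb(1)] d(3) by simp
 have ar: "card KK = card A & ((SUM K:KK. card (cut' K) - 3) = 0 & card (inner' A) = card bb |
   (SUM K:KK. card (cut' K) - 3) = 2 & card (inner' A) = 1 & card bb = 2)"
 proof (rule barrier_arith)
  show "(SUM K:KK. card (cut' K) - 3) + 3 * card KK + 2 * card (inner' A) = 3 * card A + 2 * card bb"
   using cnt sN cut_F by simp
  show "even (SUM K:KK. card (cut' K) - 3)" using ev3 by (intro dvd_sum) auto
 qed (use b2 i1 KKA parity in auto)
 \<comment> \<open>\<open>cut' A\<close> is even and every non-empty star is odd, so
   \<open>D\<close> has odd degree at every vertex that occurs. By \<open>Dsub\<close> it has only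
   edges inside \<open>A\<close>, edges inside parts, and possibly \<open>e2\<close> and
   \<open>e3\<close>.\<close>
 define D where "D = E - cut' A"
 have oddD: "odd (card {x:D. v : en x})" if v: "star v ~= {}" for v
 proof -
  have "even (card {x:cut' A. v : en x})" using closed_cut[OF A] by (simp add: closed_def)
  moreover have "star v = {x:D. v : en x} Un {x:cut' A. v : en x}" using cut_E[of A] by (auto simp: D_def)
  moreover have "card ({x:D. v : en x} Un {x:cut' A. v : en x}) = card {x:D. v : en x} + card {x:cut' A. v : en x}"
   using finE fin_cut by (intro card_Un_disjoint) (auto simp: D_def)
  ultimately show ?thesis using od[OF v] by simp
 qed
 have Dsub: "x : inner' A | x : ?N | (EX K:KK. x : inner' K)" if x: "x : D" for x
 proof (rule ccontr)
  assume n: "~ ?thesis"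
  have xE: "x : E" "x ~: cut' A" using x by (auto simp: D_def)
  hence xi: "x : inner' (F - A)" using edge_cases[OF A xE(1)] n by blast
  obtain h k where hk: "h : F" "k : F" "h ~= k" "x : bd h" "x : bd k" "{l:F. x : bd l} = {h, k}" using two_faces[OF xE(1)] by metis
  have "h : F - A" "k : F - A" using xi inner_two[OF _ hk(6,3), of "F - A"] by auto
  then obtain K L where KL: "K : KK" "h : K" "L : KK" "k : L" using UKK by blast
  have "near ?N h k" using hk n by (intro nearI[of h k x]) auto
  hence "K = L" using no KL by blast
  hence "x : inner' K" using inner_two[OF _ hk(6,3), of K] KR[OF KL(1)] KL by blast
  thus False using n KL by blast
 qed
 have ND: "bb <= D" using bb(2) inner_E[of "F - A"] cut_inner_compl[OF A] by (auto simp: D_def)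
 have iD: "inner' A <= D" using inner_E[of A] inner_cut_disj[of A] by (auto simp: D_def)
 have st: "star a ~= {}" "star b ~= {}" "star c ~= {}" using e eE by auto
 have tv: "card {x:t. v : en x} = (if v : {a, b, c} then 2 else 0)" for v
 proof -
  have "{x:t. v : en x} = (if v : en e1 then {e1} else {}) Un (if v : en e2 then {e2} else {}) Un (if v : en e3 then {e3} else {})"
   using te by auto
  thus ?thesis using e d abc(1-3) by auto
 qed
 have sing: "EX h. K = {h}" if K: "K : KK" "card (cut' K) = 3" for K
 proof -
  have KF: "K <= F" using KR[OF K(1)] by blast
  obtain h where h: "K = {h} | F - K = {h}" using cut_eq3[OF KF K(2)] by blast
  have "f : F - K" "g : F - K" using fgA A KR[OF K(1)] by blast+
  hence "F - K ~= {h}" using fg(3) by (metis singletonD)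
  thus ?thesis using h by blast
 qed
 show ?thesis
 proof (cases "(SUM K:KK. card (cut' K) - 3) = 0")
  case True
  hence "card (cut' K) = 3" if "K : KK" for K using ge3[OF that] fKK that by (simp add: le_antisym)
  hence inK: "inner' K = {}" if "K : KK" for K using sing[OF that] inner_single that by auto
  have D2: "D <= inner' A Un ?N" using Dsub inK by blast
  have ib: "card (inner' A) = card bb" using ar True by auto
  have "D ~= t"
  proof
   assume "D = t"
   thus False using oddD[OF st(1)] tv[of a] by simp
  qed
  show ?thesis
  proof (cases "inner' A = {e1}")
   case i: True
   hence "D <= t" "e1 : D" using D2 te iD by auto
   hence "D = {e1} | D = {e1, e2} | D = {e1, e3}" using \<open>D ~= t\<close> te by blast
   thus ?thesis
   proof (elim disjE)
    assume "D = {e1}"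
    hence "{x:D. c : en x} = {}" using e abc(1-3) by auto
    hence "card {x:D. c : en x} = 0" by (simp only: card.empty)
    thus ?thesis using oddD[OF st(3)] by simp
   next
    assume "D = {e1, e2}"
    hence "{x:D. b : en x} = {e1, e2}" using e by auto
    thus ?thesis using oddD[OF st(2)] d by simp
   next
    assume "D = {e1, e3}"
    hence "{x:D. a : en x} = {e1, e3}" using e by auto
    thus ?thesis using oddD[OF st(1)] d by simp
   qed
  next
   case False
   have "card (inner' A) ~= 1" using False e1A by (auto simp: card_1_singleton_iff)
   hence c2: "card (inner' A) = 2" "card bb = 2" using ib b2 i1 by auto
   have bN: "bb = ?N" using bb(1) c2(2) d(3) by (intro card_subset_eq) auto
   obtain e' where e': "inner' A = {e1, e'}" "e' ~= e1" using card2_mem[OF c2(1) e1A] by blast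
   \<comment> \<open>Each vertex of the triangle has degree 2 in \<open>t\<close>, so odd degrees in
     \<open>D\<close> would force \<open>e'\<close> to end at all three.\<close>
   have DD: "D = insert e' t" using D2 ND iD e'(1) bN te by auto
   have "e' ~: t" using \<open>D ~= t\<close> DD by (metis insert_absorb)
   have "v : en e'" if v: "v = a | v = b | v = c" for v
   proof (rule ccontr)
    assume "v ~: en e'"
    hence "{x:D. v : en x} = {x:t. v : en x}" using DD by auto
    moreover have "star v ~= {}" using st v by blast
    ultimately show False using oddD[of v] tv[of v] v by auto
   qed
   hence "{a, b, c} <= en e'" by blast
   moreover have "e' : E" using e'(1) inner_E[of A] by blast
   ultimately have "card {a, b, c} <= 2" using card_mono[OF fin_en[of e'], of "{a, b, c}"] no_loop[of e'] by simp
   thus ?thesis using abc(1-3) by simp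
  qed
 next
  case False
  hence S2: "(SUM K:KK. card (cut' K) - 3) = 2" and iA: "card (inner' A) = 1" and cb: "card bb = 2" using ar by auto
  have cKK: "card KK = card A" using ar by blast
  have bN: "bb = ?N" using bb(1) cb d(3) by (intro card_subset_eq) auto
  have inA: "inner' A = {e1}" using iA e1A by (auto simp: card_1_singleton_iff)
  have "EX K0:KK. card (cut' K0) - 3 ~= 0"
  proof (rule ccontr)
   assume "~ ?thesis"
   hence "(SUM K:KK. card (cut' K) - 3) = 0" by (intro sum.neutral) blast
   thus False using S2 by simp
  qed
  then obtain K0 where K0: "K0 : KK" "card (cut' K0) - 3 ~= 0" by blast
  have "(SUM K:KK. card (cut' K) - 3) = (card (cut' K0) - 3) + (SUM K:KK - {K0}. card (cut' K) - 3)"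
   using fKK K0(1) by (rule sum.remove)
  moreover have "card (cut' K0) - 3 >= 2" using even_nz_ge2[OF ev3[OF K0(1)] K0(2)] .
  ultimately have s: "card (cut' K0) - 3 = 2" "(SUM K:KK - {K0}. card (cut' K) - 3) = 0" using S2 by linarith+
  have c5: "card (cut' K0) = 5" using s(1) by simp
  have "card (cut' K) = 3" if "K : KK - {K0}" for K using s(2) ge3[of K] fKK that by (simp add: le_antisym)
  hence singles: "EX h. K = {h}" if "K : KK - {K0}" for K using sing[of K] that by blast
  have K0F: "K0 <= F" "K0 <= F - A" using KR[OF K0(1)] by auto
  have Deq: "D <= t Un inner' K0"
  proof
   fix x assume "x : D"
   from Dsub[OF this] show "x : t Un inner' K0"
   proof (elim disjE bexE)
    fix K assume K: "K : KK" "x : inner' K"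
    have "K = K0"
    proof (rule ccontr)
     assume "K ~= K0"
     then obtain h where "K = {h}" using singles K by blast
     thus False using K(2) inner_single by simp
    qed
    thus ?thesis using K by blast
   qed (use inA te in auto)
  qed
  have tD: "t <= D" using te ND bN iD inA by auto
  \<comment> \<open>\<open>t\<close> is even at every vertex, so the odd degree in \<open>D\<close>
    must come from an edge inside \<open>K0\<close>: every vertex that occurs at all lies on a face
    of \<open>K0\<close>.\<close>
  have touch: "EX x:inner' K0. v : en x" if v: "star v ~= {}" for v
  proof (rule ccontr)
   assume "~ ?thesis"
   hence "{x:D. v : en x} = {x:t. v : en x}" using Deq tD by blast
   thus False using oddD[OF v] tv[of v] by (auto split: if_splits)
  qed
  define Y where "Y = F - K0"
  have YF: "Y <= F" by (auto simp: Y_def)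
  define L5 where "L5 = {v. EX e:cut' K0. v : en e}"
  have fL5: "finite L5"
  proof -
   have "L5 = (UN e:cut' K0. en e)" by (auto simp: L5_def)
   thus ?thesis using fin_cut[of K0] fin_en cut_E[of K0] by auto
  qed
  have labY: "lab h <= L5" if h: "h : Y" for h
  proof
   fix w assume w: "w : lab h"
   have hF: "h : F - K0" using h by (simp add: Y_def)
   obtain y where "y : bd h" "w : en y" using w by (auto simp: lab_def)
   hence "star w ~= {}" using bdE[of h] hF by auto
   then obtain x where x: "x : inner' K0" "w : en x" using touch by blast
   hence "x : E" using inner_E by blast
   then obtain k where k: "k : F" "x : bd k" using two_faces by blast
   hence kK: "k : K0" using x inner_iff[OF K0F(1)] by blast
   have "w : lab k" using edge_lab[OF k] x by blast
   thus "w : L5" using link_cut[OF K0F(1) kK _ hF w] by (auto simp: L5_def)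
  qed
  \<comment> \<open>The five cut edges have ten ends, and by parity each label in \<open>L5\<close>
    takes at least two of them.\<close>
  have cL5: "card L5 <= 5"
  proof -
   have "(SUM v:L5. 2) <= (SUM v:L5. card {e:cut' K0. v : en e})"
   proof (rule sum_mono)
    fix v assume "v : L5"
    hence "{e:cut' K0. v : en e} ~= {}" by (auto simp: L5_def)
    hence "card {e:cut' K0. v : en e} ~= 0" using fin_cut[of K0] by simp
    moreover have "even (card {e:cut' K0. v : en e})" using closed_cut[OF K0F(1)] by (simp add: closed_def)
    ultimately show "2 <= card {e:cut' K0. v : en e}" using even_nz_ge2 by blast
   qed
   also have "... = (SUM e:cut' K0. card {v:L5. v : en e})"
    using even_sum_card[OF fL5 fin_cut[of K0], of "%v e. v : en e"] by simp
   also have "... = (SUM e:cut' K0. 2)"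
   proof (rule sum.cong[OF refl])
    fix e assume x: "e : cut' K0"
    hence "{v:L5. v : en e} = en e" by (auto simp: L5_def)
    thus "card {v:L5. v : en e} = 2" using no_loop[of e] x cut_E[of K0] by auto
   qed
   finally show ?thesis using c5 by simp
  qed
  \<comment> \<open>All parts except \<open>K0\<close> are single faces, so \<open>Y\<close>
    consists of \<open>A\<close> and \<open>card A - 1\<close> further faces.\<close>
  have cY: "card Y + 1 = 2 * card A"
  proof -
   have "card (F - A) = sum card KK"
    using part finF by (intro product_partition) (auto simp: partition_on_def intro: finite_subset)
   also have "... = card K0 + sum card (KK - {K0})" using fKK K0(1) by (rule sum.remove)
   also have "sum card (KK - {K0}) = (SUM K:KK - {K0}. 1)"
   proof (rule sum.cong[OF refl])
    fix K assume "K : KK - {K0}"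
    thus "card K = 1" using singles by fastforce
   qed
   also have "... = card KK - 1" using K0(1) fKK by simp
   finally have "card (F - A) = card K0 + (card KK - 1)" .
   moreover have "card KK >= 1" using K0(1) fKK by (metis One_nat_def Suc_leI card_gt_0_iff empty_iff)
   moreover have "card A + card (F - A) = card F" using card_compl[OF A] .
   moreover have "card K0 + card Y = card F" unfolding Y_def using card_compl[OF K0F(1)] .
   ultimately show ?thesis using cKK by linarith
  qed
  have cutY: "cut' Y = cut' K0" unfolding Y_def using cut_compl[OF K0F(1)] .
  have A2: "card A >= 2" using cA by simp
  \<comment> \<open>With three faces, the only part besides \<open>K0\<close> would be
    \<open>{h}\<close>. It would have \<open>e2\<close> and \<open>e3\<close> on its boundary, hence
    all of \<open>t\<close>, which is not facial.\<close>
  have Y3: "card Y ~= 3"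
  proof
   assume "card Y = 3"
   hence "card A = 2" using cY by simp
   hence "card (KK - {K0}) = 1" using cKK K0(1) fKK by simp
   then obtain K where K: "KK - {K0} = {K}" by (auto simp: card_1_singleton_iff)
   hence "K : KK - {K0}" by blast
   then obtain h where h: "K = {h}" using singles by blast
   have KKe: "KK = {K0, {h}}" using K h K0(1) by blast
   have hF: "h : F" using KR[of "{h}"] KKe by blast
   have "x : bd h" if x: "x : ?N" for x
   proof -
    obtain K L where "K : KK" "L : KK" "K ~= L" "x : cut' K" "x : cut' L" using bb(3) bN x by blast
    hence "x : cut' {h}" using KKe by blast
    thus ?thesis using cut_single[OF hF] by simp
   qed
   hence h23: "e2 : bd h" "e3 : bd h" by blast+
   have lh: "lab h = {a, b, c}" using lab_union[OF hF h23 d(3)] e by auto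
   obtain x where x: "x : bd h" "en x = {a, b}" using lab_edge[OF hF, of a b] lh abc(1) by auto
   hence "x = e1" using inj_onD[OF simple, of x e1] e(2) eE(1) bdE[OF hF] by auto
   hence "t <= bd h" using x h23 te by blast
   hence "t = bd h" using fin_bd[OF hF] cubic[OF hF] t(2) by (intro card_subset_eq) auto
   thus False using t(3) hF by blast
  qed
  have cc: "3 * card Y = 2 * card (inner' Y) + 5" using cubic_count[OF YF] cutY c5 by simp
  have Y5: "card Y = 5"
  proof -
   have sub: "en ` (inner' Y Un cut' Y) <= pairs L5"
   proof
    fix p assume "p : en ` (inner' Y Un cut' Y)"
    then obtain x where x: "p = en x" "x : inner' Y | x : cut' Y" by blast
    hence xE: "x : E" using inner_E cut_E by blast
    then obtain k where "k : F" "x : bd k" using two_faces by blast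
    then obtain h where h: "h : Y" "x : bd h" using x(2) inner_iff[OF YF, of x] cut_iff[OF YF, of x] by blast
    thus "p : pairs L5" using x(1) en_pairs[OF xE] edge_lab[of h x] labY[OF h(1)] YF by blast
   qed
   have inj: "inj_on en (inner' Y Un cut' Y)" using simple by (rule inj_on_subset) (use inner_E cut_E in blast)
   have fp: "finite (pairs L5)" using fL5 by (simp add: pairs_def)
   have "card (inner' Y) + card (cut' Y) = card (inner' Y Un cut' Y)"
    using fin_inner fin_cut inner_cut_disj by (intro card_Un_disjoint[symmetric]) auto
   also have "... <= card (pairs L5)" using card_inj_on_le[OF inj sub fp] .
   finally have "card (inner' Y) + 5 <= card L5 choose 2" using card_pairs[OF fL5] cutY c5 by simp
   hence "card (inner' Y) <= 5" using choose2_le(1)[OF cL5] by simp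
   hence "card Y <= 5" using cc by simp
   thus ?thesis using cY A2 Y3 by presburger
  qed
  have "F - Y = K0" using K0F by (auto simp: Y_def)
  moreover have "card K0 ~= 1"
  proof
   assume "card K0 = 1"
   then obtain h where "K0 = {h}" by (auto simp: card_1_singleton_iff)
   thus False using c5 cut_single[of h] cubic[of h] K0F by auto
  qed
  ultimately show ?thesis using band_ex[OF YF Y5 _ fL5 cL5 labY] by simp
 qed
qed

theorem mincx_k6: "EX L PP. k6_structure F E bd en L PP"
proof (cases "EX v. star v ~= {} & even (card (star v))")
 case True thus ?thesis using even_vertex_case by blast
next
 case False
 thus ?thesis using nonfacial_ex odd_case by blast
qed

end

section \<open>Induction on the size of the complex\<close>

lemma (in contraction) conn1:
 assumes conn: "ALL Y<=F. cut' Y = {} --> Y = {} | Y = F"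
 shows "ALL Y<=F1. cut E1 bd1 Y = {} --> Y = {} | Y = F1"
proof (intro allI impI)
 fix Y assume Y: "Y <= F1" "cut E1 bd1 Y = {}"
 hence "up Y = {} | up Y = F" using conn up_F[OF Y(1)] cut1[OF Y(1)] by auto
 thus "Y = {} | Y = F1"
 proof
  assume "up Y = {}" thus ?thesis using x0 by (auto simp: up_def split: if_splits)
 next
  assume u: "up Y = F"
  hence "x0 : Y" using x0F by (auto simp: up_def split: if_splits)
  hence "Y Un X = F" using u by (simp add: up_def)
  hence "F1 <= Y" using \<open>x0 : Y\<close> by (auto simp: F1_def)
  thus ?thesis using Y(1) by blast
 qed
qed

lemma (in contraction) contract_k6:
 assumes conn: "ALL Y<=F. cut' Y = {} --> Y = {} | Y = F" and X2: "2 <= card X"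
  and IH: "!!(F2 :: 'f set) (E2 :: 'e set) bd2. card F2 + card E2 < card F + card E ==> pcx F2 E2 bd2 en ==> bad F2 E2 bd2 en ==>
   ALL Y<=F2. cut E2 bd2 Y = {} --> Y = {} | Y = F2 ==> EX L PP. k6_structure F2 E2 bd2 en L PP"
 shows "EX L PP. k6_structure F E bd en L PP"
proof -
 have "card F1 + card E1 < card F + card E" using card_F1 card_E1 X2 by linarith
 then obtain L PP where "k6_structure F1 E1 bd1 en L PP" using IH[OF _ pcx1 bad1 conn1[OF conn]] by blast
 thus ?thesis using k6_up by blast
qed

lemma (in pcx) no_zero_face:
 assumes bad: "bad F E bd en" and conn: "ALL Y<=F. cut' Y = {} --> Y = {} | Y = F"
 shows "ALL f:F. bd f ~= {}"
proof (intro ballI notI)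
 fix f assume f: "f : F" "bd f = {}"
 hence "{f} = F" using conn[rule_format, of "{f}"] cut_single[OF f(1)] by auto
 hence "pm F E bd {}" using f by (auto simp: pm_def pm_at_def)
 moreover have "E = {}"
 proof (rule ccontr)
  assume "E ~= {}"
  then obtain e where "e : E" by blast
  then obtain g where "g : F" "e : bd g" using two_faces by blast
  thus False using f \<open>{f} = F\<close> by auto
 qed
 hence "is_cob' (E - {})" using is_cob_empty by simp
 ultimately show False using bad by (auto simp: bad_def)
qed

text \<open>A digon is absorbed by a neighbour \<open>g\<close>, and their union has as many
  boundary edges as \<open>g\<close>. If both edges were shared, the remaining boundary would be a
  bridge or empty; in the latter case all of \<open>E\<close> is a matching with empty
  complement.\<close>

lemma (in pcx) digon_contraction:
 assumes bad: "bad F E bd en" and conn: "ALL Y<=F. cut' Y = {} --> Y = {} | Y = F"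
  and f: "f : F" "card (bd f) = 2"
 obtains g where "g : F" "g ~= f" "contraction F E bd en {f, g} f"
proof -
 obtain e1 e2 where e: "bd f = {e1, e2}" "e1 ~= e2" using f(2) by (auto simp: card_2_iff)
 obtain g where g: "g : F" "g ~= f" "e1 : bd g" "{h:F. e1 : bd h} = {f, g}" using other_face[OF f(1), of e1] e by blast
 have XF: "{f, g} <= F" using f g by blast
 have cX: "cut' {f, g} = sym_diff (bd f) (bd g)"
 proof -
  have "cut' ({f} Un {g}) = sym_diff (cut' {f}) (cut' {g})" using f(1) g by (intro cut_Un_disj) auto
  moreover have "{f} Un {g} = {f, g}" by blast
  ultimately show ?thesis using cut_single[OF f(1)] cut_single[OF g(1)] by simp
 qed
 have fg: "finite (bd g)" using fin_bd[OF g(1)] .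
 have cg: "card (bd g) = 2 | card (bd g) = 3" using card_bd[OF g(1)] g(3) fg by auto
 have e2: "e2 ~: bd g"
 proof
  assume e2: "e2 : bd g"
  hence sd: "cut' {f, g} = bd g - {e1, e2}" using cX e g(3) by auto
  hence "card (cut' {f, g}) = card (bd g) - 2" using fg g(3) e2 e(2) by (simp add: card_Diff_subset)
  hence c2: "card (bd g) = 2" using cg bridgeless[OF XF] by auto
  hence "card (cut' {f, g}) = 0" using \<open>card (cut' {f, g}) = card (bd g) - 2\<close> by simp
  hence "cut' {f, g} = {}" using fin_cut by simp
  hence F2: "F = {f, g}" using conn XF by blast
  have "bd g = {e1, e2}" using c2 fg g(3) e2 e(2) by (intro card_seteq[symmetric]) auto
  moreover have "E Int {e1, e2} = {e1, e2}" using bdE[OF f(1)] e(1) by blast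
  ultimately have "pm F E bd E" using F2 e by (simp add: pm_def pm_at_def)
  moreover have "is_cob' (E - E)" using is_cob_empty by simp
  ultimately show False using bad by (auto simp: bad_def)
 qed
 have cX2: "cut' {f, g} = insert e2 (bd g - {e1})" using cX e g(3) e2 by auto
 have inn: "inner' {f, g} = {e1}"
 proof
  show "{e1} <= inner' {f, g}" using inner_two[OF XF g(4)] g(2) by auto
  show "inner' {f, g} <= {e1}"
  proof
   fix x assume x: "x : inner' {f, g}"
   hence xE: "x : E" using inner_E by blast
   obtain a b where ab: "a : F" "b : F" "a ~= b" "x : bd a" "x : bd b" using two_faces[OF xE] by metis
   hence "a : {f, g}" "b : {f, g}" using x inner_iff[OF XF] by blast+
   hence "x : bd f" "x : bd g" using ab by auto
   thus "x : {e1}" using e e2 by auto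
  qed
 qed
 have c: "card (cut' {f, g}) = card (bd g)"
 proof -
  have "card (insert e2 (bd g - {e1})) = Suc (card (bd g - {e1}))" using fg e2 by simp
  also have "... = card (bd g)" using card_Suc_Diff1[OF fg g(3)] .
  finally show ?thesis using cX2 by simp
 qed
 have "contraction F E bd en {f, g} f"
 proof
  show "{f, g} <= F" "f : {f, g}" using XF by auto
  show "card (cut' {f, g}) : {0, 2, 3}" using c cg by auto
  show "bad F E bd en" by (rule bad)
  show "is_cob' z" if z: "cocycle' z" "z <= inner' {f, g}" for z
  proof -
   have "z Int bd f = z" using z(2) inn e by auto
   hence "even (card z)" using z(1) f(1) unfolding cocycle_def by metis
   moreover have "z = {} | z = {e1}" using z(2) inn by auto
   ultimately have "z = {}" by auto
   thus ?thesis using is_cob_empty by simp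
  qed
  show "EX m<=inner' {f, g}. ALL h:{f, g}. pm_at bd (m Un s) h"
   if s: "s <= cut' {f, g}" "if card (cut' {f, g}) = 3 then card s = 1 else even (card s)" for s
  proof -
   define m where "m = (if e2 : s then {e1} else {})"
   have ss: "s <= insert e2 (bd g - {e1})" using s(1) cX2 by simp
   have fs: "finite s" using ss fg finite_subset by blast
   have "(m Un s) Int bd f = (if e2 : s then {e1, e2} else {})" using ss e by (auto simp: m_def)
   hence pf: "pm_at bd (m Un s) f" using f(2) e(2) by (simp add: pm_at_def)
   have "card ((m Un s) Int bd g) = card s"
   proof (cases "e2 : s")
    case True
    hence "(m Un s) Int bd g = insert e1 (s - {e2})" using ss g(3) e2 by (auto simp: m_def)
    moreover have "e1 ~: s - {e2}" using ss by auto
    ultimately have "card ((m Un s) Int bd g) = Suc (card (s - {e2}))" using fs by simp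
    thus ?thesis using card_Suc_Diff1[OF fs True] by simp
   next
    case False
    hence "(m Un s) Int bd g = s" using ss by (auto simp: m_def)
    thus ?thesis by simp
   qed
   hence pg: "pm_at bd (m Un s) g" using s(2) c by (simp add: pm_at_def split: if_splits)
   show ?thesis by (rule exI[of _ m]) (use pf pg inn in \<open>auto simp: m_def\<close>)
  qed
 qed
 thus ?thesis using that g by blast
qed

text \<open>Non-trivial cocycles on opposite sides of a cut would have no face in common, against
  \<open>meet\<close>. So one side of every small cut may be contracted.\<close>

lemma (in pcx) balanced_side:
 assumes X: "X <= F"
 shows "(ALL z. cocycle' z --> z <= inner' X --> is_cob' z) | (ALL z. cocycle' z --> z <= inner' (F - X) --> is_cob' z)"
proof (rule ccontr)
 assume "~ ?thesis"
 then obtain z y where z: "cocycle' z" "z <= inner' X" "~ is_cob' z" and y: "cocycle' y" "y <= inner' (F - X)" "~ is_cob' y" by blast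
 obtain f where f: "f : F" "z Int bd f ~= {}" "y Int bd f ~= {}" using meet[OF z(1) y(1) z(3) y(3)] by blast
 hence "f : X" using z(2) inner_iff[OF X] by blast
 moreover have "f : F - X" using f y(2) inner_iff[of "F - X"] by blast
 ultimately show False by blast
qed

text \<open>An admissible trace has \<open>card (cut' X) + card s <= 4\<close>, within the bound of
  \<open>pm_exists\<close>. A face with two edges of \<open>s\<close> would absorb a whole 2-cut and
  leave a bridge.\<close>

lemma (in cubic_cx) small_cut_contraction:
 assumes p: "pcx F E bd en" and bad: "bad F E bd en" and conn: "ALL Y<=F. cut' Y = {} --> Y = {} | Y = F"
  and X: "X <= F" "card (cut' X) <= 3" "2 <= card X" "2 <= card (F - X)" and x0: "x0 : X"
  and bal: "ALL z. cocycle' z --> z <= inner' X --> is_cob' z"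
 shows "contraction F E bd en X x0"
proof -
 interpret p: pcx F E bd en by (rule p)
 have br: "ALL Y<=F. card (cut' Y) ~= 1" using p.bridgeless by blast
 have "X ~= {}" "X ~= F" using X by auto
 hence "cut' X ~= {}" using conn X(1) by blast
 hence "card (cut' X) ~= 0" using fin_cut by simp
 moreover have "card (cut' X) ~= 1" using br X(1) by blast
 ultimately have c23: "card (cut' X) = 2 | card (cut' X) = 3" using X(2) by linarith
 show ?thesis
 proof
  show "X <= F" "x0 : X" by (rule X(1), rule x0)
  show "card (cut' X) : {0, 2, 3}" using c23 by auto
  show "bad F E bd en" by (rule bad)
  show "is_cob' z" if "cocycle' z" "z <= inner' X" for z using bal that by blast
  show "EX m<=inner' X. ALL f:X. pm_at bd (m Un s) f"
   if s: "s <= cut' X" "if card (cut' X) = 3 then card s = 1 else even (card s)" for s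
  proof -
   have cs: "card s <= card (cut' X)" using s(1) fin_cut by (intro card_mono) auto
   have fs: "finite s" using s(1) fin_cut finite_subset by blast
   have s2: "card s <= 2" "card (cut' X) + card s < 6" using c23 s(2) cs by auto
   have one: "card (s Int bd f) <= 1" if f: "f : X" for f
   proof (rule ccontr)
    assume n: "~ card (s Int bd f) <= 1"
    have le: "card (s Int bd f) <= card s" using fs by (intro card_mono) auto
    have c2: "card (cut' X) = 2" using c23 s(2) n le by auto
    have "card (s Int bd f) = 2" using n le s2 by simp
    have fF: "f : F" using f X(1) by blast
    have "s Int bd f = cut' X" using \<open>card (s Int bd f) = 2\<close> c2 s(1) fin_cut by (intro card_seteq) auto
    hence sub: "cut' X <= bd f" by blast
    have "cut' (F - X Un {f}) = sym_diff (cut' (F - X)) (cut' {f})" using f fF by (intro cut_Un_disj) auto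
    also have "... = bd f - cut' X" using cut_compl[OF X(1)] cut_single[OF fF] sub by auto
    finally have "card (cut' (F - X Un {f})) = 1"
     using sub c2 cubic[OF fF] fin_cut by (simp add: card_Diff_subset)
    moreover have "F - X Un {f} <= F" using fF by blast
    ultimately show False using br by blast
   qed
   have ev: "even (card X + card s)" using cut_parity[OF X(1)] c23 s(2) by auto
   obtain m where m: "m <= inner' X - {}" "ALL f:X. card ((m Un s) Int bd f) = 1"
    using pm_exists[OF br X(1) s(1) one ev, of "{}"] s2(2) by auto
   have "pm_at bd (m Un s) f" if "f : X" for f
    using m(2) that cubic[of f] X(1) by (auto simp: pm_at_def)
   thus ?thesis using m(1) by blast
  qed
 qed
qed

text \<open>The measure adds faces and edges because contraction lowers the number of faces without
  raising that of edges, while the reduction keeps the faces and deletes edges.\<close>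

theorem k6_exists:
 fixes F :: "'f set" and E :: "'e set" and en :: "'e => 'v set"
 assumes "pcx F E bd en" "bad F E bd en" "ALL Y<=F. cut E bd Y = {} --> Y = {} | Y = F"
 shows "EX L PP. k6_structure F E bd en L PP"
 using assms
proof (induction "card F + card E" arbitrary: F E bd en rule: less_induct)
 case less
 interpret p: pcx F E bd en by (rule less.prems)
 note bad = less.prems(2) and conn = less.prems(3)
 have nz: "ALL f:F. bd f ~= {}" using p.no_zero_face[OF bad conn] .
 show ?case
 proof (cases "EX f:F. card (bd f) = 2")
  case True
  then obtain f where f: "f : F" "card (bd f) = 2" by blast
  obtain g where g: "g : F" "g ~= f" "contraction F E bd en {f, g} f" using p.digon_contraction[OF bad conn f] by blast
  have "2 <= card {f, g}" using g(2) by simp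
  thus ?thesis using contraction.contract_k6[OF g(3) conn _ less.hyps] by blast
 next
  case False
  have all3: "card (bd f) = 3" if "f : F" for f
  proof -
   have "card (bd f) ~= 0" using nz that p.fin_bd[OF that] by simp
   thus ?thesis using p.card_bd[OF that] False that by auto
  qed
  interpret c: cubic_cx F E bd en using all3 by unfold_locales
  show ?thesis
  proof (cases "EX X<=F. card (cut E bd X) <= 3 & 2 <= card X & 2 <= card (F - X)")
   case True
   then obtain X where X: "X <= F" "card (cut E bd X) <= 3" "2 <= card X" "2 <= card (F - X)" by blast
   have "EX X<=F. card (cut E bd X) <= 3 & 2 <= card X & 2 <= card (F - X) &
    (ALL z. cocycle F E bd z --> z <= inner E bd X --> is_cob E en z)"
    using p.balanced_side[OF X(1)]
   proof
    assume "ALL z. cocycle F E bd z --> z <= inner E bd X --> is_cob E en z"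
    thus ?thesis using X by blast
   next
    assume b: "ALL z. cocycle F E bd z --> z <= inner E bd (F - X) --> is_cob E en z"
    have "F - (F - X) = X" using X(1) by blast
    thus ?thesis using b X p.cut_compl[OF X(1)] by (intro exI[of _ "F - X"]) auto
   qed
   then obtain X where X: "X <= F" "card (cut E bd X) <= 3" "2 <= card X" "2 <= card (F - X)"
    "ALL z. cocycle F E bd z --> z <= inner E bd X --> is_cob E en z" by blast
   obtain x0 where x0: "x0 : X" using X(3) by (metis card.empty ex_in_conv not_numeral_le_zero)
   have "contraction F E bd en X x0"
    by (rule c.small_cut_contraction[OF less.prems(1) bad conn X(1-4) x0 X(5)])
   thus ?thesis using contraction.contract_k6[OF _ conn X(3) less.hyps] by blast
  next
   case no: False
   interpret t: tight F E bd en
   proof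
    show "card (bd f) = 3" if "f : F" for f using all3[OF that] .
    show "card X <= 1 | card (F - X) <= 1" if h: "X <= F" "card (cut E bd X) <= 3" for X
    proof (rule ccontr)
     assume "~ ?thesis"
     hence "2 <= card X" "2 <= card (F - X)" by auto
     thus False using no h by blast
    qed
    show "bad F E bd en" by (rule bad)
   qed
   have "mincx F E bd en"
   proof
    fix Z Z0 r assume red: "reduction F E bd en Z Z0 r" and ne: "Z0 ~= {}"
     and conn0: "ALL Y<=F. cut E bd Y - Z0 = {} --> Y = {} | Y = F"
    interpret rd: reduction F E bd en Z Z0 r by (rule red)
    have en1: "rd.en1 = (%e. {w. odd (card {a:en e. r a = w})})" by (rule ext) (simp add: rd.en1_def)
    have bd1: "rd.bd1 = (%f. bd f - Z0)" by (rule ext) (simp add: rd.bd1_def)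
    have "Z0 <= E" using rd.Z0 rd.Z_E by blast
    hence "rd.E1 \<subset> E" using ne by (auto simp: rd.E1_def)
    hence "card rd.E1 < card E" using p.finE by (intro psubset_card_mono)
    moreover have "ALL Y<=F. cut rd.E1 rd.bd1 Y = {} --> Y = {} | Y = F" using conn0 rd.cut1 by auto
    ultimately have "EX L PP. k6_structure F rd.E1 rd.bd1 rd.en1 L PP"
     using less.hyps[OF _ rd.pcx1 rd.bad1] by simp
    thus "EX L PP. k6_structure F (E - Z0) (%f. bd f - Z0) (%e. {w. odd (card {a:en e. r a = w})}) L PP"
     unfolding en1 bd1 rd.E1_def .
   qed
   thus ?thesis by (rule mincx.mincx_k6)
  qed
 qed
qed

lemma edge_pairs: "e : edges G ==> e : pairs f \<longleftrightarrow> e <= f" by (simp add: pairs_def edges_def)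

lemma card_3_other: assumes "card f = 3" "v : f" "x : f" "x ~= v" "y : f" "y ~= v" "x ~= y" shows "f = {v, x, y}"
proof -
 have "finite f" using assms(1) by (metis card.infinite zero_neq_numeral)
 moreover have "card {v, x, y} = 3" using assms by auto
 ultimately show ?thesis using assms by (intro card_subset_eq[symmetric]) auto
qed

lemma card_3_ex: assumes "card f = 3" "v : f" shows "EX x:f. x ~= v"
proof (rule ccontr)
 assume "~ ?thesis"
 hence "f = {v}" using assms(2) by blast
 thus False using assms(1) by simp
qed

lemma third_arith: "s = (if ex then 1 else 0) | s = 2 & ~ ex ==> s + t <= 2 ==> (ex \<longleftrightarrow> t ~= 0) ==>
  t <= 1 & (odd s \<longleftrightarrow> t = (1 :: nat))"
 by (cases ex) auto

section \<open>Triangulated surfaces\<close>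

locale surf = fixes G :: "'a set set" assumes surf: "surface_tri G"
begin

lemma fin_G: "finite G" and ne_G: "G ~= {}" and card_face: "f : G ==> card f = 3"
 and two_G: "e : edges G ==> card {f:G. e <= f} = 2"
 using surf by (auto simp: surface_tri_def)

lemma fin_face: "f : G ==> finite f" using card_face by (metis card.infinite zero_neq_numeral)

lemma fin_edges: "finite (edges G)"
proof -
 have "edges G <= Pow (\<Union>G)" by (auto simp: edges_def)
 thus ?thesis using fin_G fin_face by (meson finite_Pow_iff finite_Union finite_subset)
qed

lemma pairs_edges: "f : G ==> pairs f <= edges G" by (auto simp: pairs_def edges_def)

lemma card_pairs_face: "f : G ==> card (pairs f) = 3"
 using card_pairs[OF fin_face] card_face by (simp add: numeral_eq_Suc)

end

sublocale surf \<subseteq> cubic_cx G "edges G" pairs "%e. e"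
proof
 show "finite G" "finite (edges G)" by (rule fin_G, rule fin_edges)
 show "pairs f <= edges G" if "f : G" for f using pairs_edges[OF that] .
 show "card {f:G. e : pairs f} = 2" if "e : edges G" for e
  using two_G[OF that] edge_pairs[OF that] by simp
 show "card (pairs f) : {0, 2, 3}" "card (pairs f) = 3" if "f : G" for f using card_pairs_face[OF that] by auto
 show "e = {} | card e = 2" if "e : edges G" for e using that by (simp add: edges_def)
 show "even (card {e:pairs f. v : e})" if "f : G" for f v using pairs_3_even[OF card_face[OF that]] .
qed

context surf
begin

lemma cutI: "Y <= G ==> e : edges G ==> f : Y ==> e <= f ==> g : G - Y ==> e <= g ==> e : cut' Y"
 using cut_iff[of Y e] edge_pairs[of e G] by blast

lemma cutE:
 assumes "e : cut' Y" "Y <= G"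
 obtains f g where "e : edges G" "f : Y" "e <= f" "g : G - Y" "e <= g"
 using assms cut_iff[of Y e] edge_pairs[of e G] by blast

lemma face_edge: "f : G ==> a : f ==> b : f ==> a ~= b ==> {a, b} : edges G"
 by (auto simp: edges_def)

lemma edge_at: assumes "e : edges G" "v : e" obtains z where "z ~= v" "e = {v, z}"
 using card2_mem[of e v] assms by (auto simp: edges_def)

lemma link:
 assumes Y: "Y <= G" and f: "f : Y" "v : f" and g: "g : G - Y" "v : g"
 shows "EX e:cut' Y. v : e"
proof (rule ccontr)
 assume n: "~ ?thesis"
 have key: "k : Y" if "{v, z} <= h" "h : Y" "{v, z} <= k" "k : G" "z ~= v" for h k z
 proof (rule ccontr)
  assume "k ~: Y"
  have "{v, z} : edges G" using that Y by (intro face_edge[of h]) auto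
  hence "{v, z} : cut' Y" using that \<open>k ~: Y\<close> Y by (intro cutI[of Y "{v, z}" h k]) auto
  thus False using n by blast
 qed
 have fG: "f : G" using f Y by blast
 obtain x where x: "x : f" "x ~= v" using card_3_ex[OF card_face[OF fG] f(2)] by blast
 have gG: "g : G" using g by blast
 obtain y where y: "y : g" "y ~= v" using card_3_ex[OF card_face[OF gG] g(2)] by blast
 have "x : \<Union>(link_edges G v)" using x f fG by (auto simp: link_edges_def)
 moreover have "y : \<Union>(link_edges G v)" using y g by (auto simp: link_edges_def)
 moreover have "v : verts G" using f fG by (auto simp: verts_def)
 ultimately have r: "(%a b. {a, b} : link_edges G v)\<^sup>*\<^sup>* x y"
  using surf unfolding surface_tri_def by blast
 hence "ALL k:G. {v, y} <= k --> k : Y"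
  using y(2)
 proof (induction rule: rtranclp_induct)
  case base
  thus ?case using key[of x f] x f by blast
 next
  case (step a b)
  obtain h where h: "h : G" "v : h" "{a, b} = h - {v}" using step.hyps(2) by (auto simp: link_edges_def)
  have ab: "a : h" "a ~= v" "b : h" "b ~= v" using h(3) by blast+
  hence "h : Y" using step.IH h by blast
  thus ?case using key[of b h] h ab by blast
 qed
 thus False using g y by blast
qed

lemma conn_G: "ALL Y<=G. cut' Y = {} --> Y = {} | Y = G"
proof (intro allI impI)
 fix Y assume Y: "Y <= G" "cut' Y = {}"
 show "Y = {} | Y = G"
 proof (rule ccontr)
  assume n: "~ ?thesis"
  then obtain f g where fg: "f : Y" "g : G - Y" using Y(1) by blast
  have no: "~ (v : h & v : k)" if "h : Y" "k : G - Y" for v h k using link[OF Y(1)] Y(2) that by blast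
  have ne: "h ~= {}" if "h : G" for h using card_face[OF that] by auto
  obtain x where x: "x : f" using ne fg(1) Y(1) by blast
  obtain y where y: "y : g" using ne fg(2) by blast
  have "x : verts G" "y : verts G" using x y fg Y(1) by (auto simp: verts_def)
  hence "(adj G)\<^sup>*\<^sup>* x y" using surf unfolding surface_tri_def by blast
  hence "EX h:Y. y : h"
  proof (induction rule: rtranclp_induct)
   case base thus ?case using x fg by blast
  next
   case (step a b)
   obtain h where h: "h : G" "{a, b} <= h" using step.hyps(2) by (auto simp: adj_def edges_def)
   obtain k where "k : Y" "a : k" using step.IH by blast
   hence "h : Y" using no[of k h a] h by blast
   thus ?case using h by blast
  qed
  thus False using no fg(2) y by blast
 qed
qed

lemma bridgeless_G: "X <= G ==> card (cut' X) ~= 1"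
proof
 assume X: "X <= G" "card (cut' X) = 1"
 then obtain e where e: "cut' X = {e}" by (auto simp: card_1_singleton_iff)
 hence "e : edges G" using cut_E by blast
 then obtain v where "v : e" by (auto simp: edges_def card_2_iff)
 hence "{x:cut' X. v : x} = {e}" using e by blast
 hence "card {x:cut' X. v : x} = 1" by simp
 thus False using closed_cut[OF X(1)] unfolding closed_def by (metis odd_one)
qed

end

text \<open>Connectedness of links and of the graph is restated through cuts of face sets, the form
  that passes to quotients. The hypotheses are applied to the set of faces reached so far.\<close>

lemma surface_triI:
 assumes fin: "finite G" and ne: "G ~= {}" and c3: "ALL f:G. card f = 3"
  and two: "ALL e:edges G. card {f:G. e <= f} = 2"
  and LC: "!!Y f g v. Y <= G ==> f : Y ==> g : G - Y ==> v : f ==> v : g ==>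
    EX e:edges G. v : e & (EX h:Y. e <= h) & (EX k:G - Y. e <= k)"
  and FC: "!!Y. Y <= G ==> Y ~= {} ==> Y ~= G ==> EX e:edges G. (EX h:Y. e <= h) & (EX k:G - Y. e <= k)"
 shows "surface_tri G"
 unfolding surface_tri_def
proof (intro conjI)
 show "ALL v:verts G. ALL x:\<Union>(link_edges G v). ALL y:\<Union>(link_edges G v). (%a b. {a, b} : link_edges G v)\<^sup>*\<^sup>* x y"
 proof (intro ballI)
  fix v x y assume "v : verts G" and x: "x : \<Union>(link_edges G v)" and y: "y : \<Union>(link_edges G v)"
  let ?r = "%a b. {a, b} : link_edges G v"
  obtain f0 where f0: "f0 : G" "v : f0" "x : f0 - {v}" using x by (auto simp: link_edges_def)
  obtain g where g: "g : G" "v : g" "y : g - {v}" using y by (auto simp: link_edges_def)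
  define Y where "Y = {f:G. v : f & (EX z:f - {v}. ?r\<^sup>*\<^sup>* x z)}"
  have all: "?r\<^sup>*\<^sup>* x z" if h: "h : Y" "z : h - {v}" for h z
  proof -
   obtain w where w: "h : G" "v : h" "w : h - {v}" "?r\<^sup>*\<^sup>* x w" using h(1) by (auto simp: Y_def)
   show ?thesis
   proof (cases "w = z")
    case False
    have "h = {v, w, z}" using card_3_other[of h v w z] c3 w h(2) False by blast
    hence "h - {v} = {w, z}" using w h(2) by auto
    hence "?r w z" using w by (auto simp: link_edges_def)
    thus ?thesis using w(4) by (rule rtranclp.rtrancl_into_rtrancl[rotated])
   qed (use w in simp)
  qed
  show "?r\<^sup>*\<^sup>* x y"
  proof (cases "g : Y")
   case True thus ?thesis using all g by blast
  next
   case False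
   have YG: "Y <= G" by (auto simp: Y_def)
   have "f0 : Y" using f0 by (auto simp: Y_def)
   then obtain e h k where e: "e : edges G" "v : e" "h : Y" "e <= h" "k : G - Y" "e <= k"
    using LC[OF YG, of f0 g v] f0 g False by blast
   obtain z where z: "z ~= v" "e = {v, z}" using card2_mem[of e v] e by (auto simp: edges_def)
   hence "?r\<^sup>*\<^sup>* x z" using all[OF e(3), of z] e by blast
   hence "k : Y" using e z by (auto simp: Y_def)
   thus ?thesis using e by blast
  qed
 qed
 show "ALL x:verts G. ALL y:verts G. (adj G)\<^sup>*\<^sup>* x y"
 proof (intro ballI)
  fix x y assume x: "x : verts G" and y: "y : verts G"
  let ?r = "adj G"
  define Y where "Y = {f:G. EX z:f. ?r\<^sup>*\<^sup>* x z}"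
  have all: "?r\<^sup>*\<^sup>* x z" if h: "h : Y" "z : h" for h z
  proof -
   obtain w where w: "h : G" "w : h" "?r\<^sup>*\<^sup>* x w" using h(1) by (auto simp: Y_def)
   show ?thesis
   proof (cases "w = z")
    case False
    hence "?r w z" using w h(2) by (auto simp: adj_def edges_def)
    thus ?thesis using w(3) by (rule rtranclp.rtrancl_into_rtrancl[rotated])
   qed (use w in simp)
  qed
  obtain f0 where f0: "f0 : G" "x : f0" using x by (auto simp: verts_def)
  have "f0 : Y" using f0 by (auto simp: Y_def)
  have YG: "Y <= G" by (auto simp: Y_def)
  have "Y = G"
  proof (rule ccontr)
   assume "Y ~= G"
   then obtain e h k where e: "e : edges G" "h : Y" "e <= h" "k : G - Y" "e <= k"
    using FC[OF YG] \<open>f0 : Y\<close> by blast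
   obtain z where z: "z : e" using e(1) by (auto simp: edges_def card_2_iff)
   hence "?r\<^sup>*\<^sup>* x z" using all[OF e(2), of z] e by blast
   hence "k : Y" using e z by (auto simp: Y_def)
   thus False using e by blast
  qed
  moreover obtain g where "g : G" "y : g" using y by (auto simp: verts_def)
  ultimately show "?r\<^sup>*\<^sup>* x y" using all by blast
 qed
qed (use assms in auto)

text \<open>Cardinalities take the place of dimensions over the field with two elements: all
  non-empty fibres of the map are cosets of \<open>K\<close>.\<close>

lemma card_fibres:
 assumes A: "finite A" and K: "K <= Pow A"
  and eq: "!!S S'. S <= A ==> S' <= A ==> \<phi> S = \<phi> S' \<longleftrightarrow> sym_diff S S' : K"
 shows "2 ^ card A = card K * card (\<phi> ` Pow A)"
proof -
 have fib: "card {S:Pow A. \<phi> S = y} = card K" if y: "y : \<phi> ` Pow A" for y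
 proof -
  obtain S0 where S0: "S0 <= A" "y = \<phi> S0" using y by blast
  have "{S:Pow A. \<phi> S = y} = (%T. sym_diff S0 T) ` K"
  proof
   show "{S:Pow A. \<phi> S = y} <= (%T. sym_diff S0 T) ` K"
   proof
    fix S assume S: "S : {S:Pow A. \<phi> S = y}"
    hence "sym_diff S0 S : K" using eq[of S0 S] S0 by auto
    moreover have "S = sym_diff S0 (sym_diff S0 S)" by blast
    ultimately show "S : (%T. sym_diff S0 T) ` K" by blast
   qed
   show "(%T. sym_diff S0 T) ` K <= {S:Pow A. \<phi> S = y}"
   proof
    fix S assume "S : (%T. sym_diff S0 T) ` K"
    then obtain T where T: "T : K" "S = sym_diff S0 T" by blast
    have SA: "S <= A" using T K S0 by blast
    have "sym_diff S0 S = T" unfolding T(2) by blast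
    hence "\<phi> S0 = \<phi> S" using eq[OF S0(1) SA] T by simp
    thus "S : {S:Pow A. \<phi> S = y}" using SA S0 by simp
   qed
  qed
  moreover have "inj_on (%T. sym_diff S0 T) K" by (rule inj_onI) blast
  ultimately show ?thesis by (simp add: card_image)
 qed
 have "(2::nat) ^ card A = card (Pow A)" by (simp add: card_Pow A)
 also have "... = (SUM S:Pow A. 1)" by simp
 also have "... = (SUM y:\<phi> ` Pow A. SUM S:{S:Pow A. \<phi> S = y}. 1)" using A by (intro sum.image_gen) simp
 also have "... = (SUM y:\<phi> ` Pow A. card K)" using fib by (intro sum.cong) auto
 finally show ?thesis by simp
qed

section \<open>Counting coboundaries and cocycles\<close>

context surf
begin

definition "Bs = cob' ` Pow (verts G)"
definition "Zs = {z. cocycle' z}"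

lemma fin_verts: "finite (verts G)" unfolding verts_def using fin_G fin_face by blast

lemma cob_V: "cob' Q = cob' (Q Int verts G)"
proof -
 have "e Int Q = e Int (Q Int verts G)" if "e : edges G" for e using that by (auto simp: edges_def verts_def)
 thus ?thesis by (auto simp: cob_def)
qed

lemma is_cob_Bs: "is_cob' z \<longleftrightarrow> z : Bs" unfolding is_cob_def Bs_def using cob_V by blast

lemma cob_mem: "{a, b} : edges G ==> {a, b} : cob' Q \<longleftrightarrow> (a : Q \<longleftrightarrow> b ~: Q)"
proof -
 assume e: "{a, b} : edges G"
 hence "a ~= b" by (auto simp: edges_def)
 moreover have "{a, b} Int Q = (if a : Q then {a} else {}) Un (if b : Q then {b} else {})" by auto
 ultimately show ?thesis using e by (auto simp: cob_def)
qed

lemma cob_eI: "a : f ==> b : f ==> f : G ==> a : Q ==> b ~: Q ==> {a, b} : cob' Q Int pairs f"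
 using cob_mem[of a b Q] face_edge[of f a b] by (cases "a = b") (auto simp: pairs_def)

lemma cob_trivial: assumes "Q <= verts G" "cob' Q = {}" shows "Q = {} | Q = verts G"
proof -
 have sub: "f <= Q" if f: "f : G" "a : f" "a : Q" for f a
 proof (rule ccontr)
  assume "~ f <= Q"
  then obtain b where "b : f" "b ~: Q" by blast
  thus False using cob_eI[of a f b Q] f assms(2) by blast
 qed
 define Y where "Y = {f:G. f Int Q ~= {}}"
 have "cut' Y = {}"
 proof (rule ccontr)
  assume "cut' Y ~= {}"
  then obtain e where "e : cut' Y" by blast
  then obtain f g where fg: "e : edges G" "f : Y" "e <= f" "g : G - Y" "e <= g"
   by (rule cutE) (auto simp: Y_def)
  have "f <= Q" using sub fg(2) by (auto simp: Y_def)
  moreover have "e ~= {}" using fg(1) by (auto simp: edges_def)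
  ultimately show False using fg by (auto simp: Y_def)
 qed
 moreover have "Y <= G" by (auto simp: Y_def)
 ultimately have "Y = {} | Y = G" using conn_G by blast
 thus ?thesis
 proof
  assume "Y = {}" thus ?thesis using assms(1) by (auto simp: Y_def verts_def)
 next
  assume YG: "Y = G"
  have "verts G <= Q" unfolding verts_def
  proof
   fix x assume "x : \<Union>G"
   then obtain f where f: "f : G" "x : f" by blast
   hence "f : Y" using YG by blast
   thus "x : Q" using sub f by (auto simp: Y_def)
  qed
  thus ?thesis using assms(1) by blast
 qed
qed

text \<open>By connectedness the kernel of the coboundary map consists of the empty set and the set
  of all vertices.\<close>

lemma card_Bs: "2 ^ card (verts G) = 2 * card Bs"
proof -
 have V: "verts G ~= {}" using ne_G card_face unfolding verts_def by fastforce
 have "2 ^ card (verts G) = card {{}, verts G} * card (cob' ` Pow (verts G))"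
 proof (rule card_fibres[OF fin_verts])
  show "{{}, verts G} <= Pow (verts G)" by blast
  fix S S' assume S: "S <= verts G" "S' <= verts G"
  have "cob' S = cob' S' \<longleftrightarrow> sym_diff (cob' S) (cob' S') = {}" by blast
  also have "... \<longleftrightarrow> cob' (sym_diff S S') = {}" by (simp only: cob_sd)
  also have "... \<longleftrightarrow> sym_diff S S' : {{}, verts G}"
  proof
   assume "cob' (sym_diff S S') = {}"
   thus "sym_diff S S' : {{}, verts G}" using cob_trivial[of "sym_diff S S'"] S by blast
  next
   assume "sym_diff S S' : {{}, verts G}"
   moreover have "cob' {} = {}" by (simp add: cob_def)
   moreover have "cob' (verts G) = {}"
   proof -
    have "even (card (e Int verts G))" if "e : edges G" for e
    proof -
     have "e Int verts G = e" using that by (auto simp: edges_def verts_def)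
     thus ?thesis using that by (simp add: edges_def)
    qed
    thus ?thesis by (auto simp: cob_def)
   qed
   ultimately show "cob' (sym_diff S S') = {}" by auto
  qed
  finally show "cob' S = cob' S' \<longleftrightarrow> sym_diff S S' : {{}, verts G}" .
 qed
 thus ?thesis using V by (simp add: Bs_def)
qed

definition "Ev = {Y. Y <= G & even (card Y)}"

lemma card_Ev: "2 ^ card G = card Ev * 2"
proof -
 have "2 ^ card G = card Ev * card ((%S. even (card S)) ` Pow G)"
 proof (rule card_fibres[OF fin_G])
  show "Ev <= Pow G" by (auto simp: Ev_def)
  fix S S' assume S: "S <= G" "S' <= G"
  hence "finite S" "finite S'" using fin_G finite_subset by blast+
  thus "even (card S) = even (card S') \<longleftrightarrow> sym_diff S S' : Ev"
   using S even_card_sym_diff[of S S'] by (auto simp: Ev_def)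
 qed
 moreover have "(%S. even (card S)) ` Pow G = {True, False}"
 proof -
  obtain f where "f : G" using ne_G by blast
  hence "False : (%S. even (card S)) ` Pow G" by (intro image_eqI[of _ _ "{f}"]) auto
  moreover have "True : (%S. even (card S)) ` Pow G" by (intro image_eqI[of _ _ "{}"]) auto
  ultimately show ?thesis by blast
 qed
 ultimately show ?thesis by simp
qed

definition "phi z = {f:G. odd (card (z Int pairs f))}"

lemma phi_sd: assumes "z <= edges G" "y <= edges G" shows "phi (sym_diff z y) = sym_diff (phi z) (phi y)"
proof -
 have f: "finite z" "finite y" using assms fin_edges finite_subset by blast+
 have "even (card (sym_diff z y Int pairs h)) \<longleftrightarrow> (even (card (z Int pairs h)) \<longleftrightarrow> even (card (y Int pairs h)))" for h
  unfolding sym_diff_Int using f by (subst even_card_sym_diff) auto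
 thus ?thesis by (auto simp: phi_def)
qed

text \<open>Every edge lies on two faces, so each edge set meets an even number of faces oddly;
  conversely dual paths realise every pair of faces.\<close>

lemma phi_surj: "phi ` Pow (edges G) = Ev"
proof
 show "phi ` Pow (edges G) <= Ev"
 proof
  fix Y assume "Y : phi ` Pow (edges G)"
  then obtain z where z: "z <= edges G" "Y = phi z" by blast
  have "(SUM f:G. card (z Int pairs f)) = 2 * card (z Int inner' G) + card (z Int cut' G)" using handshake[OF order_refl z(1)] .
  hence "even (SUM f:G. card (z Int pairs f))" using cut_F by simp
  thus "Y : Ev" using z(2) fin_G by (simp add: Ev_def phi_def even_sum_iff)
 qed
 have "Y : phi ` Pow (edges G)" if "n = card Y" "Y <= G" "even (card Y)" for n Y
  using that
 proof (induction n arbitrary: Y rule: less_induct)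
  case (less n)
  show ?case
  proof (cases "Y = {}")
   case True
   have "phi {} = {}" by (simp add: phi_def)
   thus ?thesis using True by blast
  next
   case False
   have fY: "finite Y" using less.prems(2) fin_G finite_subset by blast
   obtain f where f: "f : Y" using False by blast
   obtain g where g: "g : Y" "g ~= f" using even_card_other[OF less.prems(3) f] by blast
   define Y' where "Y' = Y - {f, g}"
   have c: "card Y' + 2 = card Y"
   proof -
    have "card Y' = card Y - card {f, g}" unfolding Y'_def using f g by (intro card_Diff_subset) auto
    moreover have "card {f, g} <= card Y" using f g fY by (intro card_mono) auto
    ultimately show ?thesis using g(2) by simp
   qed
   have "even (card Y')" using c less.prems(3) by (metis even_add even_numeral)
   moreover have "Y' <= G" using less.prems(2) by (auto simp: Y'_def)
   ultimately have "Y' : phi ` Pow (edges G)" using less.IH[of "card Y'" Y'] c less.prems(1) by simp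
   then obtain z where z: "z <= edges G" "Y' = phi z" by blast
   have fgG: "f : G" "g : G" using f g less.prems(2) by blast+
   obtain p where p: "join f g p" using join_ex[OF conn_G fgG] by blast
   have pE: "p <= edges G" using p by (simp add: join_def)
   have "phi p = {f, g}" using p fgG g(2) by (auto simp: join_def phi_def)
   hence "phi (sym_diff z p) = sym_diff Y' {f, g}" using phi_sd[OF z(1) pE] z(2) by simp
   also have "... = Y" using f g by (auto simp: Y'_def)
   finally show ?thesis using z(1) pE by (intro image_eqI[of _ _ "sym_diff z p"]) auto
  qed
 qed
 thus "Ev <= phi ` Pow (edges G)" by (auto simp: Ev_def)
qed

lemma Zs_phi: "z : Zs \<longleftrightarrow> z <= edges G & phi z = {}" by (auto simp: Zs_def cocycle_def phi_def)

lemma card_Zs: "2 ^ card (edges G) = card Zs * card Ev"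
proof -
 have "2 ^ card (edges G) = card Zs * card (phi ` Pow (edges G))"
 proof (rule card_fibres[OF fin_edges])
  show "Zs <= Pow (edges G)" using Zs_phi by blast
  fix S S' assume S: "S <= edges G" "S' <= edges G"
  have "sym_diff S S' : Zs \<longleftrightarrow> phi (sym_diff S S') = {}" using Zs_phi S by blast
  also have "... \<longleftrightarrow> phi S = phi S'" unfolding phi_sd[OF S] by blast
  finally show "phi S = phi S' \<longleftrightarrow> sym_diff S S' : Zs" by simp
 qed
 thus ?thesis using phi_surj by simp
qed

lemma Bs_Zs: "Bs <= Zs" using cob_cocycle by (auto simp: Bs_def Zs_def)

lemma fin_Zs: "finite Zs" using Zs_phi fin_edges by (meson Pow_iff finite_Pow_iff finite_subset subsetI)

lemma dim_eq: "2 ^ (card (edges G) + 2) = 2 * card Zs * 2 ^ card G"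
 using card_Zs card_Ev by simp

text \<open>Coboundaries have dimension V - 1 and cocycles E - F + 1, so their index has exponent 2
  minus the Euler characteristic. The inclusion makes this non-negative; the values 0 and 1 give
  \<open>plane_cob\<close> and \<open>proj_index2\<close>.\<close>

lemma chi_le2: "euler_char G <= 2"
proof -
 have "card Bs <= card Zs" using Bs_Zs fin_Zs by (rule card_mono[rotated])
 hence "2 ^ card (verts G) * 2 ^ card G <= 2 * card Zs * 2 ^ card G" using card_Bs by simp
 hence "(2::nat) ^ (card (verts G) + card G) <= 2 * card Zs * 2 ^ card G" by (simp only: power_add)
 hence "(2::nat) ^ (card (verts G) + card G) <= 2 ^ (card (edges G) + 2)" by (simp only: dim_eq)
 hence "card (verts G) + card G <= card (edges G) + 2" by (rule power_le_imp_le_exp[rotated]) simp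
 thus ?thesis by (simp add: euler_char_def)
qed

lemma plane_cob: assumes "euler_char G = 2" "cocycle' z" shows "is_cob' z"
proof -
 have "card (verts G) + card G = card (edges G) + 2" using assms(1) by (simp add: euler_char_def)
 hence "2 ^ card (verts G) * 2 ^ card G = 2 * card Zs * 2 ^ card G" unfolding dim_eq[symmetric] power_add[symmetric] by simp
 hence "card Bs = card Zs" using card_Bs by simp
 hence "Bs = Zs" using card_subset_eq[OF fin_Zs Bs_Zs] by simp
 thus ?thesis using assms(2) is_cob_Bs by (simp add: Zs_def)
qed

lemma proj_index2:
 assumes chi: "euler_char G = 1" and z: "cocycle' z" "~ is_cob' z" and y: "cocycle' y" "~ is_cob' y"
 shows "is_cob' (sym_diff z y)"
proof -
 have "card (verts G) + card G + 1 = card (edges G) + 2" using chi by (simp add: euler_char_def)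
 hence "2 ^ card (verts G) * 2 ^ card G * 2 = 2 * card Zs * 2 ^ card G"
  unfolding dim_eq[symmetric] by (metis power_add power_one_right)
 hence c2: "card Zs = 2 * card Bs" using card_Bs by simp
 define B2 where "B2 = (%b. sym_diff z b) ` Bs"
 have fB: "finite Bs" using Bs_Zs fin_Zs finite_subset by blast
 have "inj_on (%b. sym_diff z b) Bs" by (rule inj_onI) blast
 hence cB: "card B2 = card Bs" by (simp add: B2_def card_image)
 have dj: "Bs Int B2 = {}"
 proof (rule ccontr)
  assume "Bs Int B2 ~= {}"
  then obtain b where b: "b : Bs" "sym_diff z b : Bs" by (auto simp: B2_def)
  hence "is_cob' (sym_diff (sym_diff z b) b)" using is_cob_sd is_cob_Bs by blast
  moreover have "sym_diff (sym_diff z b) b = z" by blast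
  ultimately show False using z(2) by simp
 qed
 have "B2 <= Zs"
 proof
  fix x assume "x : B2"
  then obtain b where b: "b : Bs" "x = sym_diff z b" by (auto simp: B2_def)
  hence "cocycle' b" using Bs_Zs by (auto simp: Zs_def)
  thus "x : Zs" using cocycle_sd[OF z(1)] b(2) by (simp add: Zs_def)
 qed
 hence "Bs Un B2 = Zs" using Bs_Zs fin_Zs card_Un_disjoint[OF fB _ dj] cB c2 fB
  by (intro card_subset_eq) (auto simp: B2_def)
 moreover have "y : Zs" using y by (simp add: Zs_def)
 moreover have "y ~: Bs" using y is_cob_Bs by simp
 ultimately obtain b where b: "b : Bs" "y = sym_diff z b" by (auto simp: B2_def)
 hence "sym_diff z y = b" by blast
 thus ?thesis using b is_cob_Bs by simp
qed

text \<open>A one-sided curve cannot be pushed off itself: the parallel copy \<open>c\<close> of \<open>z1\<close> would bound.\<close>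
lemma meet_minimal:
 assumes idx: "!!z y. cocycle' z ==> cocycle' y ==> ~ is_cob' z ==> ~ is_cob' y ==> is_cob' (sym_diff z y)"
  and z1: "cocycle' z1" "~ is_cob' z1" and min: "!!D. cocycle' D ==> D <= z1 ==> D ~= z1 ==> is_cob' D"
  and z2: "cocycle' z2" "~ is_cob' z2" and dis: "!!f. f : G ==> z1 Int pairs f = {} | z2 Int pairs f = {}"
 shows False
proof -
 have zE: "z1 <= edges G" "z2 <= edges G" using z1 z2 by (auto simp: cocycle_def)
 obtain Q where Q: "sym_diff z1 z2 = cob' Q" using idx[OF z1(1) z2(1) z1(2) z2(2)] by (auto simp: is_cob_def)
 define N where "N = {f:G. z1 Int pairs f ~= {}}"
 have NG: "N <= G" by (auto simp: N_def)
 have z12: "z1 Int z2 = {}"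
 proof (rule ccontr)
  assume "z1 Int z2 ~= {}"
  then obtain e where e: "e : z1" "e : z2" by blast
  then obtain f where "f : G" "e : pairs f" using two_faces[OF subsetD[OF zE(1) e(1)]] by metis
  thus False using dis[of f] e by blast
 qed
 have cob12: "e : cob' Q \<longleftrightarrow> e : z1 | e : z2" for e using Q z12 by blast
 have eN: "f : N" if "e : z1" "e <= f" "f : G" for e f
  using that edge_pairs[of e G f] zE by (auto simp: N_def)
 have N_z2: "z2 Int pairs f = {}" if "f : N" for f using dis[of f] that by (auto simp: N_def)
 have cobN: "e : cob' Q \<longleftrightarrow> e : z1" if "f : N" "e : pairs f" for e f using cob12 N_z2[OF that(1)] that(2) by blast
 \<comment> \<open>The parallel copy of \<open>z1\<close>: the edges on the boundary of the strip
   \<open>N\<close> that run on its \<open>Q\<close>-side.\<close>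
 define c where "c = {e:edges G. e <= Q & e : cut' N}"
 have cz1: "c Int z1 = {}" and cz2: "c Int z2 = {}"
 proof -
  have False if "e <= Q" "e : cob' Q" for e
  proof -
   have "e Int Q = e" using that by blast
   thus False using that by (auto simp: cob_def edges_def)
  qed
  thus "c Int z1 = {}" "c Int z2 = {}" using cob12 by (auto simp: c_def)
 qed
 have cE: "c <= edges G" by (auto simp: c_def)
 \<comment> \<open>In a face of the strip, a vertex of \<open>Q\<close> sees one crossed edge and
   one edge inside \<open>Q\<close>, or two crossed edges. Either way both parities agree, and
   summing over \<open>N\<close> makes \<open>c\<close> even at that vertex.\<close>
 have third: "card {e:pairs f. v : e & e : z1} = (if EX e:pairs f. v : e & e <= Q then 1 else 0) |
   card {e:pairs f. v : e & e : z1} = 2 & ~ (EX e:pairs f. v : e & e <= Q)" if f: "f : N" "v : f" "v : Q" for f v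
 proof -
  have fG: "f : G" using f NG by blast
  obtain x where x: "x : f" "x ~= v" using card_3_ex[OF card_face[OF fG] f(2)] by blast
  have "EX y:f. y ~= v & y ~= x"
  proof (rule ccontr)
   assume "~ ?thesis"
   hence "f <= {v, x}" by blast
   hence "card f <= card {v, x}" by (intro card_mono) auto
   thus False using card_face[OF fG] x by simp
  qed
  then obtain y where y: "y : f" "y ~= v" "y ~= x" by blast
  have fe: "f = {v, x, y}" using card_3_other[of f v x y] card_face[OF fG] f x y by auto
  have pf: "pairs f = {{v, x}, {x, y}, {v, y}}" unfolding fe using x y by (intro pairs_3) auto
  have z: "{v, w} : z1 \<longleftrightarrow> w ~: Q" if "w = x | w = y" for w
  proof -
   have "{v, w} : pairs f" using that pf by auto
   hence "{v, w} : z1 \<longleftrightarrow> {v, w} : cob' Q" using cobN[OF f(1)] by blast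
   also have "... \<longleftrightarrow> w ~: Q" using cob_mem[of v w Q] f(3) face_edge[OF fG, of v w] that f(2) x y by auto
   finally show ?thesis .
  qed
  have s1: "{e:pairs f. v : e & e : z1} = (if x ~: Q then {{v, x}} else {}) Un (if y ~: Q then {{v, y}} else {})"
   unfolding pf using z x y by auto
  have s2: "(EX e:pairs f. v : e & e <= Q) \<longleftrightarrow> x : Q | y : Q"
   unfolding pf using f(3) x y by auto
  have nQ: "x ~: Q | y ~: Q"
  proof (rule ccontr)
   assume "~ ?thesis"
   hence "f <= Q" using fe f(3) by blast
   obtain e where e: "e : z1" "e : pairs f" using f(1) by (auto simp: N_def)
   hence "e : cob' Q" using cob12 by blast
   moreover have "e Int Q = e" using e(2) \<open>f <= Q\<close> by (auto simp: pairs_def)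
   ultimately show False using e(2) by (simp add: cob_def pairs_def)
  qed
  have "{v, x} ~= {v, y}" using x y by (auto simp: doubleton_eq_iff)
  thus ?thesis unfolding s1 s2 using nQ by auto
 qed
 have third1: "card {e:pairs f. v : e & e <= Q} <= 1" and third_par: "odd (card {e:pairs f. v : e & e : z1}) \<longleftrightarrow> card {e:pairs f. v : e & e <= Q} = 1"
  if f: "f : N" "v : f" "v : Q" for f v
 proof -
  have fG: "f : G" using f NG by blast
  have fp: "finite (pairs f)" using fin_bd[OF fG] .
  have disj: "{e:pairs f. v : e & e : z1} Int {e:pairs f. v : e & e <= Q} = {}"
  proof -
   have False if "e : pairs f" "e : z1" "e <= Q" for e
   proof -
    have "e : cob' Q" using that cob12 by blast
    moreover have "e Int Q = e" using that by blast
    ultimately show False using that(1) by (simp add: cob_def pairs_def)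
   qed
   thus ?thesis by blast
  qed
  have "card {e:pairs f. v : e & e : z1} + card {e:pairs f. v : e & e <= Q} = card ({e:pairs f. v : e & e : z1} Un {e:pairs f. v : e & e <= Q})"
   using disj fp by (intro card_Un_disjoint[symmetric]) auto
  also have "... <= card {e:pairs f. v : e}" using fp by (intro card_mono) auto
  also have "... = 2" using card_pairs_at[OF fin_face[OF fG]] card_face[OF fG] f(2) by simp
  finally have le: "card {e:pairs f. v : e & e : z1} + card {e:pairs f. v : e & e <= Q} <= 2" .
  have ex: "(EX e:pairs f. v : e & e <= Q) \<longleftrightarrow> card {e:pairs f. v : e & e <= Q} ~= 0" using fp by auto
  show "card {e:pairs f. v : e & e <= Q} <= 1" and "odd (card {e:pairs f. v : e & e : z1}) \<longleftrightarrow> card {e:pairs f. v : e & e <= Q} = 1"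
   using third_arith[OF third[OF f] le ex] by blast+
 qed
 have "closed c" unfolding closed_def
 proof (intro conjI allI)
  show "c <= edges G" by (rule cE)
  fix v
  show "even (card {e:c. v : e})"
  proof (cases "v : Q")
   case False
   hence "{e:c. v : e} = {}" by (auto simp: c_def)
   hence "card {e:c. v : e} = 0" by (simp only: card.empty)
   thus ?thesis by simp
  next
   case True
   define TE where "TE = {e:edges G. v : e & e <= Q}"
   define SE where "SE = {e:z1. v : e}"
   have tE: "TE <= edges G" "SE <= edges G" using zE by (auto simp: TE_def SE_def)
   have eq1: "TE Int pairs f = {e:pairs f. v : e & e <= Q}" if "f : N" for f using pairs_edges NG that by (auto simp: TE_def)
   have eq2: "SE Int pairs f = {e:pairs f. v : e & e : z1}" for f by (auto simp: SE_def)
   have par: "odd (card (SE Int pairs f)) \<longleftrightarrow> odd (card (TE Int pairs f))" if f: "f : N" for f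
   proof (cases "v : f")
    case vf: True
    have "card {e:pairs f. v : e & e <= Q} = 0 | card {e:pairs f. v : e & e <= Q} = 1"
     using third1[OF f vf True] by linarith
    thus ?thesis unfolding eq1[OF f] eq2 third_par[OF f vf True] by auto
   next
    case False
    hence "SE Int pairs f = {}" "TE Int pairs f = {}" by (auto simp: SE_def TE_def pairs_def)
    thus ?thesis by simp
   qed
   have cS: "SE Int cut' N = {}"
   proof -
    have False if e: "e : z1" "e : cut' N" for e
     using e(2) NG by (rule cutE) (use eN e(1) in blast)
    thus ?thesis by (auto simp: SE_def)
   qed
   have fN: "finite N" using NG fin_G finite_subset by blast
   have "even (SUM f:N. card (SE Int pairs f))" using handshake[OF NG tE(2)] cS by simp
   hence "even (card {f:N. odd (card (SE Int pairs f))})" using fN by (simp add: even_sum_iff)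
   moreover have "{f:N. odd (card (SE Int pairs f))} = {f:N. odd (card (TE Int pairs f))}" using par by blast
   ultimately have "even (SUM f:N. card (TE Int pairs f))" using fN by (simp add: even_sum_iff)
   hence "even (card (TE Int cut' N))" using handshake[OF NG tE(1)] by simp
   moreover have "TE Int cut' N = {e:c. v : e}" by (auto simp: TE_def c_def)
   ultimately show ?thesis by simp
  qed
 qed
 \<comment> \<open>\<open>c\<close> is closed and disjoint from \<open>z2\<close>, and by index two
   every non-trivial cocycle is \<open>z2\<close> plus a coboundary.\<close>
 have evc: "even (card (c Int z))" if z: "cocycle' z" for z
 proof (cases "is_cob' z")
  case True
  thus ?thesis using closed_cob[OF \<open>closed c\<close>] by (auto simp: is_cob_def)
 next
  case False
  hence "is_cob' (sym_diff z z2)" using idx[OF z z2(1) _ z2(2)] by blast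
  hence "even (card (c Int sym_diff z z2))" using closed_cob[OF \<open>closed c\<close>] by (auto simp: is_cob_def)
  moreover have "c Int sym_diff z z2 = c Int z" using cz2 by blast
  ultimately show ?thesis by simp
 qed
 obtain X0 where X0: "X0 <= G" "c = cut' X0" using duality[OF conn_G cE] evc by blast
 \<comment> \<open>\<open>z1\<close> has no edge in \<open>c\<close>, so its part inside
   \<open>X0\<close> is again a cocycle; minimality then puts all of \<open>z1\<close> on one side
   of \<open>c\<close>.\<close>
 have "EX X<=G. c = cut' X & X Int N = {}"
 proof -
  define D where "D = {e:z1. e : inner' X0}"
  have DX: "D Int pairs f = (if f : X0 then z1 Int pairs f else {})" if f: "f : G" for f
  proof (cases "f : X0")
   case True
   have "e : inner' X0" if e: "e : z1" "e : pairs f" for e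
   proof -
    have "e ~: cut' X0" using cz1 X0 e by blast
    moreover have "e ~: inner' (G - X0)" using inner_iff[of "G - X0" e] f True e by blast
    ultimately show ?thesis using edge_cases[OF X0(1), of e] zE e by blast
   qed
   thus ?thesis using True by (auto simp: D_def)
  next
   case False
   thus ?thesis using inner_iff[OF X0(1)] f by (auto simp: D_def)
  qed
  have cD: "cocycle' D" unfolding cocycle_def
  proof (intro conjI ballI)
   show "D <= edges G" using zE by (auto simp: D_def)
   show "even (card (D Int pairs f))" if f: "f : G" for f
    unfolding DX[OF f] using z1(1) f by (simp add: cocycle_def)
  qed
  have Dz: "D <= z1" by (auto simp: D_def)
  have "D = {} | D = z1"
  proof (rule ccontr)
   assume n: "~ ?thesis"
   hence "is_cob' D" using min[OF cD Dz] by blast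
   moreover have "cocycle' (sym_diff z1 D)" using cocycle_sd[OF z1(1) cD] .
   moreover have sd: "sym_diff z1 D = z1 - D" using Dz by blast
   moreover have "z1 - D ~= z1" using n Dz by blast
   ultimately have "is_cob' (z1 - D)" using min[of "z1 - D"] by auto
   hence "is_cob' (sym_diff (z1 - D) D)" using \<open>is_cob' D\<close> is_cob_sd by blast
   moreover have "sym_diff (z1 - D) D = z1" using Dz by blast
   ultimately show False using z1(2) by simp
  qed
  thus ?thesis
  proof
   assume D0: "D = {}"
   have "f ~: N" if "f : X0" for f
   proof -
    have fG: "f : G" using that X0 by blast
    hence "z1 Int pairs f = {}" using DX[OF fG] D0 that by simp
    thus ?thesis by (simp add: N_def)
   qed
   hence "X0 Int N = {}" by blast
   thus ?thesis using X0 by blast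
  next
   assume D1: "D = z1"
   have "f ~: N" if "f : G - X0" for f
   proof -
    have "z1 Int pairs f = {}" using DX[of f] D1 that by simp
    thus ?thesis by (simp add: N_def)
   qed
   hence "(G - X0) Int N = {}" by blast
   moreover have "c = cut' (G - X0)" using X0 cut_compl by simp
   ultimately show ?thesis by (intro exI[of _ "G - X0"]) auto
  qed
 qed
 then obtain X where X: "X <= G" "c = cut' X" "X Int N = {}" by blast
 have XN: "X Un N <= G" using X NG by blast
 \<comment> \<open>\<open>X\<close> and the strip fit together along \<open>c\<close>: a boundary
   edge of their union at a vertex of \<open>Q\<close> would belong to \<open>c\<close> and lie on
   three faces.\<close>
 have around: "f : X Un N" if p: "p : Q" and h: "h : X Un N" "p : h" and f: "f : G" "p : f" for p h f
 proof (rule ccontr)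
  assume "f ~: X Un N"
  then obtain e where e: "e : cut' (X Un N)" "p : e" using link[OF XN h, of f] f by blast
  from e(1) XN obtain a b where ab: "e : edges G" "a : X Un N" "e <= a" "b : G - (X Un N)" "e <= b" by (rule cutE)
  show False
  proof (cases "a : X")
   case True
   hence "e : cut' X" using ab X by (intro cutI[of X e a b]) auto
   hence "e : cut' N" using X(2) by (auto simp: c_def)
   then obtain a' where a': "a' : N" "e <= a'" using NG by (rule cutE) blast
   have "{a, b, a'} <= {h:G. e <= h}" using ab a' X(1) True NG by blast
   hence "card {a, b, a'} <= 2" using two_G[OF ab(1)] fin_G card_mono[of "{h:G. e <= h}" "{a, b, a'}"] by simp
   moreover have "a ~= b" "a ~= a'" "b ~= a'" using True ab a' X(3) by blast+
   ultimately show False by simp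
  next
   case False
   hence aN: "a : N" using ab by blast
   have eN': "e : cut' N" using ab aN NG by (intro cutI[of N e a b]) auto
   have "e ~: z1" using eN[of e b] ab by blast
   have ep: "e : pairs a" using ab edge_pairs[OF ab(1)] by blast
   hence "e ~: cob' Q" using cobN[OF aN ep] \<open>e ~: z1\<close> by blast
   obtain z where z: "z ~= p" "e = {p, z}" using edge_at[OF ab(1) e(2)] .
   hence "z : Q" using \<open>e ~: cob' Q\<close> cob_mem[of p z Q] ab(1) p by blast
   hence "e : c" using ab(1) eN' z p by (simp add: c_def)
   then obtain a' where a': "a' : X" "e <= a'" unfolding X(2) using X(1) by (rule cutE) blast
   have "{a, b, a'} <= {h:G. e <= h}" using ab a' X(1) aN NG by blast
   hence "card {a, b, a'} <= 2" using two_G[OF ab(1)] fin_G card_mono[of "{h:G. e <= h}" "{a, b, a'}"] by simp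
   moreover have "a ~= b" "a ~= a'" "b ~= a'" using False ab a' by blast+
   ultimately show False by simp
  qed
 qed
 \<comment> \<open>The vertices on the side of \<open>z1\<close> that \<open>X\<close> closes off.
   Their coboundary is \<open>z1\<close> itself, which contradicts its non-triviality.\<close>
 define R where "R = {v. EX f:X. v : f} Un {v:Q. EX e:z1. v : e}"
 have outQ: "q ~: R" if q: "q ~: Q" "EX h:G - X. q : h" for q
 proof
  assume "q : R"
  then obtain f where f: "f : X" "q : f" using q by (auto simp: R_def)
  obtain h where h: "h : G - X" "q : h" using q(2) by blast
  obtain e where "e : cut' X" "q : e" using link[OF X(1) f h] by blast
  hence "q : Q" using X(2) by (auto simp: c_def)
  thus False using q by blast
 qed
 have dir: "e : z1" if e: "e : edges G" "e = {p, q}" "p : R" "q ~: R" for e p q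
 proof (rule ccontr)
  assume ez: "e ~: z1"
  have pq: "p ~= q" using e by blast
  obtain f where f: "f : G" "e <= f" using e(1) by (auto simp: edges_def)
  have fX: "f ~: X" using f e by (auto simp: R_def)
  have pQ: "p : Q" using outQ[of p] e(2,3) f fX by blast
  have "EX h:X Un N. p : h"
  proof -
   consider "EX h:X. p : h" | "EX e:z1. p : e" using e(3) by (auto simp: R_def)
   thus ?thesis
   proof cases
    case 2
    then obtain e' where e': "e' : z1" "p : e'" by blast
    then obtain h where "h : G" "e' <= h" using zE by (auto simp: edges_def)
    hence "h : N" "p : h" using eN e' by blast+
    thus ?thesis by blast
   qed blast
  qed
  then obtain h where "h : X Un N" "p : h" by blast
  hence "f : X Un N" using around[OF pQ _ _ f(1)] f(2) e(2) by blast
  hence fN: "f : N" using fX by blast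
  have ep: "e : pairs f" using f edge_pairs[OF e(1)] by blast
  hence "e ~: cob' Q" using cobN[OF fN ep] ez by blast
  hence qQ: "q : Q" using cob_mem[of p q Q] e(1,2) pQ by blast
  have "EX x:f. x ~= p & x ~= q"
  proof (rule ccontr)
   assume "~ ?thesis"
   hence "f <= {p, q}" by blast
   hence "card f <= card {p, q}" by (intro card_mono) auto
   thus False using card_face[OF f(1)] pq by simp
  qed
  then obtain x where x: "x : f" "x ~= p" "x ~= q" by blast
  have fe: "f = {p, q, x}" using card_3_other[of f p q x] card_face[OF f(1)] f e pq x by auto
  have "x ~: Q"
  proof
   assume "x : Q"
   hence fQ: "f <= Q" using fe pQ qQ by blast
   obtain y where y: "y : z1" "y : pairs f" using fN by (auto simp: N_def)
   hence "y : cob' Q" using cob12 by blast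
   moreover have "y Int Q = y" using y(2) fQ by (auto simp: pairs_def)
   ultimately show False using y(2) by (simp add: cob_def pairs_def)
  qed
  hence "{q, x} : cob' Q Int pairs f" using cob_eI[of q f x Q] f fe qQ by blast
  hence "{q, x} : z1" using cobN[OF fN] by blast
  hence "q : R" using qQ by (auto simp: R_def)
  thus False using e by blast
 qed
 have "cob' R = z1"
 proof
  show "cob' R <= z1"
  proof
   fix e assume e: "e : cob' R"
   hence eE: "e : edges G" by (simp add: cob_def)
   then obtain p q where pq: "e = {p, q}" "p ~= q" by (auto simp: edges_def card_2_iff)
   hence "p : R \<longleftrightarrow> q ~: R" using e eE cob_mem[of p q R] by blast
   thus "e : z1" using dir[OF eE, of p q] dir[OF eE, of q p] pq by (metis insert_commute)
  qed
  show "z1 <= cob' R"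
  proof
   fix e assume e: "e : z1"
   hence eE: "e : edges G" using zE by blast
   then obtain p q where pq: "e = {p, q}" "p ~= q" by (auto simp: edges_def card_2_iff)
   have "e : cob' Q" using cob12 e by blast
   hence "p : Q \<longleftrightarrow> q ~: Q" using eE cob_mem[of p q Q] pq by blast
   obtain f where f: "f : G" "e <= f" using eE by (auto simp: edges_def)
   hence "f : G - X" using eN[OF e] X(3) by blast
   hence *: "w : R \<longleftrightarrow> w : Q" if "w : e" for w using outQ[of w] that f e by (auto simp: R_def)
   have "p : R \<longleftrightarrow> q ~: R" using *[of p] *[of q] pq \<open>p : Q \<longleftrightarrow> q ~: Q\<close> by blast
   thus "e : cob' R" using cob_mem[of p q R] eE pq by blast
  qed
 qed
 thus False using z1(2) by (auto simp: is_cob_def)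
qed

lemma meet_G:
 assumes idx: "!!z y. cocycle' z ==> cocycle' y ==> ~ is_cob' z ==> ~ is_cob' y ==> is_cob' (sym_diff z y)"
  and z: "cocycle' z" "~ is_cob' z" and y: "cocycle' y" "~ is_cob' y"
 shows "EX f:G. z Int pairs f ~= {} & y Int pairs f ~= {}"
proof (rule ccontr)
 assume n: "~ ?thesis"
 define P where "P D \<longleftrightarrow> cocycle' D & ~ is_cob' D & D <= z" for D
 have "P z" using z by (simp add: P_def)
 then obtain z1 where z1: "P z1" "!!D. P D ==> card z1 <= card D"
  using arg_min_nat_lemma[of P z card] by blast
 have fz: "finite z1" using z1(1) cocycle_fin by (simp add: P_def)
 have c: "cocycle' z1" "~ is_cob' z1" "z1 <= z" using z1(1) by (auto simp: P_def)
 show False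
 proof (rule meet_minimal[OF idx c(1,2) _ y])
  show "is_cob' D" if D: "cocycle' D" "D <= z1" "D ~= z1" for D
  proof (rule ccontr)
   assume "~ is_cob' D"
   hence "P D" using D c(3) by (auto simp: P_def)
   thus False using z1(2)[of D] psubset_card_mono[OF fz, of D] D by auto
  qed
  show "z1 Int pairs f = {} | y Int pairs f = {}" if "f : G" for f using n that c(3) by blast
 qed
qed

lemma pcx_G: assumes "euler_char G = 1" shows "pcx G (edges G) pairs (%e. e)"
proof
 show "is_cob' (sym_diff z y)" if "cocycle' z" "cocycle' y" "~ is_cob' z" "~ is_cob' y" for z y
  using proj_index2[OF assms] that by blast
 show "EX f:G. z Int pairs f ~= {} & y Int pairs f ~= {}" if "cocycle' z" "cocycle' y" "~ is_cob' z" "~ is_cob' y" for z y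
  using meet_G[OF proj_index2[OF assms]] that by blast
 show "card (cut' X) ~= 1" if "X <= G" for X using bridgeless_G[OF that] .
qed

end

section \<open>Vertex 2-colourings of a surface and dual matchings\<close>

definition mono :: "'a set => 'a set => bool" where "mono X f \<longleftrightarrow> f <= X | f Int X = {}"

context surf
begin

lemma cob_face: assumes f: "f : G" shows "card (cob' X Int pairs f) = (if mono X f then 0 else 2)"
proof (cases "mono X f")
 case True
 have "cob' X Int pairs f = {}"
 proof -
  have False if e: "e : cob' X" "e : pairs f" for e
  proof -
   have "e Int X = {} | e Int X = e" using e(2) True by (auto simp: mono_def pairs_def)
   thus False using e by (auto simp: cob_def pairs_def)
  qed
  thus ?thesis by blast
 qed
 thus ?thesis using True by simp
next
 case False
 then obtain a b where "a : f" "b : f" "a : X" "b ~: X" by (auto simp: mono_def)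
 hence "cob' X Int pairs f ~= {}" using cob_eI[of a f b X] f by blast
 hence nz: "card (cob' X Int pairs f) ~= 0" using fin_bd[OF f] by auto
 have ev: "even (card (cob' X Int pairs f))" using cob_cocycle f by (simp add: cocycle_def)
 have le: "card (cob' X Int pairs f) <= 3" using card_mono[OF fin_bd[OF f], of "cob' X Int pairs f"] cubic[OF f] by simp
 show ?thesis using even_le_3[OF ev le] nz False by simp
qed

lemma pm_cob: "(ALL f:G. ~ mono X f) ==> pm G (edges G) pairs (edges G - cob' X)"
 unfolding pm_cubic
proof (intro conjI ballI)
 fix f assume a: "ALL f:G. ~ mono X f" and f: "f : G"
 have "(edges G - cob' X) Int pairs f = pairs f - (cob' X Int pairs f)" using pairs_edges[OF f] by blast
 moreover have "card (pairs f - (cob' X Int pairs f)) = card (pairs f) - card (cob' X Int pairs f)"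
  using fin_bd[OF f] by (intro card_Diff_subset) auto
 ultimately show "card ((edges G - cob' X) Int pairs f) = 1" using cob_face[OF f, of X] a f cubic[OF f] by simp
qed blast

lemma pm_not_mono: assumes "pm G (edges G) pairs m" "edges G - m = cob' X" "f : G" shows "~ mono X f"
proof
 assume m: "mono X f"
 have "(edges G - m) Int pairs f = {}" using cob_face[OF assms(3), of X] m assms(2) fin_bd[OF assms(3)] by simp
 hence "pairs f <= m" using pairs_edges[OF assms(3)] by blast
 hence "m Int pairs f = pairs f" by blast
 thus False using assms(1,3) cubic[OF assms(3)] unfolding pm_cubic by auto
qed

lemma bad_iff: "bad G (edges G) pairs (%e. e) \<longleftrightarrow> (ALL X. EX f:G. mono X f)"
proof
 assume b: "bad G (edges G) pairs (%e. e)"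
 show "ALL X. EX f:G. mono X f"
 proof (rule ccontr)
  assume "~ ?thesis"
  then obtain X where X: "ALL f:G. ~ mono X f" by blast
  have "edges G - (edges G - cob' X) = cob' X" using cob_E by blast
  thus False using b pm_cob[OF X] unfolding bad_def is_cob_def by metis
 qed
next
 assume a: "ALL X. EX f:G. mono X f"
 show "bad G (edges G) pairs (%e. e)" unfolding bad_def is_cob_def using a pm_not_mono by blast
qed

lemma card_E3: "2 * card (edges G) = 3 * card G"
proof -
 have "inner' G = edges G" using inner_iff[of G] by blast
 thus ?thesis using cubic_count[of G] cut_F by simp
qed

lemma sum_cob: "(SUM f:G. card (cob' X Int pairs f)) = 2 * card (cob' X)"
proof -
 have "inner' G = edges G" using inner_iff[of G] by blast
 hence "cob' X Int inner' G = cob' X" using cob_E by blast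
 thus ?thesis using handshake[OF order_refl cob_E] cut_F by simp
qed

text \<open>A cut has at most two edges in each face, hence at most \<open>card G\<close> edges,
  which is two thirds of all. Equality means that no face is monochromatic.\<close>

lemma two_thirds: "has_two_thirds_bipartite G \<longleftrightarrow> (EX X. ALL f:G. ~ mono X f)"
proof
 assume "has_two_thirds_bipartite G"
 then obtain H X where H: "H <= edges G" "3 * card H = 2 * card (edges G)" "ALL e:H. card (e Int X) = 1"
  unfolding has_two_thirds_bipartite_def by blast
 have "H <= cob' X" using H by (auto simp: cob_def)
 hence "card H <= card (cob' X)" using fin_edges cob_E finite_subset by (metis card_mono)
 moreover have "card H = card G" using H(2) card_E3 by simp
 ultimately have ge: "2 * card G <= (SUM f:G. card (cob' X Int pairs f))" using sum_cob by simp
 have "~ mono X f" if f: "f : G" for f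
 proof
  assume m: "mono X f"
  have "(SUM f:G. card (cob' X Int pairs f)) < (SUM f:G. 2)"
   using fin_G cob_face f m by (intro sum_strict_mono_ex1) (auto intro!: bexI[of _ f])
  thus False using ge by simp
 qed
 thus "EX X. ALL f:G. ~ mono X f" by blast
next
 assume "EX X. ALL f:G. ~ mono X f"
 then obtain X where X: "ALL f:G. ~ mono X f" by blast
 have "2 * card (cob' X) = (SUM f:G. 2)" unfolding sum_cob[symmetric] using cob_face X by (intro sum.cong) auto
 hence "card (cob' X) = card G" by simp
 hence "3 * card (cob' X) = 2 * card (edges G)" using card_E3 by simp
 moreover have "card (e Int X) = 1" if e: "e : cob' X" for e
 proof -
  have c: "card e = 2" "odd (card (e Int X))" using e by (auto simp: cob_def edges_def)
  hence "card (e Int X) <= 2" using card_mono[of e "e Int X"] by (metis Int_lower1 card.infinite zero_neq_numeral)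
  thus ?thesis using c(2) by (cases "card (e Int X)"; cases "card (e Int X) - 1") auto
 qed
 ultimately show "has_two_thirds_bipartite G" unfolding has_two_thirds_bipartite_def
  by (intro exI[of _ "cob' X"] exI[of _ X]) (use cob_E in auto)
qed

end

lemma card_one: "finite X ==> X ~= {} ==> ~ 2 <= card X ==> card X = 1"
proof -
 assume h: "finite X" "X ~= {}" "~ 2 <= card X"
 hence "card X ~= 0" by simp
 thus "card X = 1" using h(3) by linarith
qed

section \<open>Pieces bounded by 3-cycles\<close>

context surf
begin

definition tr :: "'a set set => 'a set" where "tr X = \<Union>(cut' X)"
definition int_verts :: "'a set set => 'a set" where "int_verts X = {v:verts G. ALL f:G. v : f --> f : X}"

text \<open>The defect of the Euler characteristic when the piece \<open>X\<close> replaces a single face.\<close>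
definition kappa :: "'a set set => int" where
 "kappa X = int (card (int_verts X)) - int (card (inner' X)) + int (card X) - 1"

lemma tr_cut: assumes X: "X <= G" "card (cut' X) = 3" shows "card (tr X) = 3" "cut' X = pairs (tr X)"
proof -
 have "EX a b c. a ~= b & b ~= c & a ~= c & cut' X = {{a, b}, {b, c}, {a, c}}"
 proof (rule triangle_labels[OF X(2)])
  show "card p = 2" if "p : cut' X" for p using that cut_E by (auto simp: edges_def)
  show "even (card {p:cut' X. v : p})" for v using closed_cut[OF X(1)] by (simp add: closed_def)
 qed
 then obtain a b c where abc: "a ~= b" "b ~= c" "a ~= c" "cut' X = {{a, b}, {b, c}, {a, c}}" by blast
 hence t: "tr X = {a, b, c}" by (auto simp: tr_def)
 thus "card (tr X) = 3" using abc by simp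
 show "cut' X = pairs (tr X)" unfolding t using abc pairs_3 by metis
qed

lemma fin_int: "finite (int_verts X)" using fin_verts by (simp add: int_verts_def)

lemma Union_pairs: assumes "card f = 3" shows "\<Union>(pairs f) = f"
proof
 show "\<Union>(pairs f) <= f" by (auto simp: pairs_def)
 show "f <= \<Union>(pairs f)"
 proof
  fix x assume x: "x : f"
  obtain y where "y : f" "y ~= x" using card_3_ex[OF assms x] by blast
  hence "{x, y} : pairs f" using x by (simp add: pairs_def)
  thus "x : \<Union>(pairs f)" by blast
 qed
qed

lemma pairs_inj: "card f = 3 ==> card g = 3 ==> pairs f = pairs g ==> f = g"
 using Union_pairs by metis

lemma tr_single: "f : G ==> tr {f} = f" using cut_single[of f] Union_pairs[OF card_face[of f]] by (simp add: tr_def)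

lemma cut_pairs_single: "f : G ==> card (cut' {f}) = 3" using cut_single[of f] cubic[of f] by simp

lemma tr_verts: assumes X: "X <= G" shows "v : tr X \<longleftrightarrow> (EX f:X. v : f) & (EX g:G - X. v : g)"
proof
 assume "v : tr X"
 then obtain e where e: "e : cut' X" "v : e" by (auto simp: tr_def)
 obtain f g where "f : X" "e <= f" "g : G - X" "e <= g" using e(1) X by (rule cutE)
 thus "(EX f:X. v : f) & (EX g:G - X. v : g)" using e(2) by blast
next
 assume "(EX f:X. v : f) & (EX g:G - X. v : g)"
 thus "v : tr X" using link[OF X] by (auto simp: tr_def)
qed

lemma tr_notin: assumes X: "X <= G" "card (cut' X) = 3" "2 <= card X" shows "tr X ~: X"
proof
 assume t: "tr X : X"
 have tG: "tr X : G" using t X by blast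
 have "(X - {tr X}) Un {tr X} = X" using t by blast
 moreover have "cut' ((X - {tr X}) Un {tr X}) = sym_diff (cut' (X - {tr X})) (cut' {tr X})"
  using X(1) tG by (intro cut_Un_disj) auto
 ultimately have "cut' X = sym_diff (cut' (X - {tr X})) (cut' X)" using cut_single[OF tG] tr_cut[OF X(1,2)] by simp
 hence "cut' (X - {tr X}) = {}" by blast
 hence "X - {tr X} = {} | X - {tr X} = G" using conn_G[rule_format, of "X - {tr X}"] X(1) by blast
 thus False
 proof
  assume "X - {tr X} = {}"
  hence "X <= {tr X}" by blast
  hence "card X <= 1" using card_mono[of "{tr X}" X] by simp
  thus False using X(3) by simp
 next
  assume "X - {tr X} = G" thus False using tG by blast
 qed
qed

end

section \<open>Decomposition along 3-cycles\<close>

text \<open>Each part is one side of a 3-cycle, and \<open>T\<close> has the bounded triangle in its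
  place. Three parts are required because two complementary parts would have the same
  triangle.\<close>

locale quot = surf G for G :: "'a set set" +
 fixes QQ :: "'a set set set"
 assumes part: "partition_on G QQ" and d3: "X : QQ ==> card (cut (edges G) pairs X) = 3" and three: "3 <= card QQ"
begin

definition "T = tr ` QQ"

lemma QG: "X : QQ ==> X <= G" and Qne: "X : QQ ==> X ~= {}" and UQ: "\<Union>QQ = G"
 using part by (auto simp: partition_on_def)

lemma Qdis: "X : QQ ==> Y : QQ ==> f : X ==> f : Y ==> X = Y"
 using part by (auto simp: partition_on_def disjoint_def)

lemma finQ: "finite QQ" using part fin_G by (rule partition_on_finite)

lemma tr3: "X : QQ ==> card (tr X) = 3" and cutQ: "X : QQ ==> cut' X = pairs (tr X)"
 using tr_cut[OF QG d3] by blast+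

lemma UX: "XX <= QQ ==> \<Union>XX <= G" "XX <= QQ ==> G - \<Union>XX = \<Union>(QQ - XX)"
proof -
 assume XX: "XX <= QQ"
 show "\<Union>XX <= G" using XX UQ by blast
 show "G - \<Union>XX = \<Union>(QQ - XX)"
 proof
  show "G - \<Union>XX <= \<Union>(QQ - XX)" using UQ by blast
  show "\<Union>(QQ - XX) <= G - \<Union>XX"
  proof
   fix f assume "f : \<Union>(QQ - XX)"
   then obtain X where X: "X : QQ" "X ~: XX" "f : X" by blast
   have "f ~: Y" if "Y : XX" for Y using Qdis[of X Y f] X that XX by blast
   thus "f : G - \<Union>XX" using X QG by blast
  qed
 qed
qed

lemma cut_Union: assumes XX: "XX <= QQ"
 shows "e : cut' (\<Union>XX) \<longleftrightarrow> (EX X:XX. EX Y:QQ - XX. e : cut' X & e : cut' Y)"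
proof
 assume "e : cut' (\<Union>XX)"
 then obtain f g where fg: "e : edges G" "f : \<Union>XX" "e <= f" "g : G - \<Union>XX" "e <= g" using UX(1)[OF XX] by (rule cutE)
 obtain X where X: "X : XX" "f : X" using fg by blast
 obtain Y where Y: "Y : QQ - XX" "g : Y" using fg(4) UX(2)[OF XX] by blast
 have XQ: "X : QQ" "Y : QQ" using X Y XX by blast+
 have "g ~: X" "f ~: Y" using fg(4) X Qdis[of X Y f] XQ Y by blast+
 hence "e : cut' X" "e : cut' Y"
  using fg X Y QG[OF XQ(1)] QG[OF XQ(2)] cutI[of X e f g] cutI[of Y e g f] by blast+
 thus "EX X:XX. EX Y:QQ - XX. e : cut' X & e : cut' Y" using X Y by blast
next
 assume "EX X:XX. EX Y:QQ - XX. e : cut' X & e : cut' Y"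
 then obtain X Y where XY: "X : XX" "Y : QQ - XX" "e : cut' X" "e : cut' Y" by blast
 have XG: "X <= G" "Y <= G" using XY XX QG by blast+
 obtain f where f: "e : edges G" "f : X" "e <= f" using XY(3) XG(1) by (rule cutE)
 obtain g where g: "g : Y" "e <= g" using XY(4) XG(2) by (rule cutE)
 have "g : G - \<Union>XX" using UX(2)[OF XX] g XY by blast
 thus "e : cut' (\<Union>XX)" using cutI[OF UX(1)[OF XX] f(1) _ f(3) _ g(2)] f(2) XY(1) by blast
qed

lemma cut_Q2: assumes "X : QQ" "e : cut' X" shows "EX Y:QQ. Y ~= X & {Z:QQ. e : cut' Z} = {X, Y}"
proof -
 have "e : cut' (\<Union>{X})" using assms by simp
 then obtain Y where Y: "Y : QQ - {X}" "e : cut' Y" using cut_Union[of "{X}" e] assms(1) by blast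
 have "Z = X | Z = Y" if Z: "Z : QQ" "e : cut' Z" for Z
 proof (rule ccontr)
  assume n: "~ ?thesis"
  obtain f where f: "e : edges G" "f : X" "e <= f" using assms(2) QG[OF assms(1)] by (rule cutE)
  have YQ: "Y : QQ" using Y by blast
  obtain g where g: "g : Y" "e <= g" using Y(2) QG[OF YQ] by (rule cutE)
  obtain h where h: "h : Z" "e <= h" using Z(2) QG[OF Z(1)] by (rule cutE)
  have "f ~= g" "f ~= h" "g ~= h" using Qdis f g h n Y assms(1) Z(1) by blast+
  moreover have "{f, g, h} <= {k:G. e <= k}" using f g h QG assms(1) YQ Z(1) by blast
  hence "card {f, g, h} <= 2" using two_G[OF f(1)] fin_G card_mono[of "{k:G. e <= k}" "{f, g, h}"] by simp
  ultimately show False by simp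
 qed
 hence "{Z:QQ. e : cut' Z} = {X, Y}" using assms Y by blast
 thus ?thesis using Y by blast
qed

lemma tr_inj: "inj_on tr QQ"
proof (rule inj_onI, rule ccontr)
 fix X Y assume XY: "X : QQ" "Y : QQ" "tr X = tr Y" "X ~= Y"
 have ceq: "cut' X = cut' Y" using XY cutQ by simp
 have dj: "X Int Y = {}" using XY Qdis by blast
 have "cut' (X Un Y) = sym_diff (cut' X) (cut' Y)" using cut_Un_disj[OF QG[OF XY(1)] QG[OF XY(2)] dj] .
 hence "cut' (X Un Y) = {}" using ceq by simp
 hence "X Un Y = G" using conn_G QG[OF XY(1)] QG[OF XY(2)] Qne[OF XY(1)] by (metis Un_empty Un_subset_iff)
 have "QQ <= {X, Y}"
 proof
  fix Z assume Z: "Z : QQ"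
  obtain f where f: "f : Z" using Qne[OF Z] by blast
  hence "f : X | f : Y" using QG[OF Z] \<open>X Un Y = G\<close> by blast
  thus "Z : {X, Y}" using Qdis[OF Z _ f] XY(1,2) by blast
 qed
 hence "card QQ <= card {X, Y}" by (intro card_mono) auto
 also have "... <= 2" by (simp add: card_insert_if)
 finally show False using three by simp
qed

lemma edge_tr: "X : QQ ==> card e = 2 ==> e <= tr X \<longleftrightarrow> e : cut' X"
 using cutQ[of X] by (simp add: pairs_def)

lemma edges_T: "e : edges T \<longleftrightarrow> (EX X:QQ. e : cut' X)"
proof
 assume "e : edges T"
 thus "EX X:QQ. e : cut' X" using edge_tr by (auto simp: edges_def T_def)
next
 assume "EX X:QQ. e : cut' X"
 then obtain X where X: "X : QQ" "e : cut' X" by blast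
 hence "card e = 2" "e <= tr X" using cutQ by (auto simp: pairs_def)
 thus "e : edges T" using X by (auto simp: edges_def T_def)
qed

lemma cut_T: assumes XX: "XX <= QQ" and e: "e : cut' (\<Union>XX)"
 shows "e : edges T & (EX h:tr ` XX. e <= h) & (EX k:T - tr ` XX. e <= k)"
proof -
 obtain X Y where XY: "X : XX" "Y : QQ - XX" "e : cut' X" "e : cut' Y" using cut_Union[OF XX] e by blast
 have XQ: "X : QQ" "Y : QQ" using XY XX by blast+
 have sub: "e <= tr X" "e <= tr Y" using XY cutQ XQ by (auto simp: pairs_def)
 have "tr Y ~: tr ` XX"
 proof
  assume "tr Y : tr ` XX"
  then obtain Z where Z: "Z : XX" "tr Y = tr Z" by blast
  hence "Y = Z" using inj_onD[OF tr_inj] XQ XX by blast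
  thus False using XY Z by blast
 qed
 hence "tr Y : T - tr ` XX" using XQ by (simp add: T_def)
 thus ?thesis using sub XY(1) edges_T XQ(1) XY(3) by blast
qed

text \<open>A cut between sets of triangles corresponds to the cut between the unions of their
  parts, so both connectivity conditions of \<open>surface_triI\<close> are inherited from
  \<open>G\<close>.\<close>

lemma surface_T: "surface_tri T"
proof (rule surface_triI)
 show "finite T" using finQ by (simp add: T_def)
 show "T ~= {}" using three by (auto simp: T_def)
 show "ALL f:T. card f = 3" using tr3 by (auto simp: T_def)
 show "ALL e:edges T. card {f:T. e <= f} = 2"
 proof
  fix e assume e: "e : edges T"
  then obtain X where X: "X : QQ" "e : cut' X" using edges_T by blast
  have c: "card e = 2" using e by (simp add: edges_def)
  obtain Y where Y: "Y : QQ" "Y ~= X" "{Z:QQ. e : cut' Z} = {X, Y}" using cut_Q2[OF X] by blast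
  have "{f:T. e <= f} = tr ` {Z:QQ. e : cut' Z}" using edge_tr[OF _ c] by (auto simp: T_def)
  also have "... = {tr X, tr Y}" using Y by simp
  finally have "{f:T. e <= f} = {tr X, tr Y}" .
  moreover have "tr X ~= tr Y" using inj_onD[OF tr_inj] X Y by blast
  ultimately show "card {f:T. e <= f} = 2" by simp
 qed
next
 fix YY f g v assume Y: "YY <= T" "f : YY" "g : T - YY" "v : f" "v : g"
 define XX where "XX = {X:QQ. tr X : YY}"
 have XX: "XX <= QQ" "tr ` XX = YY" using Y(1) by (auto simp: XX_def T_def)
 obtain X where X: "X : XX" "f = tr X" using Y(2) XX by blast
 obtain Z where Z: "Z : QQ" "Z ~: XX" "g = tr Z" using Y(3) XX by (auto simp: T_def)
 obtain f' where f': "f' : X" "v : f'" using tr_verts[of X v] X XX Y(4) QG by blast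
 obtain g' where g': "g' : Z" "v : g'" using tr_verts[of Z v] Z Y(5) QG by blast
 have "f' : \<Union>XX" using f' X by blast
 moreover have "g' : G - \<Union>XX" using g' Z UX(2)[OF XX(1)] by blast
 ultimately obtain e where "e : cut' (\<Union>XX)" "v : e" using link[OF UX(1)[OF XX(1)] _ f'(2) _ g'(2)] by blast
 thus "EX e:edges T. v : e & (EX h:YY. e <= h) & (EX k:T - YY. e <= k)" using cut_T[OF XX(1), of e] XX(2) by blast
next
 fix YY assume Y: "YY <= T" "YY ~= {}" "YY ~= T"
 define XX where "XX = {X:QQ. tr X : YY}"
 have XX: "XX <= QQ" "tr ` XX = YY" using Y(1) by (auto simp: XX_def T_def)
 have "XX ~= {}" "XX ~= QQ" using XX Y by (auto simp: T_def)
 then obtain X Z where XZ: "X : XX" "Z : QQ - XX" using XX(1) by blast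
 then obtain f where "f : X" using Qne[of X] \<open>X : XX\<close> XX(1) by blast
 moreover obtain g where "g : Z" using Qne[of Z] \<open>Z : QQ - XX\<close> by blast
 ultimately have "f : \<Union>XX" "g : G - \<Union>XX" using UX(2)[OF XX(1)] XZ by blast+
 hence "\<Union>XX ~= {}" "\<Union>XX ~= G" by blast+
 hence "cut' (\<Union>XX) ~= {}" using conn_G[rule_format, OF UX(1)[OF XX(1)]] by blast
 then obtain e where "e : cut' (\<Union>XX)" by blast
 thus "EX e:edges T. (EX h:YY. e <= h) & (EX k:T - YY. e <= k)" using cut_T[OF XX(1), of e] XX(2) by blast
qed

lemma verts_T: "verts T = (UN X:QQ. tr X)" by (auto simp: verts_def T_def)

lemma int_T: assumes "X : QQ" shows "int_verts X Int verts T = {}"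
proof -
 have False if v: "v : int_verts X" "Y : QQ" "v : tr Y" for v Y
 proof -
  have t: "EX f:Y. v : f" "EX g:G - Y. v : g" using tr_verts[OF QG[OF v(2)]] v(3) by blast+
  have all: "f : X" if "f : G" "v : f" for f using v(1) that by (auto simp: int_verts_def)
  obtain f where f: "f : Y" "v : f" using t by blast
  hence "f : X" using all QG[OF v(2)] by blast
  hence "X = Y" using Qdis[OF assms v(2)] f by blast
  thus False using t(2) all by blast
 qed
 thus ?thesis unfolding verts_T by blast
qed

lemma int_dis: assumes "X : QQ" "Y : QQ" "X ~= Y" shows "int_verts X Int int_verts Y = {}"
proof -
 have False if v: "v : int_verts X" "v : int_verts Y" for v
 proof -
  obtain f where "f : G" "v : f" using v by (auto simp: int_verts_def verts_def)
  hence "f : X" "f : Y" using v by (auto simp: int_verts_def)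
  thus False using Qdis assms by blast
 qed
 thus ?thesis by blast
qed

lemma verts_split: "verts G = verts T Un (UN X:QQ. int_verts X)"
proof
 show "verts G <= verts T Un (UN X:QQ. int_verts X)"
 proof
  fix v assume v: "v : verts G"
  then obtain f where f: "f : G" "v : f" by (auto simp: verts_def)
  obtain X where X: "X : QQ" "f : X" using f UQ by blast
  show "v : verts T Un (UN X:QQ. int_verts X)"
  proof (cases "v : tr X")
   case True thus ?thesis using X verts_T by blast
  next
   case False
   hence "v : int_verts X" using tr_verts[OF QG[OF X(1)], of v] X f v by (auto simp: int_verts_def)
   thus ?thesis using X by blast
  qed
 qed
 have "tr X <= verts G" if "X : QQ" for X using tr_verts[OF QG[OF that]] by (auto simp: verts_def)
 thus "verts T Un (UN X:QQ. int_verts X) <= verts G" unfolding verts_T by (auto simp: int_verts_def)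
qed

lemma edges_split: "edges G = edges T Un (UN X:QQ. inner' X)"
proof
 show "edges G <= edges T Un (UN X:QQ. inner' X)"
 proof
  fix e assume e: "e : edges G"
  then obtain f where f: "f : G" "e <= f" by (auto simp: edges_def)
  obtain X where X: "X : QQ" "f : X" using f UQ by blast
  have "e ~: inner' (G - X)" using inner_iff[of "G - X" e] f X edge_pairs[OF e] by blast
  hence "e : inner' X | e : cut' X" using edge_cases[OF QG[OF X(1)] e] by blast
  thus "e : edges T Un (UN X:QQ. inner' X)" using X edges_T by blast
 qed
 show "edges T Un (UN X:QQ. inner' X) <= edges G" using edges_T cut_E inner_E by blast
qed

lemma inner_T: assumes "X : QQ" shows "inner' X Int edges T = {}"
proof -
 have False if e: "e : inner' X" "Y : QQ" "e : cut' Y" for e Y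
 proof -
  obtain f g where fg: "e : edges G" "f : Y" "e <= f" "g : G - Y" "e <= g" using e(3) QG[OF e(2)] by (rule cutE)
  have "f : X" "g : X" using inner_iff[OF QG[OF assms]] e(1) fg QG[OF e(2)] edge_pairs[OF fg(1)] by blast+
  thus False using Qdis[OF assms e(2), of f] fg by blast
 qed
 thus ?thesis using edges_T by blast
qed

lemma inner_dis: assumes "X : QQ" "Y : QQ" "X ~= Y" shows "inner' X Int inner' Y = {}"
proof -
 have False if e: "e : inner' X" "e : inner' Y" for e
 proof -
  have "e : edges G" using e inner_E by blast
  then obtain f where "f : G" "e : pairs f" using two_faces by metis
  hence "f : X" "f : Y" using e inner_iff[OF QG[OF assms(1)]] inner_iff[OF QG[OF assms(2)]] by blast+
  thus False using Qdis assms by blast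
 qed
 thus ?thesis by blast
qed

lemma chi_sum: "euler_char G = euler_char T + (SUM X:QQ. kappa X)"
proof -
 have fT: "finite (verts T)" "finite (edges T)" using fin_verts fin_edges verts_split edges_split by (metis finite_Un)+
 have "card (verts G) = card (verts T) + card (UN X:QQ. int_verts X)"
  unfolding verts_split using fT finQ fin_int int_T by (intro card_Un_disjoint) auto
 also have "card (UN X:QQ. int_verts X) = (SUM X:QQ. card (int_verts X))"
  using finQ fin_int int_dis by (intro card_UN_disjoint) auto
 finally have V: "card (verts G) = card (verts T) + (SUM X:QQ. card (int_verts X))" .
 have "card (edges G) = card (edges T Un (UN X:QQ. inner' X))" using edges_split by (rule arg_cong)
 also have "... = card (edges T) + card (UN X:QQ. inner' X)"
  using fT finQ fin_inner inner_T by (intro card_Un_disjoint) auto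
 also have "card (UN X:QQ. inner' X) = (SUM X:QQ. card (inner' X))"
  using finQ fin_inner inner_dis by (intro card_UN_disjoint) auto
 finally have E: "card (edges G) = card (edges T) + (SUM X:QQ. card (inner' X))" .
 have Fc: "card G = (SUM X:QQ. card X)"
  using part fin_G QG by (intro product_partition) (auto intro: finite_subset)
 have Tc: "card T = card QQ" unfolding T_def using tr_inj by (rule card_image)
 have "(SUM X:QQ. kappa X) = int (SUM X:QQ. card (int_verts X)) - int (SUM X:QQ. card (inner' X)) + int (SUM X:QQ. card X) - int (card QQ)"
  unfolding kappa_def by (simp add: sum.distrib sum_subtractf)
 thus ?thesis unfolding euler_char_def V E Fc Tc by simp
qed

end

context surf
begin

text \<open>A piece capped by its boundary triangle is a quotient of \<open>G\<close> too: the faces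
  of \<open>X\<close> stay single and the complement becomes one part. So pieces are surfaces by
  \<open>surface_T\<close>.\<close>

lemma piece_quot:
 assumes X: "X <= G" "card (cut' X) = 3" "2 <= card X"
 shows "quot G ((%f. {f}) ` X Un {G - X})" "quot.T G ((%f. {f}) ` X Un {G - X}) = insert (tr X) X"
proof -
 let ?QQ = "(%f. {f}) ` X Un {G - X}"
 have fX: "finite X" using X(1) fin_G finite_subset by blast
 have ne: "G - X ~= {}" using X cut_F by auto
 have p: "partition_on G ?QQ"
 proof (rule partition_onI)
  show "\<Union>?QQ = G" using X(1) by auto
  show "{} ~: ?QQ" using ne by auto
  show "disjnt p q" if "p : ?QQ" "q : ?QQ" "p ~= q" for p q using that by (auto simp: disjnt_def)
 qed
 have c: "card ?QQ >= 3"
 proof -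
  have "G - X ~: (%f. {f}) ` X" by auto
  hence "card ?QQ = Suc (card ((%f. {f}) ` X))" using fX by simp
  moreover have "card ((%f. {f}) ` X) = card X" by (rule card_image) (simp add: inj_on_def)
  ultimately show ?thesis using X(3) by simp
 qed
 show q: "quot G ?QQ"
 proof
  show "partition_on G ?QQ" by (rule p)
  show "3 <= card ?QQ" by (rule c)
  show "card (cut' Y) = 3" if "Y : ?QQ" for Y
   using that X cut_compl[OF X(1)] cut_pairs_single by auto
 qed
 have tc: "tr (G - X) = tr X" by (simp add: tr_def cut_compl[OF X(1)])
 have "tr ` (%f. {f}) ` X = X" using tr_single X(1) by (force simp: image_image)
 hence "tr ` ?QQ = insert (tr X) X" using tc by (simp add: image_Un)
 thus "quot.T G ?QQ = insert (tr X) X" unfolding quot.T_def[OF q] .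
qed

lemma piece_surface: "X <= G ==> card (cut' X) = 3 ==> 2 <= card X ==> surface_tri (insert (tr X) X)"
 using quot.surface_T[OF piece_quot(1)] piece_quot(2) by metis

lemma piece_verts: assumes X: "X <= G" "card (cut' X) = 3"
 shows "verts (insert (tr X) X) = tr X Un int_verts X" "tr X Int int_verts X = {}"
proof -
 show "verts (insert (tr X) X) = tr X Un int_verts X"
 proof
  show "verts (insert (tr X) X) <= tr X Un int_verts X"
   using tr_verts[OF X(1)] X(1) by (auto simp: verts_def int_verts_def)
  show "tr X Un int_verts X <= verts (insert (tr X) X)" by (auto simp: verts_def int_verts_def)
 qed
 show "tr X Int int_verts X = {}" using tr_verts[OF X(1)] by (auto simp: int_verts_def)
qed

lemma piece_edges: assumes X: "X <= G" "card (cut' X) = 3"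
 shows "edges (insert (tr X) X) = inner' X Un cut' X"
proof
 show "edges (insert (tr X) X) <= inner' X Un cut' X"
 proof
  fix e assume "e : edges (insert (tr X) X)"
  hence e: "card e = 2" "e <= tr X | (EX f:X. e <= f)" by (auto simp: edges_def)
  from e(2) show "e : inner' X Un cut' X"
  proof
   assume "e <= tr X" thus ?thesis using tr_cut[OF X] e(1) by (simp add: pairs_def)
  next
   assume "EX f:X. e <= f"
   then obtain f where f: "f : X" "e <= f" by blast
   hence eE: "e : edges G" using e(1) X by (auto simp: edges_def)
   have "e ~: inner' (G - X)" using inner_iff[of "G - X" e] f X edge_pairs[OF eE] by blast
   thus ?thesis using edge_cases[OF X(1) eE] by blast
  qed
 qed
 show "inner' X Un cut' X <= edges (insert (tr X) X)"
 proof
  fix e assume e: "e : inner' X Un cut' X"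
  hence eE: "e : edges G" using inner_E cut_E by blast
  then obtain f where f: "f : G" "e <= f" by (auto simp: edges_def)
  have "EX f:X. e <= f" using e
  proof
   assume "e : inner' X" thus ?thesis using inner_iff[OF X(1)] f edge_pairs[OF eE] by blast
  next
   assume "e : cut' X" thus ?thesis using X(1) by (rule cutE) blast
  qed
  thus "e : edges (insert (tr X) X)" using eE by (auto simp: edges_def)
 qed
qed

lemma piece_chi: assumes X: "X <= G" "card (cut' X) = 3" "2 <= card X"
 shows "euler_char (insert (tr X) X) = kappa X + 2"
proof -
 have fX: "finite X" using X(1) fin_G finite_subset by blast
 have ft: "finite (tr X)" using tr_cut(1)[OF X(1,2)] by (metis card.infinite zero_neq_numeral)
 have "card (verts (insert (tr X) X)) = 3 + card (int_verts X)"
  unfolding piece_verts(1)[OF X(1,2)] using piece_verts(2)[OF X(1,2)] ft fin_int tr_cut(1)[OF X(1,2)]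
  by (subst card_Un_disjoint) auto
 moreover have "card (edges (insert (tr X) X)) = card (inner' X) + 3"
  unfolding piece_edges[OF X(1,2)] using fin_inner fin_cut inner_cut_disj X(2) by (subst card_Un_disjoint) auto
 moreover have "card (insert (tr X) X) = card X + 1" using tr_notin[OF X] fX by simp
 ultimately show ?thesis by (simp add: euler_char_def kappa_def)
qed

lemma kappa_single: assumes f: "f : G" shows "kappa {f} = 0"
proof -
 have "int_verts {f} = {}"
 proof (rule ccontr)
  assume "int_verts {f} ~= {}"
  then obtain v where v: "v : verts G" "ALL g:G. v : g --> g = f" by (auto simp: int_verts_def)
  hence vf: "v : f" by (auto simp: verts_def)
  obtain x where x: "x : f" "x ~= v" using card_3_ex[OF card_face[OF f] vf] by blast
  have e: "{v, x} : edges G" using face_edge[OF f vf x(1)] x(2) by blast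
  have "{h:G. {v, x} <= h} <= {f}" using v(2) by blast
  hence "card {h:G. {v, x} <= h} <= 1" using card_mono[of "{f}"] by simp
  thus False using two_G[OF e] by simp
 qed
 thus ?thesis using inner_single by (simp add: kappa_def)
qed

text \<open>A capped piece with at least two faces is a closed surface of Euler characteristic
  \<open>kappa X + 2\<close>, which is at most 2; for a single face the defect is 0.\<close>

lemma kappa_le: assumes X: "X <= G" "card (cut' X) = 3" shows "kappa X <= 0"
proof (cases "2 <= card X")
 case True
 interpret p: surf "insert (tr X) X" by unfold_locales (rule piece_surface[OF X True])
 show ?thesis using p.chi_le2 piece_chi[OF X True] by simp
next
 case False
 have "X ~= {}" using X cut_empty by auto
 moreover have "finite X" using X(1) fin_G finite_subset by blast
 ultimately have "card X = 1" using False card_one by blast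
 then obtain f where "X = {f}" by (auto simp: card_1_singleton_iff)
 thus ?thesis using kappa_single[of f] X by simp
qed

end

context quot
begin

text \<open>Euler characteristics differ by the sum of the non-positive defects. If nothing is lost
  between \<open>G\<close> and \<open>T\<close>, or if \<open>G\<close> has the maximal value 2,
  every defect vanishes; then every capped piece is a sphere.\<close>

lemma kappa_zero: assumes "euler_char T = euler_char G | euler_char G = 2" and X: "X : QQ"
 shows "kappa X = 0" and "euler_char T = euler_char G"
proof -
 interpret t: surf T by unfold_locales (rule surface_T)
 have le: "kappa Y <= 0" if "Y : QQ" for Y using kappa_le[OF QG[OF that] d3[OF that]] .
 have s: "(SUM Y:QQ. kappa Y) <= 0" using le by (intro sum_nonpos) auto
 have z: "(SUM Y:QQ. kappa Y) = 0" using chi_sum assms(1) t.chi_le2 s by auto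
 hence "(SUM Y:QQ. - kappa Y) = 0" by (simp add: sum_negf)
 moreover have "(SUM Y:QQ. - kappa Y) = 0 \<longleftrightarrow> (ALL Y:QQ. - kappa Y = 0)"
  using finQ le by (intro sum_nonneg_eq_0_iff) auto
 ultimately show "kappa X = 0" using X by auto
 show "euler_char T = euler_char G" using chi_sum z by simp
qed

definition "pt s = inv_into QQ tr s"

lemma pt: "X : QQ ==> pt (tr X) = X" unfolding pt_def using tr_inj by (rule inv_into_f_f)

definition "SS = tr ` {X:QQ. 2 <= card X}"
definition "PP s = insert s (pt s)"

lemma PP_tr: "X : QQ ==> PP (tr X) = insert (tr X) X" by (simp add: PP_def pt)

lemma plane_PP: assumes "euler_char T = euler_char G | euler_char G = 2" and s: "s : SS" shows "plane_tri (PP s)" "s : PP s"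
proof -
 obtain X where X: "X : QQ" "2 <= card X" "s = tr X" using s by (auto simp: SS_def)
 show "plane_tri (PP s)" unfolding plane_tri_def X(3) PP_tr[OF X(1)]
  using piece_surface[OF QG[OF X(1)] d3[OF X(1)] X(2)] piece_chi[OF QG[OF X(1)] d3[OF X(1)] X(2)] kappa_zero(1)[OF assms(1) X(1)] by simp
 show "s : PP s" by (simp add: PP_def)
qed

lemma paste: "paste_family T SS PP G"
 unfolding paste_family_def
proof (intro conjI ballI impI)
 show "SS <= T" by (auto simp: SS_def T_def)
 have vP: "verts (PP (tr X)) = tr X Un int_verts X" if "X : QQ" for X
  unfolding PP_tr[OF that] using piece_verts(1)[OF QG[OF that] d3[OF that]] .
 fix s assume s: "s : SS"
 then obtain X where X: "X : QQ" "2 <= card X" "s = tr X" by (auto simp: SS_def)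
 show "s : PP s" by (simp add: PP_def)
 show "verts (PP s) Int verts T = s"
  using vP[OF X(1)] int_T[OF X(1)] verts_T X by blast
 fix t assume t: "t : SS" "s ~= t"
 then obtain Y where Y: "Y : QQ" "t = tr Y" by (auto simp: SS_def)
 have "X ~= Y" using t X Y by blast
 thus "verts (PP s) Int verts (PP t) <= verts T"
  using vP[OF X(1)] vP[OF Y(1)] int_dis[OF X(1) Y(1)] verts_T X Y by blast
next
 show "G = (T - SS) Un (UN s:SS. PP s - {s})"
 proof
  show "G <= (T - SS) Un (UN s:SS. PP s - {s})"
  proof
   fix f assume f: "f : G"
   obtain X where X: "X : QQ" "f : X" using f UQ by blast
   show "f : (T - SS) Un (UN s:SS. PP s - {s})"
   proof (cases "2 <= card X")
    case True
    have "tr X : SS" using X True by (auto simp: SS_def)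
    moreover have "f : PP (tr X) - {tr X}" using PP_tr[OF X(1)] X(2) tr_notin[OF QG[OF X(1)] d3[OF X(1)] True] by auto
    ultimately show ?thesis by blast
   next
    case False
    have "finite X" using QG[OF X(1)] fin_G finite_subset by blast
    hence "card X = 1" using False X(2) card_one[of X] by blast
    hence Xf: "X = {f}" using X(2) by (auto simp: card_1_singleton_iff)
    hence tf: "tr X = f" using tr_single[OF f] by simp
    have "f ~: SS"
    proof
     assume "f : SS"
     then obtain Y where Y: "Y : QQ" "2 <= card Y" "f = tr Y" by (auto simp: SS_def)
     hence "X = Y" using inj_onD[OF tr_inj, of X Y] tf X(1) by simp
     thus False using Y False by simp
    qed
    moreover have "f : T" using tf X(1) by (auto simp: T_def)
    ultimately show ?thesis by blast
   qed
  qed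
  show "(T - SS) Un (UN s:SS. PP s - {s}) <= G"
  proof
   fix f assume "f : (T - SS) Un (UN s:SS. PP s - {s})"
   thus "f : G"
   proof
    assume f: "f : T - SS"
    then obtain X where X: "X : QQ" "f = tr X" by (auto simp: T_def)
    hence "~ 2 <= card X" using f by (auto simp: SS_def)
    moreover have "finite X" using QG[OF X(1)] fin_G finite_subset by blast
    ultimately have "card X = 1" using Qne[OF X(1)] card_one by blast
    then obtain g where g: "X = {g}" by (auto simp: card_1_singleton_iff)
    hence "g : G" using QG[OF X(1)] by blast
    thus ?thesis using tr_single[of g] g X by simp
   next
    assume "f : (UN s:SS. PP s - {s})"
    then obtain s where s: "s : SS" "f : PP s" "f ~= s" by blast
    then obtain X where X: "X : QQ" "s = tr X" by (auto simp: SS_def)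
    thus ?thesis using s PP_tr[OF X(1)] QG[OF X(1)] by auto
   qed
  qed
 qed
qed

end

section \<open>Face 2-colourings and lone monochromatic faces\<close>

definition lone_mono :: "'a set set => 'a set => 'a set => bool" where
 "lone_mono G f0 X \<longleftrightarrow> mono X f0 & (ALL f:G - {f0}. ~ mono X f)"

context surf
begin

lemma col_cut: assumes R: "proper_face_2col G R"
 shows "R <= G" "inner' R = {}" "inner' (G - R) = {}" "cut' R = edges G"
proof -
 show RG: "R <= G" using R by (simp add: proper_face_2col_def)
 have split: "e : cut' R & e ~: inner' R & e ~: inner' (G - R)" if e: "e : edges G" for e
 proof -
  obtain f g where fg: "f : G" "g : G" "f ~= g" "e : pairs f" "e : pairs g" "{h:G. e : pairs h} = {f, g}" by (rule two_faces[OF e])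
  have sub: "e <= f Int g" "card e = 2" using fg by (auto simp: pairs_def)
  have fin: "finite f" using fin_face[OF fg(1)] .
  have "card (f Int g) >= 2" using card_mono[of "f Int g" e] sub fin by auto
  moreover have "card (f Int g) ~= 3"
  proof
   assume c: "card (f Int g) = 3"
   have "f Int g = f" using c card_face[OF fg(1)] fin by (intro card_subset_eq) auto
   moreover have "f Int g = g" using c card_face[OF fg(2)] fin_face[OF fg(2)] by (intro card_subset_eq) auto
   ultimately show False using fg(3) by simp
  qed
  moreover have "card (f Int g) <= 3" using card_mono[OF fin, of "f Int g"] card_face[OF fg(1)] by simp
  ultimately have "card (f Int g) = 2" by linarith
  hence "f : R \<longleftrightarrow> g ~: R" using R fg(1-3) by (simp add: proper_face_2col_def)
  thus ?thesis using cut_two[OF RG fg(6,3)] inner_two[OF RG fg(6,3)] inner_two[OF _ fg(6,3), of "G - R"] by blast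
 qed
 show "inner' R = {}" "inner' (G - R) = {}" "cut' R = edges G" using split inner_E cut_E by blast+
qed

lemma col_count: assumes R: "proper_face_2col G R" and z: "z <= edges G"
 shows "(SUM f:R. card (z Int pairs f)) = card z" "(SUM f:G - R. card (z Int pairs f)) = card z"
proof -
 note c = col_cut[OF R]
 have i: "z Int edges G = z" using z by blast
 show "(SUM f:R. card (z Int pairs f)) = card z" using handshake[OF c(1) z] c(2,4) i by simp
 have "G - R <= G" by blast
 thus "(SUM f:G - R. card (z Int pairs f)) = card z" using handshake[of "G - R", OF _ z] c(3,4) cut_compl[OF c(1)] i by simp
qed

lemma col_eulerian: assumes R: "proper_face_2col G R" shows "eulerian G"
 unfolding eulerian_def degree_def
proof
 fix v
 have "(SUM f:R. card ({e:edges G. v : e} Int pairs f)) = card {e:edges G. v : e}" by (rule col_count(1)[OF R]) auto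
 moreover have "even (SUM f:R. card ({e:edges G. v : e} Int pairs f))"
 proof (rule dvd_sum)
  fix f assume "f : R"
  hence f: "f : G" using col_cut(1)[OF R] by blast
  have "{e:edges G. v : e} Int pairs f = {e:pairs f. v : e}" using pairs_edges[OF f] by blast
  thus "even (card ({e:edges G. v : e} Int pairs f))" using closed_bd[OF f] by simp
 qed
 ultimately show "even (card {e:edges G. v : e})" by simp
qed

text \<open>Every edge has one red and one blue face, so both colours occur equally often. With all
  blue faces bichromatic the cut has twice as many edges as there are blue faces, but counted over
  the red faces it has fewer.\<close>

lemma col_no_lone:
 assumes R: "proper_face_2col G R" and f0: "f0 : R" "mono X f0" and blue: "ALL f:G - R. ~ mono X f"
 shows False
proof -
 note c = col_cut[OF R]
 have fR: "finite R" "finite (G - R)" using c(1) fin_G finite_subset by auto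
 have "(SUM f:R. card (edges G Int pairs f)) = (SUM f:R. 3)"
  using c(1) pairs_edges card_pairs_face by (intro sum.cong) (auto simp: Int_absorb1 subset_iff)
 moreover have "(SUM f:G - R. card (edges G Int pairs f)) = (SUM f:G - R. 3)"
  using pairs_edges card_pairs_face by (intro sum.cong) (auto simp: Int_absorb1 subset_iff)
 ultimately have eq: "card R = card (G - R)" using col_count[OF R order_refl] by simp
 have "(SUM f:G - R. card (cob' X Int pairs f)) = (SUM f:G - R. 2)"
  using cob_face blue by (intro sum.cong) auto
 hence 1: "card (cob' X) = 2 * card (G - R)" using col_count(2)[OF R cob_E] by simp
 have "(SUM f:R. card (cob' X Int pairs f)) < (SUM f:R. 2)"
  using fR c(1) cob_face f0 by (intro sum_strict_mono_ex1) (auto intro!: bexI[of _ f0])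
 thus False using 1 eq col_count(1)[OF R cob_E] by simp
qed

end

section \<open>Quasi-Eulerian triangulations\<close>

text \<open>A blue face of \<open>E\<close> cannot be monochromatic: either it is a face of
  \<open>T\<close>, or by induction the piece inside contains a further monochromatic face. Then
  \<open>col_no_lone\<close> applies to the red face \<open>f0\<close>.\<close>

lemma qe_no_lone: "qe_level n T f0 ==> ~ lone_mono T f0 X"
proof (induction n arbitrary: T f0)
 case (Suc n)
 obtain E R S P where q: "plane_tri E" "f0 : E" "proper_face_2col E R" "f0 : R" "S <= E - {f0}" "paste_family E S P T"
  "ALL s:S. s ~: R --> qe_level n (P s) s" using Suc.prems by auto
 interpret surf E by unfold_locales (use q(1) in \<open>simp add: plane_tri_def\<close>)
 have p: "ALL s:S. s : P s & verts (P s) Int verts E = s" "T = (E - S) Un (UN s:S. P s - {s})"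
  using q(6) by (auto simp: paste_family_def)
 show ?case
 proof
  assume X: "lone_mono T f0 X"
  have "~ mono X b" if b: "b : E - R" for b
  proof (cases "b : S")
   case False
   hence "b : T - {f0}" using b p(2) q(4) by blast
   thus ?thesis using X by (simp add: lone_mono_def)
  next
   case True
   show ?thesis
   proof
    assume mb: "mono X b"
    have "~ lone_mono (P b) b X" using Suc.IH q(7) True b by blast
    then obtain f where f: "f : P b - {b}" "mono X f" using mb by (auto simp: lone_mono_def)
    have "f ~= f0"
    proof
     assume e: "f = f0"
     have "f0 <= verts (P b) Int verts E" using e f(1) q(2) by (auto simp: verts_def)
     hence "f0 <= b" using p(1) True by blast
     hence "f0 = b" using card_face[OF q(2)] card_face[of b] fin_face[of b] b by (intro card_subset_eq) auto
     thus False using True q(5) by blast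
    qed
    hence "f : T - {f0}" using f True p(2) by blast
    thus False using X f by (simp add: lone_mono_def)
   qed
  qed
  thus False using col_no_lone[OF q(3,4)] X by (auto simp: lone_mono_def)
 qed
qed simp

lemma qe_mono: "qe_level n T f0 ==> n <= m ==> qe_level m T f0"
proof (induction n arbitrary: T f0 m)
 case (Suc n)
 obtain E R S P where q: "plane_tri E" "eulerian E" "no_sep_3cycle E" "f0 : E" "proper_face_2col E R" "f0 : R" "S <= E - {f0}" "paste_family E S P T"
  "ALL s:S. s : R --> plane_tri (P s)" "ALL s:S. s ~: R --> qe_level n (P s) s" using Suc.prems(1) by auto
 obtain k where k: "m = Suc k" "n <= k" using Suc.prems(2) by (cases m) auto
 have "ALL s:S. s ~: R --> qe_level k (P s) s" using q(10) Suc.IH k(2) by blast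
 thus ?case unfolding k(1) qe_level.simps using q(1-9) by blast
qed simp

text \<open>A count modulo 3: the three edges of a bounding 3-cycle cannot be divided as 1 and 2. In
  the application \<open>p\<close> counts those at faces of \<open>A\<close> inside and
  \<open>q\<close> the others.\<close>

lemma blue_red_arith: "3 * a = i + p ==> 3 * n = i + q ==> p + q = 3 ==> p = 3 & q = 0 & a = n + 1 | p = 0 & q = (3 :: nat)"
proof -
 assume h: "3 * a = i + p" "3 * n = i + q" "p + q = 3"
 have n1: "3 * a + 1 ~= 3 * n" "3 * n + 1 ~= 3 * a" by presburger+
 consider "p = 0" | "p = 1" | "p = 2" | "p = 3" using h(3) by linarith
 thus ?thesis using h n1 by cases linarith+
qed

lemma blue_red_arith2: "3 * k <= s ==> s + 2 * i + 6 = 3 * a + 3 ==> a = b + 3 ==> b + 2 <= k ==> s = 3 * k & i = (0 :: nat)"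
 by linarith

section \<open>Laminar 3-cuts and the barrier at the outer face\<close>

context surf
begin

lemma share_edge: assumes "f : G" "g : G" "f ~= g" "e : pairs f" "e : pairs g" "e' : pairs f" "e' : pairs g"
 shows "e = e'"
proof (rule ccontr)
 assume ne: "e ~= e'"
 have c: "card e = 2" "card e' = 2" "e Un e' <= f" "e Un e' <= g" using assms by (auto simp: pairs_def)
 have fin: "finite f" "finite g" using fin_face assms by auto
 have fe: "finite (e Un e')" using c(3) fin finite_subset by blast
 have "card (e Un e') >= 3"
 proof (rule ccontr)
  assume "~ 3 <= card (e Un e')"
  hence l: "card (e Un e') <= 2" by simp
  have "e = e Un e'" using l fe c by (intro card_seteq) auto
  moreover have "e' = e Un e'" using l fe c by (intro card_seteq) auto
  ultimately show False using ne by simp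
 qed
 hence "e Un e' = f" "e Un e' = g"
  using card_seteq[OF fin(1) c(3)] card_seteq[OF fin(2) c(4)] card_face[OF assms(1)] card_face[OF assms(2)] by simp_all
 thus False using assms(3) by simp
qed

lemma cut_ne2: assumes X: "X <= G" shows "card (cut' X) ~= 2"
proof
 assume "card (cut' X) = 2"
 then obtain e e' where e: "cut' X = {e, e'}" "e ~= e'" by (auto simp: card_2_iff)
 have eE: "e : edges G" "e' : edges G" using e(1) cut_E by blast+
 have "v : e'" if v: "v : e" for v
 proof -
  have "even (card {x:cut' X. v : x})" using closed_cut[OF X] by (simp add: closed_def)
  moreover have "e : {x:cut' X. v : x}" using v e by blast
  ultimately have "EX x:{x:cut' X. v : x}. x ~= e" by (rule even_card_other)
  thus ?thesis using e by blast
 qed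
 hence "e <= e'" by blast
 moreover have "card e = 2" "card e' = 2" using eE by (auto simp: edges_def)
 moreover have "finite e'" using \<open>card e' = 2\<close> by (metis card.infinite zero_neq_numeral)
 ultimately show False using e(2) card_subset_eq[of e' e] by simp
qed

lemma cut_ge: assumes X: "X <= G" "X ~= {}" "X ~= G"
 shows "3 <= card (cut' X)" "even (card X) ==> 4 <= card (cut' X)"
proof -
 have "cut' X ~= {}" using conn_G X by blast
 hence "card (cut' X) ~= 0" using fin_cut by simp
 thus c3: "3 <= card (cut' X)" using bridgeless_G[OF X(1)] cut_ne2[OF X(1)] by linarith
 assume "even (card X)"
 hence "card (cut' X) ~= 3" using cut_parity[OF X(1)] by (metis odd_numeral)
 thus "4 <= card (cut' X)" using c3 by linarith
qed

text \<open>A set with a 3-cut has odd size. If two of them cross, then intersection and union, or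
  both differences, have even size and cuts of at least 4, too much for \<open>3 + 3\<close>. All
  four sets are proper since they avoid or miss enough of the faces around: \<open>f0\<close> lies
  in none of them.\<close>

lemma laminar:
 assumes f0: "f0 : G" and W: "W <= G - {f0}" "card (cut' W) = 3" and V: "V <= G - {f0}" "card (cut' V) = 3"
 shows "W <= V | V <= W | W Int V = {}"
proof (rule ccontr)
 assume n: "~ ?thesis"
 have sub: "W <= G" "V <= G" "W Int V <= G" "W Un V <= G" "W - V <= G" "V - W <= G" using W V by blast+
 have fin: "finite W" "finite V" using sub fin_G finite_subset by blast+
 have od: "odd (card W)" "odd (card V)" using cut_parity[OF sub(1)] cut_parity[OF sub(2)] W V by auto
 have ne: "W Int V ~= {}" "W - V ~= {}" "V - W ~= {}" "W Un V ~= {}" using n by blast+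
 have neG: "W Int V ~= G" "W - V ~= G" "V - W ~= G" "W Un V ~= G" using W V f0 by blast+
 have c1: "card W = card (W Int V) + card (W - V)" using fin by (metis card_Int_Diff)
 have c2: "card V = card (W Int V) + card (V - W)" using fin by (metis card_Int_Diff Int_commute)
 have c3: "card (W Un V) + card (W Int V) = card W + card V" using fin card_Un_Int by metis
 show False
 proof (cases "even (card (W Int V))")
  case True
  hence "even (card (W Un V))" using c3 od by (metis even_add)
  hence "4 <= card (cut' (W Un V))" "4 <= card (cut' (W Int V))"
   using cut_ge(2)[OF sub(4) ne(4) neG(4)] cut_ge(2)[OF sub(3) ne(1) neG(1)] True by blast+
  thus False using cut_submodular[OF sub(1,2)] W V by linarith
 next
  case False
  hence "even (card (W - V))" "even (card (V - W))" using c1 c2 od by (metis even_add)+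
  hence "4 <= card (cut' (W - V))" "4 <= card (cut' (V - W))"
   using cut_ge(2)[OF sub(5) ne(2) neG(2)] cut_ge(2)[OF sub(6) ne(3) neG(3)] by blast+
  thus False using cut_posimodular[OF sub(1,2)] W V by linarith
 qed
qed

text \<open>The three neighbours \<open>H\<close> of \<open>f0\<close> are regarded as matched to
  \<open>f0\<close>. A matching of the remaining faces would give a colouring with \<open>f0\<close>
  as lone monochromatic face, so there is a barrier. The count leaves no slack: all cuts are exactly
  3 and no two faces of \<open>A\<close> are adjacent.\<close>

lemma barrier:
 assumes cobs: "!!z. cocycle' z ==> is_cob' z" and f0: "f0 : G" and no: "!!X. ~ lone_mono G f0 X"
 obtains A KK where "A <= G - {f0}" "A ~= {}" "partition_on (G - A) KK" "{f0} : KK"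
  "ALL K:KK. card (cut' K) = 3" "ALL K:KK. ALL L:KK. K ~= L --> cut' K Int cut' L = {}" "inner' A = {}" "4 <= card G"
proof -
 define H where "H = {h:G - {f0}. pairs h Int pairs f0 ~= {}}"
 have oth: "EX h:G - {f0}. e : pairs h" if e: "e : pairs f0" for e
 proof -
  obtain g where "g : G" "g ~= f0" "e : pairs g" "{k:G. e : pairs k} = {f0, g}" by (rule other_face[OF f0 e])
  thus ?thesis by blast
 qed
 then obtain o1 where o1: "!!e. e : pairs f0 ==> o1 e : G - {f0} & e : pairs (o1 e)" by metis
 have oH: "o1 ` pairs f0 = H"
 proof
  show "o1 ` pairs f0 <= H"
  proof
   fix h assume "h : o1 ` pairs f0"
   then obtain e where e: "e : pairs f0" "h = o1 e" by blast
   hence "e : pairs h Int pairs f0" using o1[OF e(1)] by simp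
   hence "pairs h Int pairs f0 ~= {}" by blast
   thus "h : H" using o1[OF e(1)] e(2) by (simp add: H_def)
  qed
  show "H <= o1 ` pairs f0"
  proof
   fix h assume "h : H"
   then obtain e where e: "h : G" "h ~= f0" "e : pairs h" "e : pairs f0" by (auto simp: H_def)
   obtain g where "g : G" "g ~= f0" "e : pairs g" and g: "{k:G. e : pairs k} = {f0, g}" by (rule other_face[OF f0 e(4)])
   have "h : {k:G. e : pairs k}" "o1 e : {k:G. e : pairs k}" using e o1[OF e(4)] by blast+
   hence "h = g" "o1 e = g" using g e(2) o1[OF e(4)] by auto
   thus "h : o1 ` pairs f0" using e(4) by blast
  qed
 qed
 have "inj_on o1 (pairs f0)"
 proof (rule inj_onI)
  fix e e' assume e: "e : pairs f0" "e' : pairs f0" "o1 e = o1 e'"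
  show "e = e'" by (rule share_edge[of f0 "o1 e"]) (use f0 o1[OF e(1)] o1[OF e(2)] e in auto)
 qed
 hence cH: "card H = 3" using oH card_image card_pairs_face[OF f0] by metis
 have HG: "H <= G - {f0}" by (auto simp: H_def)
 define U where "U = G - {f0} - H"
 have UG: "U <= G" by (auto simp: U_def)
 have finU: "finite U" using UG fin_G finite_subset by blast
 have cU: "card U + 4 = card G"
 proof -
  have "card (G - {f0}) + 1 = card G" using card.remove[OF fin_G f0] by simp
  moreover have "card U = card (G - {f0}) - card H" unfolding U_def using HG fin_G finite_subset by (intro card_Diff_subset) auto
  moreover have "card H <= card (G - {f0})" using HG fin_G by (intro card_mono) auto
  ultimately show ?thesis using cH by simp
 qed
 have share1: "card (pairs f0 Int pairs h) = 1" if h: "h : H" for h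
 proof -
  obtain e where e: "e : pairs f0" "e : pairs h" using h by (auto simp: H_def)
  have "pairs f0 Int pairs h = {e}" using share_edge[of f0 h _ e] f0 h e HG by blast
  thus ?thesis by simp
 qed
 have nm: "~ matchable (near {}) U"
 proof
  assume "matchable (near {}) U"
  then obtain m where m: "m <= edges G" "ALL f:U. card (m Int pairs f) = 1" "ALL f:G - U. m Int pairs f = {}"
   using matchable_edges[OF _ UG, of "{}"] by auto
  \<comment> \<open>All three edges of \<open>f0\<close> are chosen, one for each neighbour. The
    complement misses \<open>f0\<close> and has two edges in every other face, so it is a
    cocycle.\<close>
  define M where "M = m Un pairs f0"
  have M1: "card (M Int pairs f) = 1" if f: "f : G" "f ~= f0" for f
  proof (cases "f : U")
   case True
   hence "pairs f0 Int pairs f = {}" using f by (auto simp: U_def H_def)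
   hence "M Int pairs f = m Int pairs f" by (auto simp: M_def)
   thus ?thesis using m True by simp
  next
   case False
   hence "f : H" using f by (auto simp: U_def)
   moreover have "M Int pairs f = pairs f0 Int pairs f" using m(3) f False by (auto simp: M_def)
   ultimately show ?thesis using share1 by simp
  qed
  have cc: "card ((edges G - M) Int pairs f) = 3 - card (M Int pairs f)" if f: "f : G" for f
  proof -
   have "(edges G - M) Int pairs f = pairs f - (M Int pairs f)" using pairs_edges[OF f] by blast
   moreover have "card (pairs f - (M Int pairs f)) = card (pairs f) - card (M Int pairs f)" using fin_bd[OF f] by (intro card_Diff_subset) auto
   ultimately show ?thesis using card_pairs_face[OF f] by simp
  qed
  have M0: "card (M Int pairs f0) = 3"
  proof -
   have "M Int pairs f0 = pairs f0" by (auto simp: M_def)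
   thus ?thesis using card_pairs_face[OF f0] by simp
  qed
  have "cocycle' (edges G - M)" unfolding cocycle_def
  proof (intro conjI ballI)
   fix f assume f: "f : G"
   show "even (card ((edges G - M) Int pairs f))" using cc[OF f] M0 M1[OF f] by (cases "f = f0") auto
  qed blast
  then obtain X where X: "edges G - M = cob' X" using cobs by (auto simp: is_cob_def)
  have "lone_mono G f0 X" unfolding lone_mono_def
  proof
   show "mono X f0" using cob_face[OF f0, of X] cc[OF f0] M0 X by (auto split: if_splits)
   show "ALL f:G - {f0}. ~ mono X f"
   proof
    fix f assume "f : G - {f0}"
    thus "~ mono X f" using cob_face[of f X] cc[of f] M1[of f] X by (auto split: if_splits)
   qed
  qed
  thus False using no by blast
 qed
 obtain A0 KK0 where sep: "separation (near {}) U A0 KK0" and odd: "ALL K:KK0. odd (card K) & factor_critical (near {}) K"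
  and lt: "card A0 < card KK0"
  using tutte[of U "near {}"] finU near_sym nm by blast
 have p: "A0 <= U" "partition_on (U - A0) KK0"
  and noK: "ALL K:KK0. ALL L:KK0. K ~= L --> (ALL x:K. ALL y:L. ~ near {} x y)"
  using sep unfolding separation_def by blast+
 have finA0: "finite A0" using p finU finite_subset by blast
 define A where "A = A0 Un H"
 have AG: "A <= G - {f0}" "A <= G" using p HG by (auto simp: A_def U_def)
 have cA: "card A = card A0 + 3"
 proof -
  have "A0 Int H = {}" using p by (auto simp: U_def)
  thus ?thesis using finA0 cH unfolding A_def by (subst card_Un_disjoint) (auto intro: card_ge_0_finite)
 qed
 have Ueq: "U - A0 = (G - {f0}) - A" by (auto simp: U_def A_def)
 hence part: "partition_on ((G - {f0}) - A) KK0" using p by simp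
 have KR: "K <= G - {f0} - A" "K ~= {}" if "K : KK0" for K using part that by (auto simp: partition_on_def)
 have fKK: "finite KK0" using part fin_G by (meson finite_Diff partition_on_finite)
 have parity: "even (card KK0 + card A0)"
 proof -
  have "odds KK0 = card KK0" using odd by (simp add: odds_all)
  hence "even (card (U - A0)) \<longleftrightarrow> even (card KK0)" using card_partition_parity[OF p(2)] finU by simp
  moreover have "card (U - A0) + card A0 = card U"
   using p(1) finU finA0 by (metis card_Diff_subset card_mono le_add_diff_inverse2)
  moreover have "even (card U)" using cU even_F by (metis even_add even_numeral)
  ultimately show ?thesis by (metis even_add)
 qed
 have KK2: "card A0 + 2 <= card KK0" using even_less[OF parity lt] .
 have XG: "G - {f0} <= G" by blast
 obtain b :: "'a set set" where b: "b <= {}" and cnt: "(SUM K:KK0. card (cut' K)) + 2 * card (inner' A) + 2 * card (cut' A Int cut' (G - {f0})) = 3 * card A + card (cut' (G - {f0})) + 2 * card b"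
  using barrier_count[OF AG(2) part AG(1) XG noK] by (elim exE conjE) (rule that; assumption)
 have f0s: "{f0} <= G" using f0 by blast
 have cX: "cut' (G - {f0}) = pairs f0" using cut_compl[OF f0s] cut_single[OF f0] by simp
 have "pairs f0 <= cut' A"
 proof
  fix e assume e: "e : pairs f0"
  have "o1 e : A" "e : pairs (o1 e)" using oH o1[OF e] e by (auto simp: A_def)
  moreover have "f0 : G - A" using AG f0 by blast
  ultimately show "e : cut' A" using cut_iff[OF AG(2), of e] e pairs_edges[OF f0] by blast
 qed
 hence cAX: "cut' A Int cut' (G - {f0}) = pairs f0" using cX by blast
 have ge3: "3 <= card (cut' K)" if "K : KK0" for K
  using cut_ge(1)[of K] KR[OF that] f0 by blast
 have s3: "3 * card KK0 <= (SUM K:KK0. card (cut' K))" using sum_mono[of KK0 "%_. 3" "%K. card (cut' K)"] ge3 by simp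
 have res: "(SUM K:KK0. card (cut' K)) = 3 * card KK0 & card (inner' A) = 0"
  by (rule blue_red_arith2[OF s3 _ cA KK2]) (use cnt cAX cX card_pairs_face[OF f0] b in auto)
 have all3: "card (cut' K) = 3" if K: "K : KK0" for K
 proof (rule ccontr)
  assume "card (cut' K) ~= 3"
  hence "(SUM K:KK0. 3) < (SUM K:KK0. card (cut' K))"
   using ge3 K fKK by (intro sum_strict_mono_ex1) (auto intro!: bexI[of _ K] simp: le_less)
  thus False using res by simp
 qed
 define KK where "KK = insert {f0} KK0"
 have f0A: "f0 ~: A" using AG by blast
 have "partition_on (G - A) KK"
 proof -
  have "G - A = insert f0 (G - {f0} - A)" using f0 f0A by blast
  moreover have "partition_on ({f0} Un (G - {f0} - A)) (insert {f0} KK0)"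
  proof (rule partition_onI)
   have U: "\<Union>KK0 = G - {f0} - A" using part by (simp add: partition_on_def)
   show "\<Union>(insert {f0} KK0) = {f0} Un (G - {f0} - A)" using U by blast
   show "{} ~: insert {f0} KK0" using KR by blast
   have d0: "disjnt K L" if "K : KK0" "L : KK0" "K ~= L" for K L
    using part that by (auto simp: partition_on_def pairwise_def disjnt_def disjoint_def)
   show "disjnt K L" if "K : insert {f0} KK0" "L : insert {f0} KK0" "K ~= L" for K L
   proof -
    have f0K: "f0 ~: K'" if "K' : KK0" for K' using KR[OF that] by blast
    consider "K = {f0}" "L : KK0" | "L = {f0}" "K : KK0" | "K : KK0" "L : KK0" using \<open>K ~= L\<close> \<open>K : insert {f0} KK0\<close> \<open>L : insert {f0} KK0\<close> by blast
    thus ?thesis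
    proof cases
     case 1 thus ?thesis using f0K by (simp add: disjnt_def)
    next
     case 2 thus ?thesis using f0K by (simp add: disjnt_def)
    next
     case 3 thus ?thesis using d0 \<open>K ~= L\<close> by simp
    qed
   qed
  qed
  ultimately show ?thesis by (simp add: KK_def)
 qed
 moreover have "ALL K:KK. card (cut' K) = 3" using all3 cut_pairs_single[OF f0] by (auto simp: KK_def)
 moreover have "ALL K:KK. ALL L:KK. K ~= L --> cut' K Int cut' L = {}"
 proof -
  have d1: "cut' K Int cut' L = {}" if K: "K : KK0" "L : KK0" "K ~= L" for K L
  proof (rule ccontr)
   assume "cut' K Int cut' L ~= {}"
   then obtain e where e: "e : cut' K" "e : cut' L" by blast
   have KG: "K <= G" "L <= G" using KR K by blast+
   obtain x where x: "x : K" "e : pairs x" using cut_iff[OF KG(1)] e by blast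
   obtain y where y: "y : L" "e : pairs y" using cut_iff[OF KG(2)] e by blast
   have "K Int L = {}" using part K by (auto simp: partition_on_def disjoint_def)
   hence "x ~= y" using x y by blast
   hence "near {} x y" using x y KG by (intro nearI[of x y e]) auto
   thus False using noK K x y by blast
  qed
  have d2: "cut' {f0} Int cut' L = {}" if L: "L : KK0" for L
  proof (rule ccontr)
   assume "cut' {f0} Int cut' L ~= {}"
   then obtain e where e: "e : pairs f0" "e : cut' L" using cut_single[OF f0] by blast
   have LG: "L <= G" using KR L by blast
   obtain y where y: "y : L" "e : pairs y" using cut_iff[OF LG] e by blast
   hence "y : H" using e KR[OF L] by (auto simp: H_def)
   thus False using KR[OF L] y by (auto simp: A_def)
  qed
  show ?thesis
  proof (intro ballI impI)
   fix K L assume K: "K : KK" "L : KK" "K ~= L"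
   consider "K = {f0}" "L : KK0" | "L = {f0}" "K : KK0" | "K : KK0" "L : KK0" using K unfolding KK_def by blast
   thus "cut' K Int cut' L = {}"
   proof cases
    case 1 thus ?thesis using d2[of L] by simp
   next
    case 2 thus ?thesis using d2[of K] by (simp add: Int_commute)
   next
    case 3 thus ?thesis using d1 K(3) by simp
   qed
  qed
 qed
 moreover have "A ~= {}" using cA by auto
 moreover have "inner' A = {}" using res fin_inner by simp
 ultimately show ?thesis using that[of A KK] AG cU by (simp add: KK_def)
qed

end

lemma plane_surf: "plane_tri G ==> surf G" by (simp add: plane_tri_def surf_def)

text \<open>The contracted sets are maximal among all sides of 3-cycles away from \<open>f0\<close>,
  not only among barrier parts: laminarity makes them disjoint, and maximality keeps separating
  3-cycles out of the quotient. A part is blue if its boundary edges lie on faces of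
  \<open>A\<close> inside it, red if on other faces.\<close>

theorem qe_exists:
 assumes "plane_tri G" "f0 : G" "!!X. ~ lone_mono G f0 X"
 shows "EX n. qe_level n G f0"
 using assms
proof (induction "card G" arbitrary: G f0 rule: less_induct)
 case less
 interpret surf G by (rule plane_surf[OF less.prems(1)])
 note f0 = less.prems(2)
 have chi: "euler_char G = 2" using less.prems(1) by (simp add: plane_tri_def)
 have cobs: "is_cob' z" if "cocycle' z" for z using plane_cob[OF chi that] .
 obtain A KK where A: "A <= G - {f0}" "A ~= {}" and KK: "partition_on (G - A) KK" "{f0} : KK"
  and K3: "ALL K:KK. card (cut' K) = 3" and Kd: "ALL K:KK. ALL L:KK. K ~= L --> cut' K Int cut' L = {}"
  and iA: "inner' A = {}" and G4: "4 <= card G"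
  using barrier[OF cobs f0 less.prems(3)] by blast
 have KG: "K <= G - A" "K ~= {}" if "K : KK" for K using KK(1) that by (auto simp: partition_on_def)
 have Kdis: "K = L" if "K : KK" "L : KK" "f : K" "f : L" for K L f
  using KK(1) that by (auto simp: partition_on_def disjoint_def)
 have UK: "\<Union>KK = G - A" using KK(1) by (simp add: partition_on_def)
 \<comment> \<open>\<open>G - {f0}\<close> also has a 3-cut and would be the only maximal set, hence
   the third condition.\<close>
 define WW where "WW = {W. W <= G - {f0} & card (cut' W) = 3 & W ~= G - {f0}}"
 define Q0 where "Q0 = {M:WW. ALL W:WW. M <= W --> W = M}"
 define QQ where "QQ = insert {f0} Q0"
 have WG: "W <= G" "f0 ~: W" "finite W" if "W : WW" for W using that fin_G finite_subset by (auto simp: WW_def)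
 have finWW: "finite WW" using fin_G by (simp add: WW_def)
 have max: "EX M:Q0. W <= M" if W: "W : WW" for W
 proof -
  have "EX M:WW. W <= M & (ALL V:WW. M <= V --> M = V)" using finite_has_maximal2[OF finWW W] by blast
  thus ?thesis by (auto simp: Q0_def)
 qed
 have Q0W: "M : WW" if "M : Q0" for M using that by (simp add: Q0_def)
 have lam: "W <= V | V <= W | W Int V = {}" if "W : WW" "V : WW" for W V
  using laminar[OF f0, of W V] that by (auto simp: WW_def)
 have inM: "W <= M | W Int M = {}" if W: "W : WW" "M : Q0" for W M
  using lam[OF W(1) Q0W[OF W(2)]] W by (auto simp: Q0_def)
 have WWne: "W ~= {}" if "W : WW" for W using that cut_empty by (auto simp: WW_def)
 have single: "{f} : WW" if f: "f : G - {f0}" for f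
 proof -
  have "card (G - {f0}) + 1 = card G" using card.remove[OF fin_G f0] by simp
  hence "card (G - {f0}) ~= card {f}" using G4 by simp
  hence "{f} ~= G - {f0}" by metis
  thus ?thesis using f cut_pairs_single[of f] by (auto simp: WW_def)
 qed
 have part: "partition_on G QQ"
 proof (rule partition_onI)
  show "\<Union>QQ = G"
  proof
   show "\<Union>QQ <= G" using f0 WG Q0W by (auto simp: QQ_def)
   show "G <= \<Union>QQ"
   proof
    fix f assume f: "f : G"
    show "f : \<Union>QQ"
    proof (cases "f = f0")
     case False
     then obtain M where "M : Q0" "{f} <= M" using max[OF single[of f]] f by blast
     thus ?thesis by (auto simp: QQ_def)
    qed (simp add: QQ_def)
   qed
  qed
  show "{} ~: QQ" using WWne Q0W by (auto simp: QQ_def)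
  have d: "disjnt M N" if "M : Q0" "N : Q0" "M ~= N" for M N
  proof -
   have "N = M" if "M <= N" using that \<open>M : Q0\<close> Q0W[OF \<open>N : Q0\<close>] unfolding Q0_def by blast
   hence "~ M <= N" using \<open>M ~= N\<close> by blast
   thus ?thesis using inM[OF Q0W[OF that(1)] that(2)] by (simp add: disjnt_def)
  qed
  show "disjnt M N" if "M : QQ" "N : QQ" "M ~= N" for M N
   using that d WG(2) Q0W by (auto simp: QQ_def disjnt_def)
 qed
 have "3 <= card QQ"
 proof (rule ccontr)
  assume "~ 3 <= card QQ"
  have fQ0: "finite Q0" using finWW by (simp add: Q0_def)
  have nf: "{f0} ~: Q0" using WG(2) Q0W by blast
  hence "card QQ = Suc (card Q0)" using fQ0 by (simp add: QQ_def)
  hence c1: "card Q0 <= 1" using \<open>~ 3 <= card QQ\<close> by simp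
  have U: "\<Union>Q0 = G - {f0}"
  proof -
   have "\<Union>QQ = G" using part by (simp add: partition_on_def)
   moreover have "f0 ~: \<Union>Q0" using WG(2) Q0W by blast
   ultimately show ?thesis by (auto simp: QQ_def)
  qed
  have "card (G - {f0}) + 1 = card G" using card.remove[OF fin_G f0] by simp
  hence "card (G - {f0}) ~= 0" using G4 by linarith
  hence "G - {f0} ~= {}" by (metis card.empty)
  hence "Q0 ~= {}" using U by auto
  hence "card Q0 = 1" using c1 card_one[OF fQ0] by simp
  then obtain M where "Q0 = {M}" by (auto simp: card_1_singleton_iff)
  hence "M = G - {f0}" "M : WW" using U Q0W by auto
  thus False by (simp add: WW_def)
 qed
 then interpret q: quot G QQ
  using part cut_pairs_single[OF f0] Q0W by unfold_locales (auto simp: QQ_def WW_def)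
 interpret e: surf q.T by unfold_locales (rule q.surface_T)
 have chiT: "euler_char q.T = 2" using q.kappa_zero(2)[of "{f0}"] chi by (simp add: QQ_def)
 have planeT: "plane_tri q.T" using q.surface_T chiT by (simp add: plane_tri_def)
 have f0Q: "{f0} : QQ" by (simp add: QQ_def)
 have f0T: "f0 : q.T" using tr_single[OF f0] f0Q unfolding q.T_def by (metis imageI)
 have KW: "K : WW" if K: "K : KK" "K ~= {f0}" for K
 proof -
  have "f0 ~: K" using Kdis[OF K(1) KK(2)] K(2) by blast
  moreover have "K ~= G - {f0}" using KG[OF K(1)] A by blast
  ultimately show ?thesis using KG[OF K(1)] K3 K(1) by (auto simp: WW_def)
 qed
 have KM: "K <= M | K Int M = {}" if K: "K : KK" "M : QQ" for K M
 proof (cases "K = {f0}")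
  case False
  hence KW': "K : WW" using KW K by blast
  show ?thesis
  proof (cases "M = {f0}")
   case True thus ?thesis using WG(2)[OF KW'] by blast
  next
   case False
   hence "M : Q0" using K(2) by (simp add: QQ_def)
   thus ?thesis using inM[OF KW'] by blast
  qed
 qed blast
 \<comment> \<open>No boundary edge of \<open>M\<close> is on a face of \<open>A\<close> inside
   \<open>M\<close>. Otherwise, by \<open>sides\<close>, all three are, and the faces of
   \<open>A\<close> inside \<open>M\<close> outnumber the barrier parts there by one.\<close>
 define red where "red M \<longleftrightarrow> cut' M Int cut' (A Int M) = {}" for M
 have AG: "A <= G" using A by blast
 have cutAM: "e : cut' (A Int M) \<longleftrightarrow> f : A"
  if h: "M : QQ" "e : edges G" "f : M" "e <= f" "g : G - M" "e <= g" for M e f g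
 proof
  have AM: "A Int M <= G" using AG by blast
  assume "e : cut' (A Int M)"
  then obtain a where a: "a : A Int M" "e <= a" using AM by (rule cutE)
  have "a = f"
  proof (rule ccontr)
   assume "a ~= f"
   have fG: "f : G" using h(1,3) q.QG by blast
   have "{a, f, g} <= {k:G. e <= k}" using a fG h AG by blast
   hence "card {a, f, g} <= 2" using two_G[OF h(2)] fin_G card_mono[of "{k:G. e <= k}" "{a, f, g}"] by simp
   moreover have "a ~= g" "f ~= g" using a h by blast+
   ultimately show False using \<open>a ~= f\<close> by simp
  qed
  thus "f : A" using a by blast
 next
  assume "f : A"
  thus "e : cut' (A Int M)" using h AG by (intro cutI[of "A Int M" e f g]) auto
 qed
 have sides: "(card (A Int M) = card {K:KK. K <= M} + 1 & cut' M <= cut' (A Int M) & cut' (A Int M) - cut' M <= cut' (M - A)) | red M"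
  and notred: "~ red M ==> cut' M <= cut' (A Int M)" if M: "M : QQ" for M
 proof -
  have MG: "M <= G" using q.QG[OF M] .
  define KM' where "KM' = {K:KK. K <= M}"
  have UKM: "\<Union>KM' = M - A"
  proof
   show "\<Union>KM' <= M - A" using KG by (auto simp: KM'_def)
   show "M - A <= \<Union>KM'"
   proof
    fix f assume f: "f : M - A"
    hence "f : \<Union>KK" using UK MG by blast
    then obtain K where "K : KK" "f : K" by blast
    thus "f : \<Union>KM'" using KM[OF _ M, of K] f by (auto simp: KM'_def)
   qed
  qed
  have sub: "A Int M <= G" "M - A <= G" using MG by blast+
  have "inner' (A Int M) = {}"
  proof (rule ccontr)
   assume "inner' (A Int M) ~= {}"
   then obtain x where "x : inner' (A Int M)" by blast
   hence "x : inner' A" using inner_iff[OF sub(1)] inner_iff[OF AG] by blast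
   thus False using iA by blast
  qed
  hence 1: "3 * card (A Int M) = card (cut' (A Int M))" using cubic_count[OF sub(1)] by simp
  have fKM: "finite KM'"
  proof -
   have "KM' <= Pow G" using MG by (auto simp: KM'_def)
   thus ?thesis using fin_G by (meson finite_Pow_iff finite_subset)
  qed
  have KGs: "ALL K:KM'. K <= G" using MG by (auto simp: KM'_def)
  have dj: "disjoint KM'" using Kdis unfolding disjoint_def KM'_def by blast
  have nn: "ALL K:KM'. ALL L:KM'. K ~= L --> cut' K Int cut' L <= {}" using Kd by (auto simp: KM'_def)
  obtain b :: "'a set set" where b: "b <= {}" "(SUM K:KM'. card (cut' K)) = card (cut' (\<Union>KM')) + 2 * card b"
   using sum_cuts[OF KGs dj nn] by (elim exE conjE) (rule that; assumption)
  have "(SUM K:KM'. card (cut' K)) = (SUM K:KM'. 3)" using K3 by (intro sum.cong) (auto simp: KM'_def)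
  hence 2: "3 * card KM' = card (cut' (M - A))" using b UKM by simp
  have "A Int M Int (M - A) = {}" by blast
  moreover have "A Int M Un (M - A) = M" by blast
  ultimately have cM: "cut' M = sym_diff (cut' (A Int M)) (cut' (M - A))" using cut_Un_disj[OF sub] by simp
  have fc: "finite (cut' (A Int M))" "finite (cut' (M - A))" by (rule fin_cut)+
  let ?i = "card (cut' (A Int M) Int cut' (M - A))"
  have 3: "card (cut' (A Int M)) = ?i + card (cut' (A Int M) - cut' (M - A))" using fc by (metis card_Int_Diff)
  have 4: "card (cut' (M - A)) = ?i + card (cut' (M - A) - cut' (A Int M))" using fc by (metis card_Int_Diff Int_commute)
  have "card (cut' M) = card (cut' (A Int M) - cut' (M - A)) + card (cut' (M - A) - cut' (A Int M))"
   unfolding cM using fc by (intro card_Un_disjoint) auto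
  hence 5: "card (cut' (A Int M) - cut' (M - A)) + card (cut' (M - A) - cut' (A Int M)) = 3" using q.d3[OF M] by simp
  have br: "card (cut' (A Int M) - cut' (M - A)) = 3 & card (cut' (M - A) - cut' (A Int M)) = 0 & card (A Int M) = card KM' + 1 |
    card (cut' (A Int M) - cut' (M - A)) = 0 & card (cut' (M - A) - cut' (A Int M)) = 3"
   by (rule blue_red_arith[OF _ _ 5]) (use 1 2 3 4 in auto)
  have B: "cut' M <= cut' (A Int M) & cut' (A Int M) - cut' M <= cut' (M - A)" if "card (cut' (M - A) - cut' (A Int M)) = 0"
  proof -
   have "cut' (M - A) - cut' (A Int M) = {}" using that fc by simp
   thus ?thesis unfolding cM by blast
  qed
  have Rd: "red M" if "card (cut' (A Int M) - cut' (M - A)) = 0"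
  proof -
   have "cut' (A Int M) - cut' (M - A) = {}" using that fc by simp
   thus ?thesis unfolding red_def cM by blast
  qed
  show "(card (A Int M) = card {K:KK. K <= M} + 1 & cut' M <= cut' (A Int M) & cut' (A Int M) - cut' M <= cut' (M - A)) | red M"
   using br B Rd unfolding KM'_def by blast
  show "~ red M ==> cut' M <= cut' (A Int M)" using br B Rd by blast
 qed
 define R where "R = tr ` {M:QQ. red M}"
 have trR: "tr M : R \<longleftrightarrow> red M" if "M : QQ" for M
  using inj_onD[OF q.tr_inj] that by (auto simp: R_def)
 have col: "proper_face_2col q.T R" unfolding proper_face_2col_def
 proof (intro conjI ballI impI)
  show "R <= q.T" by (auto simp: R_def q.T_def)
  fix s t assume s: "s : q.T" and t: "t : q.T" and st: "s ~= t & card (s Int t) = 2"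
  obtain M where M: "M : QQ" "s = tr M" using s by (auto simp: q.T_def)
  obtain N where N: "N : QQ" "t = tr N" using t by (auto simp: q.T_def)
  have MN: "M ~= N" using st M N by blast
  define x where "x = s Int t"
  have x: "x : cut' M" "x : cut' N" using q.cutQ[OF M(1)] q.cutQ[OF N(1)] M N st by (auto simp: x_def pairs_def)
  obtain f where f: "x : edges G" "f : M" "x <= f" using x(1) q.QG[OF M(1)] by (rule cutE)
  obtain g where g: "g : N" "x <= g" using x(2) q.QG[OF N(1)] by (rule cutE)
  have fg: "f : G - N" "g : G - M" using f g q.QG[OF M(1)] q.QG[OF N(1)] q.Qdis[OF M(1) N(1)] MN by blast+
  have m: "x : cut' (A Int M) \<longleftrightarrow> f : A" using cutAM[OF M(1) f fg(2) g(2)] .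
  have n: "x : cut' (A Int N) \<longleftrightarrow> g : A" using cutAM[OF N(1) f(1) g fg(1) f(3)] .
  have rM: "red M \<longleftrightarrow> f ~: A" using m x(1) notred[OF M(1)] by (auto simp: red_def)
  have rN: "red N \<longleftrightarrow> g ~: A" using n x(2) notred[OF N(1)] by (auto simp: red_def)
  have "f ~= g" using f fg by blast
  have xp: "x : pairs f" "x : pairs g" using f g edge_pairs[OF f(1)] by blast+
  \<comment> \<open>Two faces of \<open>A\<close> are never adjacent and two barrier parts share no
    edge, so exactly one of \<open>f\<close> and \<open>g\<close> is in \<open>A\<close>. Hence the
    two triangles get different colours.\<close>
  have "~ (f : A & g : A)"
  proof
   assume a: "f : A & g : A"
   have "f : G" "g : G" using fg by auto
   obtain k where "k : G" "k ~= f" "x : pairs k" and k: "{h:G. x : pairs h} = {f, k}" by (rule other_face[OF \<open>f : G\<close> xp(1)])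
   note k
   moreover have "g : {h:G. x : pairs h}" using xp \<open>g : G\<close> by blast
   ultimately have "{h:G. x : pairs h} = {f, g}" using \<open>f ~= g\<close> by auto
   hence "x : inner' A" using inner_two[OF AG _ \<open>f ~= g\<close>] a by blast
   thus False using iA by blast
  qed
  moreover have "~ (f ~: A & g ~: A)"
  proof
   assume a: "f ~: A & g ~: A"
   then obtain K where K: "K : KK" "f : K" using UK fg by blast
   obtain L where L: "L : KK" "g : L" using a UK fg by blast
   have KML: "K <= M" "L <= N" using KM[OF K(1) M(1)] KM[OF L(1) N(1)] K L f g by blast+
   hence "g ~: K" "f ~: L" using fg by blast+
   have "K ~= L" using \<open>g ~: K\<close> L by blast
   moreover have "x : cut' K" using KG[OF K(1)] K f g fg \<open>g ~: K\<close> by (intro cutI[of K x f g]) auto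
   moreover have "x : cut' L" using KG[OF L(1)] L f g fg \<open>f ~: L\<close> by (intro cutI[of L x g f]) auto
   ultimately show False using Kd K(1) L(1) by blast
  qed
  ultimately show "s : R \<longleftrightarrow> t ~: R" using rM rN trR[OF M(1)] trR[OF N(1)] M N by blast
 qed
 have f0R: "f0 : R"
 proof -
  have "A Int {f0} = {}" using A by blast
  hence "red {f0}" using cut_empty by (simp add: red_def)
  thus ?thesis using trR[OF f0Q] tr_single[OF f0] by simp
 qed
 have nosep: "no_sep_3cycle q.T" unfolding no_sep_3cycle_def
 proof (intro allI notI)
  fix C assume "separating_3cycle q.T C"
  then obtain s t where st: "card C = 3" "s : q.T" "t : q.T" "~ (same_region q.T C)\<^sup>*\<^sup>* s t" "~ s <= C" "~ t <= C"
   by (auto simp: separating_3cycle_def is_3cycle_def)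
  define YY where "YY = {h:q.T. (same_region q.T C)\<^sup>*\<^sup>* s h}"
  have YT: "YY <= q.T" "s : YY" "t ~: YY" using st by (auto simp: YY_def)
  have "e.cut' YY <= pairs C"
  proof
   fix x assume "x : e.cut' YY"
   then obtain h k where hk: "x : edges q.T" "h : YY" "x <= h" "k : q.T - YY" "x <= k" using YT(1) by (rule e.cutE)
   have cx: "card x = 2" using hk(1) by (simp add: edges_def)
   have hT: "h : q.T" "k : q.T" "h ~= k" using hk YT by blast+
   have "h Int k = x"
   proof (rule ccontr)
    assume n: "h Int k ~= x"
    then obtain y where y: "y : h Int k" "y ~: x" using hk by blast
    have fx: "finite x" using cx by (metis card.infinite zero_neq_numeral)
    have "card (insert y x) = 3" using y fx cx by simp
    moreover have "insert y x <= h" "insert y x <= k" using y(1) hk by blast+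
    ultimately have "insert y x = h" "insert y x = k"
     using card_subset_eq[OF e.fin_face[OF hT(1)]] card_subset_eq[OF e.fin_face[OF hT(2)]] e.card_face[OF hT(1)] e.card_face[OF hT(2)] by simp_all
    thus False using hT by simp
   qed
   hence "x <= C"
   proof (rule_tac ccontr)
    assume n: "~ x <= C" and hx: "h Int k = x"
    have "same_region q.T C h k" using n hx hT cx by (simp add: same_region_def)
    moreover have "(same_region q.T C)\<^sup>*\<^sup>* s h" using hk by (simp add: YY_def)
    ultimately have "(same_region q.T C)\<^sup>*\<^sup>* s k" by (rule rtranclp.rtrancl_into_rtrancl[rotated])
    thus False using hk by (simp add: YY_def)
   qed
   thus "x : pairs C" using cx by (simp add: pairs_def)
  qed
  moreover have fC: "finite C" using st(1) by (metis card.infinite zero_neq_numeral)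
  moreover have cC: "card (pairs C) = 3" using card_pairs[OF fC] st(1) by (simp add: numeral_eq_Suc)
  moreover have "3 <= card (e.cut' YY)" using e.cut_ge(1)[OF YT(1)] YT st by blast
  moreover have "finite (pairs C)" using fC by (simp add: pairs_def)
  ultimately have eq: "e.cut' YY = pairs C" by (intro card_seteq) auto
  have "EX ZZ<=q.T. f0 ~: ZZ & e.cut' ZZ = pairs C & (EX a:ZZ. ~ a <= C) & (EX b:q.T - ZZ. ~ b <= C)"
  proof (cases "f0 : YY")
   case False
   thus ?thesis using YT eq st by (intro exI[of _ YY]) auto
  next
   case True
   have "q.T - (q.T - YY) = YY" using YT by blast
   thus ?thesis using YT eq st True e.cut_compl[OF YT(1)] by (intro exI[of _ "q.T - YY"]) auto
  qed
  then obtain ZZ a b where ZZ: "ZZ <= q.T" "f0 ~: ZZ" "e.cut' ZZ = pairs C" "a : ZZ" "~ a <= C" "b : q.T - ZZ" "~ b <= C" by blast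
  \<comment> \<open>The side of the 3-cycle away from \<open>f0\<close>, pulled back to
    \<open>G\<close>, belongs to \<open>WW\<close> and so lies inside one maximal set. It is then a
    single part, whose triangle \<open>a\<close> would be \<open>C\<close>.\<close>
  define XX where "XX = {M:QQ. tr M : ZZ}"
  have XX: "XX <= QQ" "tr ` XX = ZZ" using ZZ(1) by (auto simp: XX_def q.T_def)
  define W where "W = \<Union>XX"
  have cW: "cut' W = pairs C"
  proof (rule card_subset_eq)
   show "finite (pairs C)" using fC by (simp add: pairs_def)
   show sub: "cut' W <= pairs C"
   proof
    fix x assume "x : cut' W"
    hence "x : edges q.T & (EX h:ZZ. x <= h) & (EX k:q.T - ZZ. x <= k)" using q.cut_T[OF XX(1), of x] XX(2) by (simp add: W_def)
    hence "x : e.cut' ZZ" using e.cutI[OF ZZ(1)] by blast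
    thus "x : pairs C" using ZZ(3) by simp
   qed
   have WG': "W <= G" using q.UX(1)[OF XX(1)] by (simp add: W_def)
   have "W ~= {}"
   proof -
    obtain M where "M : XX" using ZZ(4) XX(2) by blast
    moreover then obtain y where "y : M" using q.Qne[of M] XX(1) by blast
    ultimately show ?thesis by (auto simp: W_def)
   qed
   moreover have "W ~= G"
   proof -
    obtain M where M: "M : QQ" "b = tr M" using ZZ(6) by (auto simp: q.T_def)
    hence "M ~: XX" using ZZ(6) by (auto simp: XX_def)
    hence "M <= G - W" using q.UX(2)[OF XX(1)] M by (auto simp: W_def)
    thus ?thesis using q.Qne[OF M(1)] by blast
   qed
   ultimately have "3 <= card (cut' W)" using cut_ge(1)[OF WG'] by blast
   moreover have "card (cut' W) <= card (pairs C)" using sub fC by (intro card_mono) (auto simp: pairs_def)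
   ultimately show "card (cut' W) = card (pairs C)" using cC by simp
  qed
  have f0W: "f0 ~: W"
  proof
   assume "f0 : W"
   then obtain M where M: "M : XX" "f0 : M" by (auto simp: W_def)
   hence "M = {f0}" using q.Qdis[of M "{f0}" f0] XX(1) f0Q by blast
   thus False using M(1) tr_single[OF f0] ZZ(2) by (simp add: XX_def)
  qed
  have WG': "W <= G" using q.UX(1)[OF XX(1)] by (simp add: W_def)
  have "W ~= G - {f0}"
  proof
   assume W0: "W = G - {f0}"
   have f0s: "{f0} <= G" using f0 by blast
   have "cut' W = pairs f0" unfolding W0 using cut_compl[OF f0s] cut_single[OF f0] by simp
   hence "C = f0" using pairs_inj[of C f0] cW st(1) card_face[OF f0] by simp
   obtain M where M: "M : QQ" "b = tr M" using ZZ(6) by (auto simp: q.T_def)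
   hence "M ~: XX" using ZZ(6) by (auto simp: XX_def)
   hence "M <= G - W" using q.UX(2)[OF XX(1)] M by (auto simp: W_def)
   hence "M <= {f0}" using W0 by blast
   hence "M = {f0}" using q.Qne[OF M(1)] by blast
   hence "b = f0" using M tr_single[OF f0] by simp
   thus False using ZZ(7) \<open>C = f0\<close> by blast
  qed
  hence WW': "W : WW" using WG' f0W cW cC by (auto simp: WW_def)
  obtain M where M: "M : Q0" "W <= M" using max[OF WW'] by blast
  obtain N where N: "N : XX" "a = tr N" using ZZ(4) XX(2) by blast
  have NQ: "N : QQ" using N XX by blast
  have MQ: "M : QQ" using M by (simp add: QQ_def)
  obtain y where "y : N" using q.Qne[OF NQ] by blast
  moreover have "N <= W" using N by (auto simp: W_def)
  ultimately have "N = M" using q.Qdis[OF NQ MQ] M(2) by blast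
  hence "W = M" using \<open>N <= W\<close> M(2) by blast
  hence "pairs C = pairs a" using cW q.cutQ[OF NQ] N(2) \<open>N = M\<close> by simp
  hence "C = a" using pairs_inj[of C a] st(1) e.card_face[of a] ZZ by auto
  thus False using ZZ(5) by blast
 qed
 have blue: "EX n. qe_level n (q.PP s) s" if s: "s : q.SS" "s ~: R" for s
 proof -
  obtain M where M: "M : QQ" "2 <= card M" "s = tr M" using s(1) by (auto simp: q.SS_def)
  have nr: "~ red M" using s(2) trR[OF M(1)] M(3) by simp
  have sd: "card (A Int M) = card {K:KK. K <= M} + 1" "cut' M <= cut' (A Int M)" "cut' (A Int M) - cut' M <= cut' (M - A)"
   using sides[OF M(1)] nr by blast+
  have MG: "M <= G" using q.QG[OF M(1)] .
  have PM: "q.PP s = insert (tr M) M" using q.PP_tr[OF M(1)] M(3) by simp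
  have MW: "M : WW"
  proof -
   have "M ~= {f0}" using M(2) by auto
   thus ?thesis using M(1) Q0W by (auto simp: QQ_def)
  qed
  have cP: "card (q.PP s) < card G"
  proof -
   have "card (G - {f0}) + 1 = card G" using card.remove[OF fin_G f0] by simp
   moreover have "M \<subset> G - {f0}" using MW by (auto simp: WW_def)
   hence "card M < card (G - {f0})" using fin_G by (intro psubset_card_mono) auto
   moreover have "card (q.PP s) <= card M + 1" unfolding PM using WG(3)[OF MW] by (simp add: card_insert_if)
   ultimately show ?thesis by linarith
  qed
  \<comment> \<open>The coboundary of such a colouring avoids the boundary of \<open>M\<close> and
    has two edges at each face of \<open>A\<close> inside. All of these lie in cuts of barrier parts
    inside \<open>M\<close>, each taking at most two, and there is one part too few.\<close>
  have nl: "~ lone_mono (q.PP s) s X" for X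
  proof
   assume X: "lone_mono (q.PP s) s X"
   have ms: "mono X (tr M)" using X M(3) by (simp add: lone_mono_def)
   have "f ~= tr M" if "f : M" for f using tr_notin[OF MG q.d3[OF M(1)] M(2)] that by blast
   hence nm: "~ mono X f" if "f : M" for f using X that PM M(3) by (auto simp: lone_mono_def)
   have cutM: "cob' X Int cut' M = {}"
   proof -
    have False if x: "x : cob' X" "x : cut' M" for x
    proof -
     have "x <= tr M" using x(2) q.cutQ[OF M(1)] by (auto simp: pairs_def)
     hence "x Int X = {} | x Int X = x" using ms by (auto simp: mono_def)
     thus False using x(1) by (auto simp: cob_def edges_def)
    qed
    thus ?thesis by blast
   qed
   define KM' where "KM' = {K:KK. K <= M}"
   have fKM: "finite KM'"
   proof -
    have "KM' <= Pow G" using MG by (auto simp: KM'_def)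
    thus ?thesis using fin_G by (meson finite_Pow_iff finite_subset)
   qed
   have sub: "A Int M <= G" using AG by blast
   have iAM: "inner' (A Int M) = {}"
   proof (rule ccontr)
    assume "inner' (A Int M) ~= {}"
    then obtain x where "x : inner' (A Int M)" by blast
    hence "x : inner' A" using inner_iff[OF sub] inner_iff[OF AG] by blast
    thus False using iA by blast
   qed
   have "(SUM f:A Int M. card (cob' X Int pairs f)) = (SUM f:A Int M. 2)"
    using cob_face nm sub by (intro sum.cong) auto
   hence 1: "card (cob' X Int cut' (A Int M)) = 2 * card (A Int M)" using handshake[OF sub cob_E] iAM by simp
   have "cob' X Int cut' (A Int M) <= (UN K:KM'. cob' X Int cut' K)"
   proof
    fix x assume x: "x : cob' X Int cut' (A Int M)"
    hence "x : cut' (M - A)" using sd(3) cutM by blast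
    moreover have MA: "M - A <= G" using MG by blast
    ultimately obtain f g where f: "x : edges G" "f : M - A" "x <= f" "g : G - (M - A)" "x <= g" by (rule cutE)
    then obtain K where K: "K : KK" "f : K" using UK MG by blast
    hence KM'': "K <= M" using KM[OF K(1) M(1)] f by blast
    hence "K <= M - A" using KG[OF K(1)] by blast
    hence "x : cut' K" using KG[OF K(1)] K f by (intro cutI[of K x f g]) auto
    thus "x : (UN K:KM'. cob' X Int cut' K)" using x K KM'' by (auto simp: KM'_def)
   qed
   hence "card (cob' X Int cut' (A Int M)) <= card (UN K:KM'. cob' X Int cut' K)" using fKM fin_cut by (intro card_mono) auto
   also have "... <= (SUM K:KM'. card (cob' X Int cut' K))" using fKM by (rule card_UN_le)
   also have "... <= (SUM K:KM'. 2)"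
   proof (rule sum_mono)
    fix K assume "K : KM'"
    hence K: "K : KK" "K <= G" using MG by (auto simp: KM'_def)
    have ev: "even (card (cob' X Int cut' K))" using cocycle_cut[OF cob_cocycle K(2)] .
    have le: "card (cob' X Int cut' K) <= 3" using K3 K(1) fin_cut card_mono[of "cut' K" "cob' X Int cut' K"] by auto
    show "card (cob' X Int cut' K) <= 2" using even_le_3[OF ev le] by auto
   qed
   finally have "2 * card (A Int M) <= 2 * card KM'" using 1 by simp
   thus False using sd(1) by (simp add: KM'_def)
  qed
  have "plane_tri (q.PP s)" "s : q.PP s" using q.plane_PP[OF _ s(1)] chi by blast+
  thus ?thesis using less.hyps[OF cP] nl by blast
 qed
 then obtain lev where lev: "!!s. s : q.SS ==> s ~: R ==> qe_level (lev s) (q.PP s) s" by metis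
 have fS: "finite q.SS" using q.finQ by (simp add: q.SS_def)
 define n where "n = Max (insert 0 (lev ` q.SS))"
 have le: "lev s <= n" if "s : q.SS" for s unfolding n_def using fS that by (intro Max_ge) auto
 have "q.SS <= q.T - {f0}"
 proof
  fix s assume "s : q.SS"
  then obtain M where M: "M : QQ" "2 <= card M" "s = tr M" by (auto simp: q.SS_def)
  have "s ~= f0"
  proof
   assume "s = f0"
   hence "tr M = tr {f0}" using M tr_single[OF f0] by simp
   hence "M = {f0}" using inj_onD[OF q.tr_inj] M f0Q by blast
   thus False using M(2) by simp
  qed
  thus "s : q.T - {f0}" using M by (auto simp: q.T_def)
 qed
 moreover have "ALL s:q.SS. s : R --> plane_tri (q.PP s)" using q.plane_PP(1) chi by blast
 moreover have "ALL s:q.SS. s ~: R --> qe_level n (q.PP s) s" using lev le qe_mono by blast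
 ultimately have "qe_level (Suc n) G f0" unfolding qe_level.simps
  using planeT e.col_eulerian[OF col] nosep f0T col f0R q.paste by blast
 thus ?case by blast
qed

section \<open>Extending colourings over plane pieces\<close>

lemma mono_cong: "f Int X = f Int Y ==> mono X f \<longleftrightarrow> mono Y f" by (auto simp: mono_def)
lemma mono_compl: "mono (- X) f \<longleftrightarrow> mono X f" by (auto simp: mono_def)

context surf
begin

lemma pm_containing:
 assumes "e : edges G" shows "EX m. pm G (edges G) pairs m & e : m"
proof -
 obtain f g where fg: "f : G" "g : G" "f ~= g" "e : pairs f" "e : pairs g" "{h:G. e : pairs h} = {f, g}" by (rule two_faces[OF assms])
 have X: "G - {g} <= G" by blast
 have br: "ALL Y<=G. card (cut' Y) ~= 1" using bridgeless_G by blast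
 have gG: "{g} <= G" using fg by blast
 have cX: "cut' (G - {g}) = pairs g" using cut_compl[OF gG] cut_single[OF fg(2)] by simp
 have "card (G - {g}) + 1 = card G" using card.remove[OF finF fg(2)] by simp
 hence ev: "even (card (G - {g}) + card {e})" using even_F by simp
 have one: "card ({e} Int pairs h) <= 1" for h by (cases "e : pairs h") auto
 have s: "{e} <= cut' (G - {g})" using cX fg by simp
 have lt: "card (cut' (G - {g})) + card {e} + 2 * card ({} :: 'a set set) < 6" using cX cubic[OF fg(2)] by simp
 obtain m where m: "m <= inner' (G - {g}) - {}" "ALL f:G - {g}. card ((m Un {e}) Int pairs f) = 1"
  using pm_exists[OF br X s one ev _ lt] by auto
 have mi: "m <= inner' (G - {g})" using m(1) by blast
 have "(m Un {e}) Int pairs g = {e}" using mi inner_cut_disj[of "G - {g}"] cX fg(5) by blast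
 hence "card ((m Un {e}) Int pairs f) = 1" if "f : G" for f using m(2) that by (cases "f = g") auto
 moreover have "m Un {e} <= edges G" using mi inner_E[of "G - {g}"] assms by blast
 ultimately have "pm G (edges G) pairs (m Un {e})" unfolding pm_cubic by blast
 thus ?thesis by blast
qed

text \<open>Two vertices of \<open>s\<close> have the same colour. A dual matching through the edge
  between them has a coboundary as its complement, and up to exchange of colours this colouring
  agrees with \<open>C\<close> on \<open>s\<close>.\<close>

lemma extend_colouring:
 assumes cobs: "!!z. cocycle' z ==> is_cob' z" and s: "s : G" "~ mono C s"
 shows "EX Y. s Int Y = s Int C & (ALL f:G. ~ mono Y f)"
proof -
 obtain a b where ab: "a : s" "b : s" "a : C" "b ~: C" using s(2) by (auto simp: mono_def)
 have abn: "a ~= b" using ab by blast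
 have "EX c:s. c ~= a & c ~= b"
 proof (rule ccontr)
  assume "~ ?thesis"
  hence "s <= {a, b}" by blast
  hence "card s <= card {a, b}" by (intro card_mono) auto
  thus False using card_face[OF s(1)] abn by simp
 qed
 then obtain c where c: "c : s" "c ~= a" "c ~= b" by blast
 have se: "s = {a, b, c}" using card_3_other[of s a b c] card_face[OF s(1)] ab c abn by auto
 have "EX d d'. d : s & s = {c, d, d'} & c ~= d & (c : C \<longleftrightarrow> d : C) & (d' : C \<longleftrightarrow> c ~: C)"
 proof (cases "c : C")
  case True
  have "s = {c, a, b}" unfolding se by blast
  thus ?thesis using True ab c(2) by metis
 next
  case False
  have "s = {c, b, a}" unfolding se by blast
  thus ?thesis using False ab c(3) by metis
 qed
 then obtain d d' where d: "d : s" "s = {c, d, d'}" "c ~= d" "c : C \<longleftrightarrow> d : C" "d' : C \<longleftrightarrow> c ~: C" by (elim exE conjE) (rule that; assumption)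
 have e: "{c, d} : edges G" using face_edge[OF s(1) c(1) d(1,3)] .
 obtain m where m: "pm G (edges G) pairs m" "{c, d} : m" using pm_containing[OF e] by blast
 obtain Q where Q: "edges G - m = cob' Q" using cobs[OF pm_cocycle[OF m(1)]] by (auto simp: is_cob_def)
 have nm: "ALL f:G. ~ mono Q f" using pm_not_mono[OF m(1) Q] by blast
 have "{c, d} ~: cob' Q" using Q m(2) by blast
 hence cd: "c : Q \<longleftrightarrow> d : Q" using cob_mem[OF e] by blast
 have "~ mono Q {c, d, d'}" using nm s(1) unfolding d(2)[symmetric] by blast
 hence "d' : Q \<longleftrightarrow> c ~: Q" using cd by (auto simp: mono_def)
 show ?thesis
 proof (cases "c : Q \<longleftrightarrow> c : C")
  case True
  hence "s Int Q = s Int C" unfolding d(2) using cd d(4,5) \<open>d' : Q \<longleftrightarrow> c ~: Q\<close> by auto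
  thus ?thesis using nm by blast
 next
  case False
  hence "s Int (- Q) = s Int C" unfolding d(2) using cd d(4,5) \<open>d' : Q \<longleftrightarrow> c ~: Q\<close> by auto
  thus ?thesis using nm mono_compl by blast
 qed
qed

end

text \<open>Splits of six vertices cut 0, 5, 8 or 9 edges of K6. A colouring of its ten faces
  without a monochromatic one would cut 10.\<close>

lemma six_split: "a <= (6 :: nat) ==> a * (6 - a) ~= 10"
proof -
 assume "a <= 6"
 then consider "a = 0" | "a = 1" | "a = 2" | "a = 3" | "a = 4" | "a = 5" | "a = 6" by linarith
 thus ?thesis by cases auto
qed

section \<open>Graphs pasted from K6\<close>

locale k6 = surf T for T :: "'a set set" +
 assumes K6: "is_K6 T" and chi1: "euler_char T = 1"
begin

lemma edges_K6: "edges T = pairs (verts T)"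
proof
 show "edges T <= pairs (verts T)" by (auto simp: edges_def pairs_def verts_def)
 show "pairs (verts T) <= edges T"
 proof
  fix p assume "p : pairs (verts T)"
  then obtain u v where "p = {u, v}" "u ~= v" "u : verts T" "v : verts T" by (auto simp: pairs_def card_2_iff)
  thus "p : edges T" using K6 by (auto simp: is_K6_def)
 qed
qed

lemma card_V: "card (verts T) = 6" using K6 by (simp add: is_K6_def)

lemma card_K6: "card (edges T) = 15" "card T = 10"
proof -
 show 15: "card (edges T) = 15" unfolding edges_K6 using card_pairs[OF fin_verts] card_V by (simp add: numeral_eq_Suc)
 show "card T = 10" using card_E3 15 by simp
qed

lemma card_cob: "card (cob' X) = card (verts T Int X) * (6 - card (verts T Int X))"
proof -
 let ?A = "verts T Int X" and ?B = "verts T - X"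
 have "cob' X = (%(a, b). {a, b}) ` (?A \<times> ?B)"
 proof
  show "cob' X <= (%(a, b). {a, b}) ` (?A \<times> ?B)"
  proof
   fix e assume e: "e : cob' X"
   hence eE: "e : edges T" by (simp add: cob_def)
   then obtain u v where uv: "e = {u, v}" "u ~= v" "u : verts T" "v : verts T"
    unfolding edges_K6 by (auto simp: pairs_def card_2_iff)
   hence "u : X \<longleftrightarrow> v ~: X" using e eE cob_mem[of u v X] by blast
   then consider "u : X" "v ~: X" | "v : X" "u ~: X" by blast
   thus "e : (%(a, b). {a, b}) ` (?A \<times> ?B)"
   proof cases
    case 1 thus ?thesis using uv by (intro image_eqI[of _ _ "(u, v)"]) auto
   next
    case 2 thus ?thesis using uv by (intro image_eqI[of _ _ "(v, u)"]) auto
   qed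
  qed
  show "(%(a, b). {a, b}) ` (?A \<times> ?B) <= cob' X"
  proof
   fix e assume "e : (%(a, b). {a, b}) ` (?A \<times> ?B)"
   then obtain a b where ab: "e = {a, b}" "a : ?A" "b : ?B" by auto
   hence "a ~= b" by blast
   hence "{a, b} : edges T" unfolding edges_K6 using ab by (auto simp: pairs_def)
   thus "e : cob' X" using cob_mem[of a b X] ab by blast
  qed
 qed
 moreover have "inj_on (%(a, b). {a, b}) (?A \<times> ?B)" by (auto simp: inj_on_def doubleton_eq_iff)
 ultimately have "card (cob' X) = card ?A * card ?B" by (simp add: card_image card_cartesian_product)
 moreover have "card ?B = 6 - card ?A" using card_V fin_verts card_Diff_subset_Int[of "verts T" X] by simp
 ultimately show ?thesis by simp
qed

lemma ex_mono: "EX f:T. mono X f"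
proof (rule ccontr)
 assume n: "~ ?thesis"
 have "2 * card (cob' X) = (SUM f:T. 2)" unfolding sum_cob[symmetric] using cob_face n by (intro sum.cong) auto
 hence "card (cob' X) = 10" using card_K6 by simp
 moreover have "card (verts T Int X) <= 6" using card_mono[OF fin_verts, of "verts T Int X"] card_V by simp
 ultimately show False using card_cob six_split by metis
qed

text \<open>Separating the three vertices of \<open>s\<close> from the other three cuts 9 edges, so
  nine faces are bichromatic and \<open>s\<close> is the only exception.\<close>

lemma unique_mono: assumes s: "s : T" and f: "f : T" "f ~= s" shows "~ mono s f"
proof
 assume m: "mono s f"
 have "verts T Int s = s" using s by (auto simp: verts_def)
 hence "card (cob' s) = 9" using card_cob[of s] card_face[OF s] by simp
 hence "(SUM g:T. card (cob' s Int pairs g)) = 18" using sum_cob[of s] by simp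
 moreover have "(SUM g:T. card (cob' s Int pairs g)) = (SUM g:T - {s, f}. card (cob' s Int pairs g))"
 proof (rule sum.mono_neutral_right)
  have "mono s s" by (simp add: mono_def)
  thus "ALL g:T - (T - {s, f}). card (cob' s Int pairs g) = 0" using cob_face m by auto
 qed (use fin_G in auto)
 moreover have "... <= (SUM g:T - {s, f}. 2)" using cob_face by (intro sum_mono) auto
 moreover have "card (T - {s, f}) = 8" using card_K6 s f fin_G by (subst card_Diff_subset) auto
 ultimately show False by simp
qed

end

lemma quasi_no_lone: "quasi_eulerian T f ==> ~ lone_mono T f X"
 using qe_no_lone by (auto simp: quasi_eulerian_def)

text \<open>Some face of K6 is monochromatic. Either it is still a face of \<open>G\<close>, or the
  piece pasted into it has a further monochromatic face.\<close>

lemma pasted_not_good: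
 assumes T: "proj_tri T" "is_K6 T" and S: "ALL s:S. quasi_eulerian (P s) s" "paste_family T S P G"
 shows "EX f:G. mono X f"
proof (rule ccontr)
 assume n: "~ ?thesis"
 interpret k6 T using T by unfold_locales (auto simp: proj_tri_def)
 obtain s where s: "s : T" "mono X s" using ex_mono by blast
 have G: "G = (T - S) Un (UN s:S. P s - {s})" using S(2) by (simp add: paste_family_def)
 have sS: "s : S" using s n G by blast
 have "ALL f:P s - {s}. ~ mono X f" using n G sS by blast
 hence "lone_mono (P s) s X" using s by (simp add: lone_mono_def)
 thus False using quasi_no_lone S(1) sS by blast
qed

text \<open>K6 is coloured by \<open>s0\<close> against the rest, which makes \<open>s0\<close> its
  only monochromatic face. That face is covered by its piece, coloured by \<open>X0\<close>; the
  other pieces are coloured by extension from their bichromatic triangles.\<close>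

lemma (in quot) extend_good:
 assumes planes: "!!s. s : SS ==> plane_tri (PP s)" and k: "k6 T"
  and s0: "s0 : SS" and X0: "lone_mono (PP s0) s0 X0"
 shows "EX Z. ALL f:G. ~ mono Z f"
proof -
 interpret k: k6 T by (rule k)
 have ST: "SS <= T" by (auto simp: SS_def T_def)
 have ex: "EX Y. s Int Y = s Int s0 & (ALL f:PP s - {s}. ~ mono Y f)" if s: "s : SS" for s
 proof (cases "s = s0")
  case True
  have "mono X0 s0" "ALL f:PP s0 - {s0}. ~ mono X0 f" using X0 by (auto simp: lone_mono_def)
  then consider "s0 <= X0" | "s0 Int X0 = {}" by (auto simp: mono_def)
  thus ?thesis
  proof cases
   case 1
   thus ?thesis using True \<open>ALL f:PP s0 - {s0}. ~ mono X0 f\<close> by (intro exI[of _ X0]) auto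
  next
   case 2
   thus ?thesis using True \<open>ALL f:PP s0 - {s0}. ~ mono X0 f\<close> mono_compl by (intro exI[of _ "- X0"]) auto
  qed
 next
  case False
  interpret p: surf "PP s" by (rule plane_surf[OF planes[OF s]])
  have cobs: "p.is_cob' z" if "p.cocycle' z" for z
   using p.plane_cob[OF _ that] planes[OF s] by (simp add: plane_tri_def)
  have "~ mono s0 s" using k.unique_mono[of s0 s] s s0 ST False by blast
  moreover have "s : PP s" by (simp add: PP_def)
  ultimately show ?thesis using p.extend_colouring[OF cobs, of s s0] by blast
 qed
 then obtain Y where Y: "!!s. s : SS ==> s Int Y s = s Int s0" "!!s f. s : SS ==> f : PP s - {s} ==> ~ mono (Y s) f" by metis
 \<comment> \<open>Pieces contribute only their interior vertices, which are disjoint from each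
   other and from K6; on the bounding triangles all colourings agree with \<open>s0\<close>.\<close>
 define Z where "Z = s0 Un (UN X:{X:QQ. 2 <= card X}. Y (tr X) Int int_verts X)"
 have s0V: "s0 <= verts T" using s0 ST by (auto simp: verts_def)
 have ZT: "v : Z \<longleftrightarrow> v : s0" if "v : verts T" for v using int_T that by (auto simp: Z_def)
 have ZX: "v : Z \<longleftrightarrow> v : Y (tr X)" if X: "X : QQ" "2 <= card X" "v : int_verts X" for v X
 proof -
  have "v ~: s0" using s0V int_T[OF X(1)] X(3) by blast
  moreover have "X' = X" if X': "X' : QQ" "v : int_verts X'" for X'
  proof (rule ccontr)
   assume "X' ~= X"
   hence "int_verts X' Int int_verts X = {}" using int_dis[OF X'(1) X(1)] by simp
   thus False using X'(2) X(3) by blast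
  qed
  ultimately show ?thesis using X unfolding Z_def by blast
 qed
 have "~ mono Z f" if f: "f : G" for f
 proof -
  obtain X where X: "X : QQ" "f : X" using f UQ by blast
  show ?thesis
  proof (cases "2 <= card X")
   case True
   have s: "tr X : SS" using X True by (auto simp: SS_def)
   have fP: "f : PP (tr X) - {tr X}" using PP_tr[OF X(1)] X(2) tr_notin[OF QG[OF X(1)] d3[OF X(1)] True] by auto
   have "f <= tr X Un int_verts X"
    using piece_verts(1)[OF QG[OF X(1)] d3[OF X(1)]] X(2) by (auto simp: verts_def)
   moreover have "v : Z \<longleftrightarrow> v : Y (tr X)" if "v : tr X" for v
   proof -
    have "v : verts T" using that X(1) verts_T by blast
    thus ?thesis using ZT Y(1)[OF s] that by blast
   qed
   ultimately have "f Int Z = f Int Y (tr X)" using ZX[OF X(1) True] by blast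
   thus ?thesis using Y(2)[OF s fP] mono_cong by blast
  next
   case False
   have "finite X" using QG[OF X(1)] fin_G finite_subset by blast
   hence "card X = 1" using False X(2) card_one[of X] by blast
   hence Xf: "X = {f}" using X(2) by (auto simp: card_1_singleton_iff)
   hence tf: "tr X = f" using tr_single[OF f] by simp
   have fT: "f : T" using tf X(1) by (auto simp: T_def)
   have "f ~: SS"
   proof
    assume "f : SS"
    then obtain W where W: "W : QQ" "2 <= card W" "f = tr W" by (auto simp: SS_def)
    hence "X = W" using inj_onD[OF tr_inj, of X W] tf X(1) by simp
    thus False using W False by simp
   qed
   hence "f ~= s0" using s0 by blast
   hence "~ mono s0 f" using k.unique_mono[of s0 f] s0 ST fT by blast
   moreover have "f Int Z = f Int s0"
   proof -
    have "f <= verts T" using fT by (auto simp: verts_def)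
    thus ?thesis using ZT by blast
   qed
   ultimately show ?thesis using mono_cong by blast
  qed
 qed
 thus ?thesis by blast
qed

theorem theorem1p7:
  fixes G :: "'a set set"
  assumes "proj_tri G"
  shows "\<not> has_two_thirds_bipartite G \<longleftrightarrow>
    (\<exists>T S P. proj_tri T \<and> is_K6 T \<and> S \<subseteq> T \<and>
       (\<forall>s\<in>S. plane_tri (P s) \<and> quasi_eulerian (P s) s) \<and>
       paste_family T S P G)"
proof -
 interpret surf G using assms by unfold_locales (simp add: proj_tri_def)
 have chi: "euler_char G = 1" using assms by (simp add: proj_tri_def)
 show ?thesis
 proof
  assume "~ has_two_thirds_bipartite G"
  hence no: "ALL X. EX f:G. mono X f" using two_thirds by blast
  hence "bad G (edges G) pairs (%e. e)" using bad_iff by blast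
  then obtain L PP where k6: "k6_structure G (edges G) pairs (%e. e) L PP"
   using k6_exists[OF pcx_G[OF chi] _ conn_G] by blast
  have L: "card L = 6" "partition_on G PP" "(UN X:PP. cut' X) = pairs L"
   and tri: "ALL X:PP. EX t<=L. card t = 3 & cut' X = pairs t"
   using k6 by (auto simp: k6_structure_def bij_betw_def)
  have fL: "finite L" using L(1) by (metis card.infinite zero_neq_numeral)
  have c3: "card (cut' X) = 3" if X: "X : PP" for X
  proof -
   obtain t where t: "t <= L" "card t = 3" "cut' X = pairs t" using tri X by blast
   thus ?thesis using card_pairs[of t] fL finite_subset[of t L] by (simp add: numeral_eq_Suc)
  qed
  have c15: "card (pairs L) = 15" using card_pairs[OF fL] L(1) by (simp add: numeral_eq_Suc)
  have fPP: "finite PP" using L(2) fin_G by (rule partition_on_finite)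
  \<comment> \<open>The parts have 15 boundary edges in total and three each.\<close>
  have "3 <= card PP"
  proof -
   have "15 <= (SUM X:PP. card (cut' X))" using c15 L(3) card_UN_le[OF fPP, of "%X. cut' X"] by simp
   also have "... = (SUM X:PP. 3)" using c3 by (intro sum.cong) auto
   finally show ?thesis by simp
  qed
  then interpret q: quot G PP using L(2) c3 by unfold_locales auto
  interpret t: surf q.T by unfold_locales (rule q.surface_T)
  have eT: "edges q.T = pairs L" using q.edges_T L(3) by blast
  have vT: "verts q.T = L"
  proof
   have "tr X <= L" if "X : PP" for X using L(3) that by (auto simp: tr_def pairs_def)
   thus "verts q.T <= L" unfolding q.verts_T by blast
   show "L <= verts q.T"
   proof
    fix x assume x: "x : L"
    have "EX y:L. y ~= x"
    proof (rule ccontr)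
     assume "~ ?thesis"
     hence "L = {x}" using x by blast
     thus False using L(1) by simp
    qed
    then obtain y where "y : L" "y ~= x" by blast
    hence "{x, y} : edges q.T" using x unfolding eT by (simp add: pairs_def)
    thus "x : verts q.T" by (auto simp: edges_def verts_def)
   qed
  qed
  have cT: "card q.T = 10" using t.card_E3 eT c15 by simp
  have chiT: "euler_char q.T = 1" using vT eT c15 L(1) cT by (simp add: euler_char_def)
  have isK6: "is_K6 q.T" unfolding is_K6_def vT eT using L(1) by (auto simp: pairs_def)
  have k: "k6 q.T" by unfold_locales (rule isK6, rule chiT)
  have pl: "plane_tri (q.PP s)" "s : q.PP s" if "s : q.SS" for s
   using q.plane_PP[OF _ that] chi chiT by auto
  have "quasi_eulerian (q.PP s) s" if s: "s : q.SS" for s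
  proof -
   have "~ lone_mono (q.PP s) s X" for X using q.extend_good[OF pl(1) k s] no by blast
   hence "EX n. qe_level n (q.PP s) s" using qe_exists[OF pl[OF s]] by blast
   thus ?thesis using pl[OF s] by (simp add: quasi_eulerian_def)
  qed
  moreover have "q.SS <= q.T" by (auto simp: q.SS_def q.T_def)
  moreover have "proj_tri q.T" using q.surface_T chiT by (simp add: proj_tri_def)
  ultimately show "EX T S P. proj_tri T & is_K6 T & S <= T &
    (ALL s:S. plane_tri (P s) & quasi_eulerian (P s) s) & paste_family T S P G"
   using isK6 pl(1) q.paste by blast
 next
  assume "EX T S P. proj_tri T & is_K6 T & S <= T &
    (ALL s:S. plane_tri (P s) & quasi_eulerian (P s) s) & paste_family T S P G"
  then obtain T S P where "proj_tri T" "is_K6 T" "ALL s:S. quasi_eulerian (P s) s" "paste_family T S P G" by blast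
  hence "EX f:G. mono X f" for X using pasted_not_good by blast
  thus "~ has_two_thirds_bipartite G" using two_thirds by blast
 qed
qed

end
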